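(* Let $(C,\Delta_C)$ and $(A,\Delta_A)$ be quantum groups. A bicharacter in $\mathcal U\mathcal M(\hat C\otimes A)$ lifts uniquely to a bicharacter in $\mathcal U\mathcal M(\hat C^{\mathrm u}\otimes A^{\mathrm u})$ and hence to bicharacters in $\mathcal U\mathcal M(\hat C\otimes A^{\mathrm u})$ and $\mathcal U\mathcal M(\hat C^{\mathrm u}\otimes A)$. That is, for every bicharacter $V\in\mathcal U\mathcal M(\hat C\otimes A)$ there are unique bicharacters $V^{\mathrm{uu}}\in\mathcal U\mathcal M(\hat C^{\mathrm u}\otimes A^{\mathrm u})$, $V'\in\mathcal U\mathcal M(\hat C\otimes A^{\mathrm u})$, $V''\in\mathcal U\mathcal M(\hat C^{\mathrm u}\otimes A)$ with $(\Lambda_{\hat C}\otimes\Lambda_A)(V^{\mathrm{uu}})=V$, $(\mathrm{id}_{\hat C}\otimes\Lambda_A)(V')=V$ and $(\Lambda_{\hat C}\otimes\mathrm{id}_A)(V'')=V$.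
   Context: Tensor products of $C^*$-algebras are spatial; $\mathcal M(A)$ is the multiplier algebra, $\mathcal U\mathcal M(A)$ its unitary group; leg numbering notation is used. A morphism $A\to B$ of $C^*$-algebras is a nondegenerate $*$-homomorphism $A\to\mathcal M(B)$ (extended to multipliers). A unitary $\mathbb W$ on $\mathcal H\otimes\mathcal H$ is multiplicative if $\mathbb W_{23}\mathbb W_{12}=\mathbb W_{12}\mathbb W_{13}\mathbb W_{23}$. It is modular if there are positive self-adjoint operators $\hat Q,Q$ on $\mathcal H$ with trivial kernels and a unitary $\widetilde{\mathbb W}$ on $\overline{\mathcal H}\otimes\mathcal H$ ($\overline{\mathcal H}$ the complex-conjugate Hilbert space) such that $\mathbb W^*(\hat Q\otimes Q)\mathbb W=\hat Q\otimes Q$ and $(x\otimes y\mid\mathbb W\mid z\otimes u)=(\overline z\otimes Qy\mid\widetilde{\mathbb W}\mid\overline x\otimes Q^{-1}u)$ for all $x,z\in\mathcal H$, $y\in\mathrm{dom}(Q)$, $u\in\mathrm{dom}(Q^{-1})$, where $(x\mid T\mid y):=(x\mid Ty)$. A quantum group is a pair $(C,\Delta_C)$ obtained from some modular multiplicative unitary $\mathbb W^C$ on $\mathcal H_C\otimes\mathcal H_C$: $C\subseteq\mathbb B(\mathcal H_C)$ is the norm closure of $\{(\omega\otimes\mathrm{id})(\mathbb W^C):\omega\in\mathbb B(\mathcal H_C)_*\}$ and $\Delta_C(x)=\mathbb W^C(x\otimes1)(\mathbb W^C)^*$. Its dual $(\hat C,\Delta_{\hat C})$ is the quantum group obtained in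 the same way from the (again modular) multiplicative unitary $\Sigma(\mathbb W^C)^*\Sigma$ ($\Sigma$ the flip), so $\Delta_{\hat C}(y)=\Sigma(\mathbb W^C)^*(1\otimes y)\mathbb W^C\Sigma$; the double dual of $C$ is $C$. $\mathbb W^C$ is the image of a unitary $\mathrm W^C\in\mathcal U\mathcal M(\hat C\otimes C)$, the reduced bicharacter. For a quantum group $C$, a left corepresentation of $\hat C$ on a $C^*$-algebra $D$ is $U\in\mathcal U\mathcal M(\hat C\otimes D)$ with $(\Delta_{\hat C}\otimes\mathrm{id}_D)(U)=U_{23}U_{13}$. The pair $(C^{\mathrm u},\mathcal V^C)$ consists of a $C^*$-algebra $C^{\mathrm u}$ and a left corepresentation $\mathcal V^C\in\mathcal U\mathcal M(\hat C\otimes C^{\mathrm u})$ that is universal: for every left corepresentation $U\in\mathcal U\mathcal M(\hat C\otimes D)$ there is a unique morphism $\varphi\colon C^{\mathrm u}\to D$ with $U=(\mathrm{id}\otimes\varphi)(\mathcal V^C)$. The comultiplication $\Delta_{C^{\mathrm u}}$ is determined by $(\mathrm{id}\otimes\Delta_{C^{\mathrm u}})(\mathcal V^C)=\mathcal V^C_{12}\mathcal V^C_{13}$, and the reducing morphism $\Lambda_C\colon C^{\mathrm u}\to C$ by $(\mathrm{id}\otimes\Lambda_C)(\mathcal V^C)=\mathrm W^C$. Applied to $A$ and to the quantum group $\hat C$, this gives $A^{\mathrm u},\Lambda_A$ and $\hat C^{\mathrm u},\Lambda_{\hat C}\colon\hat C^{\mathrm u}\to\hat C$. For $X\in\{\hat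 C,\hat C^{\mathrm u}\}$ and $Y\in\{A,A^{\mathrm u}\}$, a bicharacter in $\mathcal U\mathcal M(X\otimes Y)$ is a unitary $V$ with $(\Delta_X\otimes\mathrm{id}_Y)V=V_{23}V_{13}$ and $(\mathrm{id}_X\otimes\Delta_Y)V=V_{12}V_{13}$. *)

theory Defs
  imports "HOL-Analysis.Analysis"
begin

text \<open>Complex Hilbert spaces; the inner product is linear in the second argument.\<close>

class complex_hilbert = banach +
  fixes scaleC :: "complex \<Rightarrow> 'a \<Rightarrow> 'a" (infixr "*\<^sub>C" 75)
    and cinner :: "'a \<Rightarrow> 'a \<Rightarrow> complex"
  assumes scaleC_add_right: "c *\<^sub>C (x + y) = c *\<^sub>C x + c *\<^sub>C y"
    and scaleC_add_left: "(c + d) *\<^sub>C x = c *\<^sub>C x + d *\<^sub>C x"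
    and scaleC_scaleC: "c *\<^sub>C d *\<^sub>C x = (c * d) *\<^sub>C x"
    and scaleR_scaleC: "r *\<^sub>R x = complex_of_real r *\<^sub>C x"
    and cinner_commute: "cinner x y = cnj (cinner y x)"
    and cinner_add_right: "cinner x (y + z) = cinner x y + cinner x z"
    and cinner_scaleC_right: "cinner x (c *\<^sub>C y) = c * cinner x y"
    and cinner_norm: "cinner x x = complex_of_real ((norm x)\<^sup>2)"

lemma cinner_add_left: "cinner (x + y) z = cinner x z + cinner y z"
  by (metis cinner_add_right cinner_commute complex_cnj_add)

lemma cinner_scaleC_left: "cinner (c *\<^sub>C x) y = cnj c * cinner x y"
  by (metis cinner_scaleC_right cinner_commute complex_cnj_mult)

lemma cinner_zero_right [simp]: "cinner x 0 = 0"
  using cinner_add_right[of x 0 0] by simp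

lemma cinner_zero_left [simp]: "cinner 0 x = 0"
  using cinner_add_left[of 0 0 x] by simp

lemma cinner_minus_right: "cinner x (- y) = - cinner x y"
  using cinner_add_right[of x y "- y"] by (simp add: eq_neg_iff_add_eq_0 add.commute)

lemma cinner_minus_left: "cinner (- x) y = - cinner x y"
  using cinner_add_left[of x "- x" y] by (simp add: eq_neg_iff_add_eq_0 add.commute)

lemma cinner_diff_right: "cinner x (y - z) = cinner x y - cinner x z"
  using cinner_add_right[of x y "- z"] by (simp add: cinner_minus_right)

lemma cinner_diff_left: "cinner (x - y) z = cinner x z - cinner y z"
  using cinner_add_left[of x "- y" z] by (simp add: cinner_minus_left)

lemma cinner_sum_right: "cinner x (\<Sum>i\<in>I. f i) = (\<Sum>i\<in>I. cinner x (f i))"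
  by (induction I rule: infinite_finite_induct) (auto simp: cinner_add_right)

lemma cinner_sum_left: "cinner (\<Sum>i\<in>I. f i) x = (\<Sum>i\<in>I. cinner (f i) x)"
  by (induction I rule: infinite_finite_induct) (auto simp: cinner_add_left)

lemma scaleC_one [simp]: "1 *\<^sub>C x = x"
  using scaleR_scaleC[of 1 x] by simp

lemma scaleC_zero_left [simp]: "0 *\<^sub>C x = 0"
  using scaleR_scaleC[of 0 x] by simp

lemma cinner_eq_zero_iff: "cinner x x = 0 \<longleftrightarrow> x = 0"
  by (simp add: cinner_norm)

lemma cnj_mult_self: "cnj c * c = complex_of_real ((cmod c)\<^sup>2)" "c * cnj c = complex_of_real ((cmod c)\<^sup>2)"
  by (simp_all only: complex_norm_square mult.commute)

lemma norm_scaleC: "norm (c *\<^sub>C x) = cmod c * norm x"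
proof -
  have "complex_of_real ((norm (c *\<^sub>C x))\<^sup>2) = cnj c * c * complex_of_real ((norm x)\<^sup>2)"
    unfolding cinner_norm[symmetric] by (simp add: cinner_scaleC_left cinner_scaleC_right)
  also have "\<dots> = complex_of_real ((cmod c * norm x)\<^sup>2)"
    unfolding cnj_mult_self by (simp add: power_mult_distrib)
  finally have "(norm (c *\<^sub>C x))\<^sup>2 = (cmod c * norm x)\<^sup>2"
    by (simp only: of_real_eq_iff)
  then show ?thesis by simp
qed

lemma cmod_cinner_le: "cmod (cinner x y) \<le> norm x * norm y"
proof (cases "x = 0")
  case False
  then have nx: "norm x > 0" by simp
  define c where "c = cinner x y / cinner x x"
  define z where "z = y - c *\<^sub>C x"
  have xz: "cinner x z = 0"
    using False by (simp add: z_def c_def cinner_diff_right cinner_scaleC_right cinner_eq_zero_iff)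
  then have zx: "cinner z x = 0" by (metis cinner_commute complex_cnj_zero)
  have "y = z + c *\<^sub>C x" by (simp add: z_def)
  then have "cinner y y = cinner z z + cnj c * c * cinner x x"
    using xz zx by (simp add: cinner_add_left cinner_add_right cinner_scaleC_left cinner_scaleC_right)
  then have "complex_of_real ((norm y)\<^sup>2) = complex_of_real ((norm z)\<^sup>2 + (cmod c)\<^sup>2 * (norm x)\<^sup>2)"
    unfolding cnj_mult_self cinner_norm by simp
  then have "(norm y)\<^sup>2 = (norm z)\<^sup>2 + (cmod c)\<^sup>2 * (norm x)\<^sup>2"
    by (simp only: of_real_eq_iff)
  then have "(cmod c * norm x)\<^sup>2 \<le> (norm y)\<^sup>2" by (simp add: power_mult_distrib)
  then have "cmod c * norm x \<le> norm y" by (rule power2_le_imp_le) simp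
  moreover have "cmod c = cmod (cinner x y) / (norm x)\<^sup>2"
    by (simp add: c_def cinner_norm norm_divide norm_power)
  ultimately show ?thesis using nx
    by (simp add: power2_eq_square field_simps)
qed simp

lemma bounded_linear_cinner_right: "bounded_linear (cinner x)"
  by (rule bounded_linear_intro[where K = "norm x"])
    (auto simp: cinner_add_right scaleR_scaleC cinner_scaleC_right cmod_cinner_le
        scaleR_conv_of_real mult.commute[of _ "norm x"])

subsection \<open>Square-summable families\<close>

definition sq_summable :: "('i \<Rightarrow> complex) \<Rightarrow> bool" where
  "sq_summable f \<longleftrightarrow> (\<lambda>i. (cmod (f i))\<^sup>2) summable_on UNIV"

definition l2_norm :: "('i \<Rightarrow> complex) \<Rightarrow> real" where
  "l2_norm f = sqrt (\<Sum>\<^sub>\<infinity>i. (cmod (f i))\<^sup>2)"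

lemma l2_norm_nonneg: "l2_norm f \<ge> 0"
  by (simp add: l2_norm_def infsum_nonneg)

lemma l2_finite_le:
  assumes "sq_summable f" "finite F"
  shows "L2_set (\<lambda>i. cmod (f i)) F \<le> l2_norm f"
  unfolding L2_set_def l2_norm_def
  using assms by (intro real_sqrt_le_mono finite_sum_le_infsum) (auto simp: sq_summable_def)

lemma l2_boundedI:
  assumes "M \<ge> 0" "\<And>F. finite F \<Longrightarrow> L2_set (\<lambda>i. cmod (f i)) F \<le> M"
  shows "sq_summable f" "l2_norm f \<le> M"
proof -
  have *: "(\<Sum>i\<in>F. (cmod (f i))\<^sup>2) \<le> M\<^sup>2" if "finite F" for F
    using assms(2)[OF that] assms(1) by (simp add: L2_set_def real_sqrt_le_iff' sum_nonneg real_le_lsqrt sqrt_le_D)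
  show s: "sq_summable f" unfolding sq_summable_def
    by (rule nonneg_bdd_above_summable_on) (auto intro!: bdd_aboveI2[where M = "M\<^sup>2"] *)
  have "(\<Sum>\<^sub>\<infinity>i. (cmod (f i))\<^sup>2) \<le> M\<^sup>2"
    by (rule infsum_le_finite_sums) (use s * in \<open>auto simp: sq_summable_def\<close>)
  then show "l2_norm f \<le> M"
    unfolding l2_norm_def using assms(1) by (simp add: real_le_lsqrt infsum_nonneg)
qed

lemma sq_summable_add:
  assumes "sq_summable f" "sq_summable g"
  shows "sq_summable (\<lambda>i. f i + g i)" "l2_norm (\<lambda>i. f i + g i) \<le> l2_norm f + l2_norm g"
proof -
  have *: "L2_set (\<lambda>i. cmod (f i + g i)) F \<le> l2_norm f + l2_norm g" if "finite F" for F
  proof -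
    have "L2_set (\<lambda>i. cmod (f i + g i)) F \<le> L2_set (\<lambda>i. cmod (f i) + cmod (g i)) F"
      by (intro L2_set_mono) (auto simp: norm_triangle_ineq)
    also have "\<dots> \<le> L2_set (\<lambda>i. cmod (f i)) F + L2_set (\<lambda>i. cmod (g i)) F"
      by (rule L2_set_triangle_ineq)
    also have "\<dots> \<le> l2_norm f + l2_norm g"
      using l2_finite_le assms that by (intro add_mono) auto
    finally show ?thesis .
  qed
  show "sq_summable (\<lambda>i. f i + g i)" "l2_norm (\<lambda>i. f i + g i) \<le> l2_norm f + l2_norm g"
    using l2_boundedI[OF _ *] l2_norm_nonneg[of f] l2_norm_nonneg[of g] by auto
qed

lemma sq_summable_scale:
  assumes "sq_summable f"
  shows "sq_summable (\<lambda>i. c * f i)"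
  using assms unfolding sq_summable_def
  by (simp add: norm_mult power_mult_distrib summable_on_cmult_right)

lemma sq_summable_minus: "sq_summable f \<Longrightarrow> sq_summable (\<lambda>i. - f i)"
  unfolding sq_summable_def by simp

lemma sq_summable_diff: "sq_summable f \<Longrightarrow> sq_summable g \<Longrightarrow> sq_summable (\<lambda>i. f i - g i)"
  using sq_summable_add(1)[of f "\<lambda>i. - g i"] sq_summable_minus by auto

lemma sq_summable_zero: "sq_summable (\<lambda>i. 0)"
  unfolding sq_summable_def by simp

lemma l2_norm_scale: "l2_norm (\<lambda>i. c * f i) = cmod c * l2_norm f"
  by (simp add: l2_norm_def norm_mult power_mult_distrib infsum_cmult_right' real_sqrt_mult)

lemma l2_norm_zero_iff:
  assumes "sq_summable f" shows "l2_norm f = 0 \<longleftrightarrow> f = (\<lambda>i. 0)"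
proof
  assume "l2_norm f = 0"
  then have "L2_set (\<lambda>i. cmod (f i)) {j} \<le> 0" for j
    using l2_finite_le[OF assms, of "{j}"] by simp
  then show "f = (\<lambda>i. 0)" by (auto simp: L2_set_def)
qed (simp add: l2_norm_def)

lemma l2_inner_summable:
  assumes "sq_summable f" "sq_summable g"
  shows "(\<lambda>i. cnj (f i) * g i) summable_on UNIV"
proof -
  have "(\<lambda>i. (cmod (f i))\<^sup>2 + (cmod (g i))\<^sup>2) summable_on UNIV"
    using assms by (intro summable_on_add) (auto simp: sq_summable_def)
  then have "(\<lambda>i. norm (cnj (f i) * g i)) summable_on UNIV"
  proof (rule summable_on_comparison_test)
    fix i
    have "cmod (f i) * cmod (g i) \<le> (cmod (f i))\<^sup>2 + (cmod (g i))\<^sup>2"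
      using sum_squares_bound[of "cmod (f i)" "cmod (g i)"]
        mult_nonneg_nonneg[OF norm_ge_zero[of "f i"] norm_ge_zero[of "g i"]] by linarith
    then show "norm (cnj (f i) * g i) \<le> (cmod (f i))\<^sup>2 + (cmod (g i))\<^sup>2"
      by (simp add: norm_mult)
  qed auto
  then show ?thesis by (rule abs_summable_summable)
qed

lemma l2_complete:
  fixes X :: "nat \<Rightarrow> 'i \<Rightarrow> complex"
  assumes sq: "\<And>n. sq_summable (X n)"
    and cau: "\<And>e. e > 0 \<Longrightarrow> \<exists>N. \<forall>m\<ge>N. \<forall>n\<ge>N. l2_norm (\<lambda>i. X m i - X n i) < e"
  shows "\<exists>g. sq_summable g \<and> (\<forall>i. (\<lambda>n. X n i) \<longlonglongrightarrow> g i) \<and>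
    (\<forall>e>0. \<exists>N. \<forall>n\<ge>N. l2_norm (\<lambda>i. X n i - g i) < e)"
proof -
  have "Cauchy (\<lambda>n. X n i)" for i
  proof (rule CauchyI)
    fix e :: real assume "e > 0"
    then obtain N where N: "\<forall>m\<ge>N. \<forall>n\<ge>N. l2_norm (\<lambda>i. X m i - X n i) < e" using cau by blast
    have "norm (X m i - X n i) < e" if "m \<ge> N" "n \<ge> N" for m n
      using l2_finite_le[OF sq_summable_diff[OF sq sq], of "{i}" m n] N that by fastforce
    then show "\<exists>M. \<forall>m\<ge>M. \<forall>n\<ge>M. norm (X m i - X n i) < e" by blast
  qed
  then have "\<forall>i. \<exists>l. (\<lambda>n. X n i) \<longlonglongrightarrow> l" by (simp add: Cauchy_convergent_iff convergent_def)
  then obtain g where g: "\<And>i. (\<lambda>n. X n i) \<longlonglongrightarrow> g i" by metis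
  have key: "sq_summable (\<lambda>i. X n i - g i) \<and> l2_norm (\<lambda>i. X n i - g i) \<le> e"
    if e: "e > 0" and N: "\<forall>m\<ge>N. \<forall>n\<ge>N. l2_norm (\<lambda>i. X m i - X n i) < e" and n: "n \<ge> N" for e N n
  proof -
    have "L2_set (\<lambda>i. cmod (X n i - g i)) F \<le> e" if F: "finite F" for F
    proof (rule LIMSEQ_le_const2)
      show "(\<lambda>m. L2_set (\<lambda>i. cmod (X n i - X m i)) F) \<longlonglongrightarrow> L2_set (\<lambda>i. cmod (X n i - g i)) F"
        unfolding L2_set_def by (intro tendsto_intros g)
      show "\<exists>N. \<forall>m\<ge>N. L2_set (\<lambda>i. cmod (X n i - X m i)) F \<le> e"
      proof (intro exI allI impI)
        fix m assume "m \<ge> N"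
        then have "l2_norm (\<lambda>i. X n i - X m i) < e" using N n by blast
        with l2_finite_le[OF sq_summable_diff[OF sq sq] F, of n m]
        show "L2_set (\<lambda>i. cmod (X n i - X m i)) F \<le> e" by linarith
      qed
    qed
    then show ?thesis using l2_boundedI[of e "\<lambda>i. X n i - g i"] e by auto
  qed
  obtain N where N: "\<forall>m\<ge>N. \<forall>n\<ge>N. l2_norm (\<lambda>i. X m i - X n i) < 1" using cau[of 1] by auto
  have "sq_summable (\<lambda>i. X N i - (X N i - g i))"
    by (rule sq_summable_diff[OF sq]) (use key[OF _ N, of N] in auto)
  moreover have "(\<lambda>i. X N i - (X N i - g i)) = g" by auto
  ultimately have gs: "sq_summable g" by metis
  have "\<exists>N. \<forall>n\<ge>N. l2_norm (\<lambda>i. X n i - g i) < e" if e0: "e > 0" for e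
  proof -
    obtain N where N: "\<forall>m\<ge>N. \<forall>n\<ge>N. l2_norm (\<lambda>i. X m i - X n i) < e/2" using cau[of "e / 2"] half_gt_zero[OF e0] by blast
    then show ?thesis using key[OF _ N] that by (intro exI[of _ N]) force
  qed
  with gs g show ?thesis by blast
qed

subsection \<open>Orthonormal bases\<close>

definition orthonormal_basis :: "'a::complex_hilbert set \<Rightarrow> bool" where
  "orthonormal_basis B \<longleftrightarrow>
     (\<forall>x\<in>B. \<forall>y\<in>B. cinner x y = (if x = y then 1 else 0)) \<and>
     (\<forall>x. (\<forall>b\<in>B. cinner b x = 0) \<longrightarrow> x = 0)"

lemma orthonormal_basis_exists: "\<exists>B. orthonormal_basis (B :: 'a::complex_hilbert set)"
proof -
  define A where "A = {B :: 'a set. \<forall>x\<in>B. \<forall>y\<in>B. cinner x y = (if x = y then 1 else 0)}"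
  have "\<exists>M\<in>A. \<forall>X\<in>A. M \<subseteq> X \<longrightarrow> X = M"
  proof (rule subset_Zorn')
    fix C assume C: "subset.chain A C"
    then have CA: "C \<subseteq> A" and tot: "\<And>X Y. X \<in> C \<Longrightarrow> Y \<in> C \<Longrightarrow> X \<subseteq> Y \<or> Y \<subseteq> X"
      by (auto simp: subset.chain_def)
    show "\<Union>C \<in> A" unfolding A_def
    proof (clarify)
      fix x X y Y assume h: "x \<in> X" "X \<in> C" "y \<in> Y" "Y \<in> C"
      then obtain Z where "Z \<in> C" "x \<in> Z" "y \<in> Z" using tot[of X Y] by blast
      then show "cinner x y = (if x = y then 1 else 0)" using CA A_def by blast
    qed
  qed
  then obtain M where M: "M \<in> A" and max: "\<And>X. X \<in> A \<Longrightarrow> M \<subseteq> X \<Longrightarrow> X = M" by blast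
  have "x = 0" if x: "\<forall>b\<in>M. cinner b x = 0" for x
  proof (rule ccontr)
    assume "x \<noteq> 0"
    define e where "e = (1 / norm x) *\<^sub>R x"
    have ne: "norm e = 1" using \<open>x \<noteq> 0\<close> by (simp add: e_def)
    have be: "cinner b e = 0" if "b \<in> M" for b
      using x that by (simp add: e_def scaleR_scaleC cinner_scaleC_right)
    then have eb: "cinner e b = 0" if "b \<in> M" for b
      using that by (metis cinner_commute complex_cnj_zero)
    have ee: "cinner e e = 1" using ne by (simp add: cinner_norm)
    then have "e \<notin> M" using be by force
    moreover have "insert e M \<in> A" using M be eb ee by (auto simp: A_def)
    ultimately show False using max[of "insert e M"] by blast
  qed
  then show ?thesis using M unfolding orthonormal_basis_def A_def by blast
qed

lemma bessel_finite:
  assumes "\<forall>x\<in>B. \<forall>y\<in>B. cinner x y = (if x = y then 1 else 0)" "finite F" "F \<subseteq> B"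
  shows "(norm (x - (\<Sum>b\<in>F. cinner b x *\<^sub>C b)))\<^sup>2 = (norm x)\<^sup>2 - (\<Sum>b\<in>F. (cmod (cinner b x))\<^sup>2)"
    and "(norm (\<Sum>b\<in>F. cinner b x *\<^sub>C b))\<^sup>2 = (\<Sum>b\<in>F. (cmod (cinner b x))\<^sup>2)"
    and "b \<in> B \<Longrightarrow> cinner b (\<Sum>b\<in>F. cinner b x *\<^sub>C b) = (if b \<in> F then cinner b x else 0)"
proof -
  let ?p = "\<Sum>b\<in>F. cinner b x *\<^sub>C b"
  have bp: "cinner b ?p = (if b \<in> F then cinner b x else 0)" if "b \<in> B" for b
  proof -
    have "cinner b ?p = (\<Sum>c\<in>F. if b = c then cinner c x else 0)"
      unfolding cinner_sum_right cinner_scaleC_right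
      using assms that by (intro sum.cong) (auto split: if_splits)
    also have "\<dots> = (if b \<in> F then cinner b x else 0)" using assms(2) by (simp add: sum.delta)
    finally show ?thesis .
  qed
  then show "b \<in> B \<Longrightarrow> cinner b ?p = (if b \<in> F then cinner b x else 0)" .
  have px: "cinner ?p x = complex_of_real (\<Sum>b\<in>F. (cmod (cinner b x))\<^sup>2)"
    by (simp add: cinner_sum_left cinner_scaleC_left cnj_mult_self)
  have xp: "cinner x ?p = complex_of_real (\<Sum>b\<in>F. (cmod (cinner b x))\<^sup>2)"
    by (subst cinner_commute) (simp only: px complex_cnj_complex_of_real)
  have pp: "cinner ?p ?p = complex_of_real (\<Sum>b\<in>F. (cmod (cinner b x))\<^sup>2)"
  proof -
    have "cinner ?p ?p = (\<Sum>b\<in>F. cnj (cinner b x) * cinner b ?p)"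
      by (subst cinner_sum_left) (simp only: cinner_scaleC_left)
    also have "\<dots> = (\<Sum>b\<in>F. cnj (cinner b x) * cinner b x)"
      using assms(3) by (intro sum.cong) (auto simp: bp)
    finally show ?thesis by (simp add: cnj_mult_self)
  qed
  then show "(norm ?p)\<^sup>2 = (\<Sum>b\<in>F. (cmod (cinner b x))\<^sup>2)"
    unfolding cinner_norm by (simp only: of_real_eq_iff)
  have "cinner (x - ?p) (x - ?p) = complex_of_real ((norm x)\<^sup>2 - (\<Sum>b\<in>F. (cmod (cinner b x))\<^sup>2))"
    by (simp only: cinner_diff_left cinner_diff_right px xp pp cinner_norm[of x] of_real_diff) simp
  then show "(norm (x - ?p))\<^sup>2 = (norm x)\<^sup>2 - (\<Sum>b\<in>F. (cmod (cinner b x))\<^sup>2)"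
    unfolding cinner_norm by (simp only: of_real_eq_iff)
qed

lemma bessel_approx:
  assumes B: "orthonormal_basis (B :: 'a::complex_hilbert set)"
  shows "\<exists>F. (\<forall>n. finite (F n) \<and> F n \<subseteq> B) \<and> (\<lambda>n. \<Sum>b\<in>F n. cinner b x *\<^sub>C b) \<longlonglongrightarrow> x"
proof -
  have on: "\<forall>x\<in>B. \<forall>y\<in>B. cinner x y = (if x = y then 1 else 0)"
    using B by (auto simp: orthonormal_basis_def)
  define s where "s F = (\<Sum>b\<in>F. (cmod (cinner b x))\<^sup>2)" for F
  define p where "p F = (\<Sum>b\<in>F. cinner b x *\<^sub>C b)" for F
  define S where "S = (SUP F\<in>{F. finite F \<and> F \<subseteq> B}. s F)"
  have sle: "s F \<le> (norm x)\<^sup>2" if "finite F" "F \<subseteq> B" for F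
    using bessel_finite(1)[OF on that, of x] zero_le_power2[of "norm (x - (\<Sum>b\<in>F. cinner b x *\<^sub>C b))"]
    unfolding s_def by linarith
  then have bdd: "bdd_above (s ` {F. finite F \<and> F \<subseteq> B})" by (auto intro!: bdd_aboveI2)
  have sS: "s F \<le> S" if "finite F" "F \<subseteq> B" for F
    unfolding S_def using bdd that by (intro cSUP_upper) auto
  have "\<exists>F. finite F \<and> F \<subseteq> B \<and> S - 1 / Suc n < s F" for n
    using less_cSUP_iff[of "{F. finite F \<and> F \<subseteq> B}" s "S - 1 / Suc n"] bdd
    unfolding S_def by auto
  then obtain G where G: "\<And>n. finite (G n)" "\<And>n. G n \<subseteq> B" "\<And>n. S - 1 / Suc n < s (G n)" by metis
  define F where "F n = (\<Union>k\<le>n. G k)" for n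
  have F: "finite (F n)" "F n \<subseteq> B" for n using G by (auto simp: F_def)
  have mono: "F m \<subseteq> F n" if "m \<le> n" for m n using that by (fastforce simp: F_def)
  have smono: "s X \<le> s Y" if "finite Y" "X \<subseteq> Y" for X Y
    unfolding s_def using that by (intro sum_mono2) auto
  have sF: "S - 1 / Suc n < s (F n)" for n
  proof -
    have "s (G n) \<le> s (F n)" using F by (intro smono) (auto simp: F_def)
    then show ?thesis using G(3)[of n] by linarith
  qed
  have dist: "(norm (p (F n) - p (F m)))\<^sup>2 < 1 / Suc m" if "m \<le> n" for m n
  proof -
    have "p (F n) - p (F m) = p (F n - F m)"
      unfolding p_def using mono[OF that] F by (simp add: sum_diff)
    then have "(norm (p (F n) - p (F m)))\<^sup>2 = s (F n - F m)"
      using bessel_finite(2)[OF on, of "F n - F m" x] F unfolding p_def s_def by auto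
    also have "\<dots> = s (F n) - s (F m)"
      unfolding s_def using mono[OF that] F by (simp add: sum_diff)
    also have "\<dots> < 1 / Suc m" using sF[of m] sS[OF F, of n] by linarith
    finally show ?thesis .
  qed
  have "Cauchy (\<lambda>n. p (F n))"
  proof (rule CauchyI')
    fix e :: real assume e: "e > 0"
    obtain M where M: "inverse (real (Suc M)) < e\<^sup>2"
      using reals_Archimedean[of "e\<^sup>2"] e by auto
    have "dist (p (F m)) (p (F n)) < e" if "m \<ge> M" "n > m" for m n
    proof -
      have "(norm (p (F n) - p (F m)))\<^sup>2 < 1 / Suc m" using dist that by simp
      also have "\<dots> \<le> inverse (real (Suc M))" using that by (simp add: field_simps)
      finally have "(norm (p (F n) - p (F m)))\<^sup>2 < e\<^sup>2" using M by linarith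
      then show ?thesis using e by (simp add: power_less_imp_less_base dist_norm norm_minus_commute)
    qed
    then show "\<exists>M. \<forall>m\<ge>M. \<forall>n>m. dist (p (F m)) (p (F n)) < e" by blast
  qed
  then obtain y where y: "(\<lambda>n. p (F n)) \<longlonglongrightarrow> y"
    using Cauchy_convergent_iff convergent_def by blast
  have "cinner b (x - y) = 0" if b: "b \<in> B" for b
  proof -
    have lim: "(\<lambda>n. cinner b (p (F n))) \<longlonglongrightarrow> cinner b y"
      using y by (rule bounded_linear.tendsto[OF bounded_linear_cinner_right])
    have val: "cinner b (p (F n)) = (if b \<in> F n then cinner b x else 0)" for n
      unfolding p_def by (rule bessel_finite(3)[OF on F b])
    have "cinner b y = cinner b x"
    proof (cases "\<exists>m. b \<in> F m")
      case True
      then obtain m where m: "b \<in> F m" by blast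
      have "(\<lambda>n. cinner b (p (F n))) \<longlonglongrightarrow> cinner b x"
        by (rule tendsto_eventually, rule eventually_sequentiallyI[of m]) (use m mono in \<open>auto simp: val\<close>)
      then show ?thesis using lim LIMSEQ_unique by blast
    next
      case False
      then have "(\<lambda>n. cinner b (p (F n))) = (\<lambda>n. 0)" by (auto simp: val)
      then have "cinner b y = 0" using lim by (simp add: LIMSEQ_const_iff)
      have "(cmod (cinner b x))\<^sup>2 \<le> 1 / Suc n" for n
      proof -
        have "s (insert b (F n)) = (cmod (cinner b x))\<^sup>2 + s (F n)"
          unfolding s_def using False F by simp
        moreover have "s (insert b (F n)) \<le> S" using sS[of "insert b (F n)"] F b by auto
        ultimately show ?thesis using sF[of n] by linarith
      qed
      then have "(cmod (cinner b x))\<^sup>2 \<le> 0"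
        by (intro LIMSEQ_le_const[OF LIMSEQ_inverse_real_of_nat] exI[of _ 0] allI impI)
          (simp only: inverse_eq_divide)
      then have "cinner b x = 0" by simp
      then show ?thesis using \<open>cinner b y = 0\<close> by simp
    qed
    then show ?thesis by (simp add: cinner_diff_right)
  qed
  then have "x - y = 0" using B unfolding orthonormal_basis_def by blast
  then have "x = y" by simp
  with y have "(\<lambda>n. \<Sum>b\<in>F n. cinner b x *\<^sub>C b) \<longlonglongrightarrow> x" by (simp only: p_def)
  with F show ?thesis by (intro exI[of _ F] conjI allI)
qed


lemma parseval:
  assumes B: "orthonormal_basis (B :: 'a::complex_hilbert set)"
  shows "((\<lambda>b. cnj (cinner b x) * cinner b y) has_sum cinner x y) B"
    and "(\<lambda>b. (cmod (cinner b x))\<^sup>2) summable_on B"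
proof -
  have on: "\<forall>x\<in>B. \<forall>y\<in>B. cinner x y = (if x = y then 1 else 0)"
    using B by (auto simp: orthonormal_basis_def)
  have sle: "(\<Sum>b\<in>F. (cmod (cinner b z))\<^sup>2) \<le> (norm z)\<^sup>2" if "finite F" "F \<subseteq> B" for F z
    using bessel_finite(1)[OF on that, of z] zero_le_power2[of "norm (z - (\<Sum>b\<in>F. cinner b z *\<^sub>C b))"]
    by linarith
  have sm: "(\<lambda>b. (cmod (cinner b z))\<^sup>2) summable_on B" for z
    by (rule nonneg_bdd_above_summable_on) (auto intro!: bdd_aboveI2 sle)
  then show "(\<lambda>b. (cmod (cinner b x))\<^sup>2) summable_on B" .
  have tail: "cmod (cinner x y - (\<Sum>b\<in>F. cnj (cinner b x) * cinner b y)) \<le>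
      norm (x - (\<Sum>b\<in>F. cinner b x *\<^sub>C b)) * norm y" for F
  proof -
    have "cinner x y - (\<Sum>b\<in>F. cnj (cinner b x) * cinner b y) =
        cinner (x - (\<Sum>b\<in>F. cinner b x *\<^sub>C b)) y"
      by (simp add: cinner_diff_left cinner_sum_left cinner_scaleC_left)
    then show ?thesis by (simp add: cmod_cinner_le)
  qed
  obtain F where F: "\<And>n. finite (F n)" "\<And>n. F n \<subseteq> B"
    and lim: "(\<lambda>n. \<Sum>b\<in>F n. cinner b x *\<^sub>C b) \<longlonglongrightarrow> x"
    using bessel_approx[OF B, of x] by blast
  show "((\<lambda>b. cnj (cinner b x) * cinner b y) has_sum cinner x y) B"
    unfolding has_sum_def tendsto_iff eventually_finite_subsets_at_top
  proof (intro allI impI)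
    fix e :: real assume e: "e > 0"
    define d where "d = e / (norm y + 1)"
    have d: "d > 0" using e by (simp add: d_def add_nonneg_pos)
    obtain n where n: "norm (x - (\<Sum>b\<in>F n. cinner b x *\<^sub>C b)) < d"
      using LIMSEQ_D[OF lim d] by (auto simp: norm_minus_commute)
    show "\<exists>X. finite X \<and> X \<subseteq> B \<and> (\<forall>Y. finite Y \<and> X \<subseteq> Y \<and> Y \<subseteq> B \<longrightarrow>
        dist (\<Sum>b\<in>Y. cnj (cinner b x) * cinner b y) (cinner x y) < e)"
    proof (intro exI[of _ "F n"] conjI allI impI F)
      fix Y assume Y: "finite Y \<and> F n \<subseteq> Y \<and> Y \<subseteq> B"
      have "(\<Sum>b\<in>F n. (cmod (cinner b x))\<^sup>2) \<le> (\<Sum>b\<in>Y. (cmod (cinner b x))\<^sup>2)"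
        using Y by (intro sum_mono2) auto
      then have "(norm (x - (\<Sum>b\<in>Y. cinner b x *\<^sub>C b)))\<^sup>2 \<le> (norm (x - (\<Sum>b\<in>F n. cinner b x *\<^sub>C b)))\<^sup>2"
        using bessel_finite(1)[OF on, of Y x] bessel_finite(1)[OF on F(1)[of n] F(2)[of n], of x] Y by linarith
      then have "norm (x - (\<Sum>b\<in>Y. cinner b x *\<^sub>C b)) \<le> norm (x - (\<Sum>b\<in>F n. cinner b x *\<^sub>C b))"
        by (rule power2_le_imp_le) simp
      then have "norm (x - (\<Sum>b\<in>Y. cinner b x *\<^sub>C b)) * norm y \<le> d * norm y"
        using n by (intro mult_right_mono) auto
      also have "\<dots> < d * (norm y + 1)" using d by (intro mult_strict_left_mono) auto
      also have "\<dots> = e" using norm_ge_zero[of y] by (simp add: d_def add_nonneg_eq_0_iff)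
      finally show "dist (\<Sum>b\<in>Y. cnj (cinner b x) * cinner b y) (cinner x y) < e"
        using tail[of Y] by (simp add: dist_norm norm_minus_commute)
    qed
  qed
qed

definition some_onb :: "'a::complex_hilbert set" where
  "some_onb = (SOME B. orthonormal_basis B)"

lemma orthonormal_basis_some_onb: "orthonormal_basis some_onb"
  unfolding some_onb_def by (rule someI_ex) (rule orthonormal_basis_exists)

subsection \<open>Hilbert space tensor product\<close>

text \<open>The square-summable coordinate families with respect to the product of two chosen orthonormal
  bases. The lemmas \<open>cinner_htens\<close> and \<open>htens_total\<close> below characterise the tensor product without
  reference to the bases.\<close>

typedef (overloaded) ('a, 'b) htensor =
  "{f :: 'a::complex_hilbert \<times> 'b::complex_hilbert \<Rightarrow> complex.
     (\<forall>p. p \<notin> some_onb \<times> some_onb \<longrightarrow> f p = 0) \<and> sq_summable f}"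
  by (rule exI[of _ "\<lambda>_. 0"]) (simp add: sq_summable_zero)

setup_lifting type_definition_htensor

instantiation htensor :: (complex_hilbert, complex_hilbert) real_vector
begin

lift_definition zero_htensor :: "('a, 'b) htensor" is "\<lambda>_. 0"
  by (simp add: sq_summable_zero)

lift_definition plus_htensor :: "('a, 'b) htensor \<Rightarrow> ('a, 'b) htensor \<Rightarrow> ('a, 'b) htensor"
  is "\<lambda>f g p. f p + g p" by (auto intro: sq_summable_add)

lift_definition uminus_htensor :: "('a, 'b) htensor \<Rightarrow> ('a, 'b) htensor"
  is "\<lambda>f p. - f p" by (auto intro: sq_summable_minus)

lift_definition minus_htensor :: "('a, 'b) htensor \<Rightarrow> ('a, 'b) htensor \<Rightarrow> ('a, 'b) htensor"
  is "\<lambda>f g p. f p - g p" by (auto intro: sq_summable_diff)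

lift_definition scaleR_htensor :: "real \<Rightarrow> ('a, 'b) htensor \<Rightarrow> ('a, 'b) htensor"
  is "\<lambda>r f p. complex_of_real r * f p" by (auto intro: sq_summable_scale)

instance
  by (intro_classes; transfer) (auto simp: algebra_simps)

end

instantiation htensor :: (complex_hilbert, complex_hilbert) real_normed_vector
begin

lift_definition norm_htensor :: "('a, 'b) htensor \<Rightarrow> real" is l2_norm .

definition "sgn_htensor (x :: ('a, 'b) htensor) = x /\<^sub>R norm x"

definition "dist_htensor (x :: ('a, 'b) htensor) y = norm (x - y)"

definition uniformity_htensor :: "(('a, 'b) htensor \<times> ('a, 'b) htensor) filter" where
  "uniformity_htensor = (INF e\<in>{0 <..}. principal {(x, y). dist x y < e})"

definition open_htensor :: "('a, 'b) htensor set \<Rightarrow> bool" where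
  "open_htensor S = (\<forall>x\<in>S. \<forall>\<^sub>F (x', y) in uniformity. x' = x \<longrightarrow> y \<in> S)"

instance
proof
  fix x y :: "('a, 'b) htensor" and r :: real
  show "dist x y = norm (x - y)" by (rule dist_htensor_def)
  show "sgn x = x /\<^sub>R norm x" by (rule sgn_htensor_def)
  show "norm x = 0 \<longleftrightarrow> x = 0" by transfer (simp add: l2_norm_zero_iff)
  show "norm (x + y) \<le> norm x + norm y" by transfer (simp add: sq_summable_add)
  show "norm (r *\<^sub>R x) = \<bar>r\<bar> * norm x" by transfer (simp add: l2_norm_scale)
qed (rule uniformity_htensor_def open_htensor_def)+

end

instantiation htensor :: (complex_hilbert, complex_hilbert) complex_hilbert
begin

lift_definition scaleC_htensor :: "complex \<Rightarrow> ('a, 'b) htensor \<Rightarrow> ('a, 'b) htensor"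
  is "\<lambda>c f p. c * f p" by (auto intro: sq_summable_scale)

lift_definition cinner_htensor :: "('a, 'b) htensor \<Rightarrow> ('a, 'b) htensor \<Rightarrow> complex"
  is "\<lambda>f g. \<Sum>\<^sub>\<infinity>p. cnj (f p) * g p" .

instance
proof
  fix x y z :: "('a, 'b) htensor" and r :: real and c d :: complex
  show "c *\<^sub>C (x + y) = c *\<^sub>C x + c *\<^sub>C y" by transfer (simp add: algebra_simps)
  show "(c + d) *\<^sub>C x = c *\<^sub>C x + d *\<^sub>C x" by transfer (simp add: algebra_simps)
  show "c *\<^sub>C d *\<^sub>C x = (c * d) *\<^sub>C x" by transfer (simp add: algebra_simps)
  show "r *\<^sub>R x = complex_of_real r *\<^sub>C x" by transfer simp
  show "cinner x y = cnj (cinner y x)"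
    by transfer (simp add: infsum_cnj[symmetric] mult.commute)
  show "cinner x (y + z) = cinner x y + cinner x z"
    by transfer (simp add: distrib_left infsum_add l2_inner_summable)
  show "cinner x (c *\<^sub>C y) = c * cinner x y"
    by transfer (simp add: infsum_cmult_right' mult.left_commute)
  show "cinner x x = complex_of_real ((norm x)\<^sup>2)"
  proof -
    let ?f = "Rep_htensor x"
    have fs: "(\<lambda>p. (cmod (?f p))\<^sup>2) summable_on UNIV"
      using Rep_htensor[of x] by (simp add: sq_summable_def)
    have "cinner x x = (\<Sum>\<^sub>\<infinity>p. complex_of_real ((cmod (?f p))\<^sup>2))"
      by (simp only: cinner_htensor.rep_eq cnj_mult_self)
    also have "\<dots> = complex_of_real (\<Sum>\<^sub>\<infinity>p. (cmod (?f p))\<^sup>2)"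
      using infsumI[OF has_sum_of_real[OF has_sum_infsum[OF fs]]] .
    finally show ?thesis
      by (simp add: norm_htensor.rep_eq l2_norm_def infsum_nonneg)
  qed
next
  fix X :: "nat \<Rightarrow> ('a, 'b) htensor"
  assume X: "Cauchy X"
  define Y where "Y n = Rep_htensor (X n)" for n
  have Y: "sq_summable (Y n)" "p \<notin> some_onb \<times> some_onb \<Longrightarrow> Y n p = 0" for n p
    using Rep_htensor[of "X n"] unfolding Y_def by blast+
  have nY: "l2_norm (\<lambda>p. Y m p - Y n p) = norm (X m - X n)" for m n
    by (simp add: norm_htensor.rep_eq minus_htensor.rep_eq Y_def)
  have "\<exists>N. \<forall>m\<ge>N. \<forall>n\<ge>N. l2_norm (\<lambda>p. Y m p - Y n p) < e" if "e > 0" for e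
    using CauchyD[OF X that] by (auto simp: nY)
  from l2_complete[of Y, OF Y(1) this] obtain g where g: "sq_summable g"
    "\<And>p. (\<lambda>n. Y n p) \<longlonglongrightarrow> g p"
    "\<And>e. e > 0 \<Longrightarrow> \<exists>N. \<forall>n\<ge>N. l2_norm (\<lambda>p. Y n p - g p) < e" by blast
  have g0: "g p = 0" if "p \<notin> some_onb \<times> some_onb" for p
    using g(2)[of p] Y(2)[OF that] by (simp add: LIMSEQ_const_iff)
  define G where "G = Abs_htensor g"
  have rG: "Rep_htensor G = g" unfolding G_def
    by (rule Abs_htensor_inverse) (use g g0 in auto)
  have "X \<longlonglongrightarrow> G"
    by (rule LIMSEQ_I) (use g(3) in \<open>simp add: norm_htensor.rep_eq minus_htensor.rep_eq rG Y_def\<close>)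
  then show "convergent X" by (auto simp: convergent_def)
qed

end

lift_definition htens :: "'a::complex_hilbert \<Rightarrow> 'b::complex_hilbert \<Rightarrow> ('a, 'b) htensor"
    (infixr "\<otimes>\<^sub>h" 72)
  is "\<lambda>x y (d, e). if d \<in> some_onb \<and> e \<in> some_onb then cinner d x * cinner e y else 0"
proof (intro CollectI conjI allI impI)
  fix x :: 'a and y :: 'b
  let ?D = "some_onb :: 'a set" and ?E = "some_onb :: 'b set"
  let ?f = "\<lambda>(d, e). if d \<in> ?D \<and> e \<in> ?E then cinner d x * cinner e y else 0"
  fix p :: "'a \<times> 'b" assume "p \<notin> some_onb \<times> some_onb"
  then show "?f p = 0" by (cases p) auto
next
  fix x :: 'a and y :: 'b
  let ?D = "some_onb :: 'a set" and ?E = "some_onb :: 'b set"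
  let ?f = "\<lambda>(d, e). if d \<in> ?D \<and> e \<in> ?E then cinner d x * cinner e y else 0"
  have "(\<lambda>(d, e). (cmod (cinner d x))\<^sup>2 * (cmod (cinner e y))\<^sup>2) summable_on ?D \<times> ?E"
    by (intro summable_on_SigmaI[where g = "\<lambda>d. (cmod (cinner d x))\<^sup>2 * (\<Sum>\<^sub>\<infinity>e\<in>?E. (cmod (cinner e y))\<^sup>2)"])
      (auto intro!: has_sum_cmult_right has_sum_infsum summable_on_cmult_left parseval(2) orthonormal_basis_some_onb)
  also have "?this \<longleftrightarrow> sq_summable ?f"
    unfolding sq_summable_def
    by (rule summable_on_cong_neutral) (auto simp: norm_mult power_mult_distrib split: if_splits)
  finally show "sq_summable ?f" .
qed

lemma cinner_htens: "cinner (x \<otimes>\<^sub>h y) (x' \<otimes>\<^sub>h y') = cinner x x' * cinner y y'"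
proof -
  let ?D = "some_onb :: 'a set" and ?E = "some_onb :: 'b set"
  have rep: "Rep_htensor (x \<otimes>\<^sub>h y) =
      (\<lambda>(d, e). if d \<in> ?D \<and> e \<in> ?E then cinner d x * cinner e y else 0)" for x :: 'a and y :: 'b
    by (rule htens.rep_eq)
  let ?F = "\<lambda>(d, e). (cnj (cinner d x) * cinner d x') * (cnj (cinner e y) * cinner e y')"
  have summ: "(\<lambda>p. cnj (Rep_htensor (x \<otimes>\<^sub>h y) p) * Rep_htensor (x' \<otimes>\<^sub>h y') p) summable_on UNIV"
    using Rep_htensor[of "x \<otimes>\<^sub>h y"] Rep_htensor[of "x' \<otimes>\<^sub>h y'"] by (intro l2_inner_summable) auto
  have eq: "(\<Sum>\<^sub>\<infinity>p. cnj (Rep_htensor (x \<otimes>\<^sub>h y) p) * Rep_htensor (x' \<otimes>\<^sub>h y') p) = infsum ?F (?D \<times> ?E)"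
    by (rule infsum_cong_neutral) (auto simp: rep split: if_splits)
  have "(\<lambda>p. cnj (Rep_htensor (x \<otimes>\<^sub>h y) p) * Rep_htensor (x' \<otimes>\<^sub>h y') p) summable_on UNIV \<longleftrightarrow> ?F summable_on ?D \<times> ?E"
    by (rule summable_on_cong_neutral) (auto simp: rep split: if_splits)
  with summ have sF: "?F summable_on ?D \<times> ?E" by blast
  have "infsum ?F (?D \<times> ?E) = (\<Sum>\<^sub>\<infinity>d\<in>?D. \<Sum>\<^sub>\<infinity>e\<in>?E. ?F (d, e))"
    using infsum_Sigma'_banach[of "\<lambda>d e. ?F (d, e)" ?D "\<lambda>_. ?E"] sF by simp
  also have "\<dots> = cinner x x' * cinner y y'"
    using infsumI[OF parseval(1)[OF orthonormal_basis_some_onb, of x x']]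
      infsumI[OF parseval(1)[OF orthonormal_basis_some_onb, of y y']]
    by (simp add: infsum_cmult_right' infsum_cmult_left')
  finally show ?thesis by (simp add: cinner_htensor.rep_eq eq)
qed


lemma htens_scaleC_left: "(c *\<^sub>C x) \<otimes>\<^sub>h y = c *\<^sub>C (x \<otimes>\<^sub>h y)"
  by transfer (auto simp: cinner_scaleC_right)

lemma orthonormal_basis_htens:
  "orthonormal_basis {b \<otimes>\<^sub>h c | b c. b \<in> (some_onb :: 'a::complex_hilbert set) \<and> c \<in> (some_onb :: 'b::complex_hilbert set)}"
  (is "orthonormal_basis ?B")
proof -
  have onA: "\<And>x y. x \<in> some_onb \<Longrightarrow> y \<in> some_onb \<Longrightarrow> cinner x y = (if x = (y :: 'a) then 1 else 0)"
    and onB: "\<And>x y. x \<in> some_onb \<Longrightarrow> y \<in> some_onb \<Longrightarrow> cinner x y = (if x = (y :: 'b) then 1 else 0)"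
    using orthonormal_basis_some_onb unfolding orthonormal_basis_def by blast+
  have coord: "cinner (b \<otimes>\<^sub>h c) z = Rep_htensor z (b, c)" if "b \<in> some_onb" "c \<in> some_onb"
    for b :: 'a and c :: 'b and z
  proof -
    have "cinner (b \<otimes>\<^sub>h c) z = (\<Sum>\<^sub>\<infinity>p\<in>{(b, c)}. Rep_htensor z p)"
      unfolding cinner_htensor.rep_eq htens.rep_eq
      by (rule infsum_cong_neutral) (auto simp: onA onB that split: if_splits)
    then show ?thesis by simp
  qed
  have tot: "z = 0" if "\<forall>b\<in>?B. cinner b z = 0" for z
  proof -
    have "Rep_htensor z p = 0" for p
    proof (cases "p \<in> some_onb \<times> some_onb")
      case True
      then obtain b c where p: "p = (b, c)" "b \<in> some_onb" "c \<in> some_onb" by blast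
      then have "cinner (b \<otimes>\<^sub>h c) z = 0" using that by blast
      then show ?thesis using coord p by simp
    next
      case False
      then show ?thesis using Rep_htensor[of z] by blast
    qed
    then show ?thesis by transfer blast
  qed
  have on: "cinner x y = (if x = y then 1 else 0)" if xy: "x \<in> ?B" "y \<in> ?B" for x y
  proof -
    obtain b c b' c' where *: "x = b \<otimes>\<^sub>h c" "y = b' \<otimes>\<^sub>h c'"
      "b \<in> some_onb" "c \<in> some_onb" "b' \<in> some_onb" "c' \<in> some_onb"
      using xy by blast
    have xy: "cinner x y = (if b = b' \<and> c = c' then 1 else 0)" and xx: "cinner x x = 1"
      using * by (auto simp: cinner_htens onA onB)
    show ?thesis
    proof (cases "x = y")
      case True
      then show ?thesis using xx by simp
    next
      case False
      then have "\<not> (b = b' \<and> c = c')" using * by blast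
      then show ?thesis using xy False by simp
    qed
  qed
  show ?thesis
    unfolding orthonormal_basis_def
  proof (rule conjI)
    show "\<forall>x\<in>?B. \<forall>y\<in>?B. cinner x y = (if x = y then 1 else 0)" by (intro ballI on)
    show "\<forall>x. (\<forall>b\<in>?B. cinner b x = 0) \<longrightarrow> x = 0" by (intro allI impI, rule tot)
  qed
qed

lemma htens_total: "closure (span {x \<otimes>\<^sub>h y | x y. True}) = (UNIV :: ('a::complex_hilbert, 'b::complex_hilbert) htensor set)"
proof -
  let ?B = "{b \<otimes>\<^sub>h c | b c. b \<in> (some_onb :: 'a set) \<and> c \<in> (some_onb :: 'b set)}"
  have "z \<in> closure (span {x \<otimes>\<^sub>h y | x y. True})" for z :: "('a, 'b) htensor"
  proof -
    obtain F where F: "\<forall>n. finite (F n) \<and> F n \<subseteq> ?B"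
      and lim: "(\<lambda>n. \<Sum>b\<in>F n. cinner b z *\<^sub>C b) \<longlonglongrightarrow> z"
      using bessel_approx[OF orthonormal_basis_htens, of z] by (elim exE conjE)
    have "(\<Sum>b\<in>F n. cinner b z *\<^sub>C b) \<in> span {x \<otimes>\<^sub>h y | x y. True}" for n
    proof (rule span_sum)
      fix b assume "b \<in> F n"
      then obtain x y where "b = x \<otimes>\<^sub>h y" using F by blast
      then have "cinner b z *\<^sub>C b = (cinner b z *\<^sub>C x) \<otimes>\<^sub>h y" by (simp add: htens_scaleC_left)
      then show "cinner b z *\<^sub>C b \<in> span {x \<otimes>\<^sub>h y | x y. True}" by (intro span_base) blast
    qed
    with lim show ?thesis
      unfolding closure_sequential by (intro exI conjI allI)
  qed
  then show ?thesis by (intro equalityI subset_UNIV subsetI)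
qed

subsection \<open>The complex conjugate Hilbert space\<close>

typedef (overloaded) 'a conj_space = "UNIV :: 'a::complex_hilbert set"
  morphisms of_conj to_conj ..

setup_lifting type_definition_conj_space

instantiation conj_space :: (complex_hilbert) real_vector
begin

lift_definition zero_conj_space :: "'a conj_space" is 0 .
lift_definition plus_conj_space :: "'a conj_space \<Rightarrow> 'a conj_space \<Rightarrow> 'a conj_space" is "(+)" .
lift_definition uminus_conj_space :: "'a conj_space \<Rightarrow> 'a conj_space" is uminus .
lift_definition minus_conj_space :: "'a conj_space \<Rightarrow> 'a conj_space \<Rightarrow> 'a conj_space" is "(-)" .
lift_definition scaleR_conj_space :: "real \<Rightarrow> 'a conj_space \<Rightarrow> 'a conj_space" is scaleR .

instance
  by (intro_classes; transfer) (auto simp: scaleR_add_right scaleR_add_left)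

end

instantiation conj_space :: (complex_hilbert) real_normed_vector
begin

lift_definition norm_conj_space :: "'a conj_space \<Rightarrow> real" is norm .

definition "sgn_conj_space (x :: 'a conj_space) = x /\<^sub>R norm x"

definition "dist_conj_space (x :: 'a conj_space) y = norm (x - y)"

definition uniformity_conj_space :: "('a conj_space \<times> 'a conj_space) filter" where
  "uniformity_conj_space = (INF e\<in>{0 <..}. principal {(x, y). dist x y < e})"

definition open_conj_space :: "'a conj_space set \<Rightarrow> bool" where
  "open_conj_space S = (\<forall>x\<in>S. \<forall>\<^sub>F (x', y) in uniformity. x' = x \<longrightarrow> y \<in> S)"

instance
proof
  fix x y :: "'a conj_space" and r :: real
  show "dist x y = norm (x - y)" by (rule dist_conj_space_def)
  show "sgn x = x /\<^sub>R norm x" by (rule sgn_conj_space_def)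
  show "norm x = 0 \<longleftrightarrow> x = 0" by transfer simp
  show "norm (x + y) \<le> norm x + norm y" by transfer (rule norm_triangle_ineq)
  show "norm (r *\<^sub>R x) = \<bar>r\<bar> * norm x" by transfer simp
qed (rule uniformity_conj_space_def open_conj_space_def)+

end

instantiation conj_space :: (complex_hilbert) complex_hilbert
begin

lift_definition scaleC_conj_space :: "complex \<Rightarrow> 'a conj_space \<Rightarrow> 'a conj_space"
  is "\<lambda>c x. cnj c *\<^sub>C x" .

lift_definition cinner_conj_space :: "'a conj_space \<Rightarrow> 'a conj_space \<Rightarrow> complex"
  is "\<lambda>x y. cinner y x" .

instance
proof
  fix x y z :: "'a conj_space" and r :: real and c d :: complex
  show "c *\<^sub>C (x + y) = c *\<^sub>C x + c *\<^sub>C y" by transfer (rule scaleC_add_right)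
  show "(c + d) *\<^sub>C x = c *\<^sub>C x + d *\<^sub>C x" by transfer (simp add: scaleC_add_left)
  show "c *\<^sub>C d *\<^sub>C x = (c * d) *\<^sub>C x" by transfer (simp add: scaleC_scaleC)
  show "r *\<^sub>R x = complex_of_real r *\<^sub>C x" by transfer (simp add: scaleR_scaleC)
  show "cinner x y = cnj (cinner y x)" by transfer (rule cinner_commute)
  show "cinner x (y + z) = cinner x y + cinner x z" by transfer (rule cinner_add_left)
  show "cinner x (c *\<^sub>C y) = c * cinner x y" by transfer (simp add: cinner_scaleC_left)
  show "cinner x x = complex_of_real ((norm x)\<^sup>2)" by transfer (rule cinner_norm)
next
  fix X :: "nat \<Rightarrow> 'a conj_space"
  assume X: "Cauchy X"
  have "norm (of_conj (X m) - of_conj (X n)) = norm (X m - X n)" for m n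
    by (simp add: norm_conj_space.rep_eq minus_conj_space.rep_eq)
  then have "Cauchy (\<lambda>n. of_conj (X n))" using X by (simp add: Cauchy_iff)
  then obtain l where l: "(\<lambda>n. of_conj (X n)) \<longlonglongrightarrow> l"
    using Cauchy_convergent_iff convergent_def by blast
  have "norm (X n - to_conj l) = norm (of_conj (X n) - l)" for n
    by (simp add: norm_conj_space.rep_eq minus_conj_space.rep_eq to_conj_inverse)
  then have "X \<longlonglongrightarrow> to_conj l" using l by (simp add: LIMSEQ_iff)
  then show "convergent X" by (auto simp: convergent_def)
qed

end

subsection \<open>Bounded operators\<close>

text \<open>
  The library type \<open>'a \<Rightarrow>\<^sub>L 'b\<close> consists of the bounded real-linear maps with the operator norm;
  \<open>bops\<close> is the subspace of complex-linear ones. Real spans are used throughout: all generating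
  sets below are closed under complex scalars, so that real and complex span agree.
\<close>

definition bops :: "('a::complex_hilbert \<Rightarrow>\<^sub>L 'b::complex_hilbert) set" where
  "bops = {T. \<forall>c x. blinfun_apply T (c *\<^sub>C x) = c *\<^sub>C T x}"

definition cscale :: "complex \<Rightarrow> ('a::complex_hilbert \<Rightarrow>\<^sub>L 'b::complex_hilbert) \<Rightarrow> ('a \<Rightarrow>\<^sub>L 'b)" where
  "cscale c T = Blinfun (\<lambda>x. c *\<^sub>C T x)"

definition adj :: "('a::complex_hilbert \<Rightarrow>\<^sub>L 'b::complex_hilbert) \<Rightarrow> ('b \<Rightarrow>\<^sub>L 'a)" ("_\<^sup>\<dagger>" [1000] 999) where
  "T\<^sup>\<dagger> = (THE S. \<forall>x y. cinner (blinfun_apply S x) y = cinner x (T y))"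

definition unitary :: "('a::complex_hilbert \<Rightarrow>\<^sub>L 'b::complex_hilbert) \<Rightarrow> bool" where
  "unitary U \<longleftrightarrow> U \<in> bops \<and> U\<^sup>\<dagger> o\<^sub>L U = id_blinfun \<and> U o\<^sub>L U\<^sup>\<dagger> = id_blinfun"

definition op_tensor ::
  "('a::complex_hilbert \<Rightarrow>\<^sub>L 'c::complex_hilbert) \<Rightarrow> ('b::complex_hilbert \<Rightarrow>\<^sub>L 'd::complex_hilbert) \<Rightarrow>
    (('a, 'b) htensor \<Rightarrow>\<^sub>L ('c, 'd) htensor)" (infixr "\<otimes>\<^sub>o" 72) where
  "S \<otimes>\<^sub>o T = (THE R. R \<in> bops \<and> (\<forall>x y. blinfun_apply R (x \<otimes>\<^sub>h y) = S x \<otimes>\<^sub>h T y))"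

definition flip :: "('a::complex_hilbert, 'b::complex_hilbert) htensor \<Rightarrow>\<^sub>L ('b, 'a) htensor" where
  "flip = (THE R. R \<in> bops \<and> (\<forall>x y. blinfun_apply R (x \<otimes>\<^sub>h y) = y \<otimes>\<^sub>h x))"

definition assoc ::
  "(('a::complex_hilbert, 'b::complex_hilbert) htensor, 'c::complex_hilbert) htensor \<Rightarrow>\<^sub>L
    ('a, ('b, 'c) htensor) htensor" where
  "assoc = (THE R. R \<in> bops \<and> (\<forall>x y z. blinfun_apply R ((x \<otimes>\<^sub>h y) \<otimes>\<^sub>h z) = x \<otimes>\<^sub>h (y \<otimes>\<^sub>h z)))"

text \<open>Threefold tensor products are bracketed to the left; \<open>reassoc\<close> brings an operator on a
  right-bracketed product into this form.\<close>

definition reassoc ::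
  "(('a::complex_hilbert, ('b::complex_hilbert, 'c::complex_hilbert) htensor) htensor \<Rightarrow>\<^sub>L
      ('a, ('b, 'c) htensor) htensor) \<Rightarrow>
    ((('a, 'b) htensor, 'c) htensor \<Rightarrow>\<^sub>L (('a, 'b) htensor, 'c) htensor)" where
  "reassoc T = assoc\<^sup>\<dagger> o\<^sub>L T o\<^sub>L assoc"

definition leg12 ::
  "(('a::complex_hilbert, 'b::complex_hilbert) htensor \<Rightarrow>\<^sub>L ('a, 'b) htensor) \<Rightarrow>
    ((('a, 'b) htensor, 'c::complex_hilbert) htensor \<Rightarrow>\<^sub>L (('a, 'b) htensor, 'c) htensor)" where
  "leg12 T = T \<otimes>\<^sub>o id_blinfun"

definition leg23 ::
  "(('b::complex_hilbert, 'c::complex_hilbert) htensor \<Rightarrow>\<^sub>L ('b, 'c) htensor) \<Rightarrow>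
    ((('a::complex_hilbert, 'b) htensor, 'c) htensor \<Rightarrow>\<^sub>L (('a, 'b) htensor, 'c) htensor)" where
  "leg23 T = reassoc (id_blinfun \<otimes>\<^sub>o T)"

definition leg13 ::
  "(('a::complex_hilbert, 'c::complex_hilbert) htensor \<Rightarrow>\<^sub>L ('a, 'c) htensor) \<Rightarrow>
    ((('a, 'b::complex_hilbert) htensor, 'c) htensor \<Rightarrow>\<^sub>L (('a, 'b) htensor, 'c) htensor)" where
  "leg13 T = (flip \<otimes>\<^sub>o id_blinfun) o\<^sub>L leg23 T o\<^sub>L (flip \<otimes>\<^sub>o id_blinfun)"

subsection \<open>C*-algebras, multipliers and morphisms\<close>

text \<open>
  A C*-algebra is given by a faithful nondegenerate representation on a Hilbert space, that is, as
  a norm-closed *-algebra of operators acting nondegenerately. Spatial tensor products and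
  multiplier algebras are formed in this representation.
\<close>

definition cstar_algebra :: "('a::complex_hilbert \<Rightarrow>\<^sub>L 'a) set \<Rightarrow> bool" where
  "cstar_algebra A \<longleftrightarrow>
     A \<subseteq> bops \<and> closed A \<and> 0 \<in> A \<and>
     (\<forall>S\<in>A. \<forall>T\<in>A. S + T \<in> A \<and> S o\<^sub>L T \<in> A) \<and>
     (\<forall>T\<in>A. T\<^sup>\<dagger> \<in> A \<and> (\<forall>c. cscale c T \<in> A)) \<and>
     closure (span {blinfun_apply T x | T x. T \<in> A}) = UNIV"

definition cstar_tensor ::
  "('a::complex_hilbert \<Rightarrow>\<^sub>L 'a) set \<Rightarrow> ('b::complex_hilbert \<Rightarrow>\<^sub>L 'b) set \<Rightarrow>
    (('a, 'b) htensor \<Rightarrow>\<^sub>L ('a, 'b) htensor) set" (infixr "\<otimes>\<^sub>A" 72) where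
  "A \<otimes>\<^sub>A B = closure (span {S \<otimes>\<^sub>o T | S T. S \<in> A \<and> T \<in> B})"

definition multipliers :: "('a::complex_hilbert \<Rightarrow>\<^sub>L 'a) set \<Rightarrow> ('a \<Rightarrow>\<^sub>L 'a) set" where
  "multipliers A = {m \<in> bops. \<forall>T\<in>A. m o\<^sub>L T \<in> A \<and> T o\<^sub>L m \<in> A}"

definition unitary_multipliers :: "('a::complex_hilbert \<Rightarrow>\<^sub>L 'a) set \<Rightarrow> ('a \<Rightarrow>\<^sub>L 'a) set" where
  "unitary_multipliers A = {U \<in> multipliers A. unitary U}"

text \<open>Maps defined on a C*-algebra \<open>A\<close> are made extensional outside \<open>A\<close>, so that equality of maps on
  \<open>A\<close> is HOL equality.\<close>

definition star_hom ::
  "('a::complex_hilbert \<Rightarrow>\<^sub>L 'a) set \<Rightarrow> (('a \<Rightarrow>\<^sub>L 'a) \<Rightarrow> ('b::complex_hilbert \<Rightarrow>\<^sub>L 'b)) \<Rightarrow> bool" where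
  "star_hom A \<phi> \<longleftrightarrow>
     \<phi> \<in> A \<rightarrow>\<^sub>E bops \<and>
     (\<forall>S\<in>A. \<forall>T\<in>A. \<phi> (S + T) = \<phi> S + \<phi> T \<and> \<phi> (S o\<^sub>L T) = \<phi> S o\<^sub>L \<phi> T) \<and>
     (\<forall>T\<in>A. \<phi> (T\<^sup>\<dagger>) = (\<phi> T)\<^sup>\<dagger> \<and> (\<forall>c. \<phi> (cscale c T) = cscale c (\<phi> T)))"

definition morphism ::
  "('a::complex_hilbert \<Rightarrow>\<^sub>L 'a) set \<Rightarrow> ('b::complex_hilbert \<Rightarrow>\<^sub>L 'b) set \<Rightarrow>
    (('a \<Rightarrow>\<^sub>L 'a) \<Rightarrow> ('b \<Rightarrow>\<^sub>L 'b)) \<Rightarrow> bool" where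
  "morphism A B \<phi> \<longleftrightarrow>
     star_hom A \<phi> \<and> \<phi> \<in> A \<rightarrow>\<^sub>E multipliers B \<and>
     closure (span {\<phi> S o\<^sub>L T | S T. S \<in> A \<and> T \<in> B}) = B"

definition id_morphism :: "('a::complex_hilbert \<Rightarrow>\<^sub>L 'a) set \<Rightarrow> ('a \<Rightarrow>\<^sub>L 'a) \<Rightarrow> ('a \<Rightarrow>\<^sub>L 'a)" where
  "id_morphism A = restrict (\<lambda>T. T) A"

text \<open>The value at a multiplier \<open>m\<close> of \<open>A\<close> of the unique extension of the morphism \<open>\<phi>\<close>.\<close>

definition extension ::
  "('a::complex_hilbert \<Rightarrow>\<^sub>L 'a) set \<Rightarrow> (('a \<Rightarrow>\<^sub>L 'a) \<Rightarrow> ('b::complex_hilbert \<Rightarrow>\<^sub>L 'b)) \<Rightarrow>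
    ('a \<Rightarrow>\<^sub>L 'a) \<Rightarrow> ('b \<Rightarrow>\<^sub>L 'b)" where
  "extension A \<phi> m = (THE R. R \<in> bops \<and> (\<forall>T\<in>A. R o\<^sub>L \<phi> T = \<phi> (m o\<^sub>L T)))"

definition tensor_hom ::
  "('a::complex_hilbert \<Rightarrow>\<^sub>L 'a) set \<Rightarrow> (('a \<Rightarrow>\<^sub>L 'a) \<Rightarrow> ('c::complex_hilbert \<Rightarrow>\<^sub>L 'c)) \<Rightarrow>
    ('b::complex_hilbert \<Rightarrow>\<^sub>L 'b) set \<Rightarrow> (('b \<Rightarrow>\<^sub>L 'b) \<Rightarrow> ('d::complex_hilbert \<Rightarrow>\<^sub>L 'd)) \<Rightarrow>
    (('a, 'b) htensor \<Rightarrow>\<^sub>L ('a, 'b) htensor) \<Rightarrow> (('c, 'd) htensor \<Rightarrow>\<^sub>L ('c, 'd) htensor)" where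
  "tensor_hom A \<phi> B \<psi> =
     (THE \<Phi>. star_hom (A \<otimes>\<^sub>A B) \<Phi> \<and> (\<forall>S\<in>A. \<forall>T\<in>B. \<Phi> (S \<otimes>\<^sub>o T) = \<phi> S \<otimes>\<^sub>o \<psi> T))"

text \<open>\<open>(\<phi> \<otimes> \<psi>)(m)\<close> for a multiplier \<open>m\<close> of \<open>A \<otimes> B\<close>.\<close>

definition tensor_ext ::
  "('a::complex_hilbert \<Rightarrow>\<^sub>L 'a) set \<Rightarrow> (('a \<Rightarrow>\<^sub>L 'a) \<Rightarrow> ('c::complex_hilbert \<Rightarrow>\<^sub>L 'c)) \<Rightarrow>
    ('b::complex_hilbert \<Rightarrow>\<^sub>L 'b) set \<Rightarrow> (('b \<Rightarrow>\<^sub>L 'b) \<Rightarrow> ('d::complex_hilbert \<Rightarrow>\<^sub>L 'd)) \<Rightarrow>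
    (('a, 'b) htensor \<Rightarrow>\<^sub>L ('a, 'b) htensor) \<Rightarrow> (('c, 'd) htensor \<Rightarrow>\<^sub>L ('c, 'd) htensor)" where
  "tensor_ext A \<phi> B \<psi> = extension (A \<otimes>\<^sub>A B) (tensor_hom A \<phi> B \<psi>)"

subsection \<open>Unbounded operators\<close>

text \<open>An unbounded operator \<open>Q\<close> is represented by its graph \<open>{(x, Q x) | x \<in> dom Q}\<close>.\<close>

definition adj_graph :: "('a::complex_hilbert \<times> 'a) set \<Rightarrow> ('a \<times> 'a) set" where
  "adj_graph G = {(u, v). \<forall>(x, y)\<in>G. cinner u y = cinner v x}"

definition operator_graph :: "('a::complex_hilbert \<times> 'a) set \<Rightarrow> bool" where
  "operator_graph G \<longleftrightarrow>
     (0, 0) \<in> G \<and>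
     (\<forall>(x, y)\<in>G. \<forall>(x', y')\<in>G. (x + x', y + y') \<in> G) \<and>
     (\<forall>(x, y)\<in>G. \<forall>c. (c *\<^sub>C x, c *\<^sub>C y) \<in> G) \<and>
     single_valued G \<and> closure (Domain G) = UNIV"

definition pos_self_adjoint :: "('a::complex_hilbert \<times> 'a) set \<Rightarrow> bool" where
  "pos_self_adjoint G \<longleftrightarrow>
     operator_graph G \<and> adj_graph G = G \<and> (\<forall>(x, y)\<in>G. cinner x y \<in> \<real>\<^sub>\<ge>\<^sub>0)"

definition trivial_kernel :: "('a::complex_hilbert \<times> 'a) set \<Rightarrow> bool" where
  "trivial_kernel G \<longleftrightarrow> (\<forall>x. (x, 0) \<in> G \<longrightarrow> x = 0)"

text \<open>\<open>P \<otimes> Q\<close> is the closure of the algebraic tensor product.\<close>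

definition graph_tensor ::
  "('a::complex_hilbert \<times> 'a) set \<Rightarrow> ('b::complex_hilbert \<times> 'b) set \<Rightarrow>
    (('a, 'b) htensor \<times> ('a, 'b) htensor) set" where
  "graph_tensor P Q =
     closure (span {(x \<otimes>\<^sub>h y, x' \<otimes>\<^sub>h y') | x x' y y'. (x, x') \<in> P \<and> (y, y') \<in> Q})"

subsection \<open>Modular multiplicative unitaries and quantum groups\<close>

definition multiplicative ::
  "(('h::complex_hilbert, 'h) htensor \<Rightarrow>\<^sub>L ('h, 'h) htensor) \<Rightarrow> bool" where
  "multiplicative W \<longleftrightarrow> unitary W \<and>
     (leg23 W o\<^sub>L leg12 W :: (('h, 'h) htensor, 'h) htensor \<Rightarrow>\<^sub>L _) = leg12 W o\<^sub>L leg13 W o\<^sub>L leg23 W"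

text \<open>The set equation states \<open>W\<^sup>\<dagger> (P \<otimes> Q) W = P \<otimes> Q\<close> as an equality of unbounded operators,
  domains included; \<open>P\<close> is the operator usually written \<open>Q\<close> with a hat. In the last clause
  \<open>y' = Q y\<close> and \<open>u' = Q\<inverse> u\<close>.\<close>

definition modular_multiplicative ::
  "(('h::complex_hilbert, 'h) htensor \<Rightarrow>\<^sub>L ('h, 'h) htensor) \<Rightarrow> bool" where
  "modular_multiplicative W \<longleftrightarrow> multiplicative W \<and>
     (\<exists>P Q. \<exists>Wt :: ('h conj_space, 'h) htensor \<Rightarrow>\<^sub>L ('h conj_space, 'h) htensor.
        pos_self_adjoint P \<and> trivial_kernel P \<and>
        pos_self_adjoint Q \<and> trivial_kernel Q \<and> unitary Wt \<and>
        {(\<xi>, (W\<^sup>\<dagger>) \<eta>) | \<xi> \<eta>. (W \<xi>, \<eta>) \<in> graph_tensor P Q} = graph_tensor P Q \<and>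
        (\<forall>x z y y' u u'. (y, y') \<in> Q \<longrightarrow> (u, u') \<in> converse Q \<longrightarrow>
           cinner (x \<otimes>\<^sub>h y) (W (z \<otimes>\<^sub>h u)) =
           cinner (to_conj z \<otimes>\<^sub>h y') (Wt (to_conj x \<otimes>\<^sub>h u'))))"

text \<open>The predual of \<open>B(H)\<close>: the normal linear functionals.\<close>

definition predual :: "(('a::complex_hilbert \<Rightarrow>\<^sub>L 'a) \<Rightarrow> complex) set" where
  "predual = {\<omega>. \<exists>x y :: nat \<Rightarrow> 'a.
     summable (\<lambda>n. (norm (x n))\<^sup>2) \<and> summable (\<lambda>n. (norm (y n))\<^sup>2) \<and>
     \<omega> = (\<lambda>T. \<Sum>n. cinner (x n) (blinfun_apply T (y n)))}"

definition matrix_op ::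
  "(('a::complex_hilbert, 'b::complex_hilbert) htensor \<Rightarrow>\<^sub>L ('a, 'b) htensor) \<Rightarrow> 'b \<Rightarrow> 'b \<Rightarrow> ('a \<Rightarrow>\<^sub>L 'a)" where
  "matrix_op T u v =
     (THE S. S \<in> bops \<and> (\<forall>x y. cinner x (blinfun_apply S y) = cinner (x \<otimes>\<^sub>h u) (T (y \<otimes>\<^sub>h v))))"

text \<open>\<open>(\<omega> \<otimes> id)(T)\<close>\<close>

definition slice ::
  "(('a::complex_hilbert \<Rightarrow>\<^sub>L 'a) \<Rightarrow> complex) \<Rightarrow>
    (('a, 'b::complex_hilbert) htensor \<Rightarrow>\<^sub>L ('a, 'b) htensor) \<Rightarrow> ('b \<Rightarrow>\<^sub>L 'b)" where
  "slice \<omega> T = (THE R. R \<in> bops \<and> (\<forall>u v. cinner u (blinfun_apply R v) = \<omega> (matrix_op T u v)))"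

text \<open>The quantum group \<open>(C, \<Delta>)\<close> obtained from a modular multiplicative unitary \<open>W\<close>
  is \<open>(qg W, comult W)\<close>, and its dual is \<open>(qg (dual W), comult (dual W))\<close>. As \<open>qg (dual W)\<close> and
  \<open>qg W\<close> are represented on the same Hilbert space as \<open>W\<close>, the reduced bicharacter is \<open>W\<close> itself.\<close>

definition qg :: "(('h::complex_hilbert, 'h) htensor \<Rightarrow>\<^sub>L ('h, 'h) htensor) \<Rightarrow> ('h \<Rightarrow>\<^sub>L 'h) set" where
  "qg W = closure {slice \<omega> W | \<omega>. \<omega> \<in> predual}"

definition comult ::
  "(('h::complex_hilbert, 'h) htensor \<Rightarrow>\<^sub>L ('h, 'h) htensor) \<Rightarrow>
    ('h \<Rightarrow>\<^sub>L 'h) \<Rightarrow> (('h, 'h) htensor \<Rightarrow>\<^sub>L ('h, 'h) htensor)" where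
  "comult W = restrict (\<lambda>T. W o\<^sub>L (T \<otimes>\<^sub>o id_blinfun) o\<^sub>L W\<^sup>\<dagger>) (qg W)"

definition dual ::
  "(('h::complex_hilbert, 'h) htensor \<Rightarrow>\<^sub>L ('h, 'h) htensor) \<Rightarrow> (('h, 'h) htensor \<Rightarrow>\<^sub>L ('h, 'h) htensor)" where
  "dual W = flip o\<^sub>L W\<^sup>\<dagger> o\<^sub>L flip"

subsection \<open>Corepresentations, universal quantum groups and bicharacters\<close>

definition left_corep ::
  "('a::complex_hilbert \<Rightarrow>\<^sub>L 'a) set \<Rightarrow> (('a \<Rightarrow>\<^sub>L 'a) \<Rightarrow> (('a, 'a) htensor \<Rightarrow>\<^sub>L ('a, 'a) htensor)) \<Rightarrow>
    ('d::complex_hilbert \<Rightarrow>\<^sub>L 'd) set \<Rightarrow> (('a, 'd) htensor \<Rightarrow>\<^sub>L ('a, 'd) htensor) \<Rightarrow> bool" where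
  "left_corep X \<Delta> D U \<longleftrightarrow>
     U \<in> unitary_multipliers (X \<otimes>\<^sub>A D) \<and>
     tensor_ext X \<Delta> D (id_morphism D) U = leg23 U o\<^sub>L leg13 U"

text \<open>
  HOL cannot quantify over types inside a formula, so the universal property is tested against the
  C*-algebras \<open>D\<close> represented on one fixed Hilbert space \<open>'k\<close>. If \<open>'k\<close> is infinite-dimensional and
  at least as large as the spaces \<open>'h\<close> of the quantum group and \<open>'u\<close> of \<open>Cu\<close>, this is the universal
  property with respect to all \<open>D\<close>: the slices of a left corepresentation generate an algebra of
  density at most \<open>dim 'k\<close>, which therefore has a faithful nondegenerate representation on \<open>'k\<close>.
\<close>

definition universal_corep ::
  "'k::complex_hilbert itself \<Rightarrow> (('h::complex_hilbert, 'h) htensor \<Rightarrow>\<^sub>L ('h, 'h) htensor) \<Rightarrow>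
    ('u::complex_hilbert \<Rightarrow>\<^sub>L 'u) set \<Rightarrow> (('h, 'u) htensor \<Rightarrow>\<^sub>L ('h, 'u) htensor) \<Rightarrow> bool" where
  "universal_corep _ W Cu V \<longleftrightarrow>
     cstar_algebra Cu \<and> left_corep (qg (dual W)) (comult (dual W)) Cu V \<and>
     (\<forall>(D :: ('k \<Rightarrow>\<^sub>L 'k) set) U.
        cstar_algebra D \<longrightarrow> left_corep (qg (dual W)) (comult (dual W)) D U \<longrightarrow>
        (\<exists>!\<phi>. morphism Cu D \<phi> \<and>
           U = tensor_ext (qg (dual W)) (id_morphism (qg (dual W))) Cu \<phi> V))"

definition embeds :: "'a::complex_hilbert itself \<Rightarrow> 'k::complex_hilbert itself \<Rightarrow> bool" where
  "embeds _ _ \<longleftrightarrow> (\<exists>J :: 'a \<Rightarrow>\<^sub>L 'k. J \<in> bops \<and> (\<forall>x. norm (J x) = norm x))"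

definition infinite_dimensional :: "'k::complex_hilbert itself \<Rightarrow> bool" where
  "infinite_dimensional _ \<longleftrightarrow> \<not> (\<exists>B. finite B \<and> span B = (UNIV :: 'k set))"

definition universal_comult ::
  "(('h::complex_hilbert, 'h) htensor \<Rightarrow>\<^sub>L ('h, 'h) htensor) \<Rightarrow>
    ('u::complex_hilbert \<Rightarrow>\<^sub>L 'u) set \<Rightarrow> (('h, 'u) htensor \<Rightarrow>\<^sub>L ('h, 'u) htensor) \<Rightarrow>
    (('u \<Rightarrow>\<^sub>L 'u) \<Rightarrow> (('u, 'u) htensor \<Rightarrow>\<^sub>L ('u, 'u) htensor)) \<Rightarrow> bool" where
  "universal_comult W Cu V \<Delta> \<longleftrightarrow>
     morphism Cu (Cu \<otimes>\<^sub>A Cu) \<Delta> \<and>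
     reassoc (tensor_ext (qg (dual W)) (id_morphism (qg (dual W))) Cu \<Delta> V) = leg12 V o\<^sub>L leg13 V"

definition reducing_morphism ::
  "(('h::complex_hilbert, 'h) htensor \<Rightarrow>\<^sub>L ('h, 'h) htensor) \<Rightarrow>
    ('u::complex_hilbert \<Rightarrow>\<^sub>L 'u) set \<Rightarrow> (('h, 'u) htensor \<Rightarrow>\<^sub>L ('h, 'u) htensor) \<Rightarrow>
    (('u \<Rightarrow>\<^sub>L 'u) \<Rightarrow> ('h \<Rightarrow>\<^sub>L 'h)) \<Rightarrow> bool" where
  "reducing_morphism W Cu V \<Lambda> \<longleftrightarrow>
     morphism Cu (qg W) \<Lambda> \<and>
     tensor_ext (qg (dual W)) (id_morphism (qg (dual W))) Cu \<Lambda> V = W"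

definition bicharacter ::
  "('x::complex_hilbert \<Rightarrow>\<^sub>L 'x) set \<Rightarrow> (('x \<Rightarrow>\<^sub>L 'x) \<Rightarrow> (('x, 'x) htensor \<Rightarrow>\<^sub>L ('x, 'x) htensor)) \<Rightarrow>
    ('y::complex_hilbert \<Rightarrow>\<^sub>L 'y) set \<Rightarrow> (('y \<Rightarrow>\<^sub>L 'y) \<Rightarrow> (('y, 'y) htensor \<Rightarrow>\<^sub>L ('y, 'y) htensor)) \<Rightarrow>
    (('x, 'y) htensor \<Rightarrow>\<^sub>L ('x, 'y) htensor) \<Rightarrow> bool" where
  "bicharacter X \<Delta>X Y \<Delta>Y V \<longleftrightarrow>
     V \<in> unitary_multipliers (X \<otimes>\<^sub>A Y) \<and>
     tensor_ext X \<Delta>X Y (id_morphism Y) V = leg23 V o\<^sub>L leg13 V \<and>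
     reassoc (tensor_ext X (id_morphism X) Y \<Delta>Y V) = leg12 V o\<^sub>L leg13 V"

end

theory Submission
  imports Defs "HOL-Library.Equipollence"
begin

text \<open>
  A bicharacter \<open>V\<close> on \<open>X \<otimes> A\<close> is lifted to \<open>X \<otimes> A\<^sup>u\<close> by a commutator. Let \<open>W\<close> be the multiplicative unitary
  of \<open>A\<close>, \<open>\<V>\<close> the universal corepresentation, \<open>v\<close> the flip of \<open>V\<close>, and
  \<open>Y = v\<^sub>1\<^sub>2\<^sup>* \<V>\<^sub>1\<^sub>3 v\<^sub>1\<^sub>2 \<V>\<^sub>1\<^sub>3\<^sup>*\<close> on \<open>H \<otimes> (X \<otimes> A\<^sup>u)\<close>. The character properties of \<open>V\<close> and \<open>\<V>\<close> give
  \<open>W\<^sub>1\<^sub>2 Y\<^sub>1\<^sub>3 = Y\<^sub>2\<^sub>3 W\<^sub>1\<^sub>2\<close>. Then \<open>Y = 1 \<otimes> V'\<close>, and \<open>V'\<close> is the required lift.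

  By slicing, the last step amounts to the fact that \<open>W (a \<otimes> 1) = (1 \<otimes> a) W\<close> forces \<open>a\<close> to be a scalar. This is where
  modularity enters: \<open>a = Q b Q\<inverse> + Q\<inverse> b Q\<close> for a bounded \<open>b\<close> with a similar intertwining property, and
  the relations between \<open>W\<close>, \<open>Wt\<close> and \<open>Q\<close> then express the form \<open>a\<close> on vectors \<open>(\<langle>z| \<otimes> 1) Wt (x \<otimes> y)\<close> through
  \<open>b\<close> acting on \<open>z\<close> alone.

  The lift is unique because \<open>(\<Lambda> \<otimes> id) \<Delta>\<^sup>u\<close> and \<open>T \<mapsto> \<V> (\<Lambda>(T) \<otimes> 1) \<V>\<^sup>*\<close> agree on \<open>\<V>\<close>, hence are equal by
  universality: \<open>\<Delta>\<^sup>u\<close>, and with it a bicharacter, can be recovered from its image under \<open>\<Lambda>\<close>. Exchanging the legs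
  of \<open>V\<^sup>*\<close> gives the lifts in the first leg.
\<close>

text \<open>The commutator comes from the reduced level: on the legs \<open>H\<close>, space of
  \<open>X\<close>, \<open>H\<close> the character property of \<open>V\<close> reads
  \<open>v12\<dagger> W13 v12 W13\<dagger> = V23\<close>. With the universal corepresentation in
  place of \<open>W\<close> the left side becomes an operator that reduces to \<open>V\<close>, and
  the point is that its first leg is trivial.

  Multiplier extensions of tensor products are nested definite descriptions, and intermediate
  operators have legs on which no algebra is prescribed. So a representation of \<open>X\<close> is
  amplified to all adjointable operators of the Hilbert module \<open>X \<otimes> K\<close>: these
  include the multipliers of \<open>X \<otimes> B\<close> for every C*-algebra \<open>B\<close> on
  \<open>K\<close> and are stable under leg placement. The norm bounds, here and for tensor products
  of operators, come from one square root: \<open>n n = K^2 - m\<dagger> m\<close> inside the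
  algebra turns an estimate into the positivity of a Gram matrix.

  Unbounded operators enter only through \<open>c = (1 + Q^2)\<inverse>\<close>,
  \<open>g = Q c\<close> and \<open>s = Q^2 c\<close>, so that conjugation by \<open>Q\<close>
  becomes the equation \<open>s b c + c b s = g a g\<close> between bounded operators.\<close>

no_notation matrix_matrix_mult (infixl "**" 70)
notation blinfun_compose (infixl "**" 70)
notation id_blinfun ("\<one>")
notation op_tensor (infixr "\<otimes>" 72)
notation adj ("_\<dagger>" [1000] 999)

type_synonym ('a, 'b) hop = "('a, 'b) htensor \<Rightarrow>\<^sub>L ('a, 'b) htensor"

section \<open>Hilbert space preliminaries\<close>

lemma cinner_ext: "(\<And>y. cinner y x = cinner y x') \<Longrightarrow> x = x'"
  by (metis cinner_diff_right cinner_eq_zero_iff right_minus_eq)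

lemma cinner_swap_eq: "cinner x y = cinner u v \<Longrightarrow> cinner y x = cinner v u"
  by (subst cinner_commute, subst (2) cinner_commute) simp

lemma bounded_bilinear_cinner: "bounded_bilinear cinner"
  by (rule bounded_bilinear.intro)
    (auto simp: cinner_add_left cinner_add_right scaleR_scaleC cinner_scaleC_left cinner_scaleC_right
      scaleR_conv_of_real intro!: exI[of _ 1] cmod_cinner_le)

lemmas tendsto_cinner = bounded_bilinear.tendsto[OF bounded_bilinear_cinner]

lemma norm_le_cinnerI:
  assumes "K \<ge> 0" "\<And>y. cmod (cinner y x) \<le> K * norm y"
  shows "norm x \<le> K"
proof (cases "x = 0")
  case False
  have "norm x * norm x \<le> K * norm x"
    using assms(2)[of x] by (simp add: cinner_norm norm_power power2_eq_square norm_mult)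
  then show ?thesis using False by simp
qed (use assms(1) in simp)

lemma scaleC_zero_right [simp]: "c *\<^sub>C 0 = 0"
  using scaleC_add_right[of c 0 0] by simp

lemma scaleC_minus_right: "c *\<^sub>C (- x) = - (c *\<^sub>C x)"
  using scaleC_add_right[of c x "- x"] by (simp add: eq_neg_iff_add_eq_0 add.commute)

lemma scaleC_minus_one: "(- 1) *\<^sub>C x = - x"
  using scaleR_scaleC[of "-1" x] by simp

lemma scaleC_diff_right: "c *\<^sub>C (x - y) = c *\<^sub>C x - c *\<^sub>C y"
  using scaleC_add_right[of c x "- y"] by (simp add: scaleC_minus_right)

lemma scaleC_sum_right: "c *\<^sub>C (\<Sum>i\<in>I. f i) = (\<Sum>i\<in>I. c *\<^sub>C f i)"
  by (induction I rule: infinite_finite_induct) (auto simp: scaleC_add_right)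

lemma scaleC_scaleR: "c *\<^sub>C (r *\<^sub>R x) = r *\<^sub>R (c *\<^sub>C x)"
  by (simp add: scaleR_scaleC scaleC_scaleC mult.commute)

lemma bounded_linear_scaleC: "bounded_linear (\<lambda>x. c *\<^sub>C (x :: 'a::complex_hilbert))"
  by (rule bounded_linear_intro[where K = "cmod c"])
    (auto simp: scaleC_add_right scaleC_scaleR norm_scaleC mult.commute)

lemmas tendsto_scaleC = bounded_linear.tendsto[OF bounded_linear_scaleC]

lemma norm_sq_cinner: "(norm x)\<^sup>2 = Re (cinner x x)"
  by (simp add: cinner_norm)

lemma norm_diff_sq: "(norm (x - y))\<^sup>2 = (norm x)\<^sup>2 + (norm y)\<^sup>2 - 2 * Re (cinner x y)"
proof -
  have "Re (cinner y x) = Re (cinner x y)" by (subst cinner_commute) simp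
  then show ?thesis unfolding norm_sq_cinner by (simp add: cinner_diff_left cinner_diff_right)
qed

lemma norm_add_sq: "(norm (x + y))\<^sup>2 = (norm x)\<^sup>2 + (norm y)\<^sup>2 + 2 * Re (cinner x y)"
  using norm_diff_sq[of x "- y"] by (simp add: cinner_minus_right)

lemma cinner_flip_zero: "cinner x y = 0 \<longleftrightarrow> cinner y x = 0"
  by (metis cinner_commute complex_cnj_zero)

text \<open>The graph of an operator is a subspace of this direct sum, so closures of graphs and
  orthogonal projections onto them are covered by the results on closed subspaces.\<close>

instantiation prod :: (complex_hilbert, complex_hilbert) complex_hilbert
begin

definition scaleC_prod :: "complex \<Rightarrow> 'a \<times> 'b \<Rightarrow> 'a \<times> 'b" where
  "scaleC_prod c p = (c *\<^sub>C fst p, c *\<^sub>C snd p)"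

definition cinner_prod :: "'a \<times> 'b \<Rightarrow> 'a \<times> 'b \<Rightarrow> complex" where
  "cinner_prod p q = cinner (fst p) (fst q) + cinner (snd p) (snd q)"

instance
proof
  fix x y :: "'a \<times> 'b"
  show "cinner x y = cnj (cinner y x)"
    by (simp add: cinner_prod_def cinner_commute[of "fst x"] cinner_commute[of "snd x"])
  show "cinner x x = complex_of_real ((norm x)\<^sup>2)"
    by (simp add: cinner_prod_def norm_prod_def cinner_norm)
qed (auto simp: scaleC_prod_def cinner_prod_def scaleC_add_right scaleC_add_left scaleC_scaleC
      scaleR_scaleC cinner_add_right cinner_scaleC_right algebra_simps prod_eq_iff)

end

lemma cinner_Pair [simp]: "cinner (a, b) (c, d) = cinner a c + cinner b d"
  by (simp add: cinner_prod_def)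

lemma scaleC_Pair [simp]: "c *\<^sub>C (a, b) = (c *\<^sub>C a, c *\<^sub>C b)"
  by (simp add: scaleC_prod_def)

subsection \<open>Closed subspaces and total sets\<close>

definition csubspace :: "'a::complex_hilbert set \<Rightarrow> bool" where
  "csubspace M \<longleftrightarrow> 0 \<in> M \<and> (\<forall>x\<in>M. \<forall>y\<in>M. x + y \<in> M) \<and> (\<forall>c. \<forall>x\<in>M. c *\<^sub>C x \<in> M)"

lemma csubspace_diff: "csubspace M \<Longrightarrow> x \<in> M \<Longrightarrow> y \<in> M \<Longrightarrow> x - y \<in> M"
  unfolding csubspace_def by (metis scaleC_minus_one add_uminus_conv_diff)

lemma csubspace_scaleR: "csubspace M \<Longrightarrow> x \<in> M \<Longrightarrow> r *\<^sub>R x \<in> M"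
  by (simp add: csubspace_def scaleR_scaleC)

lemma csubspace_closure:
  assumes "csubspace M" shows "csubspace (closure M)"
  unfolding csubspace_def
proof (intro conjI ballI allI)
  show "0 \<in> closure M" using assms closure_subset by (auto simp: csubspace_def)
  fix x assume x: "x \<in> closure M"
  then obtain f where f: "\<forall>n. f n \<in> M" "f \<longlonglongrightarrow> x" by (auto simp: closure_sequential)
  show "c *\<^sub>C x \<in> closure M" for c
    using f assms tendsto_scaleC[OF f(2), of c] unfolding closure_sequential
    by (intro exI[of _ "\<lambda>n. c *\<^sub>C f n"]) (auto simp: csubspace_def)
  fix y assume "y \<in> closure M"
  then obtain g where "\<forall>n. g n \<in> M" "g \<longlonglongrightarrow> y" by (auto simp: closure_sequential)
  then show "x + y \<in> closure M" unfolding closure_sequential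
    using f assms tendsto_add[of f x sequentially g y]
    by (intro exI[of _ "\<lambda>n. f n + g n"]) (auto simp: csubspace_def)
qed

lemma csubspace_span:
  assumes "\<And>c x. x \<in> S \<Longrightarrow> c *\<^sub>C x \<in> S" shows "csubspace (span S)"
  unfolding csubspace_def
proof (intro conjI ballI allI)
  fix c x assume "x \<in> span S"
  then show "c *\<^sub>C x \<in> span S"
  proof (induction rule: span_induct_alt)
    case (step r x y)
    then show ?case
      by (simp add: scaleC_add_right scaleC_scaleR span_add span_scale span_base assms)
  qed (simp add: span_zero)
qed (auto intro: span_zero span_add)

theorem orthogonal_decomposition:
  assumes M: "csubspace M" "closed M"
  shows "\<exists>m\<in>M. \<forall>x\<in>M. cinner x (h - m) = 0"
proof -
  define d where "d = (INF x\<in>M. (norm (h - x))\<^sup>2)"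
  have ne: "M \<noteq> {}" using M by (auto simp: csubspace_def)
  have bdd: "bdd_below ((\<lambda>x. (norm (h - x))\<^sup>2) ` M)" by (auto intro!: bdd_belowI2[where m = 0])
  have dle: "d \<le> (norm (h - x))\<^sup>2" if "x \<in> M" for x
    unfolding d_def using bdd that by (rule cINF_lower)
  have "\<exists>x\<in>M. (norm (h - x))\<^sup>2 < d + 1 / Suc n" for n
    using cINF_less_iff[OF ne bdd, of "d + 1 / Suc n"] unfolding d_def by simp
  then obtain f where f: "\<And>n. f n \<in> M" "\<And>n. (norm (h - f n))\<^sup>2 < d + 1 / Suc n" by metis
  \<comment> \<open>Parallelogram law: the midpoint of two approximants lies in \<open>M\<close>, so
    its squared distance to \<open>h\<close> is at least the infimum \<open>d\<close>. This forces a
    minimizing sequence to be Cauchy.\<close>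
  have par: "(norm (f m - f n))\<^sup>2 \<le> 2 / Suc m + 2 / Suc n" for m n
  proof -
    define u v where "u = h - f m" and "v = h - f n"
    have "(norm (u - v))\<^sup>2 + (norm (u + v))\<^sup>2 = 2 * (norm u)\<^sup>2 + 2 * (norm v)\<^sup>2"
      by (simp add: norm_diff_sq norm_add_sq)
    moreover have "u - v = - (f m - f n)" by (simp add: u_def v_def)
    moreover have "u + v = 2 *\<^sub>R (h - (1/2) *\<^sub>R (f m + f n))" by (simp add: u_def v_def algebra_simps scaleR_2)
    moreover have "d \<le> (norm (h - (1/2) *\<^sub>R (f m + f n)))\<^sup>2"
      using M f by (intro dle csubspace_scaleR) (auto simp: csubspace_def)
    ultimately show ?thesis using f(2)[of m] f(2)[of n]
      by (simp add: power_mult_distrib u_def v_def norm_minus_commute)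
  qed
  have "Cauchy f"
  proof (rule CauchyI)
    fix e :: real assume e: "e > 0"
    obtain N where N: "inverse (real (Suc N)) < e\<^sup>2 / 4"
      using reals_Archimedean[of "e\<^sup>2 / 4"] e by auto
    have "norm (f m - f n) < e" if "m \<ge> N" "n \<ge> N" for m n
    proof -
      have "inverse (real (Suc k)) < e\<^sup>2 / 4" if "k \<ge> N" for k
      proof -
        have "inverse (real (Suc k)) \<le> inverse (real (Suc N))" using that by (intro le_imp_inverse_le) auto
        then show ?thesis using N by linarith
      qed
      from this[OF that(1)] this[OF that(2)] have "(norm (f m - f n))\<^sup>2 < e\<^sup>2"
        using par[of m n] by (simp add: inverse_eq_divide)
      then show ?thesis using e by (simp add: power_less_imp_less_base)
    qed
    then show "\<exists>M. \<forall>m\<ge>M. \<forall>n\<ge>M. norm (f m - f n) < e" by blast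
  qed
  then obtain m where m: "f \<longlonglongrightarrow> m" by (auto simp: Cauchy_convergent_iff convergent_def)
  have mM: "m \<in> M" using closed_sequentially[OF M(2) f(1) m] .
  have "(norm (h - m))\<^sup>2 \<le> d"
  proof (rule LIMSEQ_le)
    show "(\<lambda>n. (norm (h - f n))\<^sup>2) \<longlonglongrightarrow> (norm (h - m))\<^sup>2" by (intro tendsto_intros m)
    show "(\<lambda>n. d + 1 / Suc n) \<longlonglongrightarrow> d"
      using tendsto_add[OF tendsto_const[of d] LIMSEQ_inverse_real_of_nat] by (simp add: inverse_eq_divide)
    show "\<exists>N. \<forall>n\<ge>N. (norm (h - f n))\<^sup>2 \<le> d + 1 / Suc n" using f(2) by (meson less_imp_le)
  qed
  have "cinner x (h - m) = 0" if x: "x \<in> M" for x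
  proof (cases "x = 0")
    case False
    define e where "e = h - m"
    \<comment> \<open>\<open>c *\<^sub>C x\<close> is the projection of \<open>e\<close> onto the
      line of \<open>x\<close>; moving \<open>m\<close> by it would bring it closer to
      \<open>h\<close> unless \<open>c = 0\<close>.\<close>
    define c where "c = cinner x e / complex_of_real ((norm x)\<^sup>2)"
    have "m + c *\<^sub>C x \<in> M" using M x mM by (auto simp: csubspace_def)
    then have "(norm e)\<^sup>2 \<le> (norm (e - c *\<^sub>C x))\<^sup>2"
      using dle[of "m + c *\<^sub>C x"] \<open>(norm (h - m))\<^sup>2 \<le> d\<close> unfolding e_def diff_diff_eq by linarith
    also have "\<dots> = (norm e)\<^sup>2 + (cmod c * norm x)\<^sup>2 - 2 * Re (c * cinner e x)"
      by (simp add: norm_diff_sq norm_scaleC cinner_scaleC_right)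
    also have "c * cinner e x = complex_of_real ((cmod c * norm x)\<^sup>2)"
    proof -
      have "cinner e x = cnj (cinner x e)" by (rule cinner_commute)
      also have "cinner x e = c * complex_of_real ((norm x)\<^sup>2)" using False by (simp add: c_def)
      finally show ?thesis
        using cnj_mult_self(2)[of c] by (simp add: power_mult_distrib)
    qed
    finally have "(cmod c * norm x)\<^sup>2 \<le> 0" unfolding Re_complex_of_real by linarith
    then have "c = 0" using False by simp
    then show ?thesis using False by (simp add: c_def e_def)
  qed simp
  with mM show ?thesis by blast
qed

text \<open>Density is encoded by a trivial orthogonal complement: no spans or closures have to be
  carried along, and operators that agree on such a set agree everywhere.
  \<open>closure_span_eq_UNIV_iff\<close> relates it to the closed real span for sets stable under
  complex scalars.\<close>

definition ctotal :: "'a::complex_hilbert set \<Rightarrow> bool" where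
  "ctotal S \<longleftrightarrow> (\<forall>y. (\<forall>x\<in>S. cinner x y = 0) \<longrightarrow> y = 0)"

lemma ctotalD: "ctotal S \<Longrightarrow> (\<And>x. x \<in> S \<Longrightarrow> cinner x y = 0) \<Longrightarrow> y = 0"
  by (auto simp: ctotal_def)

lemma ctotal_mono: "ctotal S \<Longrightarrow> S \<subseteq> T \<Longrightarrow> ctotal T"
  by (auto simp: ctotal_def)

lemma ctotal_UNIV: "ctotal UNIV"
  by (auto simp: ctotal_def intro: cinner_ext)

lemma csubspace_dense:
  assumes "csubspace M" "ctotal M" shows "closure M = UNIV"
proof -
  have "h \<in> closure M" for h
  proof -
    obtain m where m: "m \<in> closure M" "\<forall>x\<in>closure M. cinner x (h - m) = 0"
      using orthogonal_decomposition[of "closure M" h] csubspace_closure[OF assms(1)] by auto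
    have "h - m = 0" using m(2) closure_subset by (intro ctotalD[OF assms(2)]) blast
    then show ?thesis using m(1) by simp
  qed
  then show ?thesis by blast
qed

lemma ctotal_closure_span:
  assumes "closure (span S) = UNIV" shows "ctotal S"
  unfolding ctotal_def
proof (intro allI impI)
  fix y assume y: "\<forall>x\<in>S. cinner x y = 0"
  have *: "cinner x y = 0" if "x \<in> span S" for x
    using that by (induction rule: span_induct_alt)
      (use y in \<open>auto simp: cinner_add_left scaleR_scaleC cinner_scaleC_left\<close>)
  obtain f where f: "\<forall>n. f n \<in> span S" "f \<longlonglongrightarrow> y" using assms by (auto simp: closure_sequential set_eq_iff)
  then have "(\<lambda>n. cinner (f n) y) \<longlonglongrightarrow> cinner y y" by (intro tendsto_cinner tendsto_const)
  then show "y = 0" using f * by (simp add: LIMSEQ_const_iff cinner_eq_zero_iff)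
qed

lemma closure_span_eq_UNIV_iff:
  assumes "\<And>c x. x \<in> S \<Longrightarrow> c *\<^sub>C x \<in> S"
  shows "closure (span S) = UNIV \<longleftrightarrow> ctotal S"
  using ctotal_closure_span csubspace_dense[OF csubspace_span, of S] assms ctotal_mono[OF _ span_superset] by blast

lemma riesz_representation:
  fixes f :: "'a::complex_hilbert \<Rightarrow> complex"
  assumes add: "\<And>x y. f (x + y) = f x + f y" and sc: "\<And>c x. f (c *\<^sub>C x) = c * f x"
    and bd: "\<And>x. cmod (f x) \<le> K * norm x"
  shows "\<exists>u. \<forall>x. f x = cinner u x"
proof (cases "\<forall>x. f x = 0")
  case True
  then show ?thesis by (intro exI[of _ 0]) simp
next
  case False
  then obtain h where h: "f h \<noteq> 0" by blast
  have bl: "bounded_linear f"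
    by (rule bounded_linear_intro[where K = K])
      (auto simp: add scaleR_scaleC sc bd scaleR_conv_of_real mult.commute[of _ K])
  have f0: "f 0 = 0" using add[of 0 0] by simp
  have diff: "f (x - y) = f x - f y" for x y using bounded_linear.linear[OF bl] by (rule linear_diff)
  let ?M = "{x. f x = 0}"
  have "closed ?M"
    using closed_Collect_eq[of f "\<lambda>_. 0"] linear_continuous_on[OF bl] by auto
  then obtain m where m: "f m = 0" "\<forall>x\<in>?M. cinner x (h - m) = 0"
    using orthogonal_decomposition[of ?M h] by (auto simp: csubspace_def add sc f0)
  define e where "e = h - m"
  have fe: "f e = f h" by (simp add: e_def diff m(1))
  then have "e \<noteq> 0" using h f0 by auto
  define u where "u = (cnj (f e) / complex_of_real ((norm e)\<^sup>2)) *\<^sub>C e"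
  have "f x = cinner u x" for x
  proof -
    have "f (x - (f x / f e) *\<^sub>C e) = 0" using h by (simp add: diff sc fe)
    then have "cinner (x - (f x / f e) *\<^sub>C e) e = 0" using m(2) unfolding e_def by blast
    then have "cinner e (x - (f x / f e) *\<^sub>C e) = 0" by (simp add: cinner_flip_zero)
    then have "cinner e x = f x / f e * complex_of_real ((norm e)\<^sup>2)"
      by (simp add: cinner_diff_right cinner_scaleC_right cinner_norm)
    then show ?thesis using \<open>e \<noteq> 0\<close> h fe by (simp add: u_def cinner_scaleC_left)
  qed
  then show ?thesis by blast
qed

subsection \<open>Complex-linear operators and adjoints\<close>

lemma bopsI: "(\<And>c x. blinfun_apply T (c *\<^sub>C x) = c *\<^sub>C T x) \<Longrightarrow> T \<in> bops"
  by (simp add: bops_def)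

lemma bops_scaleC: "T \<in> bops \<Longrightarrow> blinfun_apply T (c *\<^sub>C x) = c *\<^sub>C T x"
  by (simp add: bops_def)

lemma bounded_form_operator:
  fixes B :: "'a::complex_hilbert \<Rightarrow> 'b::complex_hilbert \<Rightarrow> complex"
  assumes al: "\<And>x x' y. B (x + x') y = B x y + B x' y" and ar: "\<And>x y y'. B x (y + y') = B x y + B x y'"
    and sl: "\<And>c x y. B (c *\<^sub>C x) y = cnj c * B x y" and sr: "\<And>c x y. B x (c *\<^sub>C y) = c * B x y"
    and bd: "\<And>x y. cmod (B x y) \<le> K * norm x * norm y" and K: "K \<ge> 0"
  shows "\<exists>T\<in>bops. (\<forall>x y. cinner x (blinfun_apply T y) = B x y) \<and> norm T \<le> K"
proof -
  have "\<exists>u. \<forall>x. cnj (B x y) = cinner u x" for y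
    by (rule riesz_representation[where K = "K * norm y"])
      (use bd in \<open>auto simp: al sl ac_simps\<close>)
  then obtain t where t: "\<And>x y. cnj (B x y) = cinner (t y) x" by metis
  have tB: "cinner x (t y) = B x y" for x y
    by (metis t cinner_commute complex_cnj_cnj)
  have tsc: "t (c *\<^sub>C y) = c *\<^sub>C t y" for c y
    by (rule cinner_ext) (simp add: tB cinner_scaleC_right sr)
  have nt: "norm (t y) \<le> norm y * K" for y
  proof (rule norm_le_cinnerI)
    show "cmod (cinner x (t y)) \<le> norm y * K * norm x" for x
      using bd[of x y] by (simp add: tB mult.commute mult.left_commute)
  qed (use K in simp)
  have bl: "bounded_linear t"
    by (rule bounded_linear_intro[where K = K])
      (auto intro: cinner_ext simp: nt tB cinner_add_right ar tsc scaleR_scaleC)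
  show ?thesis
  proof (intro bexI[of _ "Blinfun t"] conjI allI)
    show "cinner x (blinfun_apply (Blinfun t) y) = B x y" for x y
      using bl tB by (simp add: bounded_linear_Blinfun_apply)
    show "norm (Blinfun t) \<le> K" using bl nt K
      by (intro norm_blinfun_bound) (auto simp: bounded_linear_Blinfun_apply mult.commute)
    show "Blinfun t \<in> bops" using bl tsc by (simp add: bops_def bounded_linear_Blinfun_apply)
  qed
qed

lemma cinner_op_ext:
  fixes S T :: "'a::complex_hilbert \<Rightarrow>\<^sub>L 'b::complex_hilbert"
  assumes "\<And>x y. cinner x (S y) = cinner x (T y)" shows "S = T"
  by (rule blinfun_eqI) (rule cinner_ext, rule assms)

lemma adj_exists:
  fixes T :: "'a::complex_hilbert \<Rightarrow>\<^sub>L 'b::complex_hilbert"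
  assumes "T \<in> bops"
  shows "\<exists>S\<in>bops. \<forall>x y. cinner (blinfun_apply S x) y = cinner x (blinfun_apply T y)"
proof -
  have "\<exists>S\<in>bops. (\<forall>x y. cinner x (blinfun_apply S y) = cinner (blinfun_apply T x) y) \<and> norm S \<le> norm T"
  proof (rule bounded_form_operator)
    fix x :: 'a and y :: 'b
    have "norm (T x) * norm y \<le> norm T * norm x * norm y"
      by (intro mult_right_mono norm_blinfun) simp
    then show "cmod (cinner (T x) y) \<le> norm T * norm x * norm y"
      using cmod_cinner_le[of "T x" y] by linarith
  qed (use assms in \<open>auto simp: blinfun.add_right cinner_add_left cinner_add_right bops_scaleC
        cinner_scaleC_left cinner_scaleC_right\<close>)
  then obtain S where S: "S \<in> bops" "\<And>x y. cinner x (S y) = cinner (T x) y" by blast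
  have "cinner (S x) y = cinner x (T y)" for x y
    by (rule cinner_swap_eq) (rule S(2))
  then show ?thesis using S(1) by blast
qed

lemma adj_props:
  assumes "T \<in> bops"
  shows "T\<dagger> \<in> bops" "cinner (blinfun_apply (T\<dagger>) x) y = cinner x (T y)"
proof -
  obtain S where S: "S \<in> bops" "\<forall>x y. cinner (S x) y = cinner x (T y)"
    using adj_exists[OF assms] by blast
  have "T\<dagger> = S" unfolding adj_def
  proof (rule the_equality)
    fix R assume "\<forall>x y. cinner (blinfun_apply R x) y = cinner x (T y)"
    then have R: "\<And>x y. cinner (R x) y = cinner x (T y)" by blast
    have "cinner y (R x) = cinner y (S x)" for x y
      by (rule cinner_swap_eq[of "R x" y "S x" y]) (simp only: S(2) R)
    then show "R = S" by (intro cinner_op_ext)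
  qed (fact S(2))
  then show "T\<dagger> \<in> bops" "cinner ((T\<dagger>) x) y = cinner x (T y)" using S by auto
qed

lemma cinner_adj_left: "T \<in> bops \<Longrightarrow> cinner ((T\<dagger>) x) y = cinner x (T y)"
  by (rule adj_props)

lemma cinner_adj_right: "T \<in> bops \<Longrightarrow> cinner x ((T\<dagger>) y) = cinner (T x) y"
  by (rule cinner_swap_eq) (rule adj_props)

lemma adj_bops [simp, intro]: "T \<in> bops \<Longrightarrow> T\<dagger> \<in> bops"
  by (rule adj_props)

lemma adj_eqI:
  assumes "T \<in> bops" "\<And>x y. cinner (blinfun_apply S x) y = cinner x (blinfun_apply T y)"
  shows "T\<dagger> = S"
proof (rule cinner_op_ext)
  fix x y
  show "cinner y (blinfun_apply (T\<dagger>) x) = cinner y (S x)"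
    by (rule cinner_swap_eq) (simp only: assms(2) cinner_adj_left[OF assms(1)])
qed

lemma blinfun_apply_cscale [simp]: "blinfun_apply (cscale c T) x = c *\<^sub>C T x"
proof -
  have "bounded_linear (\<lambda>x. c *\<^sub>C T x)"
    by (rule bounded_linear_compose[OF bounded_linear_scaleC]) (rule blinfun.bounded_linear_right)
  then show ?thesis by (simp add: cscale_def bounded_linear_Blinfun_apply)
qed

lemma cscale_of_real: "cscale (complex_of_real r) T = r *\<^sub>R T"
  by (rule blinfun_eqI) (simp add: scaleR_scaleC blinfun.scaleR_left)

lemma bops_intros [simp, intro]:
  "\<one> \<in> bops" "0 \<in> bops"
  "S \<in> bops \<Longrightarrow> T \<in> bops \<Longrightarrow> S + T \<in> bops"
  "S \<in> bops \<Longrightarrow> T \<in> bops \<Longrightarrow> S - T \<in> bops"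
  "S \<in> bops \<Longrightarrow> - S \<in> bops"
  "S \<in> bops \<Longrightarrow> cscale c S \<in> bops"
  "S \<in> bops \<Longrightarrow> r *\<^sub>R S \<in> bops"
  "R \<in> bops \<Longrightarrow> U \<in> bops \<Longrightarrow> R ** U \<in> bops"
  by (auto simp: bops_def blinfun.add_left blinfun.diff_left blinfun.minus_left blinfun.scaleR_left
      scaleC_add_right scaleC_diff_right scaleC_minus_right scaleC_scaleC scaleC_scaleR mult.commute)

lemma closed_bops: "closed bops"
proof -
  have "bops = (\<Inter>c x. {T. blinfun_apply T (c *\<^sub>C x) = c *\<^sub>C T x})" by (auto simp: bops_def)
  also have "closed \<dots>"
    by (intro closed_INT ballI closed_Collect_eq continuous_intros
      bounded_linear.continuous_on[OF bounded_linear_scaleC])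
  finally show ?thesis .
qed

lemma adj_id [simp]: "\<one>\<dagger> = \<one>"
  and adj_zero [simp]: "0\<dagger> = 0"
  by (rule adj_eqI; simp)+

lemma adj_adj [simp]: "T \<in> bops \<Longrightarrow> (T\<dagger>)\<dagger> = T"
  by (rule adj_eqI) (auto simp: cinner_adj_right)

lemma adj_compose: "S \<in> bops \<Longrightarrow> T \<in> bops \<Longrightarrow> (S ** T)\<dagger> = T\<dagger> ** S\<dagger>"
  by (rule adj_eqI) (auto simp: cinner_adj_left)

lemma adj_add: "S \<in> bops \<Longrightarrow> T \<in> bops \<Longrightarrow> (S + T)\<dagger> = S\<dagger> + T\<dagger>"
  and adj_diff: "S \<in> bops \<Longrightarrow> T \<in> bops \<Longrightarrow> (S - T)\<dagger> = S\<dagger> - T\<dagger>"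
  and adj_cscale: "T \<in> bops \<Longrightarrow> (cscale c T)\<dagger> = cscale (cnj c) (T\<dagger>)"
  by (rule adj_eqI; auto simp: blinfun.add_left blinfun.diff_left cinner_add_left cinner_add_right
      cinner_diff_left cinner_diff_right cinner_adj_left cinner_scaleC_left cinner_scaleC_right)+

lemma adj_scaleR: "T \<in> bops \<Longrightarrow> (r *\<^sub>R T)\<dagger> = r *\<^sub>R T\<dagger>"
  using adj_cscale[of T "complex_of_real r"] by (simp add: cscale_of_real)

lemma norm_adj: assumes "T \<in> bops" shows "norm (T\<dagger>) = norm T"
proof -
  have *: "norm (T\<dagger>) \<le> norm T" if "T \<in> bops" for T :: "'c::complex_hilbert \<Rightarrow>\<^sub>L 'd::complex_hilbert"
  proof (rule norm_blinfun_bound)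
    fix x
    show "norm ((T\<dagger>) x) \<le> norm T * norm x"
    proof (rule norm_le_cinnerI)
      fix y
      have "norm (T y) * norm x \<le> norm T * norm y * norm x"
        by (intro mult_right_mono norm_blinfun) simp
      then show "cmod (cinner y ((T\<dagger>) x)) \<le> norm T * norm x * norm y"
        using cmod_cinner_le[of "T y" x] by (simp add: cinner_adj_right that mult_ac)
    qed simp
  qed simp
  show ?thesis using *[of T] *[of "T\<dagger>"] assms by simp
qed

lemma adj_diff_norm: "S \<in> bops \<Longrightarrow> T \<in> bops \<Longrightarrow> norm (S\<dagger> - T\<dagger>) = norm (S - T)"
  by (simp add: adj_diff[symmetric] norm_adj)

lemma tendsto_adj:
  assumes "f \<longlonglongrightarrow> T" "\<And>n. f n \<in> bops"
  shows "(\<lambda>n. (f n)\<dagger>) \<longlonglongrightarrow> T\<dagger>"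
proof -
  have "T \<in> bops" using closed_sequentially[OF closed_bops _ assms(1)] assms(2) by blast
  then show ?thesis using assms unfolding LIMSEQ_iff by (simp add: adj_diff_norm)
qed

lemma norm_compose_le: "norm (S ** T) \<le> norm S * norm T"
  by (rule norm_blinfun_compose)

lemma bops_eq_on_total:
  assumes "ctotal S" "R \<in> bops" "R' \<in> bops" "\<And>x. x \<in> S \<Longrightarrow> R x = R' x"
  shows "R = R'"
proof -
  have "((R - R')\<dagger>) y = 0" for y
    by (rule ctotalD[OF assms(1)]) (use assms in \<open>simp add: cinner_adj_right blinfun.diff_left\<close>)
  then have "cinner y ((R - R') x) = 0" for x y
    using cinner_adj_left[of "R - R'" y x] assms by simp
  then show ?thesis by (intro cinner_op_ext) (simp add: blinfun.diff_left cinner_diff_right)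
qed

lemma norm_sq_adj: "T \<in> bops \<Longrightarrow> complex_of_real ((norm (blinfun_apply T x))\<^sup>2) = cinner x (blinfun_apply (T\<dagger> ** T) x)"
  by (simp add: cinner_adj_right cinner_norm)

text \<open>The finite combinations form a complex subspace \<open>G\<close> of the direct sum on
  which the bound holds. The bound passes to the closure of \<open>G\<close>, makes it the graph of
  a map and, as the first components are dense, makes this map total. Linear dependence in the
  family \<open>v\<close> is harmless: the bound also guarantees consistency.\<close>

theorem total_extension:
  fixes v :: "'i \<Rightarrow> 'a::complex_hilbert" and w :: "'i \<Rightarrow> 'b::complex_hilbert"
  assumes tot: "ctotal (range v)" and K: "K \<ge> 0"
    and bd: "\<And>F c. finite F \<Longrightarrow> norm (\<Sum>i\<in>F. c i *\<^sub>C w i) \<le> K * norm (\<Sum>i\<in>F. c i *\<^sub>C v i)"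
  shows "\<exists>R\<in>bops. (\<forall>i. blinfun_apply R (v i) = w i) \<and> norm R \<le> K"
proof -
  define G where "G = {(\<Sum>i\<in>F. c i *\<^sub>C v i, \<Sum>i\<in>F. c i *\<^sub>C w i) | F c. finite F}"
  have GI: "(\<Sum>i\<in>F. c i *\<^sub>C v i, \<Sum>i\<in>F. c i *\<^sub>C w i) \<in> G" if "finite F" for F c
    using that unfolding G_def by blast
  have csG: "csubspace G" unfolding csubspace_def
  proof (intro conjI ballI allI)
    show "0 \<in> G" using GI[of "{}"] by (simp add: zero_prod_def)
    fix p assume "p \<in> G"
    then obtain F c where p: "finite F" "p = (\<Sum>i\<in>F. c i *\<^sub>C v i, \<Sum>i\<in>F. c i *\<^sub>C w i)" unfolding G_def by blast
    show "d *\<^sub>C p \<in> G" for d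
      using GI[OF p(1), of "\<lambda>i. d * c i"] by (simp add: p(2) scaleC_sum_right scaleC_scaleC)
    fix q assume "q \<in> G"
    then obtain F' c' where q: "finite F'" "q = (\<Sum>i\<in>F'. c' i *\<^sub>C v i, \<Sum>i\<in>F'. c' i *\<^sub>C w i)" unfolding G_def by blast
    \<comment> \<open>Coefficients are padded by zero so that both sums run over the union of the
      index sets.\<close>
    have ext: "(\<Sum>i\<in>F. c i *\<^sub>C u i) + (\<Sum>i\<in>F'. c' i *\<^sub>C u i) =
        (\<Sum>i\<in>F\<union>F'. ((if i \<in> F then c i else 0) + (if i \<in> F' then c' i else 0)) *\<^sub>C u i)"
      for u :: "'i \<Rightarrow> 'z::complex_hilbert"
    proof -
      have "(\<Sum>i\<in>F. c i *\<^sub>C u i) = (\<Sum>i\<in>F\<union>F'. (if i \<in> F then c i else 0) *\<^sub>C u i)"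
        "(\<Sum>i\<in>F'. c' i *\<^sub>C u i) = (\<Sum>i\<in>F\<union>F'. (if i \<in> F' then c' i else 0) *\<^sub>C u i)"
        using p q by (auto intro!: sum.mono_neutral_cong_left)
      then show ?thesis by (simp add: scaleC_add_left sum.distrib)
    qed
    show "p + q \<in> G" using p q GI[of "F \<union> F'"] by (simp add: ext)
  qed
  have bdG: "norm (snd p) \<le> K * norm (fst p)" if "p \<in> G" for p
    using that bd unfolding G_def by auto
  have bdcG: "norm (snd p) \<le> K * norm (fst p)" if pc: "p \<in> closure G" for p
  proof -
    obtain f where f: "\<And>n. f n \<in> G" "f \<longlonglongrightarrow> p" using pc by (auto simp: closure_sequential)
    show ?thesis
      by (rule LIMSEQ_le[of "\<lambda>n. norm (snd (f n))" _ "\<lambda>n. K * norm (fst (f n))"])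
        (use f bdG in \<open>auto intro!: tendsto_intros\<close>)
  qed
  have cscG: "csubspace (closure G)" by (rule csubspace_closure[OF csG])
  have "csubspace (fst ` G)"
    unfolding csubspace_def
  proof (intro conjI ballI allI)
    show "0 \<in> fst ` G" using csG unfolding csubspace_def by (metis fst_zero imageI)
    fix x assume "x \<in> fst ` G"
    then obtain p where p: "p \<in> G" "x = fst p" by blast
    show "c *\<^sub>C x \<in> fst ` G" for c
      by (rule image_eqI[of _ _ "c *\<^sub>C p"]) (use p csG in \<open>auto simp: csubspace_def scaleC_prod_def\<close>)
    fix y assume "y \<in> fst ` G"
    then obtain q where q: "q \<in> G" "y = fst q" by blast
    show "x + y \<in> fst ` G"
      by (rule image_eqI[of _ _ "p + q"]) (use p q csG in \<open>auto simp: csubspace_def\<close>)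
  qed
  moreover have "range v \<subseteq> fst ` G"
    using GI[of "{i}" "\<lambda>_. 1" for i] by force
  ultimately have dense: "closure (fst ` G) = UNIV" using csubspace_dense ctotal_mono[OF tot] by blast
  have "\<exists>y. (x, y) \<in> closure G" for x
  proof -
    have "x \<in> closure (fst ` G)" using dense by simp
    then obtain f where f: "\<And>n. f n \<in> fst ` G" "f \<longlonglongrightarrow> x" unfolding closure_sequential by blast
    then have "\<forall>n. \<exists>y. (f n, y) \<in> G" by force
    then obtain g where g: "\<And>n. (f n, g n) \<in> G" by metis
    have le: "norm (g m - g n) \<le> K * norm (f m - f n)" for m n
      using bdG[OF csubspace_diff[OF csG g[of m] g[of n]]] by simp
    have "Cauchy g"
    proof (rule CauchyI)
      fix e :: real assume e: "e > 0"
      then have "e / (K + 1) > 0" using K by simp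
      then obtain M where M: "\<forall>m\<ge>M. \<forall>n\<ge>M. norm (f m - f n) < e / (K + 1)"
        using CauchyD[OF LIMSEQ_imp_Cauchy[OF f(2)]] by blast
      have "norm (g m - g n) < e" if "m \<ge> M" "n \<ge> M" for m n
      proof -
        have "norm (g m - g n) \<le> K * norm (f m - f n)" by (rule le)
        also have "\<dots> \<le> (K + 1) * norm (f m - f n)" by (simp add: algebra_simps)
        also have "\<dots> < (K + 1) * (e / (K + 1))" using M that K by (intro mult_strict_left_mono) auto
        also have "\<dots> = e" using K by simp
        finally show ?thesis .
      qed
      then show "\<exists>M. \<forall>m\<ge>M. \<forall>n\<ge>M. norm (g m - g n) < e" by blast
    qed
    then obtain y where "g \<longlonglongrightarrow> y" by (auto simp: Cauchy_convergent_iff convergent_def)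
    with f have "(\<lambda>n. (f n, g n)) \<longlonglongrightarrow> (x, y)" by (intro tendsto_Pair)
    then show ?thesis using g unfolding closure_sequential
      by (intro exI[of _ y] exI[of _ "\<lambda>n. (f n, g n)"]) simp
  qed
  then obtain r where r: "\<And>x. (x, r x) \<in> closure G" by metis
  have uniq: "y = r x" if "(x, y) \<in> closure G" for x y
    using bdcG[OF csubspace_diff[OF cscG that r[of x]]] by simp
  have radd: "r (x + y) = r x + r y" for x y
    using uniq[of "x + y" "r x + r y"] r[of x] r[of y] cscG unfolding csubspace_def by (metis add_Pair)
  have rsc: "r (c *\<^sub>C x) = c *\<^sub>C r x" for c x
    using uniq[of "c *\<^sub>C x" "c *\<^sub>C r x"] r[of x] cscG unfolding csubspace_def by (metis scaleC_Pair)
  have rn: "norm (r x) \<le> K * norm x" for x using bdcG[OF r] by simp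
  have bl: "bounded_linear r"
    by (rule bounded_linear_intro[where K = K]) (auto simp: radd rsc scaleR_scaleC rn mult.commute)
  have rv: "r (v i) = w i" for i
    using uniq[of "v i" "w i"] GI[of "{i}" "\<lambda>_. 1"] closure_subset by force
  show ?thesis
    by (rule bexI[of _ "Blinfun r"])
      (use bl rv rn K rsc in \<open>auto simp: bops_def bounded_linear_Blinfun_apply intro!: norm_blinfun_bound\<close>)
qed

subsection \<open>Closed *-algebras of operators\<close>

text \<open>The condition \<open>cstar_algebra\<close> without nondegeneracy, which is carried
  separately as a \<open>ctotal\<close> statement. Square roots and contractivity are proved in this
  generality.\<close>

definition star_subalgebra :: "('a::complex_hilbert \<Rightarrow>\<^sub>L 'a) set \<Rightarrow> bool" where
  "star_subalgebra A \<longleftrightarrow>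
     A \<subseteq> bops \<and> closed A \<and> 0 \<in> A \<and>
     (\<forall>S\<in>A. \<forall>T\<in>A. S + T \<in> A \<and> S ** T \<in> A) \<and>
     (\<forall>T\<in>A. T\<dagger> \<in> A \<and> (\<forall>c. cscale c T \<in> A))"

lemma star_subalgebraD:
  assumes "star_subalgebra A"
  shows "T \<in> A \<Longrightarrow> T \<in> bops" "closed A" "0 \<in> A" "S \<in> A \<Longrightarrow> T \<in> A \<Longrightarrow> S + T \<in> A"
    "S \<in> A \<Longrightarrow> T \<in> A \<Longrightarrow> S ** T \<in> A" "T \<in> A \<Longrightarrow> T\<dagger> \<in> A" "T \<in> A \<Longrightarrow> cscale c T \<in> A"
    "T \<in> A \<Longrightarrow> r *\<^sub>R T \<in> A" "T \<in> A \<Longrightarrow> - T \<in> A" "S \<in> A \<Longrightarrow> T \<in> A \<Longrightarrow> S - T \<in> A"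
proof -
  have *: "T \<in> A \<Longrightarrow> r *\<^sub>R T \<in> A" for r T
    using assms unfolding star_subalgebra_def by (metis cscale_of_real)
  from *[of _ "-1"] have **: "T \<in> A \<Longrightarrow> - T \<in> A" for T by simp
  show "T \<in> A \<Longrightarrow> r *\<^sub>R T \<in> A" "T \<in> A \<Longrightarrow> - T \<in> A" by (fact * **)+
  show "S \<in> A \<Longrightarrow> T \<in> A \<Longrightarrow> S - T \<in> A"
    using **[of T] assms unfolding star_subalgebra_def by (metis add_uminus_conv_diff)
qed (use assms in \<open>auto simp: star_subalgebra_def\<close>)

lemma cstar_algebra_iff:
  "cstar_algebra A \<longleftrightarrow> star_subalgebra A \<and> ctotal {blinfun_apply T x | T x. T \<in> A}"
proof -
  have "star_subalgebra A \<Longrightarrow> closure (span {blinfun_apply T x | T x. T \<in> A}) = UNIV \<longleftrightarrow>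
      ctotal {blinfun_apply T x | T x. T \<in> A}"
  proof (rule closure_span_eq_UNIV_iff)
    fix c x assume "star_subalgebra A" "x \<in> {blinfun_apply T x | T x. T \<in> A}"
    then show "c *\<^sub>C x \<in> {blinfun_apply T x | T x. T \<in> A}"
      by clarsimp (metis star_subalgebraD(7) blinfun_apply_cscale)
  qed
  then show ?thesis unfolding cstar_algebra_def star_subalgebra_def by blast
qed

text \<open>With a unit, \<open>1 - h\<close> would be the square root of \<open>1 - a\<close>;
  solving for \<open>h\<close> stays inside \<open>A\<close>, which may lack one. The equation is
  the fixed point equation \<open>h = (a + h h) / 2\<close>, and \<open>r\<close> is the smaller
  root of \<open>r = (norm a + r^2) / 2\<close>, so the self-adjoint ball of radius
  \<open>r < 1\<close> is mapped into itself with contraction constant \<open>r\<close>.\<close>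

lemma half_root_exists:
  assumes A: "star_subalgebra A" and a: "a \<in> A" "a\<dagger> = a" "norm a < 1"
  shows "\<exists>h\<in>A. h\<dagger> = h \<and> 2 *\<^sub>R h - (h ** h) = a"
proof -
  define r where "r = 1 - sqrt (1 - norm a)"
  have r: "0 \<le> r" "r < 1" "(norm a + r\<^sup>2) / 2 = r"
    using a(3) by (auto simp: r_def power2_diff field_simps)
  let ?S = "{h \<in> A. h\<dagger> = h \<and> norm h \<le> r}"
  have "closed ?S" unfolding closed_sequential_limits
  proof (intro allI impI)
    fix f l assume f: "(\<forall>n. f n \<in> ?S) \<and> f \<longlonglongrightarrow> l"
    then have fA: "\<And>n. f n \<in> A" and fl: "f \<longlonglongrightarrow> l" by auto
    have lA: "l \<in> A" using closed_sequentially[OF star_subalgebraD(2)[OF A] fA fl] .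
    have "(\<lambda>n. (f n)\<dagger>) \<longlonglongrightarrow> l\<dagger>" using tendsto_adj[OF fl] fA star_subalgebraD(1)[OF A] by blast
    then have "f \<longlonglongrightarrow> l\<dagger>" using f by simp
    then have "l\<dagger> = l" using fl LIMSEQ_unique by blast
    moreover have "norm l \<le> r"
      by (rule LIMSEQ_le_const2[OF tendsto_norm[OF fl]]) (use f in auto)
    ultimately show "l \<in> ?S" using lA by blast
  qed
  let ?f = "\<lambda>h. (1/2) *\<^sub>R (a + (h ** h))"
  have "\<exists>!h\<in>?S. ?f h = h"
  proof (rule Banach_fix)
    show "complete ?S" using \<open>closed ?S\<close> by (simp add: complete_eq_closed)
    show "?S \<noteq> {}" using r star_subalgebraD(3)[OF A] by (auto intro!: exI[of _ 0])
    show "?f ` ?S \<subseteq> ?S"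
    proof (clarify, intro conjI)
      fix h assume h: "h \<in> A" "h\<dagger> = h" "norm h \<le> r"
      show "?f h \<in> A" using A a h by (auto intro!: star_subalgebraD)
      have hb: "h \<in> bops" "a \<in> bops" using A a h by (auto intro: star_subalgebraD)
      then show "(?f h)\<dagger> = ?f h" by (simp add: adj_scaleR adj_add adj_compose a h)
      have "norm (h ** h) \<le> r\<^sup>2"
        using norm_compose_le[of h h] mult_mono[OF h(3) h(3)] r by (simp add: power2_eq_square)
      then show "norm (?f h) \<le> r" using norm_triangle_ineq[of a "h ** h"] r(3) by simp
    qed
    show "dist (?f h) (?f k) \<le> r * dist h k" if "h \<in> ?S" "k \<in> ?S" for h k
    proof -
      have "(h ** h) - (k ** k) = (h ** (h - k)) + ((h - k) ** k)"
        by (rule blinfun_eqI) (simp add: blinfun.diff_left blinfun.add_left blinfun.diff_right)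
      moreover have "norm (h ** (h - k)) \<le> r * norm (h - k)"
        using that by (intro order_trans[OF norm_compose_le] mult_right_mono) auto
      moreover have "norm ((h - k) ** k) \<le> norm (h - k) * r"
        using that by (intro order_trans[OF norm_compose_le] mult_left_mono) auto
      ultimately have "norm ((h ** h) - (k ** k)) \<le> 2 * (r * norm (h - k))"
        using norm_triangle_ineq[of "h ** (h - k)" "(h - k) ** k"] by (simp add: mult.commute)
      moreover have "?f h - ?f k = (1/2) *\<^sub>R ((h ** h) - (k ** k))" by (simp add: algebra_simps)
      ultimately show ?thesis by (simp add: dist_norm)
    qed
  qed (use r in auto)
  then obtain h where h: "h \<in> A" "h\<dagger> = h" "?f h = h" by blast
  have "2 *\<^sub>R h = a + (h ** h)" using arg_cong[OF h(3), of "\<lambda>x. 2 *\<^sub>R x"] by simp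
  then show ?thesis using h by (intro bexI[of _ h]) auto
qed

lemma norm_adj_compose_less:
  assumes "m \<in> bops" "norm m < K" shows "norm (m\<dagger> ** m) < K\<^sup>2"
proof -
  have "norm (m\<dagger> ** m) \<le> (norm m)\<^sup>2"
    using norm_compose_le[of "m\<dagger>" m] assms by (simp add: norm_adj power2_eq_square)
  also have "\<dots> < K\<^sup>2" using assms(2) by (intro power_strict_mono) auto
  finally show ?thesis .
qed

text \<open>\<open>n = K (1 - h)\<close>, with \<open>h\<close> from \<open>half_root_exists\<close>
  for \<open>b / K^2\<close>. For \<open>b = m\<dagger> m\<close> and \<open>K > norm m\<close> this
  writes \<open>K^2 - m\<dagger> m\<close> as a square inside the algebra, which is how norm bounds
  are transferred to tensor products and amplifications.\<close>

lemma defect_root_exists: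
  assumes M: "star_subalgebra M" "\<one> \<in> M"
    and b: "b \<in> M" "b\<dagger> = b" "norm b < K\<^sup>2" "K > 0"
  shows "\<exists>n\<in>M. n\<dagger> = n \<and> n ** n = K\<^sup>2 *\<^sub>R \<one> - b"
proof -
  define a where "a = (1 / K\<^sup>2) *\<^sub>R b"
  have bb: "b \<in> bops" using M b by (auto intro: star_subalgebraD)
  have K: "K > 0" by (fact b)
  have "norm a < 1" using b K by (simp add: a_def)
  moreover have "a \<in> M" using M b by (auto simp: a_def intro!: star_subalgebraD)
  moreover have "a\<dagger> = a" using bb b by (simp add: a_def adj_scaleR)
  ultimately obtain h where h: "h \<in> M" "h\<dagger> = h" "2 *\<^sub>R h - (h ** h) = a"
    using half_root_exists[OF M(1)] by blast
  let ?n = "K *\<^sub>R (\<one> - h)"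
  have hb: "h \<in> bops" using M h by (auto intro: star_subalgebraD)
  have "?n ** ?n = K\<^sup>2 *\<^sub>R (\<one> - (2 *\<^sub>R h - (h ** h)))"
    by (rule blinfun_eqI) (simp add: blinfun.diff_left blinfun.add_left blinfun.scaleR_left blinfun.scaleR_right
      blinfun.diff_right power2_eq_square scaleR_2 scaleR_diff_right scaleR_add_right)
  also have "\<dots> = K\<^sup>2 *\<^sub>R \<one> - b" using K by (simp add: h(3) a_def scaleR_diff_right)
  finally have "?n ** ?n = K\<^sup>2 *\<^sub>R \<one> - b" .
  moreover have "?n\<dagger> = ?n" using hb h(2) by (simp add: adj_scaleR adj_diff)
  moreover have "?n \<in> M" using M h by (auto intro!: star_subalgebraD)
  ultimately show ?thesis by blast
qed

lemma star_subalgebra_bops: "star_subalgebra bops"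
  unfolding star_subalgebra_def using closed_bops by auto

lemma star_homD:
  assumes "star_hom A \<phi>"
  shows "T \<in> A \<Longrightarrow> \<phi> T \<in> bops" "S \<in> A \<Longrightarrow> T \<in> A \<Longrightarrow> \<phi> (S + T) = \<phi> S + \<phi> T"
    "S \<in> A \<Longrightarrow> T \<in> A \<Longrightarrow> \<phi> (S ** T) = \<phi> S ** \<phi> T" "T \<in> A \<Longrightarrow> \<phi> (T\<dagger>) = (\<phi> T)\<dagger>"
    "T \<in> A \<Longrightarrow> \<phi> (cscale c T) = cscale c (\<phi> T)" "T \<in> A \<Longrightarrow> \<phi> (r *\<^sub>R T) = r *\<^sub>R \<phi> T"
    "T \<notin> A \<Longrightarrow> \<phi> T = undefined" "T \<in> A \<Longrightarrow> \<phi> (- T) = - \<phi> T"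
proof -
  show *: "T \<in> A \<Longrightarrow> \<phi> (r *\<^sub>R T) = r *\<^sub>R \<phi> T" for T r
    using assms unfolding star_hom_def by (metis cscale_of_real)
  show "T \<in> A \<Longrightarrow> \<phi> (- T) = - \<phi> T" using *[of T "-1"] by simp
qed (use assms in \<open>auto simp: star_hom_def PiE_iff extensional_def\<close>)

lemma star_hom_diff:
  "star_subalgebra A \<Longrightarrow> star_hom A \<phi> \<Longrightarrow> S \<in> A \<Longrightarrow> T \<in> A \<Longrightarrow> \<phi> (S - T) = \<phi> S - \<phi> T"
  using star_homD(2)[of A \<phi> S "- T"] star_homD(8)[of A \<phi> T] star_subalgebraD(9)[of A T] by simp

lemma star_hom_zero: "star_subalgebra A \<Longrightarrow> star_hom A \<phi> \<Longrightarrow> \<phi> 0 = 0"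
  using star_homD(6)[of A \<phi> 0 0] star_subalgebraD(3)[of A] by simp

text \<open>With \<open>a = T\<^sup>* T\<close> and \<open>a = 2 h - h\<^sup>2\<close> one has \<open>1 - \<phi>(a) = (1 - \<phi>(h))\<^sup>2 \<ge> 0\<close>.\<close>

theorem star_hom_contractive:
  assumes A: "star_subalgebra A" and \<phi>: "star_hom A \<phi>" and T: "T \<in> A"
  shows "norm (\<phi> T) \<le> norm T"
proof -
  have small: "norm (\<phi> T) \<le> 1" if T: "T \<in> A" "norm T < 1" for T
  proof (rule norm_blinfun_bound)
    fix x
    have Tb: "T \<in> bops" using A T by (auto intro: star_subalgebraD)
    define a where "a = T\<dagger> ** T"
    have "norm a \<le> norm T * norm T" using norm_compose_le[of "T\<dagger>" T] Tb by (simp add: a_def norm_adj)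
    also have "\<dots> < 1" using mult_strict_mono'[OF T(2) T(2)] by simp
    finally obtain h where h: "h \<in> A" "h\<dagger> = h" "2 *\<^sub>R h - (h ** h) = a"
      using half_root_exists[OF A, of a] A T Tb by (auto simp: a_def adj_compose intro!: star_subalgebraD)
    define k where "k = \<phi> h"
    have k: "k \<in> bops" "k\<dagger> = k" using h star_homD(1,4)[OF \<phi>] unfolding k_def by metis+
    have "\<phi> a = 2 *\<^sub>R k - (k ** k)"
      using h A \<phi> by (simp add: h(3)[symmetric] k_def star_hom_diff star_homD star_subalgebraD)
    moreover have "\<phi> a = (\<phi> T)\<dagger> ** \<phi> T" using A T \<phi> by (simp add: a_def star_homD star_subalgebraD)
    ultimately have "complex_of_real ((norm (\<phi> T x))\<^sup>2) = cinner x (2 *\<^sub>R k x - k (k x))"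
      using norm_sq_adj[of "\<phi> T" x] star_homD(1)[OF \<phi> T(1)] by (simp add: blinfun.diff_left blinfun.scaleR_left)
    also have "\<dots> = complex_of_real ((norm x)\<^sup>2 - (norm (x - k x))\<^sup>2)"
    proof -
      have "cinner x (k y) = cinner (k x) y" for y using cinner_adj_left[OF k(1), of x y] k(2) by simp
      then show ?thesis unfolding of_real_diff cinner_norm[symmetric]
        by (simp add: cinner_diff_right cinner_diff_left scaleR_2 cinner_add_right)
    qed
    finally have "(norm (\<phi> T x))\<^sup>2 = (norm x)\<^sup>2 - (norm (x - k x))\<^sup>2" by (simp only: of_real_eq_iff)
    then have "(norm (\<phi> T x))\<^sup>2 \<le> (norm x)\<^sup>2" by simp
    then show "norm (\<phi> T x) \<le> 1 * norm x" using power2_le_imp_le[of "norm (\<phi> T x)" "norm x"] by simp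
  qed simp
  show ?thesis
  proof (rule field_le_epsilon)
    fix e :: real assume e: "e > 0"
    define t where "t = norm T + e"
    have t: "t > 0" "norm T < t" using e norm_ge_zero[of T] by (auto simp: t_def add_nonneg_pos)
    have "norm ((1 / t) *\<^sub>R T) < 1" using t by simp
    then have "norm (\<phi> ((1 / t) *\<^sub>R T)) \<le> 1" using A T by (intro small star_subalgebraD)
    then have "norm (\<phi> T) \<le> t" using t star_homD(6)[OF \<phi> T] by (simp add: divide_le_eq)
    then show "norm (\<phi> T) \<le> norm T + e" by (simp add: t_def)
  qed
qed

subsection \<open>Operators on tensor products\<close>

lemma compose_assoc: "(A ** B) ** C = A ** (B ** C)"
  by (rule blinfun_eqI) simp

lemma blinfun_compose_id [simp]: "A ** \<one> = A" "\<one> ** A = A"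
  by (rule blinfun_eqI, simp)+

lemma compose_square:
  assumes "A ** B = C ** D"
  shows "A ** (B ** X) = C ** (D ** X)"
  using assms by (metis compose_assoc)

lemma compose_absorb:
  assumes "A ** B = \<one>"
  shows "A ** (B ** X) = X"
  using assms by (metis compose_assoc blinfun_compose_id(2))

lemma htens_add_left: "(x + x') \<otimes>\<^sub>h y = x \<otimes>\<^sub>h y + x' \<otimes>\<^sub>h y"
  and htens_add_right: "x \<otimes>\<^sub>h (y + y') = x \<otimes>\<^sub>h y + x \<otimes>\<^sub>h y'"
  and htens_scaleC_right: "x \<otimes>\<^sub>h (c *\<^sub>C y) = c *\<^sub>C (x \<otimes>\<^sub>h y)"
  by (transfer; auto simp: cinner_add_right cinner_scaleC_right algebra_simps)+

lemma htens_scaleR_left: "(r *\<^sub>R x) \<otimes>\<^sub>h y = r *\<^sub>R (x \<otimes>\<^sub>h y)"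
  and htens_scaleR_right: "x \<otimes>\<^sub>h (r *\<^sub>R y) = r *\<^sub>R (x \<otimes>\<^sub>h y)"
  by (simp_all add: scaleR_scaleC htens_scaleC_left htens_scaleC_right)

lemma norm_htens: "norm (x \<otimes>\<^sub>h y) = norm x * norm y"
proof -
  have "cinner (x \<otimes>\<^sub>h y) (x \<otimes>\<^sub>h y) = cinner x x * cinner y y" by (rule cinner_htens)
  then have "complex_of_real ((norm (x \<otimes>\<^sub>h y))\<^sup>2) = complex_of_real ((norm x * norm y)\<^sup>2)"
    unfolding cinner_norm power_mult_distrib of_real_mult .
  then have "(norm (x \<otimes>\<^sub>h y))\<^sup>2 = (norm x * norm y)\<^sup>2" by (simp only: of_real_eq_iff)
  then show ?thesis by simp
qed

lemma bounded_linear_htens_left: "bounded_linear (\<lambda>x. x \<otimes>\<^sub>h y)"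
  and bounded_linear_htens_right: "bounded_linear (\<lambda>y. x \<otimes>\<^sub>h y)"
   apply (rule bounded_linear_intro[where K = "norm y"])
     apply (simp_all add: htens_add_left htens_scaleR_left norm_htens)
  apply (rule bounded_linear_intro[where K = "norm x"])
    apply (simp_all add: htens_add_right htens_scaleR_right norm_htens mult.commute)
  done

text \<open>An operator with legs is determined by its commutation relations with the insertions \<open>x \<mapsto> x \<otimes> y\<close> and
  \<open>y \<mapsto> x \<otimes> y\<close>.\<close>

definition rins :: "'b::complex_hilbert \<Rightarrow> 'a::complex_hilbert \<Rightarrow>\<^sub>L ('a, 'b) htensor" where
  "rins y = Blinfun (\<lambda>x. x \<otimes>\<^sub>h y)"

definition lins :: "'a::complex_hilbert \<Rightarrow> 'b::complex_hilbert \<Rightarrow>\<^sub>L ('a, 'b) htensor" where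
  "lins x = Blinfun (\<lambda>y. x \<otimes>\<^sub>h y)"

lemma rins_apply [simp]: "(rins y) x = x \<otimes>\<^sub>h y"
  and lins_apply [simp]: "(lins x) y = x \<otimes>\<^sub>h y"
  by (simp_all add: rins_def lins_def bounded_linear_Blinfun_apply bounded_linear_htens_left bounded_linear_htens_right)

lemma rins_bops [simp, intro]: "rins y \<in> bops"
  and lins_bops [simp, intro]: "lins x \<in> bops"
  by (auto simp: bops_def htens_scaleC_left htens_scaleC_right)

lemma norm_rins_le: "norm (rins y) \<le> norm y"
  and norm_lins_le: "norm (lins x) \<le> norm x"
  by (rule norm_blinfun_bound; simp add: norm_htens mult.commute)+

lemma rins_adj_htens: "((rins y)\<dagger>) (x \<otimes>\<^sub>h y') = cinner y y' *\<^sub>C x"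
  by (rule cinner_ext) (simp add: cinner_adj_right cinner_htens cinner_scaleC_right)

lemma lins_adj_htens: "((lins x)\<dagger>) (x' \<otimes>\<^sub>h y) = cinner x x' *\<^sub>C y"
  by (rule cinner_ext) (simp add: cinner_adj_right cinner_htens cinner_scaleC_right)

lemma rins_adj_rins: "(rins y)\<dagger> ** rins y' = cscale (cinner y y') \<one>"
  and lins_adj_lins: "(lins x)\<dagger> ** lins x' = cscale (cinner x x') \<one>"
  by (rule blinfun_eqI; simp add: rins_adj_htens lins_adj_htens)+

lemma ctotal_htens:
  assumes "ctotal S" "ctotal T"
  shows "ctotal {x \<otimes>\<^sub>h y | x y. x \<in> S \<and> y \<in> T}"
proof -
  have base: "ctotal {x \<otimes>\<^sub>h y | x y. True}"
    using htens_total by (rule ctotal_closure_span)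
  show ?thesis unfolding ctotal_def
  proof (intro allI impI)
    fix z :: "('a, 'b) htensor" assume z: "\<forall>u\<in>{x \<otimes>\<^sub>h y | x y. x \<in> S \<and> y \<in> T}. cinner u z = 0"
    have 1: "cinner (x \<otimes>\<^sub>h y) z = 0" if "x \<in> S" for x y
    proof -
      have "((lins x)\<dagger>) z = 0"
        by (rule ctotalD[OF assms(2)]) (use z that in \<open>auto simp: cinner_adj_right\<close>)
      then show ?thesis using cinner_adj_right[OF lins_bops, of y x z] by simp
    qed
    have "cinner (x \<otimes>\<^sub>h y) z = 0" for x y
    proof -
      have "((rins y)\<dagger>) z = 0"
        by (rule ctotalD[OF assms(1)]) (simp add: cinner_adj_right 1)
      then show ?thesis using cinner_adj_right[OF rins_bops, of x y z] by simp
    qed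
    then show "z = 0" by (intro ctotalD[OF base]) blast
  qed
qed

lemma ctotal_range_htens:
  "ctotal (range (\<lambda>p. (fst p :: 'a::complex_hilbert) \<otimes>\<^sub>h (snd p :: 'b::complex_hilbert)))"
proof (rule ctotal_mono[OF ctotal_htens[OF ctotal_UNIV ctotal_UNIV]], clarify)
  show "x \<otimes>\<^sub>h y \<in> range (\<lambda>p. (fst p :: 'a) \<otimes>\<^sub>h (snd p :: 'b))" for x y
    by (rule range_eqI[of _ _ "(x, y)"]) simp
qed

lemma htens_cinner_ext: "(\<And>x y. cinner (x \<otimes>\<^sub>h y) u = cinner (x \<otimes>\<^sub>h y) v) \<Longrightarrow> u = v"
proof -
  assume h: "\<And>x y. cinner (x \<otimes>\<^sub>h y) u = cinner (x \<otimes>\<^sub>h y) v"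
  have "u - v = 0"
    by (rule ctotalD[OF ctotal_htens[OF ctotal_UNIV ctotal_UNIV]]) (auto simp: cinner_diff_right h)
  then show ?thesis by simp
qed

lemma htens_op_eqI_total:
  assumes "ctotal S" "ctotal T" "R \<in> bops" "R' \<in> bops"
    "\<And>x y. x \<in> S \<Longrightarrow> y \<in> T \<Longrightarrow> R (x \<otimes>\<^sub>h y) = R' (x \<otimes>\<^sub>h y)"
  shows "R = R'"
  by (rule bops_eq_on_total[OF ctotal_htens[OF assms(1,2)]]) (use assms in auto)

lemmas htens_op_eqI = htens_op_eqI_total[OF ctotal_UNIV ctotal_UNIV]

lemma htens_op_eqI_left3:
  assumes "R \<in> bops" "R' \<in> bops"
    "\<And>x y z. R ((x \<otimes>\<^sub>h y) \<otimes>\<^sub>h z) = R' ((x \<otimes>\<^sub>h y) \<otimes>\<^sub>h z)"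
  shows "R = R'"
  by (rule htens_op_eqI_total[OF ctotal_htens[OF ctotal_UNIV ctotal_UNIV] ctotal_UNIV]) (use assms in auto)

lemma htens_op_eqI_right3:
  assumes "R \<in> bops" "R' \<in> bops"
    "\<And>x y z. R (x \<otimes>\<^sub>h (y \<otimes>\<^sub>h z)) = R' (x \<otimes>\<^sub>h (y \<otimes>\<^sub>h z))"
  shows "R = R'"
  by (rule htens_op_eqI_total[OF ctotal_UNIV ctotal_htens[OF ctotal_UNIV ctotal_UNIV]]) (use assms in auto)

lemma rins_op_eqI_total:
  assumes "ctotal S" "R \<in> bops" "R' \<in> bops" "\<And>y. y \<in> S \<Longrightarrow> R ** rins y = R' ** rins y"
  shows "R = R'"
  by (rule htens_op_eqI_total[OF ctotal_UNIV assms(1-3)])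
    (metis assms(4) blinfun_apply_blinfun_compose rins_apply)

lemma lins_op_eqI_total:
  assumes "ctotal S" "R \<in> bops" "R' \<in> bops" "\<And>x. x \<in> S \<Longrightarrow> R ** lins x = R' ** lins x"
  shows "R = R'"
  by (rule htens_op_eqI_total[OF assms(1) ctotal_UNIV assms(2,3)])
    (metis assms(4) blinfun_apply_blinfun_compose lins_apply)

lemmas rins_op_eqI = rins_op_eqI_total[OF ctotal_UNIV, simplified]
lemmas lins_op_eqI = lins_op_eqI_total[OF ctotal_UNIV, simplified]

lemma cinner_lincomb:
  "cinner (\<Sum>i\<in>F. c i *\<^sub>C u i) (\<Sum>i\<in>F. c i *\<^sub>C u i) = (\<Sum>i\<in>F. \<Sum>j\<in>F. cnj (c i) * c j * cinner (u i) (u j))"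
  by (simp add: cinner_sum_left cinner_sum_right cinner_scaleC_left cinner_scaleC_right sum_distrib_left mult_ac)
    (rule sum.swap)

lemma isometric_extension:
  fixes v :: "'i \<Rightarrow> 'a::complex_hilbert" and w :: "'i \<Rightarrow> 'b::complex_hilbert"
  assumes "ctotal (range v)" "\<And>i j. cinner (w i) (w j) = cinner (v i) (v j)"
  shows "\<exists>R\<in>bops. \<forall>i. R (v i) = w i"
proof -
  have "norm (\<Sum>i\<in>F. c i *\<^sub>C w i) = norm (\<Sum>i\<in>F. c i *\<^sub>C v i)" for F c
  proof -
    have "cinner (\<Sum>i\<in>F. c i *\<^sub>C w i) (\<Sum>i\<in>F. c i *\<^sub>C w i) = cinner (\<Sum>i\<in>F. c i *\<^sub>C v i) (\<Sum>i\<in>F. c i *\<^sub>C v i)"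
      unfolding cinner_lincomb assms(2) by (rule refl)
    then show ?thesis unfolding cinner_norm by (simp only: of_real_eq_iff) simp
  qed
  then show ?thesis using total_extension[OF assms(1), of 1 w] by auto
qed

text \<open>The two families have the same Gram matrix, so the isometry and its adjoint are mutually
  inverse on total sets. Flips, reassociations and identifications of orthonormal bases arise this
  way.\<close>

lemma unitary_extension:
  fixes v :: "'i \<Rightarrow> 'a::complex_hilbert" and w :: "'i \<Rightarrow> 'b::complex_hilbert"
  assumes v: "ctotal (range v)" and w: "ctotal (range w)" and vw: "\<And>i j. cinner (w i) (w j) = cinner (v i) (v j)"
  shows "\<exists>U. unitary U \<and> (\<forall>i. U (v i) = w i) \<and> (\<forall>i. (U\<dagger>) (w i) = v i)"
proof -
  obtain R where R: "R \<in> bops" "\<And>i. R (v i) = w i" using isometric_extension[OF v vw] by blast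
  have Rw: "(R\<dagger>) (w i) = v i" for i
  proof -
    have "(R\<dagger>) (w i) - v i = 0"
      by (rule ctotalD[OF v]) (use R vw in \<open>auto simp: cinner_diff_right cinner_adj_right\<close>)
    then show ?thesis by simp
  qed
  have "R\<dagger> ** R = \<one>" by (rule bops_eq_on_total[OF v]) (use R Rw in auto)
  moreover have "R ** R\<dagger> = \<one>" by (rule bops_eq_on_total[OF w]) (use R Rw in auto)
  ultimately show ?thesis using R Rw by (intro exI[of _ R]) (auto simp: unitary_def)
qed

lemma unitaryD:
  assumes "unitary U"
  shows "U \<in> bops" "U\<dagger> ** U = \<one>" "U ** U\<dagger> = \<one>"
    "(U\<dagger>) (U x) = x" "U ((U\<dagger>) y) = y"
proof -
  show 1: "U \<in> bops" "U\<dagger> ** U = \<one>" "U ** U\<dagger> = \<one>" using assms by (auto simp: unitary_def)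
  show "(U\<dagger>) (U x) = x" using arg_cong[OF 1(2), of "\<lambda>T. T x"] by simp
  show "U ((U\<dagger>) y) = y" using arg_cong[OF 1(3), of "\<lambda>T. T y"] by simp
qed

lemma unitary_id [simp]: "unitary \<one>"
  by (simp add: unitary_def)

lemma unitary_adj: "unitary U \<Longrightarrow> unitary (U\<dagger>)"
  by (simp add: unitary_def)

lemma unitary_compose: "unitary U \<Longrightarrow> unitary V \<Longrightarrow> unitary (U ** V)"
  by (simp add: unitary_def adj_compose compose_assoc compose_absorb)

text \<open>Boundedness of \<open>S \<otimes> 1\<close>: if \<open>n n = K^2 - S\<dagger> S\<close>
  with \<open>n\<close> self-adjoint, then \<open>K^2 |sum c_i x_i \<otimes> y_i|^2 - |sum c_i S x_i
  \<otimes> y_i|^2\<close> is the squared norm of \<open>sum c_i n x_i \<otimes> y_i\<close>. This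
  works for every \<open>K > norm S\<close>, whence the bound by \<open>norm S\<close>
  itself.\<close>

lemma op_tensor_id_exists:
  fixes S :: "'a::complex_hilbert \<Rightarrow>\<^sub>L 'c::complex_hilbert"
  assumes S: "S \<in> bops"
  shows "\<exists>R :: ('a, 'b::complex_hilbert) htensor \<Rightarrow>\<^sub>L ('c, 'b) htensor.
    R \<in> bops \<and> (\<forall>x y. blinfun_apply R (x \<otimes>\<^sub>h y) = S x \<otimes>\<^sub>h y) \<and> norm R \<le> norm S"
proof -
  have ex: "\<exists>R\<in>bops. (\<forall>p. blinfun_apply R (fst p \<otimes>\<^sub>h (snd p :: 'b)) = S (fst p) \<otimes>\<^sub>h snd p) \<and> norm R \<le> K"
    if K: "norm S < K" for K
  proof (rule total_extension)
    have K0: "K > 0" using K norm_ge_zero[of S] by linarith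
    then show "K \<ge> 0" by simp
    show "ctotal (range (\<lambda>p. (fst p :: 'a) \<otimes>\<^sub>h (snd p :: 'b)))" by (rule ctotal_range_htens)
    obtain n :: "'a \<Rightarrow>\<^sub>L 'a" where n: "n \<in> bops" "n\<dagger> = n" "n ** n = K\<^sup>2 *\<^sub>R \<one> - (S\<dagger> ** S)"
      using defect_root_exists[OF star_subalgebra_bops, of "S\<dagger> ** S" K] norm_adj_compose_less[OF S K] S K0
      by (auto simp: adj_compose)
    have nS: "cinner (n x) (n x') = complex_of_real (K\<^sup>2) * cinner x x' - cinner (S x) (S x')" for x x'
    proof -
      have "cinner (n x) (n x') = cinner x ((n ** n) x')"
        using cinner_adj_left[OF n(1), of x "n x'"] by (simp add: n(2))
      also have "\<dots> = complex_of_real (K\<^sup>2) * cinner x x' - cinner (S x) (S x')"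
        unfolding n(3) using S by (simp add: blinfun.diff_left blinfun.scaleR_left cinner_diff_right
          scaleR_scaleC cinner_scaleC_right cinner_adj_right)
      finally show ?thesis .
    qed
    fix F :: "('a \<times> 'b) set" and c
    let ?s = "\<lambda>A. \<Sum>i\<in>F. c i *\<^sub>C (A (fst i) \<otimes>\<^sub>h snd i)"
    have "cinner (?s n) (?s n) = complex_of_real (K\<^sup>2) * cinner (?s \<one>) (?s \<one>) - cinner (?s S) (?s S)"
      unfolding cinner_lincomb cinner_htens nS
      by (simp add: sum_distrib_left sum_subtractf[symmetric] algebra_simps)
    then have "complex_of_real ((norm (?s n))\<^sup>2) = complex_of_real (K\<^sup>2 * (norm (?s \<one>))\<^sup>2 - (norm (?s S))\<^sup>2)"
      unfolding cinner_norm of_real_diff of_real_mult .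
    then have "(norm (?s n))\<^sup>2 = K\<^sup>2 * (norm (?s \<one>))\<^sup>2 - (norm (?s S))\<^sup>2"
      by (simp only: of_real_eq_iff)
    then have "(norm (?s S))\<^sup>2 \<le> (K * norm (?s \<one>))\<^sup>2"
      using zero_le_power2[of "norm (?s n)"] unfolding power_mult_distrib by linarith
    then show "norm (\<Sum>i\<in>F. c i *\<^sub>C (S (fst i) \<otimes>\<^sub>h snd i)) \<le> K * norm (\<Sum>i\<in>F. c i *\<^sub>C (fst i \<otimes>\<^sub>h snd i))"
      using K0 power2_le_imp_le[of "norm (?s S)" "K * norm (?s \<one>)"] by simp
  qed
  obtain R where R: "R \<in> bops" "\<forall>p. R (fst p \<otimes>\<^sub>h (snd p :: 'b)) = S (fst p) \<otimes>\<^sub>h snd p"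
    using ex[of "norm S + 1"] by auto
  have "norm R \<le> norm S"
  proof (rule field_le_epsilon)
    fix e :: real assume "e > 0"
    then obtain R' where R': "R' \<in> bops" "\<forall>p. R' (fst p \<otimes>\<^sub>h (snd p :: 'b)) = S (fst p) \<otimes>\<^sub>h snd p"
      "norm R' \<le> norm S + e" using ex[of "norm S + e"] by auto
    have "R (x \<otimes>\<^sub>h y) = R' (x \<otimes>\<^sub>h y)" for x y
      using R(2)[rule_format, of "(x, y)"] R'(2)[rule_format, of "(x, y)"] by simp
    then have "R = R'" by (intro htens_op_eqI R R')
    then show "norm R \<le> norm S + e" using R' by simp
  qed
  moreover have "R (x \<otimes>\<^sub>h y) = S x \<otimes>\<^sub>h y" for x y
    using R(2)[rule_format, of "(x, y)"] by simp
  ultimately show ?thesis using R(1) by blast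
qed

lemma ctotal_range_swap:
  assumes "ctotal (range (\<lambda>p. f (fst p) (snd p)))"
  shows "ctotal (range (\<lambda>p. f (snd p) (fst p)))"
proof -
  have "range (\<lambda>p. f (fst p) (snd p)) \<subseteq> range (\<lambda>p. f (snd p) (fst p))"
  proof clarify
    fix a b show "f (fst (a, b)) (snd (a, b)) \<in> range (\<lambda>p. f (snd p) (fst p))"
      by (rule range_eqI[of _ _ "(b, a)"]) simp
  qed
  then show ?thesis using assms by (rule ctotal_mono[rotated])
qed

lemma flip_spec:
  defines "F \<equiv> flip :: ('c::complex_hilbert, 'd::complex_hilbert) htensor \<Rightarrow>\<^sub>L _"
  shows "unitary F \<and> (\<forall>x y. F (x \<otimes>\<^sub>h y) = y \<otimes>\<^sub>h x \<and> (F\<dagger>) (y \<otimes>\<^sub>h x) = x \<otimes>\<^sub>h y)"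
proof -
  let ?v = "\<lambda>p. (fst p :: 'c::complex_hilbert) \<otimes>\<^sub>h (snd p :: 'd::complex_hilbert)"
  let ?w = "\<lambda>p. (snd p :: 'd::complex_hilbert) \<otimes>\<^sub>h (fst p :: 'c::complex_hilbert)"
  have "\<exists>U. unitary U \<and> (\<forall>p. U (?v p) = ?w p) \<and> (\<forall>p. (U\<dagger>) (?w p) = ?v p)"
    by (intro unitary_extension ctotal_range_htens ctotal_range_swap[where f = "(\<otimes>\<^sub>h)", OF ctotal_range_htens])
      (simp add: cinner_htens)
  then obtain U where U: "unitary U" and *: "\<And>p. U (?v p) = ?w p" "\<And>p. (U\<dagger>) (?w p) = ?v p" by blast
  have U: "unitary U" "\<And>x y. U (x \<otimes>\<^sub>h y) = y \<otimes>\<^sub>h x" "\<And>x y. (U\<dagger>) (y \<otimes>\<^sub>h x) = x \<otimes>\<^sub>h y"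
    using U *[of "(x, y)" for x y] by simp_all
  have "F = U" unfolding F_def flip_def
    by (rule the_equality) (simp_all add: U unitaryD(1)[OF U(1)] htens_op_eqI)
  then show ?thesis using U by simp
qed

lemma unitary_flip: "unitary flip"
  and flip_apply [simp]: "flip (x \<otimes>\<^sub>h y) = y \<otimes>\<^sub>h x"
  and flip_adj_apply: "(flip\<dagger>) (x \<otimes>\<^sub>h y) = y \<otimes>\<^sub>h x"
  using flip_spec by auto

lemma flip_bops [simp, intro]: "flip \<in> bops"
  using unitary_flip by (rule unitaryD)

lemma flip_adj [simp]: "flip\<dagger> = flip"
  by (rule htens_op_eqI) (auto simp: flip_adj_apply)

lemma flip_flip [simp]: "flip ** flip = \<one>" "flip (flip x) = x"
proof -
  show *: "flip ** flip = \<one>" by (rule htens_op_eqI) auto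
  show "flip (flip x) = x" using arg_cong[OF *, of "\<lambda>T. T x"] by simp
qed

lemma flip_flip_compose [simp]: "flip ** (flip ** A) = A"
  by (rule blinfun_eqI) simp

text \<open>The general case is the composite
  \<open>(S \<otimes> 1) flip (T \<otimes> 1) flip\<close>, where the flips have norm at most 1.
  Existence and uniqueness together resolve the definite description in
  \<open>op_tensor\<close>.\<close>

lemma op_tensor_props:
  fixes S :: "'a::complex_hilbert \<Rightarrow>\<^sub>L 'c::complex_hilbert" and T :: "'b::complex_hilbert \<Rightarrow>\<^sub>L 'd::complex_hilbert"
  assumes S: "S \<in> bops" and T: "T \<in> bops"
  shows op_tensor_bops [simp, intro]: "S \<otimes> T \<in> bops"
    and op_tensor_apply [simp]: "(S \<otimes> T) (x \<otimes>\<^sub>h y) = S x \<otimes>\<^sub>h T y"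
    and norm_op_tensor_le: "norm (S \<otimes> T) \<le> norm S * norm T"
proof -
  have ff: "norm (flip ** R ** flip) \<le> norm R" for R :: "('u::complex_hilbert, 'v::complex_hilbert) htensor \<Rightarrow>\<^sub>L ('u2::complex_hilbert, 'v2::complex_hilbert) htensor"
  proof -
    have n1: "norm (flip :: ('x::complex_hilbert, 'y::complex_hilbert) htensor \<Rightarrow>\<^sub>L _) \<le> 1"
    proof (rule norm_blinfun_bound)
      fix z :: "('x, 'y) htensor"
      have "complex_of_real ((norm (flip z))\<^sup>2) = complex_of_real ((norm z)\<^sup>2)"
        using norm_sq_adj[OF flip_bops, of z] by (simp add: cinner_norm)
      then show "norm (flip z) \<le> 1 * norm z" by (simp only: of_real_eq_iff) simp
    qed simp
    have "norm (flip ** R ** flip) \<le> (1 * norm R) * 1"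
      by (intro order_trans[OF norm_compose_le] mult_mono n1 mult_nonneg_nonneg) auto
    then show ?thesis by simp
  qed
  obtain R1 :: "('a, 'd) htensor \<Rightarrow>\<^sub>L ('c, 'd) htensor" where R1: "R1 \<in> bops"
    "\<And>x y. R1 (x \<otimes>\<^sub>h y) = S x \<otimes>\<^sub>h y" "norm R1 \<le> norm S"
    using op_tensor_id_exists[OF S] by blast
  obtain R2 :: "('b, 'a) htensor \<Rightarrow>\<^sub>L ('d, 'a) htensor" where R2: "R2 \<in> bops"
    "\<And>x y. R2 (x \<otimes>\<^sub>h y) = T x \<otimes>\<^sub>h y" "norm R2 \<le> norm T"
    using op_tensor_id_exists[OF T] by blast
  define R where "R = R1 ** (flip ** R2 ** flip)"
  have R: "R \<in> bops" "R (x \<otimes>\<^sub>h y) = S x \<otimes>\<^sub>h T y" for x y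
    using R1 R2 by (auto simp: R_def)
  have "S \<otimes> T = R" unfolding op_tensor_def
    by (rule the_equality) (simp_all add: R htens_op_eqI)
  moreover have "norm R \<le> norm S * norm T" unfolding R_def
    by (intro order_trans[OF norm_compose_le] mult_mono order_trans[OF ff] R1 R2) auto
  ultimately show "S \<otimes> T \<in> bops" "(S \<otimes> T) (x \<otimes>\<^sub>h y) = S x \<otimes>\<^sub>h T y"
    "norm (S \<otimes> T) \<le> norm S * norm T" using R by auto
qed

lemma op_tensor_id [simp]: "\<one> \<otimes> \<one> = \<one>"
  by (rule htens_op_eqI) auto

lemma op_tensor_compose:
  "R \<in> bops \<Longrightarrow> S \<in> bops \<Longrightarrow> R' \<in> bops \<Longrightarrow> S' \<in> bops \<Longrightarrow>
    (R \<otimes> S) ** R' \<otimes> S' = (R ** R') \<otimes> (S ** S')"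
  by (rule htens_op_eqI) auto

lemma op_tensor_adj: "S \<in> bops \<Longrightarrow> T \<in> bops \<Longrightarrow> (S \<otimes> T)\<dagger> = S\<dagger> \<otimes> T\<dagger>"
  by (rule htens_op_eqI) (auto intro!: htens_cinner_ext simp: cinner_adj_right cinner_htens)

lemma op_tensor_add_left: "S \<in> bops \<Longrightarrow> S' \<in> bops \<Longrightarrow> T \<in> bops \<Longrightarrow> (S + S') \<otimes> T = (S \<otimes> T) + (S' \<otimes> T)"
  and op_tensor_add_right: "S \<in> bops \<Longrightarrow> T \<in> bops \<Longrightarrow> T' \<in> bops \<Longrightarrow> S \<otimes> (T + T') = (S \<otimes> T) + (S \<otimes> T')"
  and op_tensor_diff_right: "S \<in> bops \<Longrightarrow> T \<in> bops \<Longrightarrow> T' \<in> bops \<Longrightarrow> S \<otimes> (T - T') = (S \<otimes> T) - (S \<otimes> T')"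
  and op_tensor_cscale_left: "S \<in> bops \<Longrightarrow> T \<in> bops \<Longrightarrow> cscale c S \<otimes> T = cscale c (S \<otimes> T)"
  and op_tensor_cscale_right: "S \<in> bops \<Longrightarrow> T \<in> bops \<Longrightarrow> S \<otimes> cscale c T = cscale c (S \<otimes> T)"
  by (rule htens_op_eqI; auto simp: blinfun.add_left blinfun.diff_left htens_add_left htens_add_right
      htens_scaleC_left htens_scaleC_right bounded_linear.linear[OF bounded_linear_htens_left, THEN linear_diff]
      bounded_linear.linear[OF bounded_linear_htens_right, THEN linear_diff])+

lemma op_tensor_rins: "S \<in> bops \<Longrightarrow> T \<in> bops \<Longrightarrow> S \<otimes> T ** rins y = rins (T y) ** S"
  and op_tensor_lins: "S \<in> bops \<Longrightarrow> T \<in> bops \<Longrightarrow> S \<otimes> T ** lins x = lins (S x) ** T"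
  and flip_rins: "flip ** rins y = lins y" and flip_lins: "flip ** lins x = rins x"
  by (rule blinfun_eqI; simp)+

lemma flip_op_tensor: "S \<in> bops \<Longrightarrow> T \<in> bops \<Longrightarrow> flip ** S \<otimes> T = T \<otimes> S ** flip"
  by (rule htens_op_eqI) auto

lemma unitary_op_tensor: "unitary S \<Longrightarrow> unitary T \<Longrightarrow> unitary (S \<otimes> T)"
  by (simp add: unitary_def op_tensor_adj op_tensor_compose)

lemma ctotal_range_htens3:
  "ctotal (range (\<lambda>p. ((fst p :: 'a::complex_hilbert) \<otimes>\<^sub>h (fst (snd p) :: 'b::complex_hilbert)) \<otimes>\<^sub>h (snd (snd p) :: 'c::complex_hilbert)))"
  "ctotal (range (\<lambda>p. (fst p :: 'a::complex_hilbert) \<otimes>\<^sub>h ((fst (snd p) :: 'b::complex_hilbert) \<otimes>\<^sub>h (snd (snd p) :: 'c::complex_hilbert))))"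
proof -
  show "ctotal (range (\<lambda>p. ((fst p :: 'a::complex_hilbert) \<otimes>\<^sub>h (fst (snd p) :: 'b::complex_hilbert)) \<otimes>\<^sub>h (snd (snd p) :: 'c::complex_hilbert)))"
  proof (rule ctotal_mono[OF ctotal_htens[OF ctotal_range_htens ctotal_UNIV]], clarify)
    show "(fst p \<otimes>\<^sub>h snd p) \<otimes>\<^sub>h z \<in> range (\<lambda>p. ((fst p :: 'a::complex_hilbert) \<otimes>\<^sub>h (fst (snd p) :: 'b::complex_hilbert)) \<otimes>\<^sub>h (snd (snd p) :: 'c::complex_hilbert))"
      for p z by (rule range_eqI[of _ _ "(fst p, snd p, z)"]) simp
  qed
  show "ctotal (range (\<lambda>p. (fst p :: 'a::complex_hilbert) \<otimes>\<^sub>h ((fst (snd p) :: 'b::complex_hilbert) \<otimes>\<^sub>h (snd (snd p) :: 'c::complex_hilbert))))"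
  proof (rule ctotal_mono[OF ctotal_htens[OF ctotal_UNIV ctotal_range_htens]], clarify)
    show "x \<otimes>\<^sub>h (fst p \<otimes>\<^sub>h snd p) \<in> range (\<lambda>p. (fst p :: 'a::complex_hilbert) \<otimes>\<^sub>h ((fst (snd p) :: 'b::complex_hilbert) \<otimes>\<^sub>h (snd (snd p) :: 'c::complex_hilbert)))"
      for x p by (rule range_eqI[of _ _ "(x, fst p, snd p)"]) simp
  qed
qed

lemma assoc_spec:
  defines "F \<equiv> assoc :: (('a::complex_hilbert, 'b::complex_hilbert) htensor, 'c::complex_hilbert) htensor \<Rightarrow>\<^sub>L _"
  shows "unitary F \<and> (\<forall>x y z. F ((x \<otimes>\<^sub>h y) \<otimes>\<^sub>h z) = x \<otimes>\<^sub>h (y \<otimes>\<^sub>h z) \<and>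
    (F\<dagger>) (x \<otimes>\<^sub>h (y \<otimes>\<^sub>h z)) = (x \<otimes>\<^sub>h y) \<otimes>\<^sub>h z)"
proof -
  let ?v = "\<lambda>p. ((fst p :: 'a::complex_hilbert) \<otimes>\<^sub>h (fst (snd p) :: 'b::complex_hilbert)) \<otimes>\<^sub>h (snd (snd p) :: 'c::complex_hilbert)"
  let ?w = "\<lambda>p. (fst p :: 'a::complex_hilbert) \<otimes>\<^sub>h ((fst (snd p) :: 'b::complex_hilbert) \<otimes>\<^sub>h (snd (snd p) :: 'c::complex_hilbert))"
  have "\<exists>U. unitary U \<and> (\<forall>p. U (?v p) = ?w p) \<and> (\<forall>p. (U\<dagger>) (?w p) = ?v p)"
    by (intro unitary_extension ctotal_range_htens3) (simp add: cinner_htens)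
  then obtain U where U: "unitary U" and *: "\<And>p. U (?v p) = ?w p" "\<And>p. (U\<dagger>) (?w p) = ?v p" by blast
  have U: "unitary U" "\<And>x y z. U ((x \<otimes>\<^sub>h y) \<otimes>\<^sub>h z) = x \<otimes>\<^sub>h (y \<otimes>\<^sub>h z)"
      "\<And>x y z. (U\<dagger>) (x \<otimes>\<^sub>h (y \<otimes>\<^sub>h z)) = (x \<otimes>\<^sub>h y) \<otimes>\<^sub>h z"
    using U *[of "(x, y, z)" for x y z] by simp_all
  have "F = U" unfolding F_def assoc_def
    by (rule the_equality) (simp_all add: U unitaryD(1)[OF U(1)] htens_op_eqI_left3)
  then show ?thesis using U by simp
qed

lemma unitary_assoc: "unitary assoc"
  and assoc_apply [simp]: "assoc ((x \<otimes>\<^sub>h y) \<otimes>\<^sub>h z) = x \<otimes>\<^sub>h (y \<otimes>\<^sub>h z)"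
  and assoc_adj_apply [simp]: "(assoc\<dagger>) (x \<otimes>\<^sub>h (y \<otimes>\<^sub>h z)) = (x \<otimes>\<^sub>h y) \<otimes>\<^sub>h z"
  using assoc_spec by auto

lemma assoc_bops [simp, intro]: "assoc \<in> bops"
  using unitary_assoc by (rule unitaryD)

lemma assoc_inverse [simp]:
  "assoc\<dagger> ** assoc = \<one>" "assoc ** assoc\<dagger> = \<one>"
  "(assoc\<dagger>) (assoc u) = u" "assoc ((assoc\<dagger>) v) = v"
  "assoc\<dagger> ** (assoc ** A) = A" "assoc ** (assoc\<dagger> ** B) = B"
  by (auto simp: unitaryD[OF unitary_assoc] intro: compose_absorb)

subsection \<open>Leg numbering\<close>

lemma compose_left: "A ** B = C \<Longrightarrow> A ** (B ** X) = C ** X"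
  by (metis compose_assoc)

lemma reassoc_bops [simp, intro]: "T \<in> bops \<Longrightarrow> reassoc T \<in> bops"
  by (simp add: reassoc_def)

lemma leg_bops [simp, intro]:
  assumes "T \<in> bops"
  shows "leg12 T \<in> bops" "leg23 T \<in> bops" "leg13 T \<in> bops"
  using assms by (simp_all add: leg12_def leg23_def leg13_def)

lemma assoc_lins: "assoc ** (lins x \<otimes> \<one>) = lins x"
  and assoc_rins: "assoc ** rins z = \<one> \<otimes> rins z"
  by (rule htens_op_eqI; simp)+

lemma assoc_adj_lins: "assoc\<dagger> ** lins x = lins x \<otimes> \<one>"
  and assoc_adj_id_rins: "assoc\<dagger> ** (\<one> \<otimes> rins z) = rins z"
  by (rule htens_op_eqI; simp)+

lemma leg12_rins: "T \<in> bops \<Longrightarrow> leg12 T ** rins z = rins z ** T"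
  by (simp add: leg12_def op_tensor_rins)

lemma leg23_lins:
  assumes T: "T \<in> bops"
  shows "leg23 T ** (lins x \<otimes> \<one>) = (lins x \<otimes> \<one>) ** T"
  using T by (simp add: leg23_def reassoc_def compose_assoc assoc_lins op_tensor_lins)
    (simp add: compose_assoc[symmetric] assoc_adj_lins)

lemma leg13_rins:
  assumes T: "T \<in> bops"
  shows "leg13 T ** (rins y \<otimes> \<one>) = (rins y \<otimes> \<one>) ** T"
proof -
  have 1: "flip \<otimes> \<one> ** (rins y \<otimes> \<one>) = lins y \<otimes> \<one>"
    and 2: "flip \<otimes> \<one> ** (lins y \<otimes> \<one>) = rins y \<otimes> \<one>"
    by (simp_all add: op_tensor_compose flip_rins flip_lins)
  show ?thesis
    using compose_square[OF leg23_lins[OF T]] unfolding leg13_def compose_assoc 1 leg23_lins[OF T]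
    by (simp add: compose_assoc[symmetric] 2)
qed

lemma rins_id_op_eqI:
  assumes "R \<in> bops" "R' \<in> bops" "\<And>y. R ** (rins y \<otimes> \<one>) = R' ** (rins y \<otimes> \<one>)"
  shows "R = R'"
proof (rule htens_op_eqI_left3[OF assms(1,2)])
  fix x y z
  show "R ((x \<otimes>\<^sub>h y) \<otimes>\<^sub>h z) = R' ((x \<otimes>\<^sub>h y) \<otimes>\<^sub>h z)"
    using arg_cong[OF assms(3)[of y], of "\<lambda>T. T (x \<otimes>\<^sub>h z)"] by simp
qed

lemma lins_id_op_eqI:
  assumes "R \<in> bops" "R' \<in> bops" "\<And>x. R ** (lins x \<otimes> \<one>) = R' ** (lins x \<otimes> \<one>)"
  shows "R = R'"
proof (rule htens_op_eqI_left3[OF assms(1,2)])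
  fix x y z
  show "R ((x \<otimes>\<^sub>h y) \<otimes>\<^sub>h z) = R' ((x \<otimes>\<^sub>h y) \<otimes>\<^sub>h z)"
    using arg_cong[OF assms(3)[of x], of "\<lambda>T. T (y \<otimes>\<^sub>h z)"] by simp
qed

lemma id_rins_op_eqI:
  assumes "R \<in> bops" "R' \<in> bops" "\<And>z. R ** (\<one> \<otimes> rins z) = R' ** (\<one> \<otimes> rins z)"
  shows "R = R'"
proof (rule htens_op_eqI_right3[OF assms(1,2)])
  fix x y z
  show "R (x \<otimes>\<^sub>h (y \<otimes>\<^sub>h z)) = R' (x \<otimes>\<^sub>h (y \<otimes>\<^sub>h z))"
    using arg_cong[OF assms(3)[of z], of "\<lambda>T. T (x \<otimes>\<^sub>h y)"] by simp
qed

lemma id_lins_op_eqI: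
  assumes "R \<in> bops" "R' \<in> bops" "\<And>y. R ** (\<one> \<otimes> lins y) = R' ** (\<one> \<otimes> lins y)"
  shows "R = R'"
proof (rule htens_op_eqI_right3[OF assms(1,2)])
  fix x y z
  show "R (x \<otimes>\<^sub>h (y \<otimes>\<^sub>h z)) = R' (x \<otimes>\<^sub>h (y \<otimes>\<^sub>h z))"
    using arg_cong[OF assms(3)[of y], of "\<lambda>T. T (x \<otimes>\<^sub>h z)"] by simp
qed

lemma leg12_compose: "S \<in> bops \<Longrightarrow> T \<in> bops \<Longrightarrow> leg12 (S ** T) = leg12 S ** leg12 T"
  and leg12_adj: "S \<in> bops \<Longrightarrow> (leg12 S)\<dagger> = leg12 (S\<dagger>)"
  and leg12_id [simp]: "leg12 \<one> = \<one>"
  by (simp_all add: leg12_def op_tensor_compose op_tensor_adj)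

lemma leg23_compose: "S \<in> bops \<Longrightarrow> T \<in> bops \<Longrightarrow> leg23 (S ** T) = leg23 S ** leg23 T"
  by (rule lins_id_op_eqI) (simp_all add: compose_assoc leg23_lins compose_square[OF leg23_lins])

lemma leg23_adj: "S \<in> bops \<Longrightarrow> (leg23 S)\<dagger> = leg23 (S\<dagger>)"
  by (simp add: leg23_def reassoc_def adj_compose op_tensor_adj compose_assoc)

lemma leg23_id [simp]: "leg23 \<one> = \<one>"
  by (simp add: leg23_def reassoc_def)

lemma leg13_compose: "S \<in> bops \<Longrightarrow> T \<in> bops \<Longrightarrow> leg13 (S ** T) = leg13 S ** leg13 T"
  by (rule rins_id_op_eqI) (simp_all add: compose_assoc leg13_rins compose_square[OF leg13_rins])

lemma leg13_adj: "S \<in> bops \<Longrightarrow> (leg13 S)\<dagger> = leg13 (S\<dagger>)"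
  by (simp add: leg13_def adj_compose op_tensor_adj compose_assoc leg23_adj)

lemma leg13_id [simp]: "leg13 \<one> = \<one>"
  by (simp add: leg13_def op_tensor_compose)

lemma unitary_leg:
  assumes "unitary U"
  shows "unitary (leg12 U)" "unitary (leg23 U)" "unitary (leg13 U)"
  using assms by (simp_all add: unitary_def leg12_adj leg23_adj leg13_adj
      leg12_compose[symmetric] leg23_compose[symmetric] leg13_compose[symmetric])

text \<open>Leg placement is natural in the last leg. With the insertions \<open>rins z\<close> and
  \<open>lins z\<close> for \<open>J\<close> this handles a composite last leg, as in
  \<open>leg_pl1\<close> and \<open>leg_pl2\<close>.\<close>

lemma leg13_natural:
  assumes "T \<in> bops" "T' \<in> bops" "J \<in> bops" "T' ** \<one> \<otimes> J = \<one> \<otimes> J ** T"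
  shows "leg13 T' ** \<one> \<otimes> J = \<one> \<otimes> J ** leg13 T"
proof (rule rins_id_op_eqI)
  fix y
  have s: "\<one> \<otimes> J ** (rins y \<otimes> \<one>) = (rins y \<otimes> \<one>) ** \<one> \<otimes> J"
    using assms(3) by (simp add: op_tensor_compose)
  show "leg13 T' ** \<one> \<otimes> J ** (rins y \<otimes> \<one>) =
      (\<one> \<otimes> J) ** leg13 T ** (rins y \<otimes> \<one>)"
    using assms by (simp add: compose_assoc s leg13_rins compose_square[OF leg13_rins] compose_square[OF s])
qed (use assms in simp_all)

lemma leg23_natural:
  assumes "T \<in> bops" "T' \<in> bops" "J \<in> bops" "T' ** \<one> \<otimes> J = \<one> \<otimes> J ** T"
  shows "leg23 T' ** \<one> \<otimes> J = \<one> \<otimes> J ** leg23 T"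
proof (rule lins_id_op_eqI)
  fix y
  have s: "\<one> \<otimes> J ** (lins y \<otimes> \<one>) = (lins y \<otimes> \<one>) ** \<one> \<otimes> J"
    using assms(3) by (simp add: op_tensor_compose)
  show "leg23 T' ** \<one> \<otimes> J ** (lins y \<otimes> \<one>) =
      (\<one> \<otimes> J) ** leg23 T ** (lins y \<otimes> \<one>)"
    using assms by (simp add: compose_assoc s leg23_lins compose_square[OF leg23_lins] compose_square[OF s])
qed (use assms in simp_all)

lemma leg12_natural:
  "T \<in> bops \<Longrightarrow> J \<in> bops \<Longrightarrow> leg12 T ** \<one> \<otimes> J = \<one> \<otimes> J ** leg12 T"
  by (simp add: leg12_def op_tensor_compose)

lemma leg13_id_tensor: "B \<in> bops \<Longrightarrow> leg13 (\<one> \<otimes> B) = \<one> \<otimes> B"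
  by (rule rins_id_op_eqI) (simp_all add: leg13_rins op_tensor_compose)

lemma leg23_id_tensor: "B \<in> bops \<Longrightarrow> leg23 (\<one> \<otimes> B) = \<one> \<otimes> B"
  by (rule lins_id_op_eqI) (simp_all add: leg23_lins op_tensor_compose)

text \<open>\<open>pl1\<close> and \<open>pl2\<close> place an operator on \<open>H \<otimes> K\<close> on the legs 1, 2, respectively 1, 3 of a product
  that is bracketed to the right.\<close>

definition pl1 ::
  "('a::complex_hilbert, 'b::complex_hilbert) hop \<Rightarrow>
    (('a, ('b, 'c::complex_hilbert) htensor) htensor \<Rightarrow>\<^sub>L ('a, ('b, 'c) htensor) htensor)" where
  "pl1 T = assoc ** leg12 T ** assoc\<dagger>"

definition pl2 ::
  "('a::complex_hilbert, 'c::complex_hilbert) hop \<Rightarrow>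
    (('a, ('b::complex_hilbert, 'c) htensor) htensor \<Rightarrow>\<^sub>L ('a, ('b, 'c) htensor) htensor)" where
  "pl2 T = \<one> \<otimes> flip ** pl1 T ** \<one> \<otimes> flip"

lemma pl_bops [simp, intro]: "T \<in> bops \<Longrightarrow> pl1 T \<in> bops" "T \<in> bops \<Longrightarrow> pl2 T \<in> bops"
  by (simp_all add: pl1_def pl2_def)

lemma pl1_rins: "T \<in> bops \<Longrightarrow> pl1 T ** (\<one> \<otimes> rins z) = (\<one> \<otimes> rins z) ** T"
  by (simp add: pl1_def compose_assoc assoc_adj_id_rins leg12_rins)
    (simp add: compose_assoc[symmetric] assoc_rins)

lemma pl2_lins:
  assumes "T \<in> bops" shows "pl2 T ** (\<one> \<otimes> lins z) = (\<one> \<otimes> lins z) ** T"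
proof -
  have 1: "\<one> \<otimes> flip ** (\<one> \<otimes> lins z) = \<one> \<otimes> rins z"
    and 2: "\<one> \<otimes> flip ** (\<one> \<otimes> rins z) = \<one> \<otimes> lins z"
    by (simp_all add: op_tensor_compose flip_lins flip_rins)
  show ?thesis
    unfolding pl2_def compose_assoc 1 pl1_rins[OF assms]
    by (simp add: compose_assoc[symmetric] 2)
qed

lemma pl1_compose: "S \<in> bops \<Longrightarrow> T \<in> bops \<Longrightarrow> pl1 (S ** T) = pl1 S ** pl1 T"
  and pl1_adj: "S \<in> bops \<Longrightarrow> (pl1 S)\<dagger> = pl1 (S\<dagger>)"
  and pl1_id [simp]: "pl1 \<one> = \<one>"
  by (simp_all add: pl1_def leg12_compose compose_assoc adj_compose leg12_adj)

lemma id_flip_flip: "\<one> \<otimes> flip ** \<one> \<otimes> flip = \<one>"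
  by (simp add: op_tensor_compose)

lemma pl2_compose: "S \<in> bops \<Longrightarrow> T \<in> bops \<Longrightarrow> pl2 (S ** T) = pl2 S ** pl2 T"
  and pl2_adj: "S \<in> bops \<Longrightarrow> (pl2 S)\<dagger> = pl2 (S\<dagger>)"
  and pl2_id [simp]: "pl2 \<one> = \<one>"
  by (simp_all add: pl2_def pl1_compose compose_assoc adj_compose pl1_adj op_tensor_adj
      compose_absorb[OF id_flip_flip] id_flip_flip)

lemma unitary_pl: "unitary U \<Longrightarrow> unitary (pl1 U)" "unitary U \<Longrightarrow> unitary (pl2 U)"
  by (simp_all add: unitary_def pl1_adj pl2_adj pl1_compose[symmetric] pl2_compose[symmetric])

lemma leg_pl1:
  assumes T: "T \<in> bops"
  shows "leg13 (pl1 T) = pl1 (leg13 T)" "leg23 (pl1 T) = pl1 (leg23 T)"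
  by (rule id_rins_op_eqI; use T in \<open>simp add: pl1_rins leg13_natural[OF _ _ _ pl1_rins] leg23_natural[OF _ _ _ pl1_rins]\<close>)+

lemma leg_pl2:
  assumes T: "T \<in> bops"
  shows "leg13 (pl2 T) = pl2 (leg13 T)" "leg23 (pl2 T) = pl2 (leg23 T)"
  by (rule id_lins_op_eqI; use T in \<open>simp add: pl2_lins leg13_natural[OF _ _ _ pl2_lins] leg23_natural[OF _ _ _ pl2_lins]\<close>)+

lemma pl1_leg12: "T \<in> bops \<Longrightarrow> pl1 (leg12 T) = leg12 T"
  by (rule id_rins_op_eqI) (simp_all add: pl1_rins leg12_natural)

lemma pl2_leg12: "T \<in> bops \<Longrightarrow> pl2 (leg12 T) = leg12 T"
  by (rule id_lins_op_eqI) (simp_all add: pl2_lins leg12_natural)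

text \<open>The shuffle \<open>(x \<otimes> p) \<otimes> (y \<otimes> r) \<mapsto> (x \<otimes> y) \<otimes> (p \<otimes> r)\<close> turns the two factors below into
  \<open>S \<otimes> 1\<close> and \<open>1 \<otimes> T\<close>.\<close>

lemma leg13_pl1_leg23_pl2_commute:
  fixes S :: "('a::complex_hilbert, 'd1::complex_hilbert) hop"
    and T :: "('b::complex_hilbert, 'd2::complex_hilbert) hop"
  assumes S: "S \<in> bops" and T: "T \<in> bops"
  shows "leg13 (pl1 S) ** leg23 (pl2 T) = leg23 (pl2 T) ** leg13 (pl1 S)"
proof -
  let ?v = "\<lambda>q. ((fst (fst q) :: 'a) \<otimes>\<^sub>h (snd (fst q) :: 'd1)) \<otimes>\<^sub>h ((fst (snd q) :: 'b) \<otimes>\<^sub>h (snd (snd q) :: 'd2))"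
  let ?w = "\<lambda>q. ((fst (fst q) :: 'a) \<otimes>\<^sub>h (fst (snd q) :: 'b)) \<otimes>\<^sub>h ((snd (fst q) :: 'd1) \<otimes>\<^sub>h (snd (snd q) :: 'd2))"
  have "\<exists>U. unitary U \<and> (\<forall>q. U (?v q) = ?w q) \<and> (\<forall>q. (U\<dagger>) (?w q) = ?v q)"
  proof (rule unitary_extension)
    show "ctotal (range ?v)"
    proof (rule ctotal_mono[OF ctotal_htens[OF ctotal_range_htens ctotal_range_htens]], clarify)
      show "(fst p \<otimes>\<^sub>h snd p) \<otimes>\<^sub>h (fst q \<otimes>\<^sub>h snd q) \<in> range ?v" for p q
        by (rule range_eqI[of _ _ "(p, q)"]) simp
    qed
    show "ctotal (range ?w)"
    proof (rule ctotal_mono[OF ctotal_htens[OF ctotal_range_htens ctotal_range_htens]], clarify)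
      show "(fst p \<otimes>\<^sub>h snd p) \<otimes>\<^sub>h (fst q \<otimes>\<^sub>h snd q) \<in> range ?w" for p q
        by (rule range_eqI[of _ _ "((fst p, fst q), (snd p, snd q))"]) simp
    qed
  qed (simp add: cinner_htens)
  then obtain U where U: "unitary U" and *: "\<And>q. U (?v q) = ?w q" by blast
  have Uv: "U ((x \<otimes>\<^sub>h p) \<otimes>\<^sub>h (y \<otimes>\<^sub>h r)) = (x \<otimes>\<^sub>h y) \<otimes>\<^sub>h (p \<otimes>\<^sub>h r)" for x y p r
    using *[of "((x, p), (y, r))"] by simp
  have Ub: "U \<in> bops" using U by (rule unitaryD)
  have Ur: "U ** rins (y \<otimes>\<^sub>h r) = (rins y \<otimes> \<one>) ** (\<one> \<otimes> rins r)" for y r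
    by (rule htens_op_eqI) (simp_all add: Ub Uv)
  have Ul: "U ** lins (x \<otimes>\<^sub>h p) = (lins x \<otimes> \<one>) ** (\<one> \<otimes> lins p)" for x p
    by (rule htens_op_eqI) (simp_all add: Ub Uv)
  have "leg13 (pl1 S) ** U ** rins (y \<otimes>\<^sub>h r) = U ** S \<otimes> \<one> ** rins (y \<otimes>\<^sub>h r)" for y r
    using S by (simp add: compose_assoc Ur op_tensor_rins compose_square[OF leg13_rins] pl1_rins compose_square[OF Ur])
  then have "leg13 (pl1 S) ** U = U ** S \<otimes> \<one>"
    by (intro rins_op_eqI_total[OF ctotal_htens[OF ctotal_UNIV ctotal_UNIV]]) (use Ub S in auto)
  then have 1: "leg13 (pl1 S) = U ** S \<otimes> \<one> ** U\<dagger>"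
    using unitaryD(3)[OF U] by (metis compose_assoc blinfun_compose_id(1))
  have "leg23 (pl2 T) ** U ** lins (x \<otimes>\<^sub>h p) = U ** \<one> \<otimes> T ** lins (x \<otimes>\<^sub>h p)" for x p
    using T by (simp add: compose_assoc Ul op_tensor_lins compose_square[OF leg23_lins] pl2_lins compose_square[OF Ul])
  then have "leg23 (pl2 T) ** U = U ** \<one> \<otimes> T"
    by (intro lins_op_eqI_total[OF ctotal_htens[OF ctotal_UNIV ctotal_UNIV]]) (use Ub T in auto)
  then have 2: "leg23 (pl2 T) = U ** \<one> \<otimes> T ** U\<dagger>"
    using unitaryD(3)[OF U] by (metis compose_assoc blinfun_compose_id(1))
  have c: "S \<otimes> \<one> ** \<one> \<otimes> T = \<one> \<otimes> T ** S \<otimes> \<one>"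
    using S T by (simp add: op_tensor_compose)
  show ?thesis unfolding 1 2 compose_assoc compose_absorb[OF unitaryD(2)[OF U]]
    by (rule arg_cong[of _ _ "\<lambda>Z. U ** Z"]) (rule compose_square[OF c])
qed

section \<open>Flips and cyclic permutations of the legs\<close>

definition flipped ::
  "('a::complex_hilbert, 'b::complex_hilbert) hop \<Rightarrow> ('b, 'a) hop" where
  "flipped T = flip ** T ** flip"

lemma flipped_bops [simp, intro]: "T \<in> bops \<Longrightarrow> flipped T \<in> bops"
  and flipped_flipped [simp]: "flipped (flipped T) = T"
  and flipped_id [simp]: "flipped \<one> = \<one>"
  and flipped_compose: "flipped (S ** T) = flipped S ** flipped T"
  by (simp_all add: flipped_def compose_assoc)

lemma flipped_adj: "T \<in> bops \<Longrightarrow> (flipped T)\<dagger> = flipped (T\<dagger>)"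
  by (simp add: flipped_def adj_compose compose_assoc)

lemma flipped_op_tensor: "S \<in> bops \<Longrightarrow> T \<in> bops \<Longrightarrow> flipped (S \<otimes> T) = T \<otimes> S"
  by (simp add: flipped_def flip_op_tensor compose_assoc)

lemma unitary_flipped: "unitary U \<Longrightarrow> unitary (flipped U)"
  by (simp add: flipped_def unitary_compose unitary_flip)

lemma flip_flipped: "flip ** T = flipped T ** flip"
  by (simp add: flipped_def compose_assoc)

definition rot ::
  "(('a::complex_hilbert, 'b::complex_hilbert) htensor, 'c::complex_hilbert) htensor \<Rightarrow>\<^sub>L (('b, 'c) htensor, 'a) htensor" where
  "rot = flip ** assoc"

lemma unitary_rot: "unitary rot"
  by (simp add: rot_def unitary_compose unitary_flip unitary_assoc)

lemma rot_bops [simp, intro]: "rot \<in> bops"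
  using unitary_rot by (rule unitaryD)

lemma rot_apply [simp]: "rot ((x \<otimes>\<^sub>h y) \<otimes>\<^sub>h z) = (y \<otimes>\<^sub>h z) \<otimes>\<^sub>h x"
  by (simp add: rot_def)

lemma rot_leg12:
  assumes "T \<in> bops" shows "rot ** leg12 T = leg13 (flipped T) ** rot"
proof (rule rins_op_eqI)
  fix z
  have r: "rot ** rins z = (rins z \<otimes> \<one>) ** flip" by (rule htens_op_eqI) auto
  show "rot ** leg12 T ** rins z = leg13 (flipped T) ** rot ** rins z"
    using assms by (simp add: compose_assoc leg12_rins r compose_square[OF r]
      compose_square[OF leg13_rins] flip_flipped)
qed (use assms in auto)

lemma rot_leg13:
  assumes "T \<in> bops" shows "rot ** leg13 T = leg23 (flipped T) ** rot"
proof (rule rins_id_op_eqI)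
  fix y
  have r: "rot ** (rins y \<otimes> \<one>) = (lins y \<otimes> \<one>) ** flip" by (rule htens_op_eqI) auto
  show "rot ** leg13 T ** (rins y \<otimes> \<one>) = leg23 (flipped T) ** rot ** (rins y \<otimes> \<one>)"
    using assms by (simp add: compose_assoc leg13_rins r compose_square[OF r]
      compose_square[OF leg23_lins] flip_flipped)
qed (use assms in auto)

lemma rot_leg23:
  assumes "T \<in> bops" shows "rot ** leg23 T = leg12 T ** rot"
proof (rule lins_id_op_eqI)
  fix x
  have r: "rot ** (lins x \<otimes> \<one>) = rins x" by (rule htens_op_eqI) auto
  show "rot ** leg23 T ** (lins x \<otimes> \<one>) = leg12 T ** rot ** (lins x \<otimes> \<one>)"
    using assms by (simp add: compose_assoc leg23_lins r compose_left[OF r] leg12_rins)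
qed (use assms in auto)

lemma unitary_cancel_left:
  assumes "unitary U" "U ** A = U ** B" shows "A = B"
  using arg_cong[OF assms(2), of "\<lambda>X. U\<dagger> ** X"] unitaryD(2)[OF assms(1)] by (simp add: compose_absorb)

lemma unitary_cancel_right:
  assumes "unitary U" "A ** U = B ** U" shows "A = B"
  using arg_cong[OF assms(2), of "\<lambda>X. X ** U\<dagger>"] unitaryD(3)[OF assms(1)] by (simp add: compose_assoc)

definition sw ::
  "('a::complex_hilbert, ('b::complex_hilbert, 'c::complex_hilbert) htensor) htensor \<Rightarrow>\<^sub>L ('b, ('a, 'c) htensor) htensor" where
  "sw = assoc ** flip \<otimes> \<one> ** assoc\<dagger>"

lemma unitary_sw: "unitary sw"
  by (simp add: sw_def unitary_compose unitary_flip unitary_assoc unitary_adj unitary_op_tensor)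

lemma sw_bops [simp, intro]: "sw \<in> bops"
  using unitary_sw by (rule unitaryD)

lemma sw_apply [simp]: "sw (x \<otimes>\<^sub>h (y \<otimes>\<^sub>h z)) = y \<otimes>\<^sub>h (x \<otimes>\<^sub>h z)"
  by (simp add: sw_def)

lemma sw_sw: "sw ** sw = \<one>"
  by (rule htens_op_eqI_right3) auto

lemma sw_pl1:
  assumes "T \<in> bops" shows "sw ** pl1 T = pl1 (flipped T) ** sw"
proof (rule id_rins_op_eqI)
  fix z
  have r: "sw ** (\<one> \<otimes> rins z) = (\<one> \<otimes> rins z) ** flip" by (rule htens_op_eqI) auto
  show "sw ** pl1 T ** (\<one> \<otimes> rins z) = pl1 (flipped T) ** sw ** (\<one> \<otimes> rins z)"
    using assms by (simp add: compose_assoc pl1_rins r compose_square[OF r]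
      compose_square[OF pl1_rins] flip_flipped)
qed (use assms in auto)

lemma sw_pl2:
  assumes "T \<in> bops" shows "sw ** pl2 T = \<one> \<otimes> T ** sw"
proof (rule id_lins_op_eqI)
  fix z
  have r: "sw ** (\<one> \<otimes> lins z) = lins z" by (rule htens_op_eqI) auto
  show "sw ** pl2 T ** (\<one> \<otimes> lins z) = \<one> \<otimes> T ** sw ** (\<one> \<otimes> lins z)"
    using assms by (simp add: compose_assoc pl2_lins r compose_left[OF r] op_tensor_lins)
qed (use assms in auto)

lemma sw_id_tensor:
  assumes "T \<in> bops" shows "sw ** \<one> \<otimes> T = pl2 T ** sw"
proof -
  have "sw ** (sw ** pl2 T) ** sw = sw ** (\<one> \<otimes> T ** sw) ** sw"
    by (simp only: sw_pl2[OF assms])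
  then have "pl2 T ** sw = sw ** \<one> \<otimes> T"
    by (simp add: compose_assoc sw_sw compose_absorb[OF sw_sw])
  then show ?thesis by (rule sym)
qed

definition cyc ::
  "('a::complex_hilbert, ('b::complex_hilbert, 'c::complex_hilbert) htensor) htensor \<Rightarrow>\<^sub>L ('c, ('a, 'b) htensor) htensor" where
  "cyc = flip ** assoc\<dagger>"

lemma unitary_cyc: "unitary cyc"
  by (simp add: cyc_def unitary_compose unitary_flip unitary_assoc unitary_adj)

lemma cyc_bops [simp, intro]: "cyc \<in> bops"
  using unitary_cyc by (rule unitaryD)

lemma cyc_apply [simp]: "cyc (x \<otimes>\<^sub>h (y \<otimes>\<^sub>h z)) = z \<otimes>\<^sub>h (x \<otimes>\<^sub>h y)"
  by (simp add: cyc_def)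

lemma cyc_pl1:
  assumes "T \<in> bops" shows "cyc ** pl1 T = \<one> \<otimes> T ** cyc"
proof (rule id_rins_op_eqI)
  fix z
  have r: "cyc ** (\<one> \<otimes> rins z) = lins z" by (rule htens_op_eqI) auto
  show "cyc ** pl1 T ** (\<one> \<otimes> rins z) = \<one> \<otimes> T ** cyc ** (\<one> \<otimes> rins z)"
    using assms by (simp add: compose_assoc pl1_rins r compose_left[OF r] op_tensor_lins)
qed (use assms in auto)

lemma cyc_pl2:
  assumes "T \<in> bops" shows "cyc ** pl2 T = pl1 (flipped T) ** cyc"
proof (rule id_lins_op_eqI)
  fix z
  have r: "cyc ** (\<one> \<otimes> lins z) = (\<one> \<otimes> rins z) ** flip" by (rule htens_op_eqI) auto
  show "cyc ** pl2 T ** (\<one> \<otimes> lins z) = pl1 (flipped T) ** cyc ** (\<one> \<otimes> lins z)"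
    using assms by (simp add: compose_assoc pl2_lins r compose_square[OF r]
      compose_square[OF pl1_rins] flip_flipped)
qed (use assms in auto)

lemma cyc_id_tensor:
  assumes "T \<in> bops" shows "cyc ** \<one> \<otimes> T = pl2 (flipped T) ** cyc"
proof (rule lins_op_eqI)
  fix x
  have r: "cyc ** lins x = (\<one> \<otimes> lins x) ** flip" by (rule htens_op_eqI) auto
  show "cyc ** \<one> \<otimes> T ** lins x = pl2 (flipped T) ** cyc ** lins x"
    using assms by (simp add: compose_assoc pl2_lins r compose_square[OF r] op_tensor_lins
      compose_square[OF pl2_lins] flip_flipped)
qed (use assms in auto)

subsection \<open>Hilbert modules and amplifications of representations\<close>

lemma bounded_linear_compose_left: "bounded_linear (\<lambda>T. A ** T)"
  and bounded_linear_compose_right: "bounded_linear (\<lambda>T. T ** A)"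
  using bounded_bilinear.bounded_linear_right[OF bounded_bilinear_blinfun_compose]
    bounded_bilinear.bounded_linear_left[OF bounded_bilinear_blinfun_compose] by auto

lemma blinfun_compose_add: "A ** (B + C) = (A ** B) + (A ** C)" "(B' + C') ** A' = (B' ** A') + (C' ** A')"
  and blinfun_compose_diff: "A ** (B - C) = (A ** B) - (A ** C)" "(B' - C') ** A' = (B' ** A') - (C' ** A')"
  and blinfun_compose_scaleR: "A ** (r *\<^sub>R B) = r *\<^sub>R (A ** B)" "(r *\<^sub>R B') ** A' = r *\<^sub>R (B' ** A')"
  by (rule blinfun_eqI; simp add: blinfun.bilinear_simps)+

lemma blinfun_compose_cscale: "A \<in> bops \<Longrightarrow> A ** cscale c B = cscale c (A ** B)" "cscale c B' ** A' = cscale c (B' ** A')"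
  by (rule blinfun_eqI; simp add: bops_scaleC)+

lemma cscale_one [simp]: "cscale 1 T = T"
  by (rule blinfun_eqI) simp

lemma cscale_zero_left [simp]: "cscale 0 T = 0"
  by (rule blinfun_eqI) simp

lemma bounded_linear_cscale: "bounded_linear (cscale c)"
proof (rule bounded_linear_intro[where K = "cmod c"])
  show "norm (cscale c T) \<le> norm T * cmod c" for T :: "'a::complex_hilbert \<Rightarrow>\<^sub>L 'b::complex_hilbert"
  proof (rule norm_blinfun_bound)
    fix x
    have "cmod c * norm (T x) \<le> cmod c * (norm T * norm x)" by (intro mult_left_mono norm_blinfun) simp
    then show "norm ((cscale c T) x) \<le> norm T * cmod c * norm x" by (simp add: norm_scaleC mult_ac)
  qed simp
qed (rule blinfun_eqI; simp add: blinfun.bilinear_simps scaleC_add_right scaleC_scaleR)+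

lemma subspace_preimage: "bounded_linear f \<Longrightarrow> subspace S \<Longrightarrow> subspace {x. f x \<in> S}"
  by (auto simp: subspace_def bounded_linear.linear linear_0 linear_add linear_scale)

lemma closed_preimage: "bounded_linear f \<Longrightarrow> closed S \<Longrightarrow> closed {x. f x \<in> S}"
  using continuous_closed_vimage[of S f] by (simp add: vimage_def linear_continuous_at)

lemma closure_span_image_subset:
  assumes f: "bounded_linear f" and S: "subspace S" "closed S" and G: "\<And>x. x \<in> G \<Longrightarrow> f x \<in> S"
    and x: "x \<in> closure (span G)"
  shows "f x \<in> S"
proof -
  have "closure (span G) \<subseteq> {x. f x \<in> S}"
    by (intro closure_minimal span_minimal subspace_preimage closed_preimage f S) (use G in auto)
  then show ?thesis using x by blast
qed

lemma subspace_closure: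
  fixes S :: "'a::real_normed_vector set"
  assumes "subspace S" shows "subspace (closure S)"
  unfolding subspace_def
proof (intro conjI ballI allI)
  show "0 \<in> closure S" using subspace_0[OF assms] closure_subset by blast
  fix x assume "x \<in> closure S"
  then obtain f where f: "\<And>n. f n \<in> S" "f \<longlonglongrightarrow> x" unfolding closure_sequential by blast
  show "c *\<^sub>R x \<in> closure S" for c
    using f unfolding closure_sequential
    by (intro exI[of _ "\<lambda>n. c *\<^sub>R f n"] conjI allI subspace_scale[OF assms] tendsto_scaleR tendsto_const)
  fix y assume "y \<in> closure S"
  then obtain g where g: "\<And>n. g n \<in> S" "g \<longlonglongrightarrow> y" unfolding closure_sequential by blast
  show "x + y \<in> closure S"
    using f g unfolding closure_sequential
    by (intro exI[of _ "\<lambda>n. f n + g n"] conjI allI subspace_add[OF assms] tendsto_add)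
qed

lemma subspace_closure_span: "subspace (closure (span (G :: 'a::real_normed_vector set)))"
  using subspace_span by (rule subspace_closure)

lemma star_subalgebra_subspace: "star_subalgebra A \<Longrightarrow> subspace A"
  unfolding subspace_def by (auto intro: star_subalgebraD)

lemma subspace_bops: "subspace bops"
  by (auto simp: subspace_def)

lemma rins_adj_rins_compose: "(rins p)\<dagger> ** (rins q ** s) = cscale (cinner p q) s"
  by (simp add: compose_assoc[symmetric] rins_adj_rins blinfun_compose_cscale)

lemma Collect_pair_image: "{f q s | q s. s \<in> X} = (\<lambda>p. f (fst p) (snd p)) ` (UNIV \<times> X)"
  by force

lemma rins_adj_op_eqI:
  assumes "\<And>p. (rins p)\<dagger> ** R = (rins p)\<dagger> ** R'" shows "R = R'"
proof (rule blinfun_eqI, rule htens_cinner_ext)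
  fix z x y
  have "cinner x (((rins y)\<dagger> ** R) z) = cinner x (((rins y)\<dagger> ** R') z)"
    by (simp only: assms)
  then show "cinner (x \<otimes>\<^sub>h y) (R z) = cinner (x \<otimes>\<^sub>h y) (R' z)" by (simp add: cinner_adj_right)
qed

lemma rins_adj_id_tensor: "J \<in> bops \<Longrightarrow> (rins p)\<dagger> ** \<one> \<otimes> J = (rins ((J\<dagger>) p))\<dagger>"
proof -
  assume J: "J \<in> bops"
  have "((rins p)\<dagger> ** \<one> \<otimes> J)\<dagger> = rins ((J\<dagger>) p)"
    using J by (simp add: adj_compose op_tensor_adj op_tensor_rins)
  from arg_cong[OF this, of adj] show ?thesis using J by simp
qed

text \<open>\<open>hmod X\<close> is the Hilbert module \<open>X \<otimes> K\<close>, represented by operators \<open>H \<rightarrow> H \<otimes> K\<close>, and \<open>hmul X\<close> is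
  the algebra of its adjointable operators.\<close>

definition hmod :: "('x::complex_hilbert \<Rightarrow>\<^sub>L 'x) set \<Rightarrow> ('x \<Rightarrow>\<^sub>L ('x, 'd::complex_hilbert) htensor) set" where
  "hmod X = closure (span {rins q ** s | q s. s \<in> X})"

definition hmul :: "('x::complex_hilbert \<Rightarrow>\<^sub>L 'x) set \<Rightarrow> ('x, 'd::complex_hilbert) hop set" where
  "hmul X = {m \<in> bops. \<forall>e\<in>hmod X. m ** e \<in> hmod X \<and> m\<dagger> ** e \<in> hmod X}"

lemma hmod_gen: "s \<in> X \<Longrightarrow> rins q ** s \<in> hmod X"
  unfolding hmod_def by (intro subsetD[OF closure_subset] span_base) blast

lemma closed_hmod: "closed (hmod X)" and subspace_hmod: "subspace (hmod X)"
  unfolding hmod_def by (auto intro: subspace_closure_span)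

lemma hmod_image_subset:
  assumes "bounded_linear f" "subspace S" "closed S" "\<And>q s. s \<in> X \<Longrightarrow> f (rins q ** s) \<in> S" "e \<in> hmod X"
  shows "f e \<in> S"
  using assms(5) unfolding hmod_def by (rule closure_span_image_subset[OF assms(1-3), rotated]) (use assms(4) in blast)

context
  fixes X :: "('x::complex_hilbert \<Rightarrow>\<^sub>L 'x) set"
  assumes X: "star_subalgebra X"
begin

lemma hmod_bops: "e \<in> hmod X \<Longrightarrow> e \<in> bops"
  using hmod_image_subset[OF bounded_linear_ident subspace_bops closed_bops, of X e] star_subalgebraD(1)[OF X] by auto

lemma hmod_slice: "e \<in> hmod X \<Longrightarrow> (rins p)\<dagger> ** e \<in> X"
proof (rule hmod_image_subset[OF bounded_linear_compose_left star_subalgebra_subspace[OF X] star_subalgebraD(2)[OF X]])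
  fix q s assume s: "s \<in> X"
  show "(rins p)\<dagger> ** (rins q ** s) \<in> X" using s X by (simp add: rins_adj_rins_compose star_subalgebraD)
qed

lemma hmod_inner: "e \<in> hmod X \<Longrightarrow> f \<in> hmod X \<Longrightarrow> e\<dagger> ** f \<in> X"
proof (rule hmod_image_subset[OF bounded_linear_compose_left star_subalgebra_subspace[OF X] star_subalgebraD(2)[OF X]])
  fix q s assume s: "s \<in> X" and e: "e \<in> hmod X"
  have "e\<dagger> ** (rins q ** s) = ((rins q)\<dagger> ** e)\<dagger> ** s"
    using hmod_bops[OF e] by (simp add: adj_compose compose_assoc)
  then show "e\<dagger> ** (rins q ** s) \<in> X"
    using hmod_slice[OF e] s X by (simp add: star_subalgebraD)
qed

lemma hmod_id_tensor: "J \<in> bops \<Longrightarrow> e \<in> hmod X \<Longrightarrow> \<one> \<otimes> J ** e \<in> hmod X"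
  by (rule hmod_image_subset[OF bounded_linear_compose_left subspace_hmod closed_hmod])
    (auto simp: compose_assoc[symmetric] op_tensor_rins intro!: hmod_gen)

lemma hmulI:
  assumes "m \<in> bops" "\<And>q s. s \<in> X \<Longrightarrow> m ** (rins q ** s) \<in> hmod X" "\<And>q s. s \<in> X \<Longrightarrow> m\<dagger> ** (rins q ** s) \<in> hmod X"
  shows "m \<in> hmul X"
  unfolding hmul_def using assms(1)
  by (auto intro: hmod_image_subset[OF bounded_linear_compose_left subspace_hmod closed_hmod] assms)

lemma hmod_cscale:
  assumes "e \<in> hmod X" shows "cscale c e \<in> hmod X"
proof (rule hmod_image_subset[OF bounded_linear_cscale subspace_hmod closed_hmod _ assms])
  fix q :: 'a and s assume "s \<in> X"
  then have "rins q ** cscale c s \<in> hmod X" using X by (intro hmod_gen star_subalgebraD)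
  then show "cscale c (rins q ** s) \<in> hmod X" by (simp add: blinfun_compose_cscale)
qed

text \<open>The vectors \<open>q\<close> for which the conclusion holds form a closed complex
  subspace, so a total set of them is enough. Adjointability can thus be tested on vectors
  \<open>T x\<close> with \<open>T\<close> in a nondegenerate algebra, see
  \<open>multipliers_hmul\<close>.\<close>

lemma hmod_total_gen:
  fixes A :: "('x, 'd1::complex_hilbert) htensor \<Rightarrow>\<^sub>L ('x, 'd2::complex_hilbert) htensor"
  assumes S: "ctotal S" and q: "\<And>q. q \<in> S \<Longrightarrow> A ** (rins q ** s) \<in> hmod X" and s: "s \<in> X" and A: "A \<in> bops"
  shows "A ** (rins q ** s) \<in> hmod X"
proof -
  let ?M = "{q. A ** (rins q ** s) \<in> hmod X}"
  have bl: "bounded_linear (\<lambda>q. A ** (rins q ** s))"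
  proof (rule bounded_linear_intro[where K = "norm A * norm s"])
    fix q :: 'd1
    have "norm (A ** (rins q ** s)) \<le> norm A * (norm q * norm s)"
      by (rule order_trans[OF norm_compose_le mult_left_mono[OF order_trans[OF norm_compose_le mult_right_mono[OF norm_rins_le]]]]) auto
    then show "norm (A ** (rins q ** s)) \<le> norm q * (norm A * norm s)" by (simp add: mult_ac)
  qed (auto intro!: blinfun_eqI simp: htens_add_right htens_scaleR_right blinfun.bilinear_simps)
  have sub: "subspace ?M" by (rule subspace_preimage[OF bl subspace_hmod])
  have cl: "closed ?M" by (rule closed_preimage[OF bl closed_hmod])
  have "c *\<^sub>C q \<in> ?M" if "q \<in> ?M" for c q
  proof -
    have "A ** (rins (c *\<^sub>C q) ** s) = cscale c (A ** (rins q ** s))"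
      by (rule blinfun_eqI) (simp add: htens_scaleC_right bops_scaleC[OF A])
    then show ?thesis using that hmod_cscale by simp
  qed
  then have "csubspace ?M" using sub unfolding csubspace_def subspace_def by blast
  moreover have "ctotal ?M" using q by (intro ctotal_mono[OF S]) blast
  ultimately have "closure ?M = UNIV" by (rule csubspace_dense)
  then show ?thesis using cl by (metis (no_types, lifting) UNIV_I closure_closed mem_Collect_eq)
qed

lemma hmulI_total:
  assumes "ctotal S" "m \<in> bops" "\<And>q s. q \<in> S \<Longrightarrow> s \<in> X \<Longrightarrow> m ** (rins q ** s) \<in> hmod X"
    "\<And>q s. q \<in> S \<Longrightarrow> s \<in> X \<Longrightarrow> m\<dagger> ** (rins q ** s) \<in> hmod X"
  shows "m \<in> hmul X"
proof (rule hmulI[OF assms(2)])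
  fix q s assume s: "s \<in> X"
  show "m ** (rins q ** s) \<in> hmod X" by (rule hmod_total_gen[OF assms(1) _ s]) (use assms s in auto)
  show "m\<dagger> ** (rins q ** s) \<in> hmod X" by (rule hmod_total_gen[OF assms(1) _ s]) (use assms s in auto)
qed

lemma hmulD:
  assumes "m \<in> hmul X"
  shows "m \<in> bops" "e \<in> hmod X \<Longrightarrow> m ** e \<in> hmod X" "m\<dagger> \<in> hmul X"
  using assms by (auto simp: hmul_def)

lemma hmul_id [simp]: "\<one> \<in> hmul X"
  by (simp add: hmul_def)

lemma star_subalgebra_hmul:
  "star_subalgebra (hmul X :: ('x, 'd::complex_hilbert) hop set)"
  unfolding star_subalgebra_def
proof (intro conjI ballI allI)
  note hs = subspace_add[OF subspace_hmod]
  show "hmul X \<subseteq> bops" "0 \<in> hmul X" using subspace_0[OF subspace_hmod] by (auto simp: hmul_def)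
  show "closed (hmul X)" unfolding closed_sequential_limits
  proof (intro allI impI, elim conjE)
    fix f l assume f: "\<forall>n. f n \<in> hmul X" and l: "f \<longlonglongrightarrow> l"
    have fb: "\<And>n. f n \<in> bops" using f hmulD by blast
    have lb: "l \<in> bops" using closed_sequentially[OF closed_bops fb l] .
    note l' = tendsto_adj[OF l fb]
    have "l ** e \<in> hmod X" "l\<dagger> ** e \<in> hmod X" if e: "e \<in> hmod X" for e
    proof -
      show "l ** e \<in> hmod X"
        by (rule closed_sequentially[OF closed_hmod _ bounded_linear.tendsto[OF bounded_linear_compose_right l, of e]])
          (use f e in \<open>auto simp: hmul_def\<close>)
      show "l\<dagger> ** e \<in> hmod X"
        by (rule closed_sequentially[OF closed_hmod _ bounded_linear.tendsto[OF bounded_linear_compose_right l', of e]])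
          (use f e in \<open>auto simp: hmul_def\<close>)
    qed
    then show "l \<in> hmul X" using lb by (auto simp: hmul_def)
  qed
  fix S T :: "('x, 'd) hop"
  assume S: "S \<in> hmul X"
  then show "S\<dagger> \<in> hmul X" by (rule hmulD)
  show "cscale c S \<in> hmul X" for c
    using S by (auto simp: hmul_def hmod_cscale adj_cscale blinfun_compose_cscale)
  assume T: "T \<in> hmul X"
  show "S + T \<in> hmul X" using S T by (auto simp: hmul_def adj_add blinfun_compose_add intro!: hs)
  show "S ** T \<in> hmul X" using S T by (auto simp: hmul_def adj_compose compose_assoc)
qed

lemma hmul_id_tensor: "J \<in> bops \<Longrightarrow> \<one> \<otimes> J \<in> hmul X"
  by (auto simp: hmul_def op_tensor_adj intro: hmod_id_tensor)

lemma hmul_slice_id_tensor: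
  assumes m: "m \<in> hmul X" and J: "J \<in> bops" "J' \<in> bops"
  shows "(\<one> \<otimes> J')\<dagger> ** m ** \<one> \<otimes> J \<in> hmul X"
  using m J unfolding hmul_def
  by (auto simp: adj_compose op_tensor_adj compose_assoc intro!: hmod_id_tensor)

lemma hmul_slice_in: "m \<in> hmul X \<Longrightarrow> s \<in> X \<Longrightarrow> (rins p)\<dagger> ** m ** rins q ** s \<in> X"
  by (simp only: compose_assoc) (intro hmod_slice hmulD hmod_gen)

lemma hmul_pl1:
  fixes m :: "('x, 'b::complex_hilbert) hop"
  assumes m: "m \<in> hmul X"
  shows "(pl1 m :: ('x, ('b, 'c::complex_hilbert) htensor) htensor \<Rightarrow>\<^sub>L _) \<in> hmul X"
proof (rule hmulI_total[OF ctotal_htens[OF ctotal_UNIV ctotal_UNIV]])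
  have mb: "m \<in> bops" using m by (rule hmulD)
  show "pl1 m \<in> bops" using mb by simp
  have *: "(pl1 n :: ('x, ('b, 'c) htensor) htensor \<Rightarrow>\<^sub>L _) ** (rins q ** s) \<in> hmod X" if n: "n \<in> hmul X" and "q \<in> {x \<otimes>\<^sub>h y |x y. x \<in> UNIV \<and> y \<in> UNIV}" and s: "s \<in> X"
    for n :: "('x, 'b) hop" and q :: "('b, 'c) htensor" and s
  proof -
    from that obtain x y where q: "q = x \<otimes>\<^sub>h y" by blast
    have "(rins q :: 'x \<Rightarrow>\<^sub>L _) = (\<one> \<otimes> rins y) ** rins x" by (simp add: q op_tensor_rins)
    then have "pl1 n ** (rins q ** s) = (\<one> \<otimes> rins y) ** (n ** (rins x ** s))"
      using hmulD(1)[OF n] by (simp add: compose_assoc compose_square[OF pl1_rins])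
    then show ?thesis using hmod_id_tensor[OF rins_bops hmulD(2)[OF n hmod_gen[OF s]]] by simp
  qed
  show "pl1 m ** (rins q ** s) \<in> hmod X" "(pl1 m)\<dagger> ** (rins q ** s) \<in> hmod X"
    if "q \<in> {x \<otimes>\<^sub>h y |x y. x \<in> UNIV \<and> y \<in> UNIV}" "s \<in> X" for q :: "('b, 'c) htensor" and s
    using *[OF m that] *[OF hmulD(3)[OF m] that] mb by (simp_all add: pl1_adj)
qed

lemma hmul_compose: "m \<in> hmul X \<Longrightarrow> n \<in> hmul X \<Longrightarrow> m ** n \<in> hmul X"
  using star_subalgebra_hmul by (rule star_subalgebraD)

lemma hmul_pl2: "m \<in> hmul X \<Longrightarrow> pl2 m \<in> hmul X"
  using hmul_slice_id_tensor[OF hmul_pl1, of m flip flip] by (simp add: pl2_def op_tensor_adj)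

end

section \<open>Amplification of a nondegenerate representation\<close>

lemma star_hom_tendsto:
  assumes A: "star_subalgebra A" and hom: "star_hom A \<phi>" and f: "f \<longlonglongrightarrow> T" "\<And>n. f n \<in> A"
  shows "T \<in> A" "(\<lambda>n. \<phi> (f n)) \<longlonglongrightarrow> \<phi> T"
proof -
  show T: "T \<in> A" using closed_sequentially[OF star_subalgebraD(2)[OF A] f(2,1)] .
  have le: "norm (\<phi> (f n) - \<phi> T) \<le> norm (f n - T)" for n
    using star_hom_contractive[OF A hom, of "f n - T"] T f(2)[of n]
    by (simp add: star_hom_diff[OF A hom] star_subalgebraD(10)[OF A])
  show "(\<lambda>n. \<phi> (f n)) \<longlonglongrightarrow> \<phi> T"
    unfolding tendsto_iff dist_norm
  proof (intro allI impI)
    fix e :: real assume "e > 0"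
    then have "\<forall>\<^sub>F n in sequentially. norm (f n - T) < e"
      using f(1) unfolding tendsto_iff dist_norm by blast
    then show "\<forall>\<^sub>F n in sequentially. norm (\<phi> (f n) - \<phi> T) < e"
      by (rule eventually_mono) (use le order_le_less_trans in blast)
  qed
qed

text \<open>Nondegenerate representations on a Hilbert space, with no target algebra prescribed:
  compositions and conjugations are formed without tracking multipliers.
  \<open>star_rep_morphism\<close> and \<open>bops_morphism_compacts\<close> connect them with
  morphisms.\<close>

locale star_rep =
  fixes X :: "('x::complex_hilbert \<Rightarrow>\<^sub>L 'x) set" and \<phi> :: "('x \<Rightarrow>\<^sub>L 'x) \<Rightarrow> ('y::complex_hilbert \<Rightarrow>\<^sub>L 'y)"
  assumes subalg: "star_subalgebra X" and hom: "star_hom X \<phi>"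
    and nondeg: "ctotal {(\<phi> s) z | s z. s \<in> X}"

text \<open>The map \<open>rins q ** s \<mapsto> rins q ** \<phi> s\<close> is extended to the
  Hilbert module as a closed relation, because it is not clear in advance that it respects linear
  relations among the generators; this follows from \<open>hext_graph_norm\<close>.\<close>

definition hext_graph :: "('x::complex_hilbert \<Rightarrow>\<^sub>L 'x) set \<Rightarrow> (('x \<Rightarrow>\<^sub>L 'x) \<Rightarrow> ('y::complex_hilbert \<Rightarrow>\<^sub>L 'y)) \<Rightarrow>
    (('x \<Rightarrow>\<^sub>L ('x, 'd::complex_hilbert) htensor) \<times> ('y \<Rightarrow>\<^sub>L ('y, 'd) htensor)) set" where
  "hext_graph X \<phi> = closure (span {(rins q ** s, rins q ** \<phi> s) | q s. s \<in> X})"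

definition hext :: "('x::complex_hilbert \<Rightarrow>\<^sub>L 'x) set \<Rightarrow> (('x \<Rightarrow>\<^sub>L 'x) \<Rightarrow> ('y::complex_hilbert \<Rightarrow>\<^sub>L 'y)) \<Rightarrow>
    ('x \<Rightarrow>\<^sub>L ('x, 'd::complex_hilbert) htensor) \<Rightarrow> ('y \<Rightarrow>\<^sub>L ('y, 'd) htensor)" where
  "hext X \<phi> e = (SOME e'. (e, e') \<in> hext_graph X \<phi>)"

text \<open>This is \<open>\<phi> \<otimes> id\<close>. It refers only to the Hilbert module of
  \<open>X\<close> and not to an algebra on the second leg, so one operator serves as the extension
  to the multipliers of \<open>X \<otimes>\<^sub>A B\<close> for every C*-algebra
  \<open>B\<close>.\<close>

definition amp :: "('x::complex_hilbert \<Rightarrow>\<^sub>L 'x) set \<Rightarrow> (('x \<Rightarrow>\<^sub>L 'x) \<Rightarrow> ('y::complex_hilbert \<Rightarrow>\<^sub>L 'y)) \<Rightarrow>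
    ('x, 'd::complex_hilbert) hop \<Rightarrow> ('y, 'd) hop" where
  "amp X \<phi> m = (THE R. R \<in> bops \<and> (\<forall>e\<in>hmod X. R ** hext X \<phi> e = hext X \<phi> (m ** e)))"

context star_rep
begin

lemma hom_bops [simp]: "s \<in> X \<Longrightarrow> \<phi> s \<in> bops"
  by (rule star_homD[OF hom])

lemmas hom_tendsto = star_hom_tendsto[OF subalg hom]

lemma hext_graph_gen: "s \<in> X \<Longrightarrow> (rins q ** s, rins q ** \<phi> s) \<in> hext_graph X \<phi>"
  unfolding hext_graph_def by (intro subsetD[OF closure_subset] span_base) blast

lemma hext_graph_subset:
  assumes "subspace S" "closed S" "\<And>q s. s \<in> X \<Longrightarrow> (rins q ** s, rins q ** \<phi> s) \<in> S"
  shows "hext_graph X \<phi> \<subseteq> S"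
  unfolding hext_graph_def using assms by (intro closure_minimal span_minimal) auto

text \<open>Conditions of this form define closed subspaces of pairs, by the contractivity of
  \<open>\<phi>\<close>. Once verified on generators they hold on all of
  \<open>hext_graph\<close>.\<close>

lemma closed_graph_condition:
  fixes f :: "'e::real_normed_vector \<Rightarrow> 'x \<Rightarrow>\<^sub>L 'x" and g :: "'f::real_normed_vector \<Rightarrow> 'y \<Rightarrow>\<^sub>L 'y"
  assumes f: "bounded_linear f" and g: "bounded_linear g"
  shows "closed {p. f (fst p) \<in> X \<and> g (snd p) = \<phi> (f (fst p))}" (is "closed ?S")
    and "subspace {p. f (fst p) \<in> X \<and> g (snd p) = \<phi> (f (fst p))}"
proof -
  show "closed ?S" unfolding closed_sequential_limits
  proof (intro allI impI, elim conjE)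
    fix h l assume h: "\<forall>n. h n \<in> ?S" and l: "h \<longlonglongrightarrow> l"
    have 1: "(\<lambda>n. f (fst (h n))) \<longlonglongrightarrow> f (fst l)" by (intro bounded_linear.tendsto[OF f] tendsto_fst l)
    have 2: "(\<lambda>n. g (snd (h n))) \<longlonglongrightarrow> g (snd l)" by (intro bounded_linear.tendsto[OF g] tendsto_snd l)
    have "f (fst (h n)) \<in> X" "g (snd (h n)) = \<phi> (f (fst (h n)))" for n using h by auto
    then show "l \<in> ?S" using hom_tendsto[OF 1] 2 LIMSEQ_unique by auto
  qed
  show "subspace ?S"
    unfolding subspace_def using star_subalgebraD(3,4,8)[OF subalg] star_homD(2,6)[OF hom] star_hom_zero[OF subalg hom]
    by (auto simp: bounded_linear.linear[OF f, THEN linear_0] bounded_linear.linear[OF f, THEN linear_add]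
      bounded_linear.linear[OF f, THEN linear_scale] bounded_linear.linear[OF g, THEN linear_0]
      bounded_linear.linear[OF g, THEN linear_add] bounded_linear.linear[OF g, THEN linear_scale])
qed

lemma hext_graph_mem:
  assumes "(e, e') \<in> hext_graph X \<phi>"
  shows "e \<in> hmod X" "e' \<in> bops"
proof -
  have "hext_graph X \<phi> \<subseteq> {p. fst p \<in> hmod X} \<inter> {p. snd p \<in> bops}"
    by (intro hext_graph_subset subspace_inter closed_Int subspace_preimage closed_preimage
      bounded_linear_fst bounded_linear_snd subspace_hmod closed_hmod subspace_bops closed_bops)
      (auto intro: hmod_gen)
  then show "e \<in> hmod X" "e' \<in> bops" using assms by auto
qed

lemma hext_graph_slice:
  assumes "(e, e') \<in> hext_graph X \<phi>"
  shows "(rins p)\<dagger> ** e' = \<phi> ((rins p)\<dagger> ** e)"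
proof -
  have "hext_graph X \<phi> \<subseteq> {q. (rins p)\<dagger> ** fst q \<in> X \<and> (rins p)\<dagger> ** snd q = \<phi> ((rins p)\<dagger> ** fst q)}"
  proof (intro hext_graph_subset closed_graph_condition bounded_linear_compose_left)
    fix q s assume s: "s \<in> X"
    show "(rins q ** s, rins q ** \<phi> s) \<in> {q. (rins p)\<dagger> ** fst q \<in> X \<and> (rins p)\<dagger> ** snd q = \<phi> ((rins p)\<dagger> ** fst q)}"
      using s by (simp add: rins_adj_rins_compose star_subalgebraD(7)[OF subalg] star_homD(5)[OF hom])
  qed
  then show ?thesis using assms by auto
qed

lemma hext_graph_inner:
  assumes e: "(e, e') \<in> hext_graph X \<phi>" and f: "(f, f') \<in> hext_graph X \<phi>"
  shows "e'\<dagger> ** f' = \<phi> (e\<dagger> ** f)"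
proof -
  have "hext_graph X \<phi> \<subseteq> {q. e\<dagger> ** fst q \<in> X \<and> e'\<dagger> ** snd q = \<phi> (e\<dagger> ** fst q)}"
  proof (intro hext_graph_subset closed_graph_condition bounded_linear_compose_left)
    fix q s assume s: "s \<in> X"
    have eb: "e \<in> bops" "e' \<in> bops" using hext_graph_mem[OF e] hmod_bops[OF subalg] by auto
    have sl: "(rins q)\<dagger> ** e \<in> X" using hmod_slice[OF subalg] hext_graph_mem(1)[OF e] by blast
    have 1: "e\<dagger> ** (rins q ** s) = ((rins q)\<dagger> ** e)\<dagger> ** s"
      using eb by (simp add: adj_compose compose_assoc)
    have 2: "e'\<dagger> ** (rins q ** \<phi> s) = ((rins q)\<dagger> ** e')\<dagger> ** \<phi> s"
      using eb by (simp add: adj_compose compose_assoc)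
    show "(rins q ** s, rins q ** \<phi> s) \<in> {q. e\<dagger> ** fst q \<in> X \<and> e'\<dagger> ** snd q = \<phi> (e\<dagger> ** fst q)}"
      unfolding mem_Collect_eq fst_conv snd_conv 1 2 hext_graph_slice[OF e]
      using s sl star_subalgebraD(5,6)[OF subalg] star_homD(3,4)[OF hom] by simp
  qed
  then show ?thesis using f by auto
qed

text \<open>\<open>e'\<dagger> ** e'\<close> is the image of \<open>e\<dagger> ** e\<close>, so
  contractivity of \<open>\<phi>\<close> bounds the extension. That the graph is single-valued and
  covers the whole module follows from this bound.\<close>

lemma hext_graph_norm:
  assumes "(e, e') \<in> hext_graph X \<phi>"
  shows "norm e' \<le> norm e"
proof (rule norm_blinfun_bound)
  fix z
  have eb: "e \<in> bops" "e' \<in> bops" "e \<in> hmod X" using hext_graph_mem[OF assms] hmod_bops[OF subalg] by auto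
  have "(norm (e' z))\<^sup>2 = cmod (cinner z ((e'\<dagger> ** e') z))"
    by (simp only: norm_sq_adj[OF eb(2), symmetric] norm_of_real abs_power2)
  also have "\<dots> \<le> norm z * norm ((e'\<dagger> ** e') z)" by (rule cmod_cinner_le)
  also have "\<dots> \<le> norm z * (norm (e'\<dagger> ** e') * norm z)" by (intro mult_left_mono norm_blinfun) simp
  also have "norm (e'\<dagger> ** e') \<le> norm (e\<dagger> ** e)"
    unfolding hext_graph_inner[OF assms assms] by (rule star_hom_contractive[OF subalg hom hmod_inner[OF subalg eb(3) eb(3)]])
  also have "norm (e\<dagger> ** e) \<le> norm e * norm e" using norm_compose_le[of "e\<dagger>" e] by (simp add: norm_adj eb)
  finally have "(norm (e' z))\<^sup>2 \<le> (norm e * norm z)\<^sup>2"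
    by (simp add: power2_eq_square mult_ac mult_left_mono mult_right_mono)
  then show "norm (e' z) \<le> norm e * norm z" by (rule power2_le_imp_le) simp
qed simp

lemma hext_graph_subspace: "subspace (hext_graph X \<phi>)"
  unfolding hext_graph_def by (rule subspace_closure_span)

lemma hext_graph_unique: "(e, e') \<in> hext_graph X \<phi> \<Longrightarrow> (e, e'') \<in> hext_graph X \<phi> \<Longrightarrow> e' = e''"
  using hext_graph_norm[of 0 "e' - e''"] subspace_diff[OF hext_graph_subspace, of "(e, e')" "(e, e'')"] by auto

lemma hext_graph_exists:
  fixes e :: "'x \<Rightarrow>\<^sub>L ('x, 'a::complex_hilbert) htensor"
  assumes e: "e \<in> hmod X" shows "\<exists>e'. (e, e') \<in> hext_graph X \<phi>"
proof -
  let ?P = "{(rins (q :: 'a) ** s, rins q ** \<phi> s) | q s. s \<in> X}"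
  have P: "?P = (\<lambda>p. (rins (fst p) ** snd p, rins (fst p) ** \<phi> (snd p))) ` (UNIV \<times> X)"
    by (rule Collect_pair_image)
  have "{rins (q :: 'a) ** s | q s. s \<in> X} = (\<lambda>p. rins (fst p) ** snd p) ` (UNIV \<times> X)" by (rule Collect_pair_image)
  then have "{rins (q :: 'a) ** s | q s. s \<in> X} = fst ` ?P" unfolding P image_image by simp
  moreover have "span (fst ` ?P) = fst ` span ?P" by (rule linear_span_image) (rule bounded_linear.linear[OF bounded_linear_fst])
  ultimately have "closure (span {rins (q :: 'a) ** s | q s. s \<in> X}) = closure (fst ` span ?P)" by (simp only:)
  then have "e \<in> closure (fst ` span ?P)" using e unfolding hmod_def by (simp only:)
  then obtain f where f: "\<And>n. f n \<in> fst ` span ?P" "f \<longlonglongrightarrow> e" unfolding closure_sequential by blast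
  then have "\<exists>g. \<forall>n. (f n, g n) \<in> span ?P" by (intro choice) fastforce
  then obtain g where g: "\<And>n. (f n, g n) \<in> hext_graph X \<phi>" unfolding hext_graph_def using closure_subset by blast
  have le: "norm (g m - g n) \<le> norm (f m - f n)" for m n
    using hext_graph_norm[of "f m - f n" "g m - g n"] subspace_diff[OF hext_graph_subspace g[of m] g[of n]] by simp
  have "Cauchy g"
  proof (rule CauchyI)
    fix r :: real assume "r > 0"
    then obtain M where "\<forall>m\<ge>M. \<forall>n\<ge>M. norm (f m - f n) < r" using CauchyD[OF LIMSEQ_imp_Cauchy[OF f(2)]] by blast
    then show "\<exists>M. \<forall>m\<ge>M. \<forall>n\<ge>M. norm (g m - g n) < r" using le by (meson order_le_less_trans)
  qed
  then obtain e' where "g \<longlonglongrightarrow> e'" by (auto simp: Cauchy_convergent_iff convergent_def)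
  with f have "(\<lambda>n. (f n, g n)) \<longlonglongrightarrow> (e, e')" by (intro tendsto_Pair)
  moreover have "closed (hext_graph X \<phi> :: (_ \<times> ('y \<Rightarrow>\<^sub>L ('y, 'a) htensor)) set)" unfolding hext_graph_def by simp
  ultimately show ?thesis using closed_sequentially[of "hext_graph X \<phi>" "\<lambda>n. (f n, g n)"] g by blast
qed

lemma hext_in_graph: "e \<in> hmod X \<Longrightarrow> (e, hext X \<phi> e) \<in> hext_graph X \<phi>"
  unfolding hext_def using someI_ex[OF hext_graph_exists] .

lemma hext_eqI: "(e, e') \<in> hext_graph X \<phi> \<Longrightarrow> hext X \<phi> e = e'"
  using hext_graph_unique hext_in_graph hext_graph_mem(1) by blast

lemma hext_gen: "s \<in> X \<Longrightarrow> hext X \<phi> (rins q ** s) = rins q ** \<phi> s"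
  by (rule hext_eqI) (rule hext_graph_gen)

lemma hext_bops: "e \<in> hmod X \<Longrightarrow> hext X \<phi> e \<in> bops"
  using hext_in_graph hext_graph_mem(2) by blast

lemma hext_slice: "e \<in> hmod X \<Longrightarrow> (rins p)\<dagger> ** hext X \<phi> e = \<phi> ((rins p)\<dagger> ** e)"
  by (intro hext_graph_slice hext_in_graph)

lemma hext_inner: "e \<in> hmod X \<Longrightarrow> f \<in> hmod X \<Longrightarrow> (hext X \<phi> e)\<dagger> ** hext X \<phi> f = \<phi> (e\<dagger> ** f)"
  by (intro hext_graph_inner hext_in_graph)

lemma hext_unique:
  assumes "e \<in> hmod X" "\<And>p. (rins p)\<dagger> ** R = \<phi> ((rins p)\<dagger> ** e)"
  shows "hext X \<phi> e = R"
  by (rule rins_adj_op_eqI) (simp add: hext_slice assms)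

lemma hext_add: "e \<in> hmod X \<Longrightarrow> f \<in> hmod X \<Longrightarrow> hext X \<phi> (e + f) = hext X \<phi> e + hext X \<phi> f"
  using subspace_add[OF hext_graph_subspace hext_in_graph hext_in_graph] by (intro hext_eqI) simp

lemma hext_id_tensor:
  assumes "J \<in> bops" "e \<in> hmod X"
  shows "hext X \<phi> (\<one> \<otimes> J ** e) = \<one> \<otimes> J ** hext X \<phi> e"
  by (rule hext_unique)
    (use assms in \<open>auto simp: hmod_id_tensor[OF subalg] compose_assoc[symmetric] rins_adj_id_tensor hext_slice\<close>)

lemma hext_cscale: "e \<in> hmod X \<Longrightarrow> cscale c e \<in> hmod X \<Longrightarrow> hext X \<phi> (cscale c e) = cscale c (hext X \<phi> e)"
  by (rule hext_unique) (auto simp: blinfun_compose_cscale hext_slice star_homD(5)[OF hom] hmod_slice[OF subalg])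

lemma ctotal_hext: "ctotal {(hext X \<phi> e) z | e z. e \<in> hmod X}"
proof (rule ctotal_mono[OF ctotal_htens[OF nondeg ctotal_UNIV]], clarify)
  fix s z y assume s: "s \<in> X"
  have "(\<phi> s) z \<otimes>\<^sub>h y = hext X \<phi> (rins y ** s) z" using s by (simp add: hext_gen)
  then show "\<exists>e za. (\<phi> s) z \<otimes>\<^sub>h y = (hext X \<phi> e) za \<and> e \<in> hmod X"
    using hmod_gen[OF s] by blast
qed

lemma hext_op_eqI:
  fixes R :: "('y, 'd::complex_hilbert) htensor \<Rightarrow>\<^sub>L 'z::complex_hilbert"
  assumes "R \<in> bops" "R' \<in> bops" "\<And>e. e \<in> hmod X \<Longrightarrow> R ** hext X \<phi> e = R' ** hext X \<phi> e"
  shows "R = R'"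
proof (rule bops_eq_on_total[OF ctotal_hext assms(1,2)], clarify)
  fix e :: "'x \<Rightarrow>\<^sub>L ('x, 'd) htensor" and z assume "e \<in> hmod X"
  then show "R (hext X \<phi> e z) = R' (hext X \<phi> e z)"
    using arg_cong[OF assms(3), of e "\<lambda>T. blinfun_apply T z"] by simp
qed

text \<open>The Gram matrix argument of \<open>op_tensor_id_exists\<close>, now on the vectors
  \<open>hext X \<phi> e z\<close>: the root \<open>n\<close> of \<open>K^2 - m\<dagger> m\<close>
  lies in \<open>hmul X\<close>, and inner products are computed through
  \<open>hext_inner\<close>.\<close>

lemma amp_exists:
  fixes m :: "('x, 'd::complex_hilbert) hop"
  assumes m: "m \<in> hmul X"
  shows "\<exists>R\<in>bops. \<forall>e\<in>hmod X. R ** hext X \<phi> e = hext X \<phi> (m ** e)"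
proof -
  define K where "K = norm m + 1"
  have K: "norm m < K" by (simp add: K_def)
  have K0: "K > 0" using K norm_ge_zero[of m] by linarith
  have mb: "m \<in> bops" using m by (rule hmulD[OF subalg])
  note hs = star_subalgebra_hmul[OF subalg]
  \<comment> \<open>\<open>total_extension\<close> takes a family indexed by a whole type, so
    operators outside the module are sent to 0.\<close>
  define E where "E e = (if e \<in> hmod X then e else 0)" for e :: "'x \<Rightarrow>\<^sub>L ('x, 'd) htensor"
  have E: "E e \<in> hmod X" for e by (simp add: E_def subspace_0[OF subspace_hmod])
  obtain n where n: "n \<in> hmul X" "n\<dagger> = n" "n ** n = K\<^sup>2 *\<^sub>R \<one> - (m\<dagger> ** m)"
    using defect_root_exists[OF hs, of "m\<dagger> ** m" K] norm_adj_compose_less[OF mb K] m mb K0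
      star_subalgebraD(5,6)[OF hs] by (auto simp: adj_compose hmul_id[OF subalg])
  have inner: "cinner (hext X \<phi> (A ** E e) z) (hext X \<phi> (A ** E e') z') =
      cinner z (\<phi> ((E e)\<dagger> ** ((A\<dagger> ** A) ** E e')) z')" if A: "A \<in> hmul X" for A e e' z z'
  proof -
    have h: "A ** E e \<in> hmod X" "A ** E e' \<in> hmod X" using A E by (auto simp: hmul_def)
    have b: "hext X \<phi> (A ** E e) \<in> bops" using h by (intro hext_bops)
    have "cinner (hext X \<phi> (A ** E e) z) (hext X \<phi> (A ** E e') z') =
        cinner z (((hext X \<phi> (A ** E e))\<dagger> ** hext X \<phi> (A ** E e')) z')"
      using b by (simp add: cinner_adj_right)
    also have "\<dots> = cinner z (\<phi> ((A ** E e)\<dagger> ** (A ** E e')) z')" by (simp only: hext_inner[OF h])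
    also have "(A ** E e)\<dagger> ** (A ** E e') = (E e)\<dagger> ** ((A\<dagger> ** A) ** E e')"
      using hmulD(1)[OF subalg A] hmod_bops[OF subalg E] by (simp add: adj_compose compose_assoc)
    finally show ?thesis .
  qed
  have nn: "cinner (hext X \<phi> (n ** E e) z) (hext X \<phi> (n ** E e') z') =
      complex_of_real (K\<^sup>2) * cinner (hext X \<phi> (E e) z) (hext X \<phi> (E e') z')
        - cinner (hext X \<phi> (m ** E e) z) (hext X \<phi> (m ** E e') z')" for e e' z z'
  proof -
    have X1: "(E e)\<dagger> ** E e' \<in> X" using E by (intro hmod_inner[OF subalg])
    have X2: "(E e)\<dagger> ** ((m\<dagger> ** m) ** E e') \<in> X"
      using E m by (intro hmod_inner[OF subalg]) (auto simp: hmul_def compose_assoc)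
    have "(E e)\<dagger> ** ((n\<dagger> ** n) ** E e') = K\<^sup>2 *\<^sub>R ((E e)\<dagger> ** E e') - ((E e)\<dagger> ** ((m\<dagger> ** m) ** E e'))"
      by (simp add: n(2,3) blinfun_compose_diff blinfun_compose_scaleR)
    then have "\<phi> ((E e)\<dagger> ** ((n\<dagger> ** n) ** E e')) =
        K\<^sup>2 *\<^sub>R \<phi> ((E e)\<dagger> ** E e') - \<phi> ((E e)\<dagger> ** ((m\<dagger> ** m) ** E e'))"
      using X1 X2 by (simp add: star_hom_diff[OF subalg hom] star_homD(6)[OF hom] star_subalgebraD(8)[OF subalg])
    then show ?thesis
      using inner[of \<one> e z e' z'] unfolding inner[OF n(1)] inner[OF m]
      by (simp add: hmul_id[OF subalg] blinfun.diff_left blinfun.scaleR_left cinner_diff_right scaleR_scaleC cinner_scaleC_right)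
  qed
  have "\<exists>R\<in>bops. (\<forall>p. blinfun_apply R (hext X \<phi> (E (fst p)) (snd p)) = hext X \<phi> (m ** E (fst p)) (snd p)) \<and> norm R \<le> K"
  proof (rule total_extension)
    show "K \<ge> 0" using K0 by simp
    show "ctotal (range (\<lambda>p. (hext X \<phi> (E (fst p))) (snd p)))"
    proof (rule ctotal_mono[OF ctotal_hext], clarify)
      fix e :: "'x \<Rightarrow>\<^sub>L ('x, 'd) htensor" and z assume "e \<in> hmod X"
      then show "(hext X \<phi> e) z \<in> range (\<lambda>p. (hext X \<phi> (E (fst p))) (snd p))"
        by (intro range_eqI[of _ _ "(e, z)"]) (simp add: E_def)
    qed
    fix F :: "(('x \<Rightarrow>\<^sub>L ('x, 'd) htensor) \<times> 'y) set" and c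
    let ?s = "\<lambda>A. \<Sum>i\<in>F. c i *\<^sub>C (hext X \<phi> (A ** E (fst i))) (snd i)"
    have "cinner (?s n) (?s n) = complex_of_real (K\<^sup>2) * cinner (?s \<one>) (?s \<one>) - cinner (?s m) (?s m)"
      unfolding cinner_lincomb nn blinfun_compose_id
      by (simp add: sum_distrib_left sum_subtractf[symmetric] algebra_simps)
    then have "complex_of_real ((norm (?s n))\<^sup>2) = complex_of_real (K\<^sup>2 * (norm (?s \<one>))\<^sup>2 - (norm (?s m))\<^sup>2)"
      unfolding cinner_norm of_real_diff of_real_mult .
    then have "(norm (?s n))\<^sup>2 = K\<^sup>2 * (norm (?s \<one>))\<^sup>2 - (norm (?s m))\<^sup>2"
      by (simp only: of_real_eq_iff)
    then have "(norm (?s m))\<^sup>2 \<le> (K * norm (?s \<one>))\<^sup>2"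
      using zero_le_power2[of "norm (?s n)"] unfolding power_mult_distrib by linarith
    then show "norm (\<Sum>i\<in>F. c i *\<^sub>C (hext X \<phi> (m ** E (fst i))) (snd i))
        \<le> K * norm (\<Sum>i\<in>F. c i *\<^sub>C (hext X \<phi> (E (fst i))) (snd i))"
      using K0 power2_le_imp_le[of "norm (?s m)" "K * norm (?s \<one>)"] by simp
  qed
  then obtain R where R: "R \<in> bops"
    and *: "\<And>p. R (hext X \<phi> (E (fst p)) (snd p)) = hext X \<phi> (m ** E (fst p)) (snd p)" by blast
  have "R ** hext X \<phi> e = hext X \<phi> (m ** e)" if "e \<in> hmod X" for e
    by (rule blinfun_eqI) (use *[of "(e, z)" for z] that in \<open>simp add: E_def\<close>)
  then show ?thesis using R by blast
qed

lemma amp_props: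
  assumes m: "m \<in> hmul X"
  shows amp_bops: "amp X \<phi> m \<in> bops" and amp_hext: "e \<in> hmod X \<Longrightarrow> amp X \<phi> m ** hext X \<phi> e = hext X \<phi> (m ** e)"
proof -
  obtain R where R: "R \<in> bops" "\<forall>e\<in>hmod X. R ** hext X \<phi> e = hext X \<phi> (m ** e)"
    using amp_exists[OF m] by auto
  have "amp X \<phi> m = R"
    unfolding amp_def by (rule the_equality) (use R in \<open>auto intro: hext_op_eqI\<close>)
  with R show "amp X \<phi> m \<in> bops" "e \<in> hmod X \<Longrightarrow> amp X \<phi> m ** hext X \<phi> e = hext X \<phi> (m ** e)" by auto
qed

lemma amp_slice:
  assumes m: "m \<in> hmul X" and s: "s \<in> X"
  shows "(rins p)\<dagger> ** amp X \<phi> m ** rins q ** \<phi> s = \<phi> ((rins p)\<dagger> ** m ** rins q ** s)"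
  using amp_hext[OF m hmod_gen[OF s], of q] hmulD(2)[OF subalg m hmod_gen[OF s], of q]
  by (simp add: compose_assoc hext_gen[OF s] hext_slice)

text \<open>The amplification is determined by its slices in the second leg, with no mention of
  \<open>hext\<close>. Explicit formulas such as \<open>amp_conj\<close> and
  \<open>amp_composed\<close> are verified in this way.\<close>

lemma amp_eqI:
  assumes m: "m \<in> hmul X" and R: "R \<in> bops"
    and sl: "\<And>p q s. s \<in> X \<Longrightarrow> (rins p)\<dagger> ** R ** rins q ** \<phi> s = \<phi> ((rins p)\<dagger> ** m ** rins q ** s)"
  shows "amp X \<phi> m = R"
proof (rule htens_op_eqI_total[OF nondeg ctotal_UNIV amp_bops[OF m] R], clarify)
  fix s z y assume s: "s \<in> X"
  have "amp X \<phi> m ** (rins y ** \<phi> s) = R ** (rins y ** \<phi> s)"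
    by (rule rins_adj_op_eqI) (use sl[OF s] amp_slice[OF m s] in \<open>simp add: compose_assoc\<close>)
  from arg_cong[OF this, of "\<lambda>T. T z"]
  show "(amp X \<phi> m) ((\<phi> s) z \<otimes>\<^sub>h y) = R ((\<phi> s) z \<otimes>\<^sub>h y)" by simp
qed

lemma amp_eqI_hext:
  assumes "m \<in> hmul X" "R \<in> bops" "\<And>e. e \<in> hmod X \<Longrightarrow> R ** hext X \<phi> e = hext X \<phi> (m ** e)"
  shows "amp X \<phi> m = R"
  by (rule hext_op_eqI) (use assms amp_bops amp_hext in auto)

lemma amp_compose:
  assumes "m \<in> hmul X" "n \<in> hmul X" shows "amp X \<phi> (m ** n) = amp X \<phi> m ** amp X \<phi> n"
  by (rule amp_eqI_hext)
    (use assms in \<open>auto simp: hmul_compose[OF subalg] amp_bops compose_assoc amp_hext hmulD(2)[OF subalg]\<close>)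

lemma amp_id_tensor: "J \<in> bops \<Longrightarrow> amp X \<phi> (\<one> \<otimes> J) = \<one> \<otimes> J"
  by (rule amp_eqI_hext) (auto simp: hmul_id_tensor[OF subalg] hext_id_tensor)

lemma amp_id: "amp X \<phi> \<one> = \<one>"
  using amp_id_tensor[of \<one>] by simp

lemma amp_adj:
  fixes m :: "('x, 'a::complex_hilbert) hop"
  assumes m: "m \<in> hmul X" shows "amp X \<phi> (m\<dagger>) = (amp X \<phi> m)\<dagger>"
proof (rule amp_eqI_hext)
  show "m\<dagger> \<in> hmul X" "(amp X \<phi> m)\<dagger> \<in> bops" using m hmulD(3)[OF subalg] amp_bops by auto
  fix e :: "'x \<Rightarrow>\<^sub>L ('x, 'a) htensor" assume e: "e \<in> hmod X"
  have mb: "m \<in> bops" using m by (rule hmulD[OF subalg])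
  have me: "m\<dagger> ** e \<in> hmod X" using m e by (simp add: hmul_def)
  have *: "(hext X \<phi> f)\<dagger> ** ((amp X \<phi> m)\<dagger> ** hext X \<phi> e) = (hext X \<phi> f)\<dagger> ** hext X \<phi> (m\<dagger> ** e)"
    if f: "f \<in> hmod X" for f :: "'x \<Rightarrow>\<^sub>L ('x, 'a) htensor"
  proof -
    have mf: "m ** f \<in> hmod X" using m f by (simp add: hmul_def)
    have "(hext X \<phi> f)\<dagger> ** ((amp X \<phi> m)\<dagger> ** hext X \<phi> e) = (amp X \<phi> m ** hext X \<phi> f)\<dagger> ** hext X \<phi> e"
      using f m by (simp add: adj_compose hext_bops amp_bops compose_assoc)
    also have "\<dots> = \<phi> ((m ** f)\<dagger> ** e)" using f m mf e by (simp add: amp_hext hext_inner)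
    also have "(m ** f)\<dagger> ** e = f\<dagger> ** (m\<dagger> ** e)"
      using mb hmod_bops[OF subalg f] by (simp add: adj_compose compose_assoc)
    finally show ?thesis using f me by (simp add: hext_inner)
  qed
  show "(amp X \<phi> m)\<dagger> ** hext X \<phi> e = hext X \<phi> (m\<dagger> ** e)"
  proof (rule blinfun_eqI)
    fix z
    let ?d = "((amp X \<phi> m)\<dagger> ** hext X \<phi> e) z - hext X \<phi> (m\<dagger> ** e) z"
    have "?d = 0"
    proof (rule ctotalD[OF ctotal_hext])
      fix x assume "x \<in> {(hext X \<phi> f) y | f y. f \<in> (hmod X :: ('x \<Rightarrow>\<^sub>L ('x, 'a) htensor) set)}"
      then obtain f :: "'x \<Rightarrow>\<^sub>L ('x, 'a) htensor" and y where f: "f \<in> hmod X" "x = hext X \<phi> f y" by blast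
      have "cinner y (((hext X \<phi> f)\<dagger>) ?d) = 0"
        using arg_cong[OF *[OF f(1)], of "\<lambda>T. cinner y (T z)"] by (simp add: blinfun.diff_right cinner_diff_right)
      then show "cinner x ?d = 0" using f by (simp add: cinner_adj_right hext_bops)
    qed
    then show "((amp X \<phi> m)\<dagger> ** hext X \<phi> e) z = hext X \<phi> (m\<dagger> ** e) z" by simp
  qed
qed

lemma amp_unitary: "m \<in> hmul X \<Longrightarrow> unitary m \<Longrightarrow> unitary (amp X \<phi> m)"
  using hmulD(3)[OF subalg, of m] by (simp add: unitary_def amp_bops amp_adj[symmetric] amp_compose[symmetric] amp_id)

lemma amp_natural:
  fixes J :: "'a::complex_hilbert \<Rightarrow>\<^sub>L 'b::complex_hilbert"
  assumes m: "m \<in> hmul X" "m' \<in> hmul X" and J: "J \<in> bops"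
    and eq: "m' ** \<one> \<otimes> J = \<one> \<otimes> J ** m"
  shows "amp X \<phi> m' ** \<one> \<otimes> J = \<one> \<otimes> J ** amp X \<phi> m"
proof (rule hext_op_eqI)
  fix e :: "'x \<Rightarrow>\<^sub>L ('x, 'a) htensor" assume e: "e \<in> hmod X"
  have "amp X \<phi> m' ** \<one> \<otimes> J ** hext X \<phi> e = hext X \<phi> (m' ** (\<one> \<otimes> J ** e))"
    using e J m by (simp add: compose_assoc hext_id_tensor[symmetric] amp_hext hmod_id_tensor[OF subalg])
  also have "\<dots> = \<one> \<otimes> J ** amp X \<phi> m ** hext X \<phi> e"
    using e J m by (simp add: compose_assoc compose_square[OF eq] amp_hext hext_id_tensor hmulD(2)[OF subalg])
  finally show "amp X \<phi> m' ** \<one> \<otimes> J ** hext X \<phi> e = \<one> \<otimes> J ** amp X \<phi> m ** hext X \<phi> e" .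
qed (simp_all add: m J amp_bops)

lemma amp_compress:
  fixes J :: "'a::complex_hilbert \<Rightarrow>\<^sub>L 'b::complex_hilbert"
  assumes m: "m \<in> hmul X" and J: "J \<in> bops" "J' \<in> bops"
  shows "amp X \<phi> ((\<one> \<otimes> J')\<dagger> ** m ** \<one> \<otimes> J) =
    (\<one> \<otimes> J')\<dagger> ** amp X \<phi> m ** \<one> \<otimes> J"
proof (rule amp_eqI_hext)
  show "(\<one> \<otimes> J')\<dagger> ** m ** \<one> \<otimes> J \<in> hmul X" using m J by (rule hmul_slice_id_tensor[OF subalg])
  fix e :: "'x \<Rightarrow>\<^sub>L ('x, 'a) htensor" assume e: "e \<in> hmod X"
  then show "(\<one> \<otimes> J')\<dagger> ** amp X \<phi> m ** \<one> \<otimes> J ** hext X \<phi> e =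
      hext X \<phi> ((\<one> \<otimes> J')\<dagger> ** m ** \<one> \<otimes> J ** e)"
    using J m by (simp add: op_tensor_adj compose_assoc hext_id_tensor[symmetric] amp_hext
        hmod_id_tensor[OF subalg] hmulD(2)[OF subalg])
qed (simp_all add: m J amp_bops)

lemma amp_pl1: "m \<in> hmul X \<Longrightarrow> amp X \<phi> (pl1 m) = pl1 (amp X \<phi> m)"
  by (rule id_rins_op_eqI)
    (simp_all add: amp_bops hmul_pl1[OF subalg] pl1_rins amp_natural[OF _ _ _ pl1_rins] hmulD(1)[OF subalg])

lemma amp_pl2: "m \<in> hmul X \<Longrightarrow> amp X \<phi> (pl2 m) = pl2 (amp X \<phi> m)"
  by (rule id_lins_op_eqI)
    (simp_all add: amp_bops hmul_pl2[OF subalg] pl2_lins amp_natural[OF _ _ _ pl2_lins] hmulD(1)[OF subalg])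

end

subsection \<open>Spatial tensor products\<close>

lemma subspace_closed_adj_preimage:
  assumes S: "subspace S" "closed S"
  shows "subspace {T \<in> bops. T\<dagger> \<in> S}" and "closed {T \<in> bops. T\<dagger> \<in> S}"
proof -
  show "subspace {T \<in> bops. T\<dagger> \<in> S}"
    using S(1) by (auto simp: subspace_def adj_add adj_scaleR)
  show "closed {T \<in> bops. T\<dagger> \<in> S}" unfolding closed_sequential_limits
  proof (intro allI impI, elim conjE)
    fix f l assume f: "\<forall>n. f n \<in> {T \<in> bops. T\<dagger> \<in> S}" and l: "f \<longlonglongrightarrow> l"
    have fb: "\<And>n. f n \<in> bops" and fS: "\<And>n. (f n)\<dagger> \<in> S" using f by auto
    show "l \<in> {T \<in> bops. T\<dagger> \<in> S}"
      using closed_sequentially[OF closed_bops fb l] closed_sequentially[OF S(2) fS tendsto_adj[OF l fb]] by simp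
  qed
qed

lemma closure_span_mem: "x \<in> G \<Longrightarrow> x \<in> closure (span G)"
  using closure_subset span_base by blast

lemma star_subalgebra_closure_span:
  fixes G :: "('a::complex_hilbert \<Rightarrow>\<^sub>L 'a) set"
  assumes b: "G \<subseteq> bops" and c: "\<And>S T. S \<in> G \<Longrightarrow> T \<in> G \<Longrightarrow> S ** T \<in> closure (span G)"
    and a: "\<And>T. T \<in> G \<Longrightarrow> T\<dagger> \<in> closure (span G)" and s: "\<And>c T. T \<in> G \<Longrightarrow> cscale c T \<in> closure (span G)"
  shows "star_subalgebra (closure (span G))"
  unfolding star_subalgebra_def
proof (intro conjI ballI allI)
  note sub = subspace_closure_span[of G] and cl = closed_closure[of "span G"]
  show "closure (span G) \<subseteq> bops" by (intro closure_minimal span_minimal b subspace_bops closed_bops)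
  show "0 \<in> closure (span G)" by (rule subspace_0[OF sub])
  fix S assume S: "S \<in> closure (span G)"
  have "closure (span G) \<subseteq> {T \<in> bops. T\<dagger> \<in> closure (span G)}"
    by (intro closure_minimal span_minimal subspace_closed_adj_preimage sub cl) (use a b in auto)
  then show "S\<dagger> \<in> closure (span G)" using S by blast
  show "cscale c S \<in> closure (span G)" for c
    by (rule closure_span_image_subset[OF bounded_linear_cscale sub cl s S])
  fix T assume T: "T \<in> closure (span G)"
  show "S + T \<in> closure (span G)" using S T by (rule subspace_add[OF sub])
  have "S' ** T \<in> closure (span G)" if "S' \<in> G" for S'
    by (rule closure_span_image_subset[OF bounded_linear_compose_left sub cl c[OF that] T])
  then show "S ** T \<in> closure (span G)"
    by (rule closure_span_image_subset[OF bounded_linear_compose_right sub cl _ S])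
qed simp

lemma op_tensor_in_cstar_tensor: "S \<in> A \<Longrightarrow> T \<in> B \<Longrightarrow> S \<otimes> T \<in> A \<otimes>\<^sub>A B"
  unfolding cstar_tensor_def by (rule closure_span_mem) blast

lemma cstar_tensor_image_subset:
  assumes "bounded_linear f" "subspace C" "closed C" "\<And>S T. S \<in> A \<Longrightarrow> T \<in> B \<Longrightarrow> f (S \<otimes> T) \<in> C" "t \<in> A \<otimes>\<^sub>A B"
  shows "f t \<in> C"
  using assms(5) unfolding cstar_tensor_def
  by (rule closure_span_image_subset[OF assms(1-3), rotated]) (use assms(4) in blast)

lemma subspace_cstar_tensor: "subspace (A \<otimes>\<^sub>A B)" and closed_cstar_tensor: "closed (A \<otimes>\<^sub>A B)"
  by (auto simp: cstar_tensor_def intro: subspace_closure_span)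

lemma star_subalgebra_cstar_tensor:
  assumes A: "star_subalgebra A" and B: "star_subalgebra B"
  shows "star_subalgebra (A \<otimes>\<^sub>A B)"
  unfolding cstar_tensor_def
proof (rule star_subalgebra_closure_span)
  let ?G = "{S \<otimes> T | S T. S \<in> A \<and> T \<in> B}"
  note Ab = star_subalgebraD(1)[OF A] and Bb = star_subalgebraD(1)[OF B]
  have GI: "S \<otimes> T \<in> closure (span ?G)" if "S \<in> A" "T \<in> B" for S T
    by (rule closure_span_mem) (use that in blast)
  show "?G \<subseteq> bops" using Ab Bb by auto
  show "R ** R' \<in> closure (span ?G)" if R: "R \<in> ?G" "R' \<in> ?G" for R R'
  proof -
    from R obtain S T S' T' where *: "R = S \<otimes> T" "R' = S' \<otimes> T'" "S \<in> A" "T \<in> B" "S' \<in> A" "T' \<in> B" by blast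
    then have "R ** R' = (S ** S') \<otimes> (T ** T')" using Ab Bb by (simp add: op_tensor_compose)
    then show ?thesis using GI * star_subalgebraD(5)[OF A] star_subalgebraD(5)[OF B] by simp
  qed
  fix R assume "R \<in> ?G"
  then obtain S T where *: "R = S \<otimes> T" "S \<in> A" "T \<in> B" by blast
  show "R\<dagger> \<in> closure (span ?G)"
    using * GI star_subalgebraD(6)[OF A] star_subalgebraD(6)[OF B] Ab Bb by (simp add: op_tensor_adj)
  show "cscale c R \<in> closure (span ?G)" for c
    using * GI[of "cscale c S" T] star_subalgebraD(7)[OF A] Ab Bb by (simp add: op_tensor_cscale_left)
qed

lemma cstar_algebraD: "cstar_algebra A \<Longrightarrow> star_subalgebra A" "cstar_algebra A \<Longrightarrow> ctotal {blinfun_apply T x | T x. T \<in> A}"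
  by (simp_all add: cstar_algebra_iff)

lemma cstar_algebra_cstar_tensor:
  assumes A: "cstar_algebra A" and B: "cstar_algebra B"
  shows "cstar_algebra (A \<otimes>\<^sub>A B)"
  unfolding cstar_algebra_iff
proof (rule conjI)
  show "star_subalgebra (A \<otimes>\<^sub>A B)" by (rule star_subalgebra_cstar_tensor) (fact cstar_algebraD[OF A] cstar_algebraD[OF B])+
  note Ab = star_subalgebraD(1)[OF cstar_algebraD(1)[OF A]] and Bb = star_subalgebraD(1)[OF cstar_algebraD(1)[OF B]]
  show "ctotal {blinfun_apply T x | T x. T \<in> A \<otimes>\<^sub>A B}"
  proof (rule ctotal_mono[OF ctotal_htens[OF cstar_algebraD(2)[OF A] cstar_algebraD(2)[OF B]]], clarify)
    fix S T x y assume "S \<in> A" "T \<in> B"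
    then show "\<exists>R z. blinfun_apply S x \<otimes>\<^sub>h blinfun_apply T y = blinfun_apply R z \<and> R \<in> A \<otimes>\<^sub>A B"
      using Ab Bb op_tensor_in_cstar_tensor by (intro exI[of _ "S \<otimes> T"] exI[of _ "x \<otimes>\<^sub>h y"]) auto
  qed
qed

lemma multipliersI:
  assumes "m \<in> bops" "\<And>T. T \<in> C \<Longrightarrow> m ** T \<in> C" "\<And>T. T \<in> C \<Longrightarrow> m\<dagger> ** T \<in> C" and C: "star_subalgebra C"
  shows "m \<in> multipliers C"
  unfolding multipliers_def
proof (intro CollectI conjI ballI)
  fix T assume T: "T \<in> C"
  have "(m\<dagger> ** T\<dagger>)\<dagger> = T ** m" using T assms(1) star_subalgebraD(1)[OF C] by (simp add: adj_compose)
  then show "T ** m \<in> C" using assms(3)[of "T\<dagger>"] T C star_subalgebraD(6)[OF C] by metis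
qed (use assms in auto)

lemma multipliersD:
  assumes "m \<in> multipliers C"
  shows "m \<in> bops" "T \<in> C \<Longrightarrow> m ** T \<in> C" "T \<in> C \<Longrightarrow> T ** m \<in> C"
  using assms by (auto simp: multipliers_def)

lemma multipliers_adj:
  assumes m: "m \<in> multipliers C" and C: "star_subalgebra C" shows "m\<dagger> \<in> multipliers C"
proof (rule multipliersI[OF _ _ _ C])
  fix T assume T: "T \<in> C"
  have "(T\<dagger> ** m)\<dagger> = m\<dagger> ** T" using T multipliersD(1)[OF m] star_subalgebraD(1)[OF C] by (simp add: adj_compose)
  then show "m\<dagger> ** T \<in> C" using multipliersD(3)[OF m] T C star_subalgebraD(6)[OF C] by metis
  show "(m\<dagger>)\<dagger> ** T \<in> C" using multipliersD[OF m] T by simp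
qed (use multipliersD[OF m] in simp)

lemma multipliers_compose: "m \<in> multipliers C \<Longrightarrow> n \<in> multipliers C \<Longrightarrow> m ** n \<in> multipliers C"
  by (auto simp: multipliers_def compose_assoc) (simp add: compose_assoc[symmetric])

lemma bounded_linear_flipped: "bounded_linear flipped"
  unfolding flipped_def using bounded_linear_compose[OF bounded_linear_compose_right bounded_linear_compose_left] .

lemma flipped_cstar_tensor:
  assumes "t \<in> A \<otimes>\<^sub>A B" "A \<subseteq> bops" "B \<subseteq> bops" shows "flipped t \<in> B \<otimes>\<^sub>A A"
  by (rule cstar_tensor_image_subset[OF bounded_linear_flipped subspace_cstar_tensor closed_cstar_tensor _ assms(1)])
    (use assms in \<open>auto simp: flipped_op_tensor subset_iff intro: op_tensor_in_cstar_tensor\<close>)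

lemma flipped_multipliers:
  assumes m: "m \<in> multipliers (A \<otimes>\<^sub>A B)" and AB: "A \<subseteq> bops" "B \<subseteq> bops"
  shows "flipped m \<in> multipliers (B \<otimes>\<^sub>A A)"
  unfolding multipliers_def
proof (intro CollectI conjI ballI)
  show "flipped m \<in> bops" using multipliersD(1)[OF m] by simp
  fix T assume "T \<in> B \<otimes>\<^sub>A A"
  then have T: "flipped T \<in> A \<otimes>\<^sub>A B" using AB by (intro flipped_cstar_tensor)
  have "flipped m ** T = flipped (m ** flipped T)" "T ** flipped m = flipped (flipped T ** m)"
    by (simp_all add: flipped_compose)
  then show "flipped m ** T \<in> B \<otimes>\<^sub>A A" "T ** flipped m \<in> B \<otimes>\<^sub>A A"
    using multipliersD(2,3)[OF m T] AB by (simp_all add: flipped_cstar_tensor)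
qed

lemma op_tensor_hmul:
  assumes A: "star_subalgebra A" and S: "S \<in> A" and T: "T \<in> bops"
  shows "S \<otimes> T \<in> hmul A"
proof (rule hmulI[OF A])
  have Sb: "S \<in> bops" "S\<dagger> \<in> bops" using S star_subalgebraD(1)[OF A] by auto
  then show "S \<otimes> T \<in> bops" using T by simp
  fix q s assume s: "s \<in> A"
  have "S \<otimes> T ** (rins q ** s) = rins (T q) ** (S ** s)"
    "(S \<otimes> T)\<dagger> ** (rins q ** s) = rins (blinfun_apply (T\<dagger>) q) ** (S\<dagger> ** s)"
    using Sb T by (simp_all add: op_tensor_adj compose_assoc[symmetric] op_tensor_rins)
  then show "S \<otimes> T ** (rins q ** s) \<in> hmod A" "(S \<otimes> T)\<dagger> ** (rins q ** s) \<in> hmod A"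
    using s S A by (auto intro!: hmod_gen star_subalgebraD)
qed

lemma cstar_tensor_hmul:
  assumes A: "star_subalgebra A" and B: "B \<subseteq> bops" and t: "t \<in> A \<otimes>\<^sub>A B"
  shows "t \<in> hmul A"
  by (rule cstar_tensor_image_subset[OF bounded_linear_ident star_subalgebra_subspace[OF star_subalgebra_hmul[OF A]]
        star_subalgebraD(2)[OF star_subalgebra_hmul[OF A]] _ t]) (use B in \<open>auto intro: op_tensor_hmul[OF A]\<close>)

lemma cstar_tensor_rins_hmod:
  assumes A: "star_subalgebra A" and B: "B \<subseteq> bops" and t: "t \<in> A \<otimes>\<^sub>A B"
  shows "t ** rins q \<in> hmod A"
  by (rule cstar_tensor_image_subset[OF bounded_linear_compose_right subspace_hmod closed_hmod _ t])
    (use B star_subalgebraD(1)[OF A] in \<open>auto simp: op_tensor_rins subset_iff intro!: hmod_gen\<close>)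

text \<open>Vectors \<open>q = T x\<close> with \<open>T\<close> in \<open>B\<close> are total, and
  for them \<open>m ** (rins q ** s)\<close> is \<open>(m ** s \<otimes> T) ** rins x\<close>, where
  \<open>m\<close> has been absorbed by the tensor product algebra.\<close>

lemma multipliers_hmul:
  assumes A: "star_subalgebra A" and B: "cstar_algebra B" and m: "m \<in> multipliers (A \<otimes>\<^sub>A B)"
  shows "m \<in> hmul A"
proof (rule hmulI_total[OF A cstar_algebraD(2)[OF B]])
  note Bb = star_subalgebraD(1)[OF cstar_algebraD(1)[OF B]] and Ab = star_subalgebraD(1)[OF A]
  have m': "m\<dagger> \<in> multipliers (A \<otimes>\<^sub>A B)"
    using m by (rule multipliers_adj) (intro star_subalgebra_cstar_tensor A cstar_algebraD B)
  have *: "n ** (rins q ** s) \<in> hmod A"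
    if n: "n \<in> multipliers (A \<otimes>\<^sub>A B)" and q: "q \<in> {blinfun_apply T x | T x. T \<in> B}" and s: "s \<in> A" for n q s
  proof -
    from q obtain T x where T: "q = blinfun_apply T x" "T \<in> B" by blast
    have "rins q ** s = s \<otimes> T ** rins x" using T s Ab Bb by (simp add: op_tensor_rins)
    then have "n ** (rins q ** s) = (n ** s \<otimes> T) ** rins x" by (simp add: compose_assoc)
    then show ?thesis
      using cstar_tensor_rins_hmod[OF A _ multipliersD(2)[OF n op_tensor_in_cstar_tensor[OF s T(2)]], of x] Bb by auto
  qed
  show "m \<in> bops" using m by (rule multipliersD)
  show "m ** (rins q ** s) \<in> hmod A" "m\<dagger> ** (rins q ** s) \<in> hmod A"
    if "q \<in> {blinfun_apply T x | T x. T \<in> B}" "s \<in> A" for q s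
    using *[OF m that] *[OF m' that] by auto
qed

context star_rep
begin

lemma amp_op_tensor:
  assumes S: "S \<in> X" and T: "T \<in> bops"
  shows "amp X \<phi> (S \<otimes> T) = \<phi> S \<otimes> T"
proof (rule amp_eqI[OF op_tensor_hmul[OF subalg S T]])
  note Xb = star_subalgebraD(1)[OF subalg]
  show "\<phi> S \<otimes> T \<in> bops" using S T by simp
  fix p q s assume s: "s \<in> X"
  have "(rins p)\<dagger> ** (\<phi> S \<otimes> T) ** rins q ** \<phi> s = cscale (cinner p (T q)) (\<phi> (S ** s))"
    "(rins p)\<dagger> ** S \<otimes> T ** rins q ** s = cscale (cinner p (T q)) (S ** s)"
    using S T s Xb by (simp_all add: compose_assoc compose_square[OF op_tensor_rins] rins_adj_rins_compose star_homD(3)[OF hom])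
  then show "(rins p)\<dagger> ** (\<phi> S \<otimes> T) ** rins q ** \<phi> s = \<phi> ((rins p)\<dagger> ** S \<otimes> T ** rins q ** s)"
    using S s star_subalgebraD(5)[OF subalg] by (simp add: star_homD(5)[OF hom])
qed

lemma amp_add: "m \<in> hmul X \<Longrightarrow> n \<in> hmul X \<Longrightarrow> amp X \<phi> (m + n) = amp X \<phi> m + amp X \<phi> n"
  by (rule amp_eqI_hext)
    (auto simp: amp_bops blinfun_compose_add amp_hext hext_add hmulD(2)[OF subalg] star_subalgebraD(4)[OF star_subalgebra_hmul[OF subalg]])

lemma amp_cscale: "m \<in> hmul X \<Longrightarrow> amp X \<phi> (cscale c m) = cscale c (amp X \<phi> m)"
  by (rule amp_eqI_hext)
    (auto simp: amp_bops blinfun_compose_cscale amp_hext hext_cscale hmod_cscale[OF subalg] hmulD(2)[OF subalg]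
      star_subalgebraD(7)[OF star_subalgebra_hmul[OF subalg]])

text \<open>Amplification is itself a *-homomorphism on \<open>hmul X\<close>, so
  \<open>star_hom_contractive\<close> makes it norm continuous. The closedness arguments in
  \<open>amp_in\<close> and \<open>star_rep_compose\<close> rest on this.\<close>

lemma star_hom_amp: "star_hom (hmul X) (restrict (amp X \<phi>) (hmul X))"
  unfolding star_hom_def
  by (auto simp: amp_bops amp_add amp_compose amp_adj amp_cscale star_subalgebraD[OF star_subalgebra_hmul[OF subalg]])

lemma hext_zero: "hext X \<phi> 0 = 0"
  by (rule hext_eqI) (use subspace_0[OF hext_graph_subspace] in \<open>simp add: zero_prod_def\<close>)

lemma amp_in:
  fixes t :: "('x, 'd::complex_hilbert) hop"
  assumes C: "subspace C" "closed C" and B: "B \<subseteq> bops" and t: "t \<in> X \<otimes>\<^sub>A B"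
    and gen: "\<And>S T. S \<in> X \<Longrightarrow> T \<in> B \<Longrightarrow> \<phi> S \<otimes> T \<in> C"
  shows "amp X \<phi> t \<in> C"
proof -
  note hs = star_subalgebra_hmul[OF subalg]
  let ?D = "{t \<in> hmul X. amp X \<phi> t \<in> C}"
  have "subspace ?D" unfolding subspace_def
  proof (intro conjI ballI allI)
    have "amp X \<phi> (0 :: ('x, 'd) hop) = 0"
      by (rule amp_eqI_hext) (simp_all add: star_subalgebraD(3)[OF hs] hext_zero)
    then show "0 \<in> ?D" using subspace_0[OF C(1)] star_subalgebraD(3)[OF hs] by simp
    show "x + y \<in> ?D" if "x \<in> ?D" "y \<in> ?D" for x y
      using that subspace_add[OF C(1)] star_subalgebraD(4)[OF hs] by (auto simp: amp_add)
    show "r *\<^sub>R x \<in> ?D" if "x \<in> ?D" for r x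
      using that subspace_scale[OF C(1)] star_subalgebraD(8)[OF hs] amp_cscale[of x "complex_of_real r"]
      by (auto simp: cscale_of_real)
  qed
  moreover have "closed ?D" unfolding closed_sequential_limits
  proof (intro allI impI, elim conjE)
    fix f l assume f: "\<forall>n. f n \<in> ?D" and l: "f \<longlonglongrightarrow> l"
    then have fh: "\<And>n. f n \<in> hmul X" and fC: "\<And>n. amp X \<phi> (f n) \<in> C" by auto
    have lh: "l \<in> hmul X" using star_hom_tendsto(1)[OF hs star_hom_amp l fh] .
    have "(\<lambda>n. amp X \<phi> (f n)) \<longlonglongrightarrow> amp X \<phi> l"
      using star_hom_tendsto(2)[OF hs star_hom_amp l fh] fh lh by simp
    then show "l \<in> ?D" using closed_sequentially[OF C(2), of "\<lambda>n. amp X \<phi> (f n)"] fC lh by blast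
  qed
  ultimately have "X \<otimes>\<^sub>A B \<subseteq> ?D" unfolding cstar_tensor_def
    by (intro closure_minimal span_minimal) (use B gen in \<open>auto simp: amp_op_tensor subset_iff intro: op_tensor_hmul[OF subalg]\<close>)
  then show ?thesis using t by blast
qed

lemma amp_in_cstar_tensor:
  assumes "B \<subseteq> bops" "t \<in> X \<otimes>\<^sub>A B" shows "amp X \<phi> t \<in> \<phi> ` X \<otimes>\<^sub>A B"
  by (rule amp_in[OF subspace_cstar_tensor closed_cstar_tensor assms]) (auto intro: op_tensor_in_cstar_tensor)

end

lemma star_rep_id: "cstar_algebra A \<Longrightarrow> star_rep A (id_morphism A)"
proof
  assume A: "cstar_algebra A"
  note s = cstar_algebraD(1)[OF A]
  show "star_subalgebra A" by fact
  show "star_hom A (id_morphism A)"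
    using star_subalgebraD[OF s] by (auto simp: star_hom_def id_morphism_def)
  have "{blinfun_apply (id_morphism A S) z | S z. S \<in> A} = {blinfun_apply S z | S z. S \<in> A}"
    by (auto simp: id_morphism_def)
  then show "ctotal {(id_morphism A S) z | S z. S \<in> A}" using cstar_algebraD(2)[OF A] by simp
qed

lemma amp_id_morphism:
  assumes A: "cstar_algebra A" and m: "m \<in> hmul A" shows "amp A (id_morphism A) m = m"
proof -
  interpret star_rep A "id_morphism A" by (rule star_rep_id[OF A])
  show ?thesis
    by (rule amp_eqI[OF m hmulD(1)[OF subalg m]]) (simp_all add: id_morphism_def hmul_slice_in[OF subalg m])
qed

lemma star_hom_agree:
  assumes C: "star_subalgebra (closure (span G))" and \<Phi>: "star_hom (closure (span G)) \<Phi>" "star_hom (closure (span G)) \<Psi>"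
    and eq: "\<And>T. T \<in> G \<Longrightarrow> \<Phi> T = \<Psi> T"
  shows "\<Phi> = \<Psi>"
proof -
  let ?C = "closure (span G)" let ?D = "{T \<in> ?C. \<Phi> T = \<Psi> T}"
  have "subspace ?D" unfolding subspace_def
    using star_subalgebraD(3,4,8)[OF C] star_hom_zero[OF C \<Phi>(1)] star_hom_zero[OF C \<Phi>(2)]
      star_homD(2,6)[OF \<Phi>(1)] star_homD(2,6)[OF \<Phi>(2)] by simp
  moreover have "closed ?D" unfolding closed_sequential_limits
  proof (intro allI impI, elim conjE)
    fix f l assume f: "\<forall>n. f n \<in> ?D" and l: "f \<longlonglongrightarrow> l"
    then have fh: "\<And>n. f n \<in> ?C" and e: "\<And>n. \<Phi> (f n) = \<Psi> (f n)" by auto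
    have "\<Phi> l = \<Psi> l"
      using star_hom_tendsto(2)[OF C \<Phi>(1) l fh] star_hom_tendsto(2)[OF C \<Phi>(2) l fh] LIMSEQ_unique unfolding e by blast
    then show "l \<in> ?D" using star_hom_tendsto(1)[OF C \<Phi>(1) l fh] by blast
  qed
  ultimately have "?C \<subseteq> ?D" by (intro closure_minimal span_minimal) (use eq closure_span_mem in blast)+
  then show ?thesis using star_homD(7)[OF \<Phi>(1)] star_homD(7)[OF \<Phi>(2)] by (intro ext) (metis (mono_tags, lifting) mem_Collect_eq subset_iff)
qed

section \<open>Tensor products of two representations\<close>

locale star_rep_pair = A: star_rep A \<phi> + B: star_rep B \<psi>
  for A :: "('a::complex_hilbert \<Rightarrow>\<^sub>L 'a) set" and \<phi> :: "('a \<Rightarrow>\<^sub>L 'a) \<Rightarrow> ('c::complex_hilbert \<Rightarrow>\<^sub>L 'c)"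
    and B :: "('b::complex_hilbert \<Rightarrow>\<^sub>L 'b) set" and \<psi> :: "('b \<Rightarrow>\<^sub>L 'b) \<Rightarrow> ('d::complex_hilbert \<Rightarrow>\<^sub>L 'd)"
begin

abbreviation "amp_right V \<equiv> flipped (amp B \<psi> (flipped V))"

lemma A_bops: "A \<subseteq> bops" and B_bops: "B \<subseteq> bops"
  using star_subalgebraD(1)[OF A.subalg] star_subalgebraD(1)[OF B.subalg] by auto

lemma flipped_hmul: "t \<in> A \<otimes>\<^sub>A B \<Longrightarrow> flipped t \<in> hmul B"
  by (intro cstar_tensor_hmul[OF B.subalg A_bops] flipped_cstar_tensor A_bops B_bops)

lemma amp_right_cstar_tensor: "t \<in> A \<otimes>\<^sub>A B \<Longrightarrow> amp_right t \<in> A \<otimes>\<^sub>A \<psi> ` B"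
  by (rule flipped_cstar_tensor[OF B.amp_in_cstar_tensor[OF A_bops]])
    (use A_bops B_bops in \<open>auto intro: flipped_cstar_tensor\<close>)

lemma amp_right_in_hmul: "t \<in> A \<otimes>\<^sub>A B \<Longrightarrow> amp_right t \<in> hmul A"
  by (rule cstar_tensor_hmul[OF A.subalg _ amp_right_cstar_tensor]) auto

lemma amp_right_op_tensor: "S \<in> A \<Longrightarrow> T \<in> B \<Longrightarrow> amp_right (S \<otimes> T) = S \<otimes> \<psi> T"
  using A_bops B_bops by (simp add: subset_iff flipped_op_tensor B.amp_op_tensor)

lemma tensor_subalgebra: "star_subalgebra (A \<otimes>\<^sub>A B)"
  by (rule star_subalgebra_cstar_tensor[OF A.subalg B.subalg])

lemma tensor_hom_eqI:
  assumes "star_hom (A \<otimes>\<^sub>A B) \<Phi>" "\<And>S T. S \<in> A \<Longrightarrow> T \<in> B \<Longrightarrow> \<Phi> (S \<otimes> T) = \<phi> S \<otimes> \<psi> T"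
  shows "tensor_hom A \<phi> B \<psi> = \<Phi>"
  unfolding tensor_hom_def
proof (rule the_equality)
  fix \<Psi> assume "star_hom (A \<otimes>\<^sub>A B) \<Psi> \<and> (\<forall>S\<in>A. \<forall>T\<in>B. \<Psi> (S \<otimes> T) = \<phi> S \<otimes> \<psi> T)"
  then show "\<Psi> = \<Phi>"
    by (intro star_hom_agree[OF tensor_subalgebra[unfolded cstar_tensor_def]])
      (use assms in \<open>auto simp: cstar_tensor_def\<close>)
qed (use assms in blast)

lemma star_hom_amp_both: "star_hom (A \<otimes>\<^sub>A B) (restrict (\<lambda>t. amp A \<phi> (amp_right t)) (A \<otimes>\<^sub>A B))"
  unfolding star_hom_def
proof (intro conjI ballI allI)
  show "restrict (\<lambda>t. amp A \<phi> (amp_right t)) (A \<otimes>\<^sub>A B) \<in> A \<otimes>\<^sub>A B \<rightarrow>\<^sub>E bops"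
    by (auto intro!: A.amp_bops amp_right_in_hmul)
  have fl: "flipped (S + T) = flipped S + flipped T" "flipped (cscale c S) = cscale c (flipped S)"
    for c and S T :: "('u::complex_hilbert, 'v::complex_hilbert) hop"
    by (auto simp: flipped_def blinfun_compose_add blinfun_compose_cscale)
  note D = star_subalgebraD[OF tensor_subalgebra]
  fix S assume S: "S \<in> A \<otimes>\<^sub>A B"
  have Sb: "S \<in> bops" using D S by blast
  show "restrict (\<lambda>t. amp A \<phi> (amp_right t)) (A \<otimes>\<^sub>A B) (S\<dagger>) = (restrict (\<lambda>t. amp A \<phi> (amp_right t)) (A \<otimes>\<^sub>A B) S)\<dagger>"
    using S D amp_right_in_hmul[OF S] flipped_hmul[OF S] Sb
    by (simp add: flipped_adj[symmetric] B.amp_adj B.amp_bops flipped_adj[of "amp B \<psi> (flipped S)", symmetric] A.amp_adj)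
  show "restrict (\<lambda>t. amp A \<phi> (amp_right t)) (A \<otimes>\<^sub>A B) (cscale c S) = cscale c (restrict (\<lambda>t. amp A \<phi> (amp_right t)) (A \<otimes>\<^sub>A B) S)" for c
    using S D amp_right_in_hmul[OF S] flipped_hmul[OF S] by (simp add: fl B.amp_cscale A.amp_cscale)
  fix T assume T: "T \<in> A \<otimes>\<^sub>A B"
  show "restrict (\<lambda>t. amp A \<phi> (amp_right t)) (A \<otimes>\<^sub>A B) (S + T) =
      restrict (\<lambda>t. amp A \<phi> (amp_right t)) (A \<otimes>\<^sub>A B) S + restrict (\<lambda>t. amp A \<phi> (amp_right t)) (A \<otimes>\<^sub>A B) T"
    using S T D amp_right_in_hmul[OF S] flipped_hmul[OF S] amp_right_in_hmul[OF T] flipped_hmul[OF T]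
    by (simp add: fl B.amp_add A.amp_add)
  show "restrict (\<lambda>t. amp A \<phi> (amp_right t)) (A \<otimes>\<^sub>A B) (S ** T) =
      restrict (\<lambda>t. amp A \<phi> (amp_right t)) (A \<otimes>\<^sub>A B) S ** restrict (\<lambda>t. amp A \<phi> (amp_right t)) (A \<otimes>\<^sub>A B) T"
    using S T D amp_right_in_hmul[OF S] flipped_hmul[OF S] amp_right_in_hmul[OF T] flipped_hmul[OF T]
    by (simp add: flipped_compose B.amp_compose A.amp_compose)
qed

lemma tensor_hom_amp: "tensor_hom A \<phi> B \<psi> = restrict (\<lambda>t. amp A \<phi> (amp_right t)) (A \<otimes>\<^sub>A B)"
  by (rule tensor_hom_eqI[OF star_hom_amp_both])
    (simp add: op_tensor_in_cstar_tensor amp_right_op_tensor A.amp_op_tensor)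

lemma ctotal_tensor_range: "ctotal {(\<phi> S \<otimes> \<psi> T) z | S T z. S \<in> A \<and> T \<in> B}"
proof (rule ctotal_mono[OF ctotal_htens[OF A.nondeg B.nondeg]], clarify)
  fix S T x y assume "S \<in> A" "T \<in> B"
  then show "\<exists>Sa Ta z. (\<phi> S) x \<otimes>\<^sub>h (\<psi> T) y = (\<phi> Sa \<otimes> \<psi> Ta) z \<and> Sa \<in> A \<and> Ta \<in> B"
    by (intro exI[of _ S] exI[of _ T] exI[of _ "x \<otimes>\<^sub>h y"]) simp
qed

lemma tensor_op_eqI:
  assumes "R \<in> bops" "R' \<in> bops" "\<And>S T. S \<in> A \<Longrightarrow> T \<in> B \<Longrightarrow> R ** (\<phi> S \<otimes> \<psi> T) = R' ** (\<phi> S \<otimes> \<psi> T)"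
  shows "R = R'"
proof (rule bops_eq_on_total[OF ctotal_tensor_range assms(1,2)], clarify)
  fix S T z assume "S \<in> A" "T \<in> B"
  from arg_cong[OF assms(3)[OF this], of "\<lambda>R. R z"]
  show "R ((\<phi> S \<otimes> \<psi> T) z) = R' ((\<phi> S \<otimes> \<psi> T) z)" by simp
qed

text \<open>After \<open>id \<otimes> \<psi>\<close> there is no prescribed algebra on the second
  leg in which to be a multiplier, but the operator remains adjointable over \<open>A\<close>, so
  that \<open>amp A \<phi>\<close> can be applied next. The argument is that of
  \<open>multipliers_hmul\<close>, with the total vectors \<open>\<psi> T x\<close>.\<close>

lemma amp_right_multiplier:
  assumes V: "V \<in> multipliers (A \<otimes>\<^sub>A B)" and fV: "flipped V \<in> hmul B"
  shows "S \<in> A \<Longrightarrow> T \<in> B \<Longrightarrow> amp_right V ** (S \<otimes> \<psi> T) = amp_right (V ** S \<otimes> T)"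
    and "amp_right V \<in> hmul A"
proof -
  have *: "amp_right W ** (S \<otimes> \<psi> T) = amp_right (W ** S \<otimes> T)"
    if "flipped W \<in> hmul B" "S \<in> A" "T \<in> B" for W S T
    using that amp_right_op_tensor[of S T, symmetric] flipped_hmul[OF op_tensor_in_cstar_tensor[of S A T B]]
    by (simp add: flipped_compose B.amp_compose)
  then show "S \<in> A \<Longrightarrow> T \<in> B \<Longrightarrow> amp_right V ** (S \<otimes> \<psi> T) = amp_right (V ** S \<otimes> T)" using fV by blast
  have **: "amp_right W ** (rins q ** s) \<in> hmod A"
    if W: "W \<in> multipliers (A \<otimes>\<^sub>A B)" "flipped W \<in> hmul B" and q: "q \<in> {(\<psi> T) x | T x. T \<in> B}" and s: "s \<in> A" for W q s
  proof -
    from q obtain T x where T: "q = (\<psi> T) x" "T \<in> B" by blast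
    have "rins q ** s = (s \<otimes> \<psi> T) ** rins x" using T s A_bops by (simp add: op_tensor_rins subset_iff)
    then have "amp_right W ** (rins q ** s) = amp_right (W ** s \<otimes> T) ** rins x"
      using *[OF W(2) s T(2)] by (simp add: compose_assoc[symmetric])
    moreover have "amp_right (W ** s \<otimes> T) \<in> A \<otimes>\<^sub>A \<psi> ` B"
      using W(1) s T(2) by (intro amp_right_cstar_tensor multipliersD op_tensor_in_cstar_tensor)
    moreover have "\<psi> ` B \<subseteq> bops" by auto
    ultimately show ?thesis using cstar_tensor_rins_hmod[OF A.subalg] by metis
  qed
  have Vb: "V \<in> bops" using V by (rule multipliersD)
  have fV': "flipped (V\<dagger>) \<in> hmul B" using hmulD(3)[OF B.subalg fV] Vb by (simp add: flipped_adj)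
  have adj: "(amp_right V)\<dagger> = amp_right (V\<dagger>)"
    using fV Vb by (simp add: flipped_adj B.amp_bops B.amp_adj[symmetric])
  show "amp_right V \<in> hmul A"
  proof (rule hmulI_total[OF A.subalg B.nondeg])
    show "amp_right V \<in> bops" using fV by (simp add: B.amp_bops)
    fix q s assume "q \<in> {blinfun_apply (\<psi> T) x | T x. T \<in> B}" "s \<in> A"
    then show "amp_right V ** (rins q ** s) \<in> hmod A" "(amp_right V)\<dagger> ** (rins q ** s) \<in> hmod A"
      unfolding adj using **[OF V fV] **[OF multipliers_adj[OF V tensor_subalgebra] fV'] by auto
  qed
qed

text \<open>Both definite descriptions in \<open>tensor_ext\<close> are resolved here, the
  homomorphism on the tensor product and its extension to multipliers. From then on
  \<open>tensor_ext\<close> is a pair of amplifications.\<close>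

lemma tensor_ext_amp:
  assumes V: "V \<in> multipliers (A \<otimes>\<^sub>A B)" and fV: "flipped V \<in> hmul B"
  shows "tensor_ext A \<phi> B \<psi> V = amp A \<phi> (amp_right V)"
  unfolding tensor_ext_def extension_def tensor_hom_amp
proof (rule the_equality)
  note aV = amp_right_multiplier(2)[OF V fV]
  have eq: "amp A \<phi> (amp_right V) ** amp A \<phi> (amp_right t) = amp A \<phi> (amp_right (V ** t))" if t: "t \<in> A \<otimes>\<^sub>A B" for t
    using aV amp_right_in_hmul[OF t] flipped_hmul[OF t] fV
    by (simp add: flipped_compose B.amp_compose A.amp_compose)
  show "amp A \<phi> (amp_right V) \<in> bops \<and> (\<forall>T\<in>A \<otimes>\<^sub>A B. amp A \<phi> (amp_right V) ** restrict (\<lambda>t. amp A \<phi> (amp_right t)) (A \<otimes>\<^sub>A B) T =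
      restrict (\<lambda>t. amp A \<phi> (amp_right t)) (A \<otimes>\<^sub>A B) (V ** T))"
    using eq aV multipliersD(2)[OF V] by (simp add: A.amp_bops)
  fix R assume R: "R \<in> bops \<and> (\<forall>T\<in>A \<otimes>\<^sub>A B. R ** restrict (\<lambda>t. amp A \<phi> (amp_right t)) (A \<otimes>\<^sub>A B) T =
      restrict (\<lambda>t. amp A \<phi> (amp_right t)) (A \<otimes>\<^sub>A B) (V ** T))"
  show "R = amp A \<phi> (amp_right V)"
  proof (rule tensor_op_eqI)
    fix S T assume ST: "S \<in> A" "T \<in> B"
    then have t: "S \<otimes> T \<in> A \<otimes>\<^sub>A B" by (rule op_tensor_in_cstar_tensor)
    have "amp A \<phi> (amp_right (S \<otimes> T)) = \<phi> S \<otimes> \<psi> T" using ST by (simp add: amp_right_op_tensor A.amp_op_tensor)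
    then show "R ** (\<phi> S \<otimes> \<psi> T) = amp A \<phi> (amp_right V) ** (\<phi> S \<otimes> \<psi> T)"
      using R t eq[OF t] multipliersD(2)[OF V t] by auto
  qed (use R aV in \<open>auto simp: A.amp_bops\<close>)
qed

end

section \<open>Representations from morphisms and from conjugation\<close>

lemma bounded_linear_cinner_apply: "bounded_linear (\<lambda>T. cinner y (blinfun_apply T x))"
  by (rule bounded_linear_compose[OF bounded_linear_cinner_right]) (rule blinfun.bounded_linear_left)

text \<open>A vector orthogonal to all \<open>\<phi> S z\<close> is orthogonal to the ranges of all
  operators in the closed span of \<open>\<phi>(A) B\<close>. That span is \<open>B\<close>, which
  acts nondegenerately.\<close>

lemma star_rep_morphism:
  assumes A: "cstar_algebra A" and B: "cstar_algebra B" and \<phi>: "morphism A B \<phi>"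
  shows "star_rep A \<phi>"
proof
  show "star_subalgebra A" using A by (rule cstar_algebraD)
  show hom: "star_hom A \<phi>" using \<phi> by (simp add: morphism_def)
  show "ctotal {(\<phi> s) z | s z. s \<in> A}"
    unfolding ctotal_def
  proof (intro allI impI)
    fix y assume y: "\<forall>x\<in>{(\<phi> s) z | s z. s \<in> A}. cinner x y = 0"
    have y': "cinner y ((\<phi> S) z) = 0" if "S \<in> A" for S z
      using y that by (subst cinner_flip_zero) blast
    show "y = 0"
    proof (rule ctotalD[OF cstar_algebraD(2)[OF B]])
      fix x assume "x \<in> {blinfun_apply T x | T x. T \<in> B}"
      then obtain T z where T: "x = blinfun_apply T z" "T \<in> B" by blast
      then have T': "T \<in> closure (span {\<phi> S ** T | S T. S \<in> A \<and> T \<in> B})" using \<phi> by (simp add: morphism_def)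
      have "cinner y (T z) \<in> {0}"
        by (rule closure_span_image_subset[OF bounded_linear_cinner_apply _ _ _ T'])
          (auto simp: subspace_def y')
      then show "cinner x y = 0" using T by (simp add: cinner_flip_zero[of y])
    qed
  qed
qed

lemma rins_adj_op_tensor: "S \<in> bops \<Longrightarrow> (rins p)\<dagger> ** S \<otimes> \<one> = S ** (rins p)\<dagger>"
  by (rule htens_op_eqI) (simp_all add: rins_adj_htens bops_scaleC)

lemma slice_leg13:
  assumes m: "m \<in> bops"
  shows "(rins p)\<dagger> ** (leg13 m ** rins q) = ((rins p)\<dagger> ** (m ** rins q)) \<otimes> \<one>"
proof (rule htens_op_eqI)
  fix x y
  have 1: "(rins p)\<dagger> ** (rins y \<otimes> \<one>) = rins y ** (rins p)\<dagger>" by (rule rins_adj_op_tensor) simp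
  have "leg13 m ** rins q ** rins y = leg13 m ** (rins y \<otimes> \<one>) ** rins q"
    by (simp add: compose_assoc op_tensor_rins)
  also have "\<dots> = (rins y \<otimes> \<one>) ** (m ** rins q)" by (simp add: leg13_rins m compose_assoc)
  finally have "(rins p)\<dagger> ** (leg13 m ** rins q ** rins y) = rins y ** ((rins p)\<dagger> ** (m ** rins q))"
    by (simp add: compose_square[OF 1] compose_assoc)
  from arg_cong[OF this, of "\<lambda>T. T x"]
  show "((rins p)\<dagger> ** (leg13 m ** rins q)) (x \<otimes>\<^sub>h y) =
      (((rins p)\<dagger> ** (m ** rins q)) \<otimes> \<one>) (x \<otimes>\<^sub>h y)" using m by simp
qed (use m in auto)

text \<open>This shape covers \<open>comult W\<close>, the action \<open>conj_left\<close> of the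
  universal corepresentation, and the transport of a representation to \<open>'k\<close> in
  \<open>universal_corep_separates\<close>.\<close>

lemma star_rep_conj:
  assumes "star_rep X \<pi>" and U: "unitary U"
  shows "star_rep X (restrict (\<lambda>s. U ** (\<pi> s \<otimes> \<one>) ** U\<dagger>) X)"
proof -
  interpret star_rep X \<pi> by fact
  note Ub = unitaryD(1)[OF U] and UU = compose_absorb[OF unitaryD(2)[OF U]]
  show ?thesis
  proof
    show "star_subalgebra X" by (rule subalg)
    have "U ** R \<otimes> \<one> ** U\<dagger> ** (U ** S \<otimes> \<one> ** U\<dagger>) = U ** ((R ** S) \<otimes> \<one>) ** U\<dagger>"
      if "R \<in> bops" "S \<in> bops" for R S
      using that by (simp add: compose_assoc UU op_tensor_compose[symmetric])
        (simp add: compose_assoc[symmetric] op_tensor_compose)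
    then show "star_hom X (restrict (\<lambda>s. U ** (\<pi> s \<otimes> \<one>) ** U\<dagger>) X)"
      using Ub star_subalgebraD[OF subalg] unfolding star_hom_def
      by (auto simp: star_homD[OF hom] op_tensor_add_left blinfun_compose_add op_tensor_cscale_left
        blinfun_compose_cscale adj_compose op_tensor_adj compose_assoc)
    show "ctotal {(restrict (\<lambda>s. U ** (\<pi> s \<otimes> \<one>) ** U\<dagger>) X s) z | s z. s \<in> X}"
      unfolding ctotal_def
    proof (intro allI impI)
      fix y assume y: "\<forall>x\<in>{(restrict (\<lambda>s. U ** (\<pi> s \<otimes> \<one>) ** U\<dagger>) X s) z | s z. s \<in> X}. cinner x y = 0"
      have "(U\<dagger>) y = 0"
      proof (rule ctotalD[OF ctotal_htens[OF nondeg ctotal_UNIV]], clarify)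
        fix s z b assume s: "s \<in> X"
        have "cinner ((restrict (\<lambda>s. U ** (\<pi> s \<otimes> \<one>) ** U\<dagger>) X s) (U (z \<otimes>\<^sub>h b))) y = 0"
          using y s by blast
        then show "cinner ((\<pi> s) z \<otimes>\<^sub>h b) ((U\<dagger>) y) = 0"
          using s Ub by (simp add: cinner_adj_right unitaryD(4)[OF U])
      qed
      then show "y = 0" using unitaryD(5)[OF U, of y] by simp
    qed
  qed
qed

text \<open>Slicing the last leg turns \<open>leg13\<close> of an operator into its slice tensored
  with the identity (\<open>slice_leg13\<close>), which is the form in which \<open>\<pi> s\<close>
  enters the conjugated representation.\<close>

lemma amp_conj:
  assumes "star_rep X \<pi>" and U: "unitary U" and m: "m \<in> hmul X"
  shows "amp X (restrict (\<lambda>s. U ** (\<pi> s \<otimes> \<one>) ** U\<dagger>) X) m =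
    (U \<otimes> \<one>) ** leg13 (amp X \<pi> m) ** (U \<otimes> \<one>)\<dagger>"
proof -
  interpret star_rep X \<pi> by fact
  interpret c: star_rep X "restrict (\<lambda>s. U ** (\<pi> s \<otimes> \<one>) ** U\<dagger>) X" by (rule star_rep_conj[OF assms(1,2)])
  note Ub = unitaryD(1)[OF U] and UU = compose_absorb[OF unitaryD(2)[OF U]]
  have ab: "amp X \<pi> m \<in> bops" using m by (rule amp_bops)
  show ?thesis
  proof (rule c.amp_eqI[OF m])
    show "U \<otimes> \<one> ** leg13 (amp X \<pi> m) ** (U \<otimes> \<one>)\<dagger> \<in> bops" using Ub ab by simp
    fix p q s assume s: "s \<in> X"
    have sl: "(rins p)\<dagger> ** m ** rins q ** s \<in> X" by (rule hmul_slice_in[OF subalg m s])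
    let ?M = "(rins p)\<dagger> ** (amp X \<pi> m ** rins q)"
    have Mb: "?M \<in> bops" using ab by simp
    have 1: "(U \<otimes> \<one>)\<dagger> ** rins q = rins q ** U\<dagger>" using Ub by (simp add: op_tensor_adj op_tensor_rins)
    have "(rins p)\<dagger> ** (U \<otimes> \<one> ** leg13 (amp X \<pi> m) ** (U \<otimes> \<one>)\<dagger>) ** rins q =
        U ** ?M \<otimes> \<one> ** U\<dagger>"
      by (simp only: compose_assoc 1 compose_square[OF rins_adj_op_tensor[OF Ub]])
        (simp only: slice_leg13[OF ab, symmetric] compose_assoc)
    note K = this
    have a: "(rins p)\<dagger> ** (U \<otimes> \<one> ** leg13 (amp X \<pi> m) ** (U \<otimes> \<one>)\<dagger>) ** rins q **
        (U ** (\<pi> s \<otimes> \<one>) ** U\<dagger>) = U ** (?M \<otimes> \<one> ** (\<pi> s \<otimes> \<one>)) ** U\<dagger>"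
      unfolding K by (simp only: compose_assoc UU)
    have b: "?M \<otimes> \<one> ** (\<pi> s \<otimes> \<one>) = (?M ** \<pi> s) \<otimes> \<one>"
      using Mb s op_tensor_compose[of ?M id_blinfun "\<pi> s" \<one>] by simp
    have c: "?M ** \<pi> s = \<pi> ((rins p)\<dagger> ** m ** rins q ** s)"
      using amp_slice[OF m s, of p q] by (simp add: compose_assoc)
    show "(rins p)\<dagger> ** (U \<otimes> \<one> ** leg13 (amp X \<pi> m) ** (U \<otimes> \<one>)\<dagger>) ** rins q **
        restrict (\<lambda>s. U ** (\<pi> s \<otimes> \<one>) ** U\<dagger>) X s =
        restrict (\<lambda>s. U ** (\<pi> s \<otimes> \<one>) ** U\<dagger>) X ((rins p)\<dagger> ** m ** rins q ** s)"
      by (simp only: restrict_apply'[OF s] restrict_apply'[OF sl] a b c)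
  qed
qed

lemma star_rep_comult:
  assumes "cstar_algebra (qg W)" "unitary W" shows "star_rep (qg W) (comult W)"
proof -
  have "comult W = restrict (\<lambda>s. W ** (id_morphism (qg W) s \<otimes> \<one>) ** W\<dagger>) (qg W)"
    by (auto simp: comult_def id_morphism_def)
  then show ?thesis using star_rep_conj[OF star_rep_id[OF assms(1)] assms(2)] by simp
qed

lemma amp_comult:
  assumes A: "cstar_algebra (qg W)" and W: "unitary W" and m: "m \<in> hmul (qg W)"
  shows "amp (qg W) (comult W) m = leg12 W ** leg13 m ** (leg12 W)\<dagger>"
proof -
  have "comult W = restrict (\<lambda>s. W ** (id_morphism (qg W) s \<otimes> \<one>) ** W\<dagger>) (qg W)"
    by (auto simp: comult_def id_morphism_def)
  then show ?thesis
    using amp_conj[OF star_rep_id[OF A] W m] amp_id_morphism[OF A m] by (simp add: leg12_def)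
qed

lemma subspace_closed_tensor_preimage:
  fixes S :: "'a::complex_hilbert \<Rightarrow>\<^sub>L 'c::complex_hilbert" and C :: "(('a, 'b::complex_hilbert) htensor \<Rightarrow>\<^sub>L ('c, 'd::complex_hilbert) htensor) set"
  assumes S: "S \<in> bops" and C: "subspace C" "closed C"
  shows "subspace {d \<in> bops. S \<otimes> d \<in> C}" "closed {d \<in> bops. S \<otimes> d \<in> C}"
proof -
  have z: "S \<otimes> (0 :: 'b \<Rightarrow>\<^sub>L 'd) = 0" using op_tensor_cscale_right[OF S, of "0 :: 'b \<Rightarrow>\<^sub>L 'd" 0] by simp
  show "subspace {d \<in> bops. S \<otimes> d \<in> C}" unfolding subspace_def
    using subspace_0[OF C(1)] subspace_add[OF C(1)] subspace_scale[OF C(1)] z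
    by (auto simp: op_tensor_add_right[OF S] cscale_of_real[symmetric] op_tensor_cscale_right[OF S])
  show "closed {d \<in> bops. S \<otimes> d \<in> C}" unfolding closed_sequential_limits
  proof (intro allI impI, elim conjE)
    fix f l assume f: "\<forall>n. f n \<in> {d \<in> bops. S \<otimes> d \<in> C}" and l: "f \<longlonglongrightarrow> l"
    then have fb: "\<And>n. f n \<in> bops" and fC: "\<And>n. S \<otimes> f n \<in> C" by auto
    have lb: "l \<in> bops" using closed_sequentially[OF closed_bops fb l] .
    have "(\<lambda>n. S \<otimes> f n) \<longlonglongrightarrow> S \<otimes> l"
    proof (rule LIM_zero_cancel, rule Lim_null_comparison)
      show "\<forall>\<^sub>F n in sequentially. norm ((S \<otimes> f n) - (S \<otimes> l)) \<le> norm S * norm (f n - l)"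
        using norm_op_tensor_le[OF S bops_intros(4)[OF fb lb]] by (simp add: op_tensor_diff_right[OF S fb lb])
      have "(\<lambda>n. norm (f n - l)) \<longlonglongrightarrow> 0" using l by (simp add: LIM_zero_iff tendsto_norm_zero_iff)
      then show "(\<lambda>n. norm S * norm (f n - l)) \<longlonglongrightarrow> 0" by (rule tendsto_mult_right_zero)
    qed
    then show "l \<in> {d \<in> bops. S \<otimes> d \<in> C}" using closed_sequentially[OF C(2), of "\<lambda>n. S \<otimes> f n"] fC lb by blast
  qed
qed

context star_rep_pair
begin

text \<open>Both sides are \<open>(\<phi> \<otimes> \<psi>)(V)\<close>.\<close>

lemma amp_commute:
  assumes V: "V \<in> multipliers (A \<otimes>\<^sub>A B)" and fV: "flipped V \<in> hmul B" and hV: "V \<in> hmul A"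
  shows "amp A \<phi> (amp_right V) = flipped (amp B \<psi> (flipped (amp A \<phi> V)))"
proof -
  interpret sw: star_rep_pair B \<psi> A \<phi> ..
  let ?\<Psi> = "restrict (\<lambda>t. flipped (amp B \<psi> (flipped (amp A \<phi> t)))) (A \<otimes>\<^sub>A B)"
  have fVm: "flipped V \<in> multipliers (B \<otimes>\<^sub>A A)" using V A_bops B_bops by (rule flipped_multipliers)
  have aV: "flipped (amp A \<phi> V) \<in> hmul B" using sw.amp_right_multiplier(2)[OF fVm] hV by simp
  have fl: "flipped t \<in> B \<otimes>\<^sub>A A" if "t \<in> A \<otimes>\<^sub>A B" for t using that A_bops B_bops by (rule flipped_cstar_tensor)
  have at: "flipped (amp A \<phi> t) \<in> hmul B" "t \<in> hmul A" if "t \<in> A \<otimes>\<^sub>A B" for t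
    using sw.amp_right_in_hmul[OF fl[OF that]] cstar_tensor_hmul[OF A.subalg B_bops that] by simp_all
  have "star_hom (A \<otimes>\<^sub>A B) ?\<Psi>" unfolding star_hom_def
  proof (intro conjI ballI allI)
    have add: "flipped (S + T) = flipped S + flipped T" "flipped (cscale c S) = cscale c (flipped S)"
      for c and S T :: "('u::complex_hilbert, 'v::complex_hilbert) hop"
      by (auto simp: flipped_def blinfun_compose_add blinfun_compose_cscale)
    note D = star_subalgebraD[OF tensor_subalgebra]
    show "?\<Psi> \<in> A \<otimes>\<^sub>A B \<rightarrow>\<^sub>E bops" using at by (auto intro!: B.amp_bops)
    fix S assume S: "S \<in> A \<otimes>\<^sub>A B"
    show "?\<Psi> (S\<dagger>) = (?\<Psi> S)\<dagger>"
      using S D at[OF S] by (simp add: flipped_adj A.amp_adj[symmetric] A.amp_bops B.amp_bops B.amp_adj[symmetric])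
    show "?\<Psi> (cscale c S) = cscale c (?\<Psi> S)" for c
      using S D at[OF S] by (simp add: add B.amp_cscale A.amp_cscale)
    fix T assume T: "T \<in> A \<otimes>\<^sub>A B"
    show "?\<Psi> (S + T) = ?\<Psi> S + ?\<Psi> T" "?\<Psi> (S ** T) = ?\<Psi> S ** ?\<Psi> T"
      using S T D at[OF S] at[OF T] by (simp_all add: add B.amp_add A.amp_add flipped_compose B.amp_compose A.amp_compose)
  qed
  moreover have "?\<Psi> (S \<otimes> T) = \<phi> S \<otimes> \<psi> T" if "S \<in> A" "T \<in> B" for S T
    using that A_bops B_bops by (simp add: op_tensor_in_cstar_tensor A.amp_op_tensor flipped_op_tensor subset_iff B.amp_op_tensor)
  ultimately have eq: "?\<Psi> = restrict (\<lambda>t. amp A \<phi> (amp_right t)) (A \<otimes>\<^sub>A B)"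
    using tensor_hom_eqI tensor_hom_amp by metis
  show ?thesis
  proof (rule tensor_op_eqI)
    show "amp A \<phi> (amp_right V) \<in> bops" "flipped (amp B \<psi> (flipped (amp A \<phi> V))) \<in> bops"
      using amp_right_multiplier(2)[OF V fV] aV by (auto intro: A.amp_bops B.amp_bops)
    fix S T assume ST: "S \<in> A" "T \<in> B"
    have t: "S \<otimes> T \<in> A \<otimes>\<^sub>A B" using ST by (rule op_tensor_in_cstar_tensor)
    have Vt: "V ** S \<otimes> T \<in> A \<otimes>\<^sub>A B" using V t by (rule multipliersD)
    have "amp A \<phi> (amp_right V) ** amp A \<phi> (amp_right (S \<otimes> T)) = amp A \<phi> (amp_right (V ** S \<otimes> T))"
      using amp_right_multiplier(2)[OF V fV] amp_right_in_hmul[OF t] flipped_hmul[OF t] fV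
      by (simp add: flipped_compose B.amp_compose A.amp_compose)
    moreover have "flipped (amp B \<psi> (flipped (amp A \<phi> V))) ** flipped (amp B \<psi> (flipped (amp A \<phi> (S \<otimes> T)))) =
        flipped (amp B \<psi> (flipped (amp A \<phi> (V ** S \<otimes> T))))"
      using aV hV at[OF t] by (simp add: flipped_compose B.amp_compose A.amp_compose)
    moreover have "amp A \<phi> (amp_right (S \<otimes> T)) = \<phi> S \<otimes> \<psi> T"
      using ST by (simp add: amp_right_op_tensor A.amp_op_tensor)
    moreover have "flipped (amp B \<psi> (flipped (amp A \<phi> t))) = amp A \<phi> (amp_right t)" if "t \<in> A \<otimes>\<^sub>A B" for t
      using fun_cong[OF eq, of t] that by simp
    ultimately show "amp A \<phi> (amp_right V) ** (\<phi> S \<otimes> \<psi> T) = flipped (amp B \<psi> (flipped (amp A \<phi> V))) ** (\<phi> S \<otimes> \<psi> T)"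
      using t Vt by metis
  qed
qed

end

subsection \<open>Compact operators\<close>

definition rank1 :: "'a::complex_hilbert \<Rightarrow> 'b::complex_hilbert \<Rightarrow> ('b \<Rightarrow>\<^sub>L 'a)" where
  "rank1 p q = Blinfun (\<lambda>x. cinner q x *\<^sub>C p)"

lemma rank1_apply [simp]: "blinfun_apply (rank1 p q) x = cinner q x *\<^sub>C p"
proof -
  have "bounded_linear (\<lambda>x. cinner q x *\<^sub>C p)"
  proof (rule bounded_linear_intro[where K = "norm q * norm p"])
    show "norm (cinner q x *\<^sub>C p) \<le> norm x * (norm q * norm p)" for x
      using mult_right_mono[OF cmod_cinner_le[of q x] norm_ge_zero[of p]] by (simp add: norm_scaleC mult_ac)
  qed (simp_all add: cinner_add_right scaleC_add_left scaleR_scaleC cinner_scaleC_right scaleC_scaleC)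
  then show ?thesis by (simp add: rank1_def bounded_linear_Blinfun_apply)
qed

lemma rank1_bops [simp, intro]: "rank1 p q \<in> bops"
  by (rule bopsI) (simp add: cinner_scaleC_right scaleC_scaleC)

lemma rank1_adj: "(rank1 p q)\<dagger> = rank1 q p"
  by (rule adj_eqI) (auto simp: cinner_scaleC_left cinner_scaleC_right cinner_commute[of p] mult.commute)

lemma compose_rank1: "T \<in> bops \<Longrightarrow> T ** rank1 p q = rank1 (T p) q"
  by (rule blinfun_eqI) (simp add: bops_scaleC)

lemma rank1_compose: "T \<in> bops \<Longrightarrow> rank1 p q ** T = rank1 p (blinfun_apply (T\<dagger>) q)"
  by (rule blinfun_eqI) (simp add: cinner_adj_left)

definition compacts :: "('a::complex_hilbert \<Rightarrow>\<^sub>L 'a) set" where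
  "compacts = closure (span {rank1 p q | p q. True})"

lemma rank1_compacts: "rank1 p q \<in> compacts"
  unfolding compacts_def by (rule closure_span_mem) blast

lemma subspace_compacts: "subspace compacts" and closed_compacts: "closed compacts"
  unfolding compacts_def by (auto intro: subspace_closure_span)

lemma compacts_image_subset:
  assumes "bounded_linear f" "subspace C" "closed C" "\<And>p q. f (rank1 p q) \<in> C" "t \<in> compacts"
  shows "f t \<in> C"
  using assms(5) unfolding compacts_def
  by (rule closure_span_image_subset[OF assms(1-3), rotated]) (use assms(4) in blast)

lemma cstar_algebra_compacts: "cstar_algebra compacts"
  unfolding cstar_algebra_iff
proof (rule conjI)
  show "star_subalgebra (compacts :: ('a \<Rightarrow>\<^sub>L 'a) set)" unfolding compacts_def
  proof (rule star_subalgebra_closure_span)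
    fix c and T :: "'a \<Rightarrow>\<^sub>L 'a" assume "T \<in> {rank1 p q | p q. True}"
    then obtain p q where T: "T = rank1 p q" by blast
    have "cscale c T = rank1 (c *\<^sub>C p) q" unfolding T by (rule blinfun_eqI) (simp add: scaleC_scaleC mult.commute)
    then show "cscale c T \<in> closure (span {rank1 p q | p q. True})" by (intro closure_span_mem) blast
  qed (auto simp: rank1_adj compose_rank1 simp del: rank1_apply intro!: closure_span_mem, blast+)
  show "ctotal {blinfun_apply T x | T x. T \<in> (compacts :: ('a \<Rightarrow>\<^sub>L 'a) set)}"
    unfolding ctotal_def
  proof (intro allI impI)
    fix y :: 'a assume y: "\<forall>x\<in>{blinfun_apply T x | T x. T \<in> compacts}. cinner x y = 0"
    then have "cinner ((rank1 y y) y) y = 0" using rank1_compacts by blast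
    then show "y = 0" by (simp add: cinner_scaleC_left cinner_norm)
  qed
qed

lemma bops_compose_compacts: "T \<in> bops \<Longrightarrow> k \<in> compacts \<Longrightarrow> T ** k \<in> compacts"
  by (rule compacts_image_subset[OF bounded_linear_compose_left subspace_compacts closed_compacts])
    (auto simp: compose_rank1 rank1_compacts)

lemma compacts_compose_bops: "T \<in> bops \<Longrightarrow> k \<in> compacts \<Longrightarrow> k ** T \<in> compacts"
  by (rule compacts_image_subset[OF bounded_linear_compose_right subspace_compacts closed_compacts])
    (auto simp: rank1_compose rank1_compacts)

lemma compacts_bops: "k \<in> compacts \<Longrightarrow> k \<in> bops"
  using cstar_algebraD(1)[OF cstar_algebra_compacts] by (rule star_subalgebraD)

text \<open>\<open>s \<otimes> rank1 p q\<close> factors as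
  \<open>rins p ** s ** (rins q)\<dagger>\<close>, and an adjointable operator acts on the module
  element \<open>rins p ** s\<close>. With the compact operators on the second leg, an adjointable
  corepresentation on a Hilbert space thus becomes one in the multiplier sense.\<close>

lemma hmul_multipliers_compacts:
  fixes A :: "('a::complex_hilbert \<Rightarrow>\<^sub>L 'a) set" and m :: "('a, 'd::complex_hilbert) hop"
  assumes A: "star_subalgebra A" and m: "m \<in> hmul A"
  shows "m \<in> multipliers (A \<otimes>\<^sub>A compacts)"
proof (rule multipliersI)
  show mb: "m \<in> bops" using m by (rule hmulD[OF A])
  show "star_subalgebra (A \<otimes>\<^sub>A compacts)"
    by (rule star_subalgebra_cstar_tensor[OF A cstar_algebraD(1)[OF cstar_algebra_compacts]])
  have e: "e ** (rins q)\<dagger> \<in> A \<otimes>\<^sub>A compacts" if e: "e \<in> hmod A" for e :: "'a \<Rightarrow>\<^sub>L ('a, 'd) htensor" and q :: 'd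
  proof (rule hmod_image_subset[OF bounded_linear_compose_right subspace_cstar_tensor closed_cstar_tensor _ e])
    fix p :: 'd and s assume s: "s \<in> A"
    have "rins p ** s ** (rins q)\<dagger> = s \<otimes> rank1 p q"
      by (rule htens_op_eqI) (use star_subalgebraD(1)[OF A s] in \<open>auto simp: rins_adj_htens bops_scaleC htens_scaleC_left htens_scaleC_right\<close>)
    then show "rins p ** s ** (rins q)\<dagger> \<in> A \<otimes>\<^sub>A compacts" using s by (simp add: op_tensor_in_cstar_tensor rank1_compacts)
  qed
  have *: "n ** t \<in> A \<otimes>\<^sub>A compacts" if n: "n \<in> hmul A" and t: "t \<in> A \<otimes>\<^sub>A compacts" for n t :: "('a, 'd) hop"
  proof (rule cstar_tensor_image_subset[OF bounded_linear_compose_left subspace_cstar_tensor closed_cstar_tensor _ t])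
    fix s and k :: "'d \<Rightarrow>\<^sub>L 'd" assume s: "s \<in> A" and k: "k \<in> compacts"
    have sb: "s \<in> bops" by (rule star_subalgebraD(1)[OF A s])
    have "subspace {t. n ** t \<in> A \<otimes>\<^sub>A compacts}" "closed {t. n ** t \<in> A \<otimes>\<^sub>A compacts}"
      by (intro subspace_preimage closed_preimage bounded_linear_compose_left subspace_cstar_tensor closed_cstar_tensor)+
    note E = subspace_closed_tensor_preimage[OF sb this]
    have "n ** (s \<otimes> rank1 p q) \<in> A \<otimes>\<^sub>A compacts" for p q :: 'd
    proof -
      have "s \<otimes> rank1 p q = rins p ** s ** (rins q)\<dagger>"
        by (rule htens_op_eqI) (use sb in \<open>auto simp: rins_adj_htens bops_scaleC htens_scaleC_left htens_scaleC_right\<close>)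
      then have "n ** (s \<otimes> rank1 p q) = (n ** (rins p ** s)) ** (rins q)\<dagger>" by (simp add: compose_assoc)
      then show ?thesis using e[OF hmulD(2)[OF A n hmod_gen[OF s]]] by simp
    qed
    then have "k \<in> {k \<in> bops. s \<otimes> k \<in> {t. n ** t \<in> A \<otimes>\<^sub>A compacts}}"
      by (intro compacts_image_subset[OF bounded_linear_ident E _ k]) auto
    then show "n ** s \<otimes> k \<in> A \<otimes>\<^sub>A compacts" using k by blast
  qed
  show "m ** t \<in> A \<otimes>\<^sub>A compacts" "m\<dagger> ** t \<in> A \<otimes>\<^sub>A compacts" if "t \<in> A \<otimes>\<^sub>A compacts" for t
    using *[OF m that] *[OF hmulD(3)[OF A m] that] by auto
qed

subsection \<open>Self-adjoint operators\<close>

text \<open>For a symmetric operator \<open>Q\<close>, surjectivity of \<open>1 + Q\<^sup>2\<close> characterizes self-adjointness.\<close>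

definition sa_graph :: "('a::complex_hilbert \<times> 'a) set \<Rightarrow> bool" where
  "sa_graph G \<longleftrightarrow> csubspace G \<and> (\<forall>u v x y. (u, v) \<in> G \<longrightarrow> (x, y) \<in> G \<longrightarrow> cinner u y = cinner v x) \<and>
     (\<forall>h. \<exists>y y' y''. (y, y') \<in> G \<and> (y', y'') \<in> G \<and> h = y + y'')"

text \<open>For a self-adjoint \<open>Q\<close> with graph \<open>G\<close>: \<open>c = (1 + Q\<^sup>2)\<inverse>\<close>, \<open>g = Q c\<close> and \<open>s = Q\<^sup>2 c\<close>.\<close>

locale sa_parts =
  fixes G :: "('a::complex_hilbert \<times> 'a) set" and c g s :: "'a \<Rightarrow>\<^sub>L 'a"
  assumes bops [simp]: "c \<in> bops" "g \<in> bops" "s \<in> bops"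
    and adj [simp]: "c\<dagger> = c" "g\<dagger> = g" "s\<dagger> = s"
    and sum: "c + s = \<one>"
    and cg: "(c h, g h) \<in> G" and gs: "(g h, s h) \<in> G"
    and parts_unique: "(y, y') \<in> G \<Longrightarrow> (y', y'') \<in> G \<Longrightarrow> c (y + y'') = y \<and> g (y + y'') = y' \<and> s (y + y'') = y''"
    and gg: "g ** g = c ** s" and gc: "g ** c = c ** g"

lemma sa_graphD:
  assumes "sa_graph G"
  shows "csubspace G" "(u, v) \<in> G \<Longrightarrow> (x, y) \<in> G \<Longrightarrow> cinner u y = cinner v x"
    "(x, y) \<in> G \<Longrightarrow> (x', y') \<in> G \<Longrightarrow> (x + x', y + y') \<in> G" "(x, y) \<in> G \<Longrightarrow> (d *\<^sub>C x, d *\<^sub>C y) \<in> G"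
    "(x, y) \<in> G \<Longrightarrow> (x', y') \<in> G \<Longrightarrow> (x - x', y - y') \<in> G"
proof -
  show cs: "csubspace G" using assms by (simp add: sa_graph_def)
  show "(u, v) \<in> G \<Longrightarrow> (x, y) \<in> G \<Longrightarrow> cinner u y = cinner v x" using assms by (auto simp: sa_graph_def)
  show "(x, y) \<in> G \<Longrightarrow> (x', y') \<in> G \<Longrightarrow> (x + x', y + y') \<in> G" "(x, y) \<in> G \<Longrightarrow> (d *\<^sub>C x, d *\<^sub>C y) \<in> G"
    using cs unfolding csubspace_def by (metis add_Pair scaleC_Pair)+
  show "(x, y) \<in> G \<Longrightarrow> (x', y') \<in> G \<Longrightarrow> (x - x', y - y') \<in> G"
    using csubspace_diff[OF cs] by (metis diff_Pair)
qed

text \<open>Symmetry gives \<open>cinner y y'' = (norm y')^2\<close>, so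
  \<open>(norm (y + y''))^2\<close> is a sum of nonnegative terms.\<close>

lemma symmetric_graph_norm:
  assumes sym: "\<And>u v x y. (u, v) \<in> G \<Longrightarrow> (x, y) \<in> G \<Longrightarrow> cinner u y = cinner v x"
    and y: "(y, y') \<in> G" "(y', y'') \<in> G"
  shows "norm y \<le> norm (y + y'')" "norm y' \<le> norm (y + y'')" "norm y'' \<le> norm (y + y'')"
proof -
  have "cinner y' y' = cinner y'' y" by (rule sym[OF y(2,1)])
  then have "Re (cinner y y'') = (norm y')\<^sup>2"
    by (subst cinner_commute) (simp add: norm_sq_cinner)
  then have n: "(norm (y + y''))\<^sup>2 = (norm y)\<^sup>2 + (norm y'')\<^sup>2 + 2 * (norm y')\<^sup>2" by (simp add: norm_add_sq)
  show "norm y \<le> norm (y + y'')" "norm y' \<le> norm (y + y'')" "norm y'' \<le> norm (y + y'')"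
    by (rule power2_le_imp_le; use n zero_le_power2[of "norm y"] zero_le_power2[of "norm y'"] zero_le_power2[of "norm y''"] in simp)+
qed

lemma sa_parts_exist:
  assumes G: "sa_graph G"
  shows "\<exists>c g s. sa_parts G c g s"
proof -
  note D = sa_graphD[OF G]
  have "\<forall>h. \<exists>y y' y''. (y, y') \<in> G \<and> (y', y'') \<in> G \<and> h = y + y''" using G by (simp add: sa_graph_def)
  then obtain C K S where CKS: "\<And>h. (C h, K h) \<in> G" "\<And>h. (K h, S h) \<in> G" "\<And>h. h = C h + S h" by metis
  have uniq: "C (y + y'') = y \<and> K (y + y'') = y' \<and> S (y + y'') = y''" if y: "(y, y') \<in> G" "(y', y'') \<in> G" for y y' y''
  proof -
    let ?h = "y + y''"
    have 1: "(C ?h - y, K ?h - y') \<in> G" "(K ?h - y', S ?h - y'') \<in> G" using D(5) CKS y by blast+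
    have 2: "(C ?h - y) + (S ?h - y'') = 0" using CKS(3)[of ?h] by (simp add: algebra_simps)
    show ?thesis using symmetric_graph_norm[OF D(2) 1] unfolding 2 by simp
  qed
  have add: "C (h + k) = C h + C k \<and> K (h + k) = K h + K k \<and> S (h + k) = S h + S k" for h k
  proof -
    have "h + k = (C h + C k) + (S h + S k)" using CKS(3)[of h] CKS(3)[of k] by (simp add: algebra_simps)
    then show ?thesis using uniq[OF D(3)[OF CKS(1)[of h] CKS(1)[of k]] D(3)[OF CKS(2)[of h] CKS(2)[of k]]] by simp
  qed
  have sc: "C (d *\<^sub>C h) = d *\<^sub>C C h \<and> K (d *\<^sub>C h) = d *\<^sub>C K h \<and> S (d *\<^sub>C h) = d *\<^sub>C S h" for d h
  proof -
    have "d *\<^sub>C h = d *\<^sub>C C h + d *\<^sub>C S h" using CKS(3)[of h] by (simp add: scaleC_add_right[symmetric])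
    then show ?thesis using uniq[OF D(4)[OF CKS(1)[of h]] D(4)[OF CKS(2)[of h]], of d] by simp
  qed
  have nrm: "norm (C h) \<le> norm h" "norm (K h) \<le> norm h" "norm (S h) \<le> norm h" for h
    using symmetric_graph_norm[OF D(2) CKS(1,2)] CKS(3)[of h] by metis+
  have bl: "bounded_linear C" "bounded_linear K" "bounded_linear S"
    by (rule bounded_linear_intro[where K = 1]; simp add: add scaleR_scaleC sc nrm)+
  define c g s where "c = Blinfun C" and "g = Blinfun K" and "s = Blinfun S"
  have ap [simp]: "c h = C h" "g h = K h" "s h = S h" for h
    by (simp_all add: c_def g_def s_def bounded_linear_Blinfun_apply bl)
  have b: "c \<in> bops" "g \<in> bops" "s \<in> bops" by (auto intro!: bopsI simp: sc)
  have sum: "c + s = \<one>" by (rule blinfun_eqI) (simp add: blinfun.add_left CKS(3)[symmetric])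
  have symC: "cinner (C h) k = cinner h (C k)" for h k
  proof -
    have "cinner (C h) k = cinner (C h) (C k) + cinner (C h) (S k)" using CKS(3)[of k] cinner_add_right by metis
    also have "cinner (C h) (S k) = cinner (K h) (K k)" by (rule D(2)[OF CKS(1,2)])
    also have "\<dots> = cinner (S h) (C k)" by (rule D(2)[OF CKS(2,1)])
    also have "cinner (C h) (C k) + cinner (S h) (C k) = cinner h (C k)" using CKS(3)[of h] cinner_add_left by metis
    finally show ?thesis .
  qed
  have symK: "cinner (K h) k = cinner h (K k)" for h k
  proof -
    have "cinner (K h) k = cinner (K h) (C k) + cinner (K h) (S k)" using CKS(3)[of k] cinner_add_right by metis
    also have "cinner (K h) (C k) = cinner (C h) (K k)" by (rule D(2)[OF CKS(1,1), symmetric])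
    also have "cinner (K h) (S k) = cinner (S h) (K k)" by (rule D(2)[OF CKS(2,2)])
    also have "cinner (C h) (K k) + cinner (S h) (K k) = cinner h (K k)" using CKS(3)[of h] cinner_add_left by metis
    finally show ?thesis .
  qed
  have symS: "cinner (S h) k = cinner h (S k)" for h k
  proof -
    have "S h = h - C h" "S k = k - C k" using CKS(3)[of h] CKS(3)[of k] by (simp_all add: algebra_simps)
    then show ?thesis by (simp add: cinner_diff_left cinner_diff_right symC)
  qed
  \<comment> \<open>With \<open>y = C h\<close>, subtracting the graph point
    \<open>(C y, K y)\<close> from \<open>(C h, K h)\<close> leaves \<open>(S y, K h - K y)\<close>.
    Together with \<open>(K y, S y)\<close> this is a decomposition of \<open>K h\<close>, and
    uniqueness identifies its components.\<close>
  have step: "C (K h) = K (C h) \<and> K (K h) = S (C h)" for h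
  proof -
    let ?y = "C h"
    have "S ?y = ?y - C ?y" using CKS(3)[of ?y] by (simp add: algebra_simps)
    then have "(S ?y, K h - K ?y) \<in> G" using D(5)[OF CKS(1)[of h] CKS(1)[of ?y]] by simp
    from uniq[OF CKS(2)[of ?y] this] show ?thesis by simp
  qed
  have CS: "C (S h) = S (C h)" for h
  proof -
    have "C h = C (C h) + C (S h)" using CKS(3)[of h] add by metis
    moreover have "C h = C (C h) + S (C h)" by (rule CKS(3))
    ultimately show ?thesis by (metis add_left_cancel)
  qed
  have "sa_parts G c g s"
  proof
    show "c\<dagger> = c" "g\<dagger> = g" "s\<dagger> = s" by (rule adj_eqI; use b in \<open>simp add: symC symK symS\<close>)+
    show "g ** g = c ** s" by (rule blinfun_eqI) (simp add: step CS)
    show "g ** c = c ** g" by (rule blinfun_eqI) (simp add: step)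
  qed (use b sum CKS uniq in auto)
  then show ?thesis by blast
qed

text \<open>Von Neumann's argument: the residual \<open>(h - y, - y')\<close> of the projection of
  \<open>(h, 0)\<close> onto the closed graph is orthogonal to the graph, which says that
  \<open>(y', h - y)\<close> belongs to the adjoint graph, hence to \<open>G\<close>.\<close>

lemma sa_graph_pos_self_adjoint:
  assumes "pos_self_adjoint G" shows "sa_graph G"
proof -
  have og: "operator_graph G" and ad: "adj_graph G = G" using assms by (auto simp: pos_self_adjoint_def)
  have "(0, 0) \<in> G" "(x, y) \<in> G \<Longrightarrow> (x', y') \<in> G \<Longrightarrow> (x + x', y + y') \<in> G" "(x, y) \<in> G \<Longrightarrow> (d *\<^sub>C x, d *\<^sub>C y) \<in> G" for x y x' y' d
    using og unfolding operator_graph_def by blast+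
  then have cs: "csubspace G" unfolding csubspace_def by (auto simp: zero_prod_def)
  have sym: "cinner u y = cinner v x" if "(u, v) \<in> G" "(x, y) \<in> G" for u v x y
    using that ad unfolding adj_graph_def by blast
  have memI: "(u, v) \<in> G" if "\<And>x y. (x, y) \<in> G \<Longrightarrow> cinner u y = cinner v x" for u v
    using that ad unfolding adj_graph_def by blast
  have "closed G" unfolding closed_sequential_limits
  proof (intro allI impI, elim conjE)
    fix f l assume f: "\<forall>n. f n \<in> G" and l: "f \<longlonglongrightarrow> l"
    have "cinner (fst l) y = cinner (snd l) x" if "(x, y) \<in> G" for x y
    proof -
      have "(\<lambda>n. cinner (fst (f n)) y) \<longlonglongrightarrow> cinner (fst l) y" "(\<lambda>n. cinner (snd (f n)) x) \<longlonglongrightarrow> cinner (snd l) x"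
        by (intro tendsto_cinner tendsto_fst tendsto_snd tendsto_const l)+
      moreover have "cinner (fst (f n)) y = cinner (snd (f n)) x" for n using sym[of "fst (f n)" "snd (f n)"] f that by simp
      ultimately show ?thesis using LIMSEQ_unique by simp
    qed
    then have "(fst l, snd l) \<in> G" by (rule memI)
    then show "l \<in> G" by simp
  qed
  have "\<exists>y y' y''. (y, y') \<in> G \<and> (y', y'') \<in> G \<and> h = y + y''" for h
  proof -
    obtain m where m: "m \<in> G" "\<forall>x\<in>G. cinner x ((h, 0) - m) = 0"
      using orthogonal_decomposition[OF cs \<open>closed G\<close>] by blast
    obtain y y' where m': "m = (y, y')" by (cases m)
    have "(y', h - y) \<in> G"
    proof (rule memI)
      fix u v assume "(u, v) \<in> G"
      then have "cinner u (h - y) = cinner v y'" using m(2) by (force simp: m' cinner_minus_right)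
      then show "cinner y' v = cinner (h - y) u" by (rule cinner_swap_eq[symmetric])
    qed
    then show ?thesis using m(1) m' by (intro exI[of _ y] exI[of _ y'] exI[of _ "h - y"]) simp
  qed
  then show ?thesis using cs sym by (auto simp: sa_graph_def)
qed

context sa_parts
begin

lemma sum_apply: "c h + s h = h"
  using arg_cong[OF sum, of "\<lambda>T. T h"] by (simp add: blinfun.add_left)

lemma s_eq: "s = \<one> - c"
  using sum by (simp add: algebra_simps)

text \<open>For a self-adjoint \<open>Q\<close> this is \<open>(Q^2 - 1) / (Q^2 + 1)\<close>, a
  self-adjoint contraction with \<open>k^2 + 4 g^2 = 1\<close> (\<open>norm_k\<close>). This
  identity makes the series of \<open>(norm (g (k^n x)))^2\<close> telescope.\<close>

definition k where "k = \<one> - 2 *\<^sub>R c"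

lemma k_bops [simp]: "k \<in> bops" and k_adj [simp]: "k\<dagger> = k"
  by (simp_all add: k_def adj_diff adj_scaleR)

lemma gk: "g (k h) = k (g h)"
  using arg_cong[OF gc, of "\<lambda>T. T h"] by (simp add: k_def blinfun.bilinear_simps)

lemma k_apply: "blinfun_apply k h = s h - c h"
proof -
  have "s h = h - c h" using sum_apply[of h] by (simp add: algebra_simps)
  then show ?thesis by (simp add: k_def blinfun.bilinear_simps scaleR_2)
qed

lemma norm_k: "4 * (norm (g h))\<^sup>2 = (norm h)\<^sup>2 - (norm (k h))\<^sup>2"
proof -
  have "cinner (g h) (g h) = cinner h (blinfun_apply (g ** g) h)" using cinner_adj_left[OF bops(2), of h "g h"] by simp
  also have "\<dots> = cinner (c h) (s h)" unfolding gg using cinner_adj_left[OF bops(1), of h "s h"] by simp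
  finally have gn: "(norm (g h))\<^sup>2 = Re (cinner (c h) (s h))" by (simp add: norm_sq_cinner)
  have h: "h = c h + s h" by (simp add: sum_apply)
  have k: "k h = s h - c h" by (rule k_apply)
  have comm: "Re (cinner (s h) (c h)) = Re (cinner (c h) (s h))" by (subst cinner_commute) simp
  have "(norm h)\<^sup>2 = (norm (c h))\<^sup>2 + (norm (s h))\<^sup>2 + 2 * Re (cinner (c h) (s h))"
    by (subst h) (rule norm_add_sq)
  moreover have "(norm (k h))\<^sup>2 = (norm (s h))\<^sup>2 + (norm (c h))\<^sup>2 - 2 * Re (cinner (c h) (s h))"
    unfolding k by (simp add: norm_diff_sq comm)
  ultimately show ?thesis using gn by simp
qed

abbreviation kp :: "nat \<Rightarrow> 'a \<Rightarrow> 'a" where "kp n \<equiv> (blinfun_apply k ^^ n)"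

lemma kp_linear: "kp n (x + y) = kp n x + kp n y" "kp n (d *\<^sub>C x) = d *\<^sub>C kp n x" "kp n (g x) = g (kp n x)"
  by (induction n) (simp_all add: blinfun.add_right bops_scaleC gk)

lemma kp_norm: "norm (kp n x) \<le> norm x"
proof (induction n)
  case (Suc n)
  have "(norm (k (kp n x)))\<^sup>2 \<le> (norm (kp n x))\<^sup>2" using norm_k[of "kp n x"] zero_le_power2[of "norm (g (kp n x))"] by linarith
  then have "norm (k (kp n x)) \<le> norm (kp n x)" using power2_le_imp_le by (metis norm_ge_zero)
  then show ?case using Suc by simp
qed simp

lemma partial_sum: "(\<Sum>n<N. (norm (g (kp n x)))\<^sup>2) = ((norm x)\<^sup>2 - (norm (kp N x))\<^sup>2) / 4"
proof (induction N)
  case (Suc N)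
  then show ?case using norm_k[of "kp N x"] by (simp add: field_simps)
qed simp

lemma summable_gk: "summable (\<lambda>n. (norm (g (kp n x)))\<^sup>2)" "(\<Sum>n. (norm (g (kp n x)))\<^sup>2) \<le> (norm x)\<^sup>2 / 4"
proof -
  have b: "(\<Sum>n<N. (norm (g (kp n x)))\<^sup>2) \<le> (norm x)\<^sup>2 / 4" for N
    unfolding partial_sum by (simp add: divide_right_mono)
  show "summable (\<lambda>n. (norm (g (kp n x)))\<^sup>2)"
    by (rule summableI_nonneg_bounded[where x = "(norm x)\<^sup>2 / 4"]) (use b in auto)
  then show "(\<Sum>n. (norm (g (kp n x)))\<^sup>2) \<le> (norm x)\<^sup>2 / 4" by (rule suminf_le_const) (rule b)
qed

lemma gk_null: "(\<lambda>n. kp n (g x)) \<longlonglongrightarrow> 0"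
proof -
  have "(\<lambda>n. (norm (g (kp n x)))\<^sup>2) \<longlonglongrightarrow> 0" by (rule summable_LIMSEQ_zero[OF summable_gk(1)])
  then have "(\<lambda>n. sqrt ((norm (g (kp n x)))\<^sup>2)) \<longlonglongrightarrow> sqrt 0" by (rule tendsto_real_sqrt)
  then show ?thesis by (simp add: kp_linear tendsto_norm_zero_iff)
qed

text \<open>With \<open>k = 1 - 2 c\<close> the equation reads \<open>b - k b k = 2 g a g\<close>, whose solution is the Neumann series
  \<open>2 \<Sum>\<^sub>n k\<^sup>n g a g k\<^sup>n\<close>; it converges since \<open>4 g\<^sup>2 = 1 - k\<^sup>2\<close>.\<close>

theorem smoothing_exists:
  assumes a: "a \<in> bops"
  shows "\<exists>b\<in>bops. s ** b ** c + c ** b ** s = g ** a ** g"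
proof -
  define t where "t x y n = cinner (g (kp n x)) (a (g (kp n y)))" for x y n
  have tb: "norm (t x y n) \<le> norm a * (((norm (g (kp n x)))\<^sup>2 + (norm (g (kp n y)))\<^sup>2) / 2)" for x y n
  proof -
    let ?p = "norm (g (kp n x))" and ?q = "norm (g (kp n y))"
    have "norm (t x y n) \<le> ?p * norm (a (g (kp n y)))" unfolding t_def by (rule cmod_cinner_le)
    also have "\<dots> \<le> ?p * (norm a * ?q)" by (intro mult_left_mono norm_blinfun) simp
    also have "\<dots> = norm a * (?p * ?q)" by simp
    also have "\<dots> \<le> norm a * ((?p\<^sup>2 + ?q\<^sup>2) / 2)" using sum_squares_bound[of ?p ?q] by (intro mult_left_mono) auto
    finally show ?thesis .
  qed
  have sm: "summable (\<lambda>n. norm a * (((norm (g (kp n x)))\<^sup>2 + (norm (g (kp n y)))\<^sup>2) / 2))" for x y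
    by (intro summable_mult summable_divide summable_add summable_gk)
  have ts: "summable (t x y)" for x y
    by (rule summable_comparison_test'[OF sm, of 0]) (rule tb)
  define B where "B x y = 2 * suminf (t x y)" for x y
  have B2: "norm (B x y) \<le> norm a * ((norm x)\<^sup>2 + (norm y)\<^sup>2) / 4" for x y
  proof -
    have "norm (suminf (t x y)) \<le> (\<Sum>n. norm a * (((norm (g (kp n x)))\<^sup>2 + (norm (g (kp n y)))\<^sup>2) / 2))"
      by (rule norm_suminf_le[OF tb sm])
    also have "\<dots> = norm a * ((\<Sum>n. (norm (g (kp n x)))\<^sup>2) + (\<Sum>n. (norm (g (kp n y)))\<^sup>2)) / 2"
      using summable_gk by (simp add: suminf_mult suminf_divide suminf_add summable_add summable_divide)
    also have "\<dots> \<le> norm a * ((norm x)\<^sup>2 / 4 + (norm y)\<^sup>2 / 4) / 2"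
      by (intro divide_right_mono mult_left_mono add_mono summable_gk) auto
    finally show ?thesis unfolding B_def norm_mult by (simp add: algebra_simps)
  qed
  have t_add: "t (x + x') y = (\<lambda>n. t x y n + t x' y n)" "t x (y + y') = (\<lambda>n. t x y n + t x y' n)"
    "t (d *\<^sub>C x) y = (\<lambda>n. cnj d * t x y n)" "t x (d *\<^sub>C y) = (\<lambda>n. d * t x y n)" for x x' y y' d
    using a by (auto simp: t_def kp_linear blinfun.add_right cinner_add_left cinner_add_right bops_scaleC
        cinner_scaleC_left cinner_scaleC_right)
  have Badd: "B (x + x') y = B x y + B x' y" "B x (y + y') = B x y + B x y'" "B (d *\<^sub>C x) y = cnj d * B x y"
    "B x (d *\<^sub>C y) = d * B x y" for x x' y y' d
    unfolding B_def t_add using ts by (simp_all add: suminf_add[symmetric] suminf_mult algebra_simps)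
  have "\<exists>b\<in>bops. (\<forall>x y. cinner x (blinfun_apply b y) = B x y) \<and> norm b \<le> norm a / 2"
  proof (rule bounded_form_operator)
    show "cmod (B x y) \<le> norm a / 2 * norm x * norm y" for x y
    proof (cases "x = 0 \<or> y = 0")
      case True
      then show ?thesis using Badd(3)[of 0 0 y] Badd(4)[of x 0 0] by auto
    next
      case False
      \<comment> \<open>\<open>B2\<close> bounds the form by squares of norms. By homogeneity it is
        enough to apply it to unit vectors, which gives the product of the norms with the constant
        \<open>norm a / 2\<close>.\<close>
      define u where "u = complex_of_real (inverse (norm x)) *\<^sub>C x"
      define v where "v = complex_of_real (inverse (norm y)) *\<^sub>C y"
      have nu: "norm u = 1" "norm v = 1" using False by (auto simp: u_def v_def norm_scaleC norm_inverse)
      have "x = complex_of_real (norm x) *\<^sub>C u" "y = complex_of_real (norm y) *\<^sub>C v"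
        using False by (auto simp: u_def v_def scaleC_scaleC simp flip: of_real_mult)
      then have "B x y = complex_of_real (norm x) * (complex_of_real (norm y) * B u v)"
        using Badd(3)[of "complex_of_real (norm x)" u y] Badd(4)[of u "complex_of_real (norm y)" v] by simp
      then have "cmod (B x y) = norm x * norm y * cmod (B u v)" by (simp add: norm_mult)
      also have "\<dots> \<le> norm x * norm y * (norm a / 2)" using B2[of u v] nu by (intro mult_left_mono) auto
      finally show ?thesis by (simp add: mult_ac)
    qed
  qed (simp_all add: Badd)
  then obtain b where b: "b \<in> bops" "\<And>x y. cinner x (b y) = B x y" by blast
  have shift: "t (k x) (k y) n = t x y (Suc n)" for x y n by (simp add: t_def funpow_swap1)
  have eq: "cinner x (b y) - cinner (k x) (b (k y)) = 2 * cinner (g x) (a (g y))" for x y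
  proof -
    have "(\<lambda>n. t x y (Suc n)) = t (k x) (k y)" by (rule ext) (simp only: shift)
    then have "suminf (t (k x) (k y)) = suminf (t x y) - t x y 0" using suminf_split_head[OF ts[of x y]] by simp
    moreover have "t x y 0 = cinner (g x) (a (g y))" by (simp add: t_def)
    ultimately have *: "suminf (t (k x) (k y)) = suminf (t x y) - cinner (g x) (a (g y))" by simp
    show ?thesis unfolding b B_def * by (simp add: right_diff_distrib)
  qed
  have "s ** b ** c + c ** b ** s = g ** a ** g"
  proof (rule cinner_op_ext)
    fix x y
    have x: "x = c x + s x" "y = c y + s y" by (simp_all add: sum_apply)
    have kx: "k x = s x - c x" "k y = s y - c y" by (rule k_apply)+
    have "cinner x (b y) - cinner (k x) (b (k y)) = 2 * (cinner (s x) (b (c y)) + cinner (c x) (b (s y)))"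
      unfolding kx by (subst (1) x(1), subst (1) x(2))
        (simp add: blinfun.add_right blinfun.diff_right cinner_add_left cinner_add_right cinner_diff_left cinner_diff_right)
    from trans[OF this[symmetric] eq[of x y]]
    have "cinner (s x) (b (c y)) + cinner (c x) (b (s y)) = cinner (g x) (a (g y))"
      by (metis mult_left_cancel zero_neq_numeral)
    then show "cinner x ((s ** b ** c + c ** b ** s) y) = cinner x ((g ** a ** g) y)"
      using cinner_adj_left[OF bops(3), of x "b (c y)"] cinner_adj_left[OF bops(1), of x "b (s y)"]
        cinner_adj_left[OF bops(2), of x "a (g y)"]
      by (simp add: blinfun.add_left cinner_add_right)
  qed
  then show ?thesis using b by blast
qed

text \<open>The equation is \<open>Q X Q\<inverse> + Q\<inverse> X Q = 0\<close> multiplied by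
  \<open>g\<close> on both sides, which keeps it bounded. It says \<open>X = k X k\<close>, hence
  \<open>X = k^n X k^n\<close> for all \<open>n\<close>; since \<open>k^n g\<close> tends to 0
  strongly, \<open>X\<close> vanishes on the total vectors \<open>g y\<close>.\<close>

lemma smoothing_unique:
  assumes X: "X \<in> bops" and eq: "s ** X ** c + c ** X ** s = 0" and inj: "ctotal (range (blinfun_apply g))"
  shows "X = 0"
proof -
  have fix_eq: "cinner x (X y) = cinner (k x) (X (k y))" for x y
  proof -
    have x: "x = c x + s x" "y = c y + s y" by (simp_all add: sum_apply)
    have kx: "k x = s x - c x" "k y = s y - c y" by (rule k_apply)+
    have "cinner (s x) (X (c y)) + cinner (c x) (X (s y)) = 0"
      using arg_cong[OF eq, of "\<lambda>T. cinner x (T y)"]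
        cinner_adj_left[OF bops(3), of x "X (c y)"] cinner_adj_left[OF bops(1), of x "X (s y)"]
      by (simp add: blinfun.add_left cinner_add_right)
    moreover have "cinner x (X y) - cinner (k x) (X (k y)) = 2 * (cinner (s x) (X (c y)) + cinner (c x) (X (s y)))"
      unfolding kx by (subst (1) x(1), subst (1) x(2))
        (simp add: blinfun.add_right blinfun.diff_right cinner_add_left cinner_add_right cinner_diff_left cinner_diff_right)
    ultimately show ?thesis by simp
  qed
  have pow: "cinner x (X y) = cinner (kp n x) (X (kp n y))" for n x y
    by (induction n) (simp_all add: fix_eq[of "kp n x" "kp n y" for n, symmetric])
  have "X (g y) = 0" for y
  proof (rule cinner_ext)
    fix x :: 'a
    have "(\<lambda>n. norm x * (norm X * norm (kp n (g y)))) \<longlonglongrightarrow> norm x * (norm X * norm (0 :: 'a))"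
      by (intro tendsto_mult tendsto_const tendsto_norm gk_null)
    then have "(\<lambda>n. norm x * (norm X * norm (kp n (g y)))) \<longlonglongrightarrow> 0" by simp
    moreover have "cmod (cinner x (X (g y))) \<le> norm x * (norm X * norm (kp n (g y)))" for n
    proof -
      have "cmod (cinner x (X (g y))) = cmod (cinner (kp n x) (X (kp n (g y))))" by (simp only: pow[of x "g y" n])
      also have "\<dots> \<le> norm (kp n x) * norm (X (kp n (g y)))" by (rule cmod_cinner_le)
      also have "\<dots> \<le> norm x * (norm X * norm (kp n (g y)))" by (intro mult_mono kp_norm norm_blinfun) auto
      finally show ?thesis .
    qed
    ultimately have "cmod (cinner x (X (g y))) \<le> 0" by (intro LIMSEQ_le_const) auto
    then show "cinner x (X (g y)) = cinner x 0" by simp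
  qed
  then show ?thesis by (intro bops_eq_on_total[OF inj X]) auto
qed

end

section \<open>Tensor products of injective self-adjoint operators\<close>

definition injective_graph :: "('a::complex_hilbert \<times> 'a) set \<Rightarrow> bool" where
  "injective_graph G \<longleftrightarrow> (\<forall>y. (y, 0) \<in> G \<longrightarrow> y = 0) \<and> (\<forall>y. (0, y) \<in> G \<longrightarrow> y = 0)"

lemma injective_graph_pos_self_adjoint:
  assumes "pos_self_adjoint G" "trivial_kernel G" shows "injective_graph G"
  using assms unfolding injective_graph_def pos_self_adjoint_def operator_graph_def trivial_kernel_def single_valued_def by blast

lemma sa_graph_injective:
  assumes G: "sa_graph G" and ker: "injective_graph G" and P: "sa_parts G c g s"
  shows "ctotal (range (g))"
  unfolding ctotal_def
proof (intro allI impI)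
  interpret sa_parts G c g s by fact
  fix y assume y: "\<forall>x\<in>range (g). cinner x y = 0"
  have "g y = 0"
  proof (rule cinner_ext)
    fix x
    have "cinner x (g y) = cinner (g x) y" using cinner_adj_left[OF bops(2), of x y] by simp
    then show "cinner x (g y) = cinner x 0" using y by simp
  qed
  then have "(c y, 0) \<in> G" "(0, s y) \<in> G" using cg[of y] gs[of y] by simp_all
  then have "c y = 0" "s y = 0" using ker by (auto simp: injective_graph_def)
  then show "y = 0" using sum_apply[of y] by simp
qed

lemma closed_csubspace_span:
  "csubspace (closure (span {(x \<otimes>\<^sub>h y, x' \<otimes>\<^sub>h y') | x x' y y'. (x, x') \<in> P \<and> (y, y') \<in> Q}))"
  if P: "csubspace P" for P :: "('a::complex_hilbert \<times> 'a) set" and Q :: "('b::complex_hilbert \<times> 'b) set"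
proof (intro csubspace_closure csubspace_span)
  fix d p assume "p \<in> {(x \<otimes>\<^sub>h y, x' \<otimes>\<^sub>h y') | x x' y y'. (x, x') \<in> P \<and> (y, y') \<in> Q}"
  then obtain x x' y y' where p: "p = (x \<otimes>\<^sub>h y, x' \<otimes>\<^sub>h y')" "(x, x') \<in> P" "(y, y') \<in> Q" by blast
  have "(d *\<^sub>C x, d *\<^sub>C x') \<in> P" using P p(2) unfolding csubspace_def by (metis scaleC_Pair)
  moreover have "d *\<^sub>C p = ((d *\<^sub>C x) \<otimes>\<^sub>h y, (d *\<^sub>C x') \<otimes>\<^sub>h y')" by (simp add: p(1) htens_scaleC_left)
  ultimately show "d *\<^sub>C p \<in> {(x \<otimes>\<^sub>h y, x' \<otimes>\<^sub>h y') | x x' y y'. (x, x') \<in> P \<and> (y, y') \<in> Q}" using p(3) by blast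
qed

lemma graph_tensor_gen: "(x, x') \<in> P \<Longrightarrow> (y, y') \<in> Q \<Longrightarrow> (x \<otimes>\<^sub>h y, x' \<otimes>\<^sub>h y') \<in> graph_tensor P Q"
  unfolding graph_tensor_def by (rule closure_span_mem) blast

lemma bounded_linear_cinner_left: "bounded_linear (\<lambda>x. cinner x y)"
  using bounded_bilinear.bounded_linear_left[OF bounded_bilinear_cinner] .

lemma graph_tensor_symmetric:
  assumes P: "sa_graph P" and Q: "sa_graph Q" and uv: "(u, v) \<in> graph_tensor P Q" and xy: "(x, y) \<in> graph_tensor P Q"
  shows "cinner u y = cinner v x"
proof -
  let ?G = "{(x \<otimes>\<^sub>h y, x' \<otimes>\<^sub>h y') | x x' y y'. (x, x') \<in> P \<and> (y, y') \<in> Q}"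
  have z: "subspace {0 :: complex}" by (auto simp: subspace_def)
  have 1: "cinner (fst p) (snd q) - cinner (snd p) (fst q) = 0" if p: "p \<in> ?G" and q: "q \<in> closure (span ?G)" for p q
  proof -
    have "cinner (fst p) (snd q) - cinner (snd p) (fst q) \<in> {0}"
    proof (rule closure_span_image_subset[OF _ z _ _ q])
      show "bounded_linear (\<lambda>q. cinner (fst p) (snd q) - cinner (snd p) (fst q))"
        by (intro bounded_linear_sub bounded_linear_compose[OF bounded_linear_cinner_right] bounded_linear_fst bounded_linear_snd)
      fix q assume "q \<in> ?G"
      with p obtain a a' b b' e e' f f' where *: "p = (a \<otimes>\<^sub>h b, a' \<otimes>\<^sub>h b')" "(a, a') \<in> P" "(b, b') \<in> Q"
        "q = (e \<otimes>\<^sub>h f, e' \<otimes>\<^sub>h f')" "(e, e') \<in> P" "(f, f') \<in> Q" by blast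
      then show "cinner (fst p) (snd q) - cinner (snd p) (fst q) \<in> {0}"
        using sa_graphD(2)[OF P *(2,5)] sa_graphD(2)[OF Q *(3,6)] by (simp add: cinner_htens)
    qed simp
    then show ?thesis by simp
  qed
  have "cinner (fst p) (snd q) - cinner (snd p) (fst q) \<in> {0}"
    if p: "p \<in> closure (span ?G)" and q: "q \<in> closure (span ?G)" for p q
  proof (rule closure_span_image_subset[OF _ z _ _ p])
    show "bounded_linear (\<lambda>p. cinner (fst p) (snd q) - cinner (snd p) (fst q))"
      by (intro bounded_linear_sub bounded_linear_compose[OF bounded_linear_cinner_left] bounded_linear_fst bounded_linear_snd)
  qed (use 1[OF _ q] in auto)
  from this[OF uv[unfolded graph_tensor_def] xy[unfolded graph_tensor_def]] show ?thesis by simp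
qed

locale graph_pair =
  P: sa_parts P c g s + Q: sa_parts Q c' g' s'
  for P :: "('a::complex_hilbert \<times> 'a) set" and c g s and Q :: "('b::complex_hilbert \<times> 'b) set" and c' g' s' +
  assumes saP: "sa_graph P" and saQ: "sa_graph Q" and injP: "injective_graph P" and injQ: "injective_graph Q"
begin

lemma tot: "ctotal (range (g))" "ctotal (range (g'))"
  by (rule sa_graph_injective[OF saP injP P.sa_parts_axioms], rule sa_graph_injective[OF saQ injQ Q.sa_parts_axioms])

text \<open>Formally \<open>(1 + (P \<otimes> Q)^2) (c \<otimes> c')\<close>: the vector
  \<open>M h\<close> is the sum of \<open>(c \<otimes> c') h\<close> and of its image
  \<open>(s \<otimes> s') h\<close> under the square of \<open>P \<otimes> Q\<close>, so the range
  of \<open>M\<close> lies in that of \<open>1 + (P \<otimes> Q)^2\<close>.\<close>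

definition M where "M = (c \<otimes> c') + (s \<otimes> s')"

lemma M_bops [simp]: "M \<in> bops" and M_adj [simp]: "M\<dagger> = M"
  by (simp_all add: M_def adj_add op_tensor_adj)

lemma square_sum: "c = (c ** c) + (g ** g)" "c' = (c' ** c') + (g' ** g')"
  "s = (s ** s) + (g ** g)" "s' = (s' ** s') + (g' ** g')"
  by (simp_all add: P.gg Q.gg P.s_eq Q.s_eq blinfun_compose_diff)

lemma ctotal_gg: "ctotal (range ((g \<otimes> g')))"
proof (rule ctotal_mono[OF ctotal_htens[OF tot]], clarify)
  fix x y
  show "g x \<otimes>\<^sub>h g' y \<in> range ((g \<otimes> g'))"
    by (rule range_eqI[of _ _ "x \<otimes>\<^sub>h y"]) simp
qed

text \<open>By \<open>square_sum\<close> each of \<open>c\<close>, \<open>s\<close>,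
  \<open>c'\<close>, \<open>s'\<close> is its own square plus \<open>g g\<close> or
  \<open>g' g'\<close>, so both summands of \<open>M\<close> dominate the square of
  \<open>g \<otimes> g'\<close>. A vector orthogonal to the range of \<open>M\<close> is therefore
  annihilated by \<open>g \<otimes> g'\<close>, which is self-adjoint with total range.\<close>

lemma ctotal_M: "ctotal (range (M))"
  unfolding ctotal_def
proof (intro allI impI)
  fix h assume h: "\<forall>x\<in>range (M). cinner x h = 0"
  have sq: "Re (cinner ((R \<otimes> T) x) x) \<ge> (norm ((A \<otimes> B) x))\<^sup>2"
    if R: "R = (C ** C) + (A ** A)" and T: "T = (D ** D) + (B ** B)" and b: "A \<in> bops" "B \<in> bops" "C \<in> bops" "D \<in> bops"
      and ad: "A\<dagger> = A" "B\<dagger> = B" "C\<dagger> = C" "D\<dagger> = D"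
    for R A C :: "'a \<Rightarrow>\<^sub>L 'a" and T B D :: "'b \<Rightarrow>\<^sub>L 'b" and x
  proof -
    have pos: "cinner (((A ** A) \<otimes> (B ** B)) x) x = complex_of_real ((norm ((A \<otimes> B) x))\<^sup>2)"
      if "A \<in> bops" "B \<in> bops" "A\<dagger> = A" "B\<dagger> = B" for A :: "'a \<Rightarrow>\<^sub>L 'a" and B :: "'b \<Rightarrow>\<^sub>L 'b"
    proof -
      have ab: "(A \<otimes> B) \<in> bops" using that by simp
      have "(A ** A) \<otimes> (B ** B) = (A \<otimes> B)\<dagger> ** A \<otimes> B" using that by (simp add: op_tensor_adj op_tensor_compose)
      then show ?thesis using cinner_adj_left[OF ab, of "(A \<otimes> B) x" x] by (simp add: cinner_norm)
    qed
    have "R \<otimes> T = ((C ** C) \<otimes> (D ** D)) + ((C ** C) \<otimes> (B ** B)) + ((A ** A) \<otimes> (D ** D)) + ((A ** A) \<otimes> (B ** B))"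
      unfolding R T using b by (simp add: op_tensor_add_left op_tensor_add_right algebra_simps)
    then have "Re (cinner ((R \<otimes> T) x) x) = (norm ((C \<otimes> D) x))\<^sup>2 + (norm ((C \<otimes> B) x))\<^sup>2
        + (norm ((A \<otimes> D) x))\<^sup>2 + (norm ((A \<otimes> B) x))\<^sup>2"
      using b ad by (simp only: blinfun.add_left cinner_add_left pos plus_complex.simps Re_complex_of_real)
    then show ?thesis using zero_le_power2[of "norm ((C \<otimes> D) x)"]
        zero_le_power2[of "norm ((C \<otimes> B) x)"] zero_le_power2[of "norm ((A \<otimes> D) x)"] by linarith
  qed
  have "cinner (M h) h = 0" using h by blast
  then have "Re (cinner ((c \<otimes> c') h) h) + Re (cinner ((s \<otimes> s') h) h) = 0"
    by (simp add: M_def blinfun.add_left cinner_add_left complex_eq_iff)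
  moreover have "Re (cinner ((c \<otimes> c') h) h) \<ge> (norm ((g \<otimes> g') h))\<^sup>2"
    by (rule sq[OF square_sum(1,2)]) simp_all
  moreover have "Re (cinner ((s \<otimes> s') h) h) \<ge> (norm ((g \<otimes> g') h))\<^sup>2"
    by (rule sq[OF square_sum(3,4)]) simp_all
  ultimately have "(norm ((g \<otimes> g') h))\<^sup>2 \<le> 0"
    using zero_le_power2[of "norm ((g \<otimes> g') h)"] by linarith
  then have g0: "(g \<otimes> g') h = 0" by simp
  show "h = 0"
  proof (rule ctotalD[OF ctotal_gg], clarify)
    fix x
    have "(g \<otimes> g')\<dagger> = g \<otimes> g'" by (simp add: op_tensor_adj)
    then show "cinner ((g \<otimes> g') x) h = 0"
      using cinner_adj_left[of "g \<otimes> g'" x h] g0 by simp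
  qed
qed

abbreviation "PQ \<equiv> graph_tensor P Q"

lemma csubspace_PQ: "csubspace PQ" and closed_PQ: "closed PQ"
  using closed_csubspace_span[OF sa_graphD(1)[OF saP]] by (auto simp: graph_tensor_def)

lemma tensor_graph_mem:
  fixes R R' :: "'c::complex_hilbert \<Rightarrow>\<^sub>L 'a" and T T' :: "'d::complex_hilbert \<Rightarrow>\<^sub>L 'b"
  assumes "R \<in> bops" "R' \<in> bops" "T \<in> bops" "T' \<in> bops"
    "\<And>h. (R h, R' h) \<in> P" "\<And>h. (T h, T' h) \<in> Q"
  shows "((R \<otimes> T) h, (R' \<otimes> T') h) \<in> PQ"
proof (rule closure_span_image_subset[where f = "\<lambda>h. ((R \<otimes> T) h, (R' \<otimes> T') h)"])
  show "bounded_linear (\<lambda>h. ((R \<otimes> T) h, (R' \<otimes> T') h))"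
    by (intro bounded_linear_Pair blinfun.bounded_linear_right)
  show "subspace PQ" by (simp add: graph_tensor_def subspace_closure_span)
  show "h \<in> closure (span {x \<otimes>\<^sub>h y | x y. True})" unfolding htens_total by simp
  fix u :: "('c, 'd) htensor" assume "u \<in> {x \<otimes>\<^sub>h y | x y. True}"
  then obtain x y where u: "u = x \<otimes>\<^sub>h y" by blast
  show "((R \<otimes> T) u, (R' \<otimes> T') u) \<in> PQ"
    using graph_tensor_gen[OF assms(5)[of x] assms(6)[of y]] by (simp add: u assms(1-4))
qed (rule closed_PQ)

end

context sa_parts
begin

lemma commute_parts:
  assumes T: "T \<in> bops" and G: "\<And>u v. (u, v) \<in> G \<Longrightarrow> (T u, T v) \<in> G"
  shows "c ** T = T ** c" "g ** T = T ** g" "s ** T = T ** s"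
proof -
  have "c (T h) = T (c h) \<and> g (T h) = T (g h) \<and> s (T h) = T (s h)" for h
    using parts_unique[OF G[OF cg[of h]] G[OF gs[of h]]] sum_apply[of h] by (simp flip: blinfun.add_right)
  then show "c ** T = T ** c" "g ** T = T ** g" "s ** T = T ** s" by (auto intro: blinfun_eqI)
qed

end

context graph_pair
begin

lemma tensor_parts:
  "((c \<otimes> c') h, (g \<otimes> g') h) \<in> PQ"
  "((g \<otimes> g') h, (s \<otimes> s') h) \<in> PQ"
  by (rule tensor_graph_mem; simp add: P.cg Q.cg P.gs Q.gs)+

text \<open>Surjectivity of \<open>1 + (P \<otimes> Q)^2\<close>: its range contains the dense range
  of \<open>M\<close>, and it is closed because \<open>symmetric_graph_norm\<close> controls all
  three components by their sum.\<close>

lemma sa_graph_PQ: "sa_graph PQ"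
proof -
  let ?D = "{h. \<exists>y y' y''. (y, y') \<in> PQ \<and> (y', y'') \<in> PQ \<and> h = y + y''}"
  have cs: "csubspace (range (M))"
    unfolding csubspace_def
  proof (intro conjI ballI allI; clarify?)
    show "0 \<in> range (M)" by (rule range_eqI[of _ _ 0]) simp
    fix x y d
    show "M x + M y \<in> range (M)" by (rule range_eqI[of _ _ "x + y"]) (simp add: blinfun.add_right)
    show "d *\<^sub>C M x \<in> range (M)" by (rule range_eqI[of _ _ "d *\<^sub>C x"]) (simp add: bops_scaleC)
  qed
  have "range (M) \<subseteq> ?D"
    using tensor_parts by (fastforce simp: M_def blinfun.add_left)
  moreover have "closed ?D" unfolding closed_sequential_limits
  proof (intro allI impI, elim conjE)
    fix f l assume f: "\<forall>n. f n \<in> ?D" and l: "f \<longlonglongrightarrow> l"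
    obtain y y' y'' where y: "\<And>n. (y n, y' n) \<in> PQ" "\<And>n. (y' n, y'' n) \<in> PQ" "\<And>n. f n = y n + y'' n"
      using f by simp metis
    note sym = graph_tensor_symmetric[OF saP saQ]
    have d: "(y m - y n, y' m - y' n) \<in> PQ" "(y' m - y' n, y'' m - y'' n) \<in> PQ" for m n
      using csubspace_diff[OF csubspace_PQ] y by (metis diff_Pair)+
    have e: "(y m - y n) + (y'' m - y'' n) = f m - f n" for m n by (simp add: y(3))
    note nb = symmetric_graph_norm[OF sym d, unfolded e]
    have "Cauchy f" using l LIMSEQ_imp_Cauchy by blast
    then have ex: "\<exists>N. \<forall>m\<ge>N. \<forall>n\<ge>N. norm (f m - f n) < e" if "e > 0" for e using that by (simp add: Cauchy_iff)
    have "Cauchy z" if "\<And>m n. norm (z m - z n) \<le> norm (f m - f n)" for z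
      unfolding Cauchy_iff
    proof (intro allI impI)
      fix e :: real assume "e > 0"
      then obtain N where "\<forall>m\<ge>N. \<forall>n\<ge>N. norm (f m - f n) < e" using ex by blast
      then show "\<exists>N. \<forall>m\<ge>N. \<forall>n\<ge>N. norm (z m - z n) < e" using that le_less_trans by blast
    qed
    from this[OF nb(1)] this[OF nb(2)] this[OF nb(3)] obtain a a' a'' where a: "y \<longlonglongrightarrow> a" "y' \<longlonglongrightarrow> a'" "y'' \<longlonglongrightarrow> a''"
      unfolding Cauchy_convergent_iff convergent_def by blast
    have "(a, a') \<in> PQ" by (rule closed_sequentially[OF closed_PQ, of "\<lambda>n. (y n, y' n)"]) (use y a in \<open>auto intro: tendsto_Pair\<close>)
    moreover have "(a', a'') \<in> PQ" by (rule closed_sequentially[OF closed_PQ, of "\<lambda>n. (y' n, y'' n)"]) (use y a in \<open>auto intro: tendsto_Pair\<close>)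
    moreover have "l = a + a''"
      by (rule LIMSEQ_unique[OF l]) (use tendsto_add[OF a(1,3)] in \<open>simp add: y(3)[symmetric]\<close>)
    ultimately show "l \<in> ?D" by blast
  qed
  ultimately have "closure (range (M)) \<subseteq> ?D" by (rule closure_minimal)
  then have "?D = UNIV" using csubspace_dense[OF cs ctotal_M] by blast
  then show ?thesis unfolding sa_graph_def using csubspace_PQ graph_tensor_symmetric[OF saP saQ] by blast
qed

lemma injective_graph_PQ: "injective_graph PQ"
  unfolding injective_graph_def
proof (intro conjI allI impI)
  note tot2 = ctotal_htens[OF tot]
  fix y assume y: "(y, 0) \<in> PQ"
  show "y = 0"
  proof (rule ctotalD[OF tot2], clarify)
    fix u v
    have "(c u \<otimes>\<^sub>h c' v, g u \<otimes>\<^sub>h g' v) \<in> PQ"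
      by (rule graph_tensor_gen[OF P.cg Q.cg])
    from graph_tensor_symmetric[OF saP saQ y this]
    show "cinner (g u \<otimes>\<^sub>h g' v) y = 0" by (simp add: cinner_flip_zero)
  qed
next
  note tot2 = ctotal_htens[OF tot]
  fix y assume y: "(0, y) \<in> PQ"
  show "y = 0"
  proof (rule ctotalD[OF tot2], clarify)
    fix u v
    have "(g u \<otimes>\<^sub>h g' v, s u \<otimes>\<^sub>h s' v) \<in> PQ"
      by (rule graph_tensor_gen[OF P.gs Q.gs])
    from graph_tensor_symmetric[OF saP saQ y this]
    show "cinner (g u \<otimes>\<^sub>h g' v) y = 0" by (simp add: cinner_flip_zero)
  qed
qed

lemma M_cancel:
  assumes "X \<in> bops" "Y \<in> bops" "M ** X ** M = M ** Y ** M" shows "X = Y"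
proof (rule bops_eq_on_total[OF ctotal_M assms(1,2)], clarify)
  fix v
  show "X (M v) = Y (M v)"
  proof -
    have "X (M v) - Y (M v) = 0"
    proof (rule ctotalD[OF ctotal_M], clarify)
      fix u
      have "cinner (M u) (X (M v)) = cinner (M u) (Y (M v))"
        using arg_cong[OF assms(3), of "\<lambda>T. cinner u (T v)"]
          cinner_adj_left[OF M_bops, of u] by simp
      then show "cinner (M u) (X (M v) - Y (M v)) = 0" by (simp add: cinner_diff_right)
    qed
    then show ?thesis by simp
  qed
qed

end

locale graph_pair_parts = graph_pair P c g s Q c' g' s' + R: sa_parts PQ C K S
  for P :: "('a::complex_hilbert \<times> 'a) set" and c g s and Q :: "('b::complex_hilbert \<times> 'b) set" and c' g' s' C K S
begin

lemma parts_M: "C ** M = c \<otimes> c'" "K ** M = g \<otimes> g'" "S ** M = s \<otimes> s'"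
  using R.parts_unique[OF tensor_parts] by (auto intro!: blinfun_eqI simp: M_def blinfun.add_left)

lemma M_parts: "M ** C = c \<otimes> c'" "M ** K = g \<otimes> g'" "M ** S = s \<otimes> s'"
  using parts_M[THEN arg_cong[of _ _ adj]] by (simp_all add: adj_compose op_tensor_adj)

text \<open>The parts \<open>C\<close>, \<open>K\<close>, \<open>S\<close> of
  \<open>P \<otimes> Q\<close> are not given as elementary tensors, but their products with
  \<open>M\<close> are (\<open>parts_M\<close>, \<open>M_parts\<close>). The equation is therefore
  checked after multiplication by \<open>M\<close> on both sides, and \<open>M\<close> is
  cancelled.\<close>

lemma smoothing_tensor:
  assumes b: "b \<in> bops" "d \<in> bops" "a \<in> bops" "e \<in> bops"
    and eq: "((s ** b ** c) \<otimes> (s' ** d ** c')) + ((c ** b ** s) \<otimes> (c' ** d ** s')) =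
      (g ** a ** g) \<otimes> (g' ** e ** g')"
  shows "(S ** b \<otimes> d ** C) + (C ** b \<otimes> d ** S) = K ** a \<otimes> e ** K"
proof (rule M_cancel)
  have *: "M ** (A ** B ** A') ** M = (M ** A) ** B ** (A' ** M)" for A B A'
    by (simp only: compose_assoc)
  show "M ** ((S ** b \<otimes> d ** C) + (C ** b \<otimes> d ** S)) ** M = M ** (K ** a \<otimes> e ** K) ** M"
    unfolding blinfun_compose_add * parts_M M_parts
    using b by (simp only: op_tensor_compose P.bops Q.bops bops_intros eq)
qed (use b in auto)

text \<open>Since \<open>s c = g g\<close> in either factor, tensoring with 1 turns the equations
  for \<open>P\<close> and for \<open>Q\<close> into equations for \<open>P \<otimes> Q\<close>. As
  \<open>W\<close> commutes with \<open>C\<close>, \<open>K\<close> and \<open>S\<close>, the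
  difference \<open>X\<close> of \<open>W (b \<otimes> 1) W\<dagger>\<close> and
  \<open>1 \<otimes> b'\<close> solves the homogeneous equation and vanishes by
  \<open>smoothing_unique\<close>.\<close>

lemma smoothing_intertwines:
  assumes W: "unitary W" and inv: "\<And>u v. (u, v) \<in> PQ \<Longrightarrow> (W u, W v) \<in> PQ"
    and a: "a \<in> bops" "a' \<in> bops" and eq: "W ** a \<otimes> \<one> = \<one> \<otimes> a' ** W"
    and b: "b \<in> bops" "b' \<in> bops" "s ** b ** c + c ** b ** s = g ** a ** g"
      "s' ** b' ** c' + c' ** b' ** s' = g' ** a' ** g'"
  shows "W ** b \<otimes> \<one> = \<one> \<otimes> b' ** W"
proof -
  note WD = unitaryD[OF W]
  have com: "C ** W = W ** C" "K ** W = W ** K" "S ** W = W ** S"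
    by (rule R.commute_parts[OF WD(1)], erule inv)+
  have com': "A ** W\<dagger> = W\<dagger> ** A" if "A ** W = W ** A" "A \<in> bops" "A\<dagger> = A" for A
    using arg_cong[OF that(1), of adj, unfolded adj_compose[OF that(2) WD(1)] adj_compose[OF WD(1) that(2)] that(3)] by (rule sym)
  note comd = com(1)[THEN com', OF R.bops(1) R.adj(1)] com(2)[THEN com', OF R.bops(2) R.adj(2)] com(3)[THEN com', OF R.bops(3) R.adj(3)]
  have 1: "(S ** b \<otimes> \<one> ** C) + (C ** b \<otimes> \<one> ** S) = K ** a \<otimes> \<one> ** K"
  proof (rule smoothing_tensor)
    have "s' ** c' = g' ** g'" "c' ** s' = g' ** g'" using Q.gg by (simp_all add: Q.s_eq blinfun_compose_diff)
    then show "((s ** b ** c) \<otimes> (s' ** \<one> ** c')) + ((c ** b ** s) \<otimes> (c' ** \<one> ** s')) =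
      (g ** a ** g) \<otimes> (g' ** \<one> ** g')"
      using a b by (simp add: op_tensor_add_left[symmetric])
  qed (use a b in auto)
  have 2: "(S ** \<one> \<otimes> b' ** C) + (C ** \<one> \<otimes> b' ** S) = K ** \<one> \<otimes> a' ** K"
  proof (rule smoothing_tensor)
    have "s ** c = g ** g" "c ** s = g ** g" using P.gg by (simp_all add: P.s_eq blinfun_compose_diff)
    then show "((s ** \<one> ** c) \<otimes> (s' ** b' ** c')) + ((c ** \<one> ** s) \<otimes> (c' ** b' ** s')) =
      (g ** \<one> ** g) \<otimes> (g' ** a' ** g')"
      using a b by (simp add: op_tensor_add_right[symmetric])
  qed (use a b in auto)
  define X where "X = (W ** b \<otimes> \<one> ** W\<dagger>) - (\<one> \<otimes> b')"
  have mv: "A ** (W ** B ** W\<dagger>) ** A' = W ** (A ** B ** A') ** W\<dagger>"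
    if "A ** W = W ** A" "A' ** W\<dagger> = W\<dagger> ** A'" for A A' B
    using that(1) that(2)[symmetric] compose_square[OF that(1)] by (simp add: compose_assoc)
  have aW: "W ** a \<otimes> \<one> ** W\<dagger> = \<one> \<otimes> a'"
    unfolding eq by (simp add: compose_assoc WD)
  have d: "(A - B) + (A' - B') = (A + A') - (B + B')" for A B A' B' :: "('a, 'b) hop" by simp
  have "X = 0"
  proof (rule R.smoothing_unique)
    show "X \<in> bops" using b WD(1) by (simp add: X_def)
    have "S ** X ** C + C ** X ** S =
        (W ** ((S ** b \<otimes> \<one> ** C) + (C ** b \<otimes> \<one> ** S)) ** W\<dagger>) -
        ((S ** \<one> \<otimes> b' ** C) + (C ** \<one> \<otimes> b' ** S))"
      unfolding X_def blinfun_compose_diff blinfun_compose_add d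
      by (simp only: mv[OF com(3) comd(1)] mv[OF com(1) comd(3)] R.bops R.adj)
    also have "\<dots> = 0"
      unfolding 1 2 mv[OF com(2) comd(2), symmetric] aW by simp
    finally show "S ** X ** C + C ** X ** S = 0" .
    show "ctotal (range (K))" by (rule sa_graph_injective[OF sa_graph_PQ injective_graph_PQ R.sa_parts_axioms])
  qed
  then have "W ** b \<otimes> \<one> ** W\<dagger> = \<one> \<otimes> b'" by (simp add: X_def)
  then have "(W ** b \<otimes> \<one> ** W\<dagger>) ** W = \<one> \<otimes> b' ** W" by simp
  then show ?thesis by (simp add: compose_assoc WD)
qed

end

subsection \<open>Invariance under a modular multiplicative unitary\<close>

definition slice_left :: "('a::complex_hilbert, 'b::complex_hilbert) hop \<Rightarrow> 'a \<Rightarrow> 'a \<Rightarrow> ('b \<Rightarrow>\<^sub>L 'b)" where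
  "slice_left W x z = (lins x)\<dagger> ** W ** lins z"

lemma slice_left_bops [simp, intro]: "W \<in> bops \<Longrightarrow> slice_left W x z \<in> bops"
  by (simp add: slice_left_def)

lemma cinner_slice_left: "cinner y ((slice_left W x z) u) = cinner (x \<otimes>\<^sub>h y) (W (z \<otimes>\<^sub>h u))"
  by (simp add: slice_left_def cinner_adj_right[OF lins_bops])

lemma to_conj_add: "to_conj (x + y) = to_conj x + to_conj y" and to_conj_scaleC: "to_conj (c *\<^sub>C x) = cnj c *\<^sub>C to_conj x"
  and cinner_to_conj: "cinner (to_conj x) (to_conj y) = cinner y x" and norm_to_conj: "norm (to_conj x) = norm x"
  by (transfer, simp)+

lemma ctotal_to_conj: "ctotal S \<Longrightarrow> ctotal (to_conj ` S)"
  unfolding ctotal_def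
proof (intro allI impI)
  fix y assume S: "\<forall>y. (\<forall>x\<in>S. cinner x y = 0) \<longrightarrow> y = 0" and y: "\<forall>x\<in>to_conj ` S. cinner x y = 0"
  have "cinner x (of_conj y) = 0" if "x \<in> S" for x
  proof -
    have "cinner (to_conj x) (to_conj (of_conj y)) = 0" using y that by (simp add: of_conj_inverse)
    then show ?thesis by (simp add: cinner_to_conj cinner_flip_zero)
  qed
  then have "of_conj y = 0" using S by blast
  then show "y = 0" by (metis of_conj_inverse zero_conj_space_def)
qed

lemma ctotal_range_g: "sa_graph G \<Longrightarrow> injective_graph G \<Longrightarrow> ctotal {y. \<exists>x z. (x, y) \<in> G \<and> (y, z) \<in> G}"
proof -
  assume G: "sa_graph G" "injective_graph G"
  obtain c g s where P: "sa_parts G c g s" using sa_parts_exist[OF G(1)] by blast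
  show ?thesis by (rule ctotal_mono[OF sa_graph_injective[OF G P]]) (use sa_parts.cg[OF P] sa_parts.gs[OF P] in blast)
qed

section \<open>Slices of a modular multiplicative unitary\<close>

locale modular_data =
  fixes W :: "('h::complex_hilbert, 'h) hop" and P Q :: "('h \<times> 'h) set"
    and Wt :: "('h conj_space, 'h) htensor \<Rightarrow>\<^sub>L ('h conj_space, 'h) htensor"
  assumes mult: "multiplicative W" and P: "pos_self_adjoint P" "trivial_kernel P" and Q: "pos_self_adjoint Q" "trivial_kernel Q"
    and Wt: "unitary Wt"
    and inv_eq: "{(\<xi>, (W\<dagger>) \<eta>) | \<xi> \<eta>. (W \<xi>, \<eta>) \<in> graph_tensor P Q} = graph_tensor P Q"
    and coeff: "\<And>x z y y' u u'. (y, y') \<in> Q \<Longrightarrow> (u', u) \<in> Q \<Longrightarrow>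
       cinner (x \<otimes>\<^sub>h y) (W (z \<otimes>\<^sub>h u)) = cinner (to_conj z \<otimes>\<^sub>h y') (Wt (to_conj x \<otimes>\<^sub>h u'))"

lemma modular_dataI:
  fixes W :: "('a::complex_hilbert, 'a) hop"
  assumes "modular_multiplicative W" obtains P Q Wt where "modular_data W P Q Wt"
  using assms unfolding modular_multiplicative_def
proof (elim conjE exE)
  fix P Q :: "('a \<times> 'a) set" and Wt :: "('a conj_space, 'a) htensor \<Rightarrow>\<^sub>L ('a conj_space, 'a) htensor"
  assume *: "multiplicative W" "pos_self_adjoint P" "trivial_kernel P" "pos_self_adjoint Q" "trivial_kernel Q" "unitary Wt"
    "{(\<xi>, (W\<dagger>) \<eta>) | \<xi> \<eta>. (W \<xi>, \<eta>) \<in> graph_tensor P Q} = graph_tensor P Q"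
    "\<forall>x z y y' u u'. (y, y') \<in> Q \<longrightarrow> (u, u') \<in> converse Q \<longrightarrow>
       cinner (x \<otimes>\<^sub>h y) (W (z \<otimes>\<^sub>h u)) = cinner (to_conj z \<otimes>\<^sub>h y') (Wt (to_conj x \<otimes>\<^sub>h u'))"
  have "modular_data W P Q Wt" by (rule modular_data.intro) (rule * | use *(8) in simp)+
  then show thesis by (rule that)
qed

context modular_data
begin

lemma unitary_W: "unitary W" using mult by (simp add: multiplicative_def)

lemmas W_bops [simp] = unitaryD(1)[OF unitary_W]
lemmas Wt_bops [simp] = unitaryD(1)[OF Wt]

lemma graphs: "sa_graph P" "sa_graph Q" "injective_graph P" "injective_graph Q"
  using P Q by (auto intro: sa_graph_pos_self_adjoint injective_graph_pos_self_adjoint)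

lemma W_preserves:
  assumes uv: "(u, v) \<in> graph_tensor P Q" shows "(W u, W v) \<in> graph_tensor P Q"
proof -
  from uv obtain \<eta> where "v = (W\<dagger>) \<eta>" "(W u, \<eta>) \<in> graph_tensor P Q"
    by (subst (asm) inv_eq[symmetric]) blast
  then show ?thesis by (simp add: unitaryD[OF unitary_W])
qed

abbreviation "T \<equiv> slice_left W"
abbreviation "S z x \<equiv> slice_left Wt (to_conj z) (to_conj x)"

lemma coeff_slices: "(y, y') \<in> Q \<Longrightarrow> (u, u') \<in> Q \<Longrightarrow> cinner y (T x z u') = cinner y' (S z x u)"
  unfolding cinner_slice_left by (rule coeff)

text \<open>The coefficient relation says that \<open>S z x v\<close> is in the domain of the
  adjoint of \<open>Q\<close> with value \<open>T x z (Q v)\<close>, and \<open>Q\<close> is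
  self-adjoint. Formally, \<open>S z x = Q\<inverse> (T x z) Q\<close>.\<close>

lemma slices_graph: "(v, v') \<in> Q \<Longrightarrow> (S z x v, T x z v') \<in> Q"
proof -
  assume v: "(v, v') \<in> Q"
  have "((S z x) v, (T x z) v') \<in> adj_graph Q"
    unfolding adj_graph_def using coeff_slices[OF _ v] by (auto intro: cinner_swap_eq[symmetric])
  then show ?thesis using Q(1) by (simp add: pos_self_adjoint_def)
qed

text \<open>Invariance of \<open>P \<otimes> Q\<close> under \<open>W\<close> compares coefficients
  of \<open>T x (P z)\<close> with those of \<open>T (P x) z\<close>, up to \<open>Q\<close> in the
  second leg, and \<open>coeff_slices\<close> removes this \<open>Q\<close>. The result links
  \<open>Wt\<close> to \<open>W\<close> through \<open>P\<close> alone.\<close>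

lemma slices_eq:
  assumes z: "(z, z') \<in> P" and x: "(x, x') \<in> P" shows "S z' x = T x' z"
proof (rule bops_eq_on_total[OF ctotal_range_g[OF graphs(2,4)]], safe?)
  fix v v1 v2 assume v: "(v1, v) \<in> Q" "(v, v2) \<in> Q"
  have "(S z' x) v - T x' z v = 0"
  proof (rule ctotalD[OF ctotal_range_g[OF graphs(2,4)]], safe)
    fix y' y y2 assume y: "(y, y') \<in> Q" "(y', y2) \<in> Q"
    have "(W (z \<otimes>\<^sub>h v), W (z' \<otimes>\<^sub>h v2)) \<in> graph_tensor P Q"
      by (intro W_preserves graph_tensor_gen z v)
    from graph_tensor_symmetric[OF graphs(1,2) graph_tensor_gen[OF x y(1)] this]
    have "cinner y (T x z' v2) = cinner y' (T x' z v)" by (simp add: cinner_slice_left)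
    then show "cinner y' ((S z' x) v - T x' z v) = 0"
      using coeff_slices[OF y(1) v(2), of x z'] by (simp add: cinner_diff_right)
  qed
  then show "(S z' x) v = T x' z v" by simp
qed auto

lemma slice_intertwines:
  assumes "b \<in> bops" "b' \<in> bops" "W ** b \<otimes> \<one> = \<one> \<otimes> b' ** W"
  shows "b' (T x z v) = T x (b z) v"
proof (rule cinner_ext)
  fix y
  have "cinner y (b' (T x z v)) = cinner ((b'\<dagger>) y) (T x z v)" by (simp add: cinner_adj_left assms)
  also have "\<dots> = cinner (((\<one> \<otimes> b')\<dagger>) (x \<otimes>\<^sub>h y)) (W (z \<otimes>\<^sub>h v))"
    by (simp add: cinner_slice_left op_tensor_adj assms)
  also have "\<dots> = cinner (x \<otimes>\<^sub>h y) ((\<one> \<otimes> b' ** W) (z \<otimes>\<^sub>h v))" by (simp add: cinner_adj_left assms)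
  also have "\<dots> = cinner y (T x (b z) v)" by (simp add: assms(3)[symmetric] cinner_slice_left assms(1))
  finally show "cinner y (b' (T x z v)) = cinner y (T x (b z) v)" .
qed

lemma intertwines_smoothing:
  assumes a: "a \<in> bops" "a' \<in> bops" and eq: "W ** a \<otimes> \<one> = \<one> \<otimes> a' ** W" and Qp: "sa_parts Q c' g' s'"
  shows "\<exists>b\<in>bops. \<exists>b'\<in>bops. W ** b \<otimes> \<one> = \<one> \<otimes> b' ** W \<and>
    s' ** b' ** c' + c' ** b' ** s' = g' ** a' ** g'"
proof -
  obtain c g s where Pp: "sa_parts P c g s" using sa_parts_exist[OF graphs(1)] by blast
  interpret PQ: graph_pair P c g s Q c' g' s'
    by (intro graph_pair.intro graph_pair_axioms.intro Pp Qp graphs)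
  obtain C K S' where R: "sa_parts (graph_tensor P Q) C K S'" using sa_parts_exist[OF PQ.sa_graph_PQ] by blast
  interpret graph_pair_parts P c g s Q c' g' s' C K S'
    by (intro graph_pair_parts.intro PQ.graph_pair_axioms R)
  obtain b where b: "b \<in> bops" "s ** b ** c + c ** b ** s = g ** a ** g" using PQ.P.smoothing_exists[OF a(1)] by blast
  obtain b' where b': "b' \<in> bops" "s' ** b' ** c' + c' ** b' ** s' = g' ** a' ** g'" using PQ.Q.smoothing_exists[OF a(2)] by blast
  show ?thesis using smoothing_intertwines[OF unitary_W W_preserves a eq b(1) b'(1) b(2) b'(2)] b b' by blast
qed

text \<open>Between two slice vectors \<open>a'\<close> is replaced by
  \<open>Q b' Q\<inverse> + Q\<inverse> b' Q\<close>. What \<open>Q\<close> and its inverse do to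
  slices is known from \<open>slices_graph\<close>; in between, \<open>b'\<close> passes into the
  vector \<open>z\<close> by \<open>slice_intertwines\<close>, and \<open>coeff_slices\<close>
  returns to slices of \<open>Wt\<close>.\<close>

lemma intertwines_form:
  assumes a: "a \<in> bops" "a' \<in> bops" and eq: "W ** a \<otimes> \<one> = \<one> \<otimes> a' ** W"
  shows "\<exists>b :: 'h \<Rightarrow>\<^sub>L 'h. b \<in> bops \<and> (\<forall>z1 z2 x1 x2 v1 v2. z1 \<in> Range P \<longrightarrow> z2 \<in> Range P \<longrightarrow> x1 \<in> Domain P \<longrightarrow> x2 \<in> Domain P \<longrightarrow>
     v1 \<in> {y. \<exists>x z. (x, y) \<in> Q \<and> (y, z) \<in> Q} \<longrightarrow> v2 \<in> {y. \<exists>x z. (x, y) \<in> Q \<and> (y, z) \<in> Q} \<longrightarrow>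
     cinner (S z1 x1 v1) (a' (S z2 x2 v2)) = cinner (S z1 x1 v1) (S (b z2) x2 v2) + cinner (S ((b\<dagger>) z1) x1 v1) (S z2 x2 v2))"
proof -
  obtain c g s where Qp: "sa_parts Q c g s" using sa_parts_exist[OF graphs(2)] by blast
  interpret Q: sa_parts Q c g s by fact
  obtain b b' where b: "b \<in> bops" "b' \<in> bops" "W ** b \<otimes> \<one> = \<one> \<otimes> b' ** W"
    and sm: "s ** b' ** c + c ** b' ** s = g ** a' ** g" using intertwines_smoothing[OF a eq Qp] by blast
  have bd: "W ** b\<dagger> \<otimes> \<one> = \<one> \<otimes> b'\<dagger> ** W"
  proof -
    note WD = unitaryD[OF unitary_W]
    have "b\<dagger> \<otimes> \<one> ** W\<dagger> = W\<dagger> ** \<one> \<otimes> b'\<dagger>"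
      using arg_cong[OF b(3), of adj] by (simp add: adj_compose op_tensor_adj b(1,2))
    then have "W ** (b\<dagger> \<otimes> \<one> ** W\<dagger>) ** W = W ** (W\<dagger> ** \<one> \<otimes> b'\<dagger>) ** W" by simp
    then show ?thesis by (simp add: compose_assoc WD compose_absorb[OF WD(2)] compose_absorb[OF WD(3)])
  qed
  note sl = slice_intertwines[OF b] and sld = slice_intertwines[OF adj_bops[OF b(1)] adj_bops[OF b(2)] bd]
  have split: "g (y + y'') = y' \<and> c (y + y'') = y \<and> s (y + y'') = y''" if "(y, y') \<in> Q" "(y', y'') \<in> Q" for y y' y''
    using Q.parts_unique[OF that] by simp
  show ?thesis
  proof (intro exI[of _ b] conjI allI impI b(1))
    fix z1 z2 x1 x2 v1 v2 assume "z1 \<in> Range P" "z2 \<in> Range P" "x1 \<in> Domain P" "x2 \<in> Domain P"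
      and "v1 \<in> {y. \<exists>x z. (x, y) \<in> Q \<and> (y, z) \<in> Q}" "v2 \<in> {y. \<exists>x z. (x, y) \<in> Q \<and> (y, z) \<in> Q}"
    then obtain y1 y2 x1' x2' u1 u2 t1 t2 where P12: "(y1, z1) \<in> P" "(y2, z2) \<in> P" "(x1, x1') \<in> P" "(x2, x2') \<in> P"
      and v: "(u1, v1) \<in> Q" "(v1, t1) \<in> Q" "(u2, v2) \<in> Q" "(v2, t2) \<in> Q" by blast
    define w1 w2 where "w1 = S z1 x1 v1" and "w2 = S z2 x2 v2"
    have w: "w1 = T x1' y1 v1" "w2 = T x2' y2 v2" by (simp_all add: w1_def w2_def slices_eq[OF P12(1,3)] slices_eq[OF P12(2,4)])
    have lo: "((S y1 x1') u1, w1) \<in> Q" "((S y2 x2') u2, w2) \<in> Q"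
      unfolding w by (intro slices_graph v)+
    have hi: "(w1, (T x1 z1) t1) \<in> Q" "(w2, (T x2 z2) t2) \<in> Q"
      unfolding w1_def w2_def by (intro slices_graph v)+
    \<comment> \<open>\<open>w1\<close> is the image under \<open>Q\<close> of a slice vector, and
      \<open>Q w1\<close> is a slice vector too. Hence \<open>w1 = g h1\<close> with
      \<open>c h1\<close> and \<open>s h1\<close> known explicitly; likewise for
      \<open>w2\<close>.\<close>
    define h1 h2 where "h1 = (S y1 x1') u1 + (T x1 z1) t1"
      and "h2 = (S y2 x2') u2 + (T x2 z2) t2"
    note h1 = split[OF lo(1) hi(1), folded h1_def] and h2 = split[OF lo(2) hi(2), folded h2_def]
    have "cinner w1 (a' w2) = cinner (g h1) (a' (g h2))" by (simp add: h1 h2)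
    also have "\<dots> = cinner h1 ((g ** a' ** g) h2)" using cinner_adj_left[OF Q.bops(2), of h1 "a' (g h2)"] by simp
    also have "\<dots> = cinner (s h1) (b' (c h2)) + cinner (c h1) (b' (s h2))"
      unfolding sm[symmetric] using cinner_adj_left[OF Q.bops(3), of h1 "b' (c h2)"] cinner_adj_left[OF Q.bops(1), of h1 "b' (s h2)"]
      by (simp add: blinfun.add_left cinner_add_right)
    also have "cinner (c h1) (b' (s h2)) = cinner w1 (S (b z2) x2 v2)"
      unfolding h1[THEN conjunct2, THEN conjunct1] h2[THEN conjunct2, THEN conjunct2] sl by (rule coeff_slices[OF lo(1) v(4)])
    also have "cinner (s h1) (b' (c h2)) = cinner ((b'\<dagger>) (s h1)) (c h2)" by (simp add: cinner_adj_left b)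
    also have "\<dots> = cinner (S ((b\<dagger>) z1) x1 v1) w2"
      unfolding h1[THEN conjunct2, THEN conjunct2] h2[THEN conjunct2, THEN conjunct1] sld
      by (rule cinner_swap_eq) (rule coeff_slices[OF lo(2) v(2)])
    finally show "cinner (S z1 x1 v1) (a' (S z2 x2 v2)) = cinner (S z1 x1 v1) (S (b z2) x2 v2) + cinner (S ((b\<dagger>) z1) x1 v1) (S z2 x2 v2)"
      by (simp add: w1_def w2_def add.commute)
  qed
qed

text \<open>On the total vectors \<open>Wt (x \<otimes> v)\<close> the form of
  \<open>intertwines_form\<close> becomes an operator identity in which \<open>b\<close> affects
  only the conjugate leg, through \<open>z\<close>. Tested on \<open>z \<otimes> h1\<close> and
  \<open>z \<otimes> h2\<close>, it shows that \<open>a'\<close> is a scalar.\<close>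

theorem intertwines_scalar:
  assumes a: "a \<in> bops" "a' \<in> bops" and eq: "W ** a \<otimes> \<one> = \<one> \<otimes> a' ** W"
  shows "\<exists>\<kappa>. a' = cscale \<kappa> \<one>"
proof (cases "\<exists>z\<in>Range P. z \<noteq> 0")
  case True
  then obtain z where z: "z \<in> Range P" "z \<noteq> 0" by blast
  let ?V = "{y. \<exists>x z. (x, y) \<in> Q \<and> (y, z) \<in> Q}"
  let ?L = "\<lambda>z. (lins (to_conj z) :: 'h \<Rightarrow>\<^sub>L ('h conj_space, 'h) htensor)\<dagger>"
  from intertwines_form[OF a eq] obtain b :: "'h \<Rightarrow>\<^sub>L 'h" where b': "b \<in> bops \<and> (\<forall>z1 z2 x1 x2 v1 v2. z1 \<in> Range P \<longrightarrow>
      z2 \<in> Range P \<longrightarrow> x1 \<in> Domain P \<longrightarrow> x2 \<in> Domain P \<longrightarrow> v1 \<in> ?V \<longrightarrow> v2 \<in> ?V \<longrightarrow>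
      cinner (S z1 x1 v1) (a' (S z2 x2 v2)) = cinner (S z1 x1 v1) (S (b z2) x2 v2) + cinner (S ((b\<dagger>) z1) x1 v1) (S z2 x2 v2))"
    by (rule exE)
  note b = b'[THEN conjunct1] and form = b'[THEN conjunct2, rule_format, OF z(1) z(1)]
  \<comment> \<open>\<open>X = 0\<close> says that \<open>|z><z| \<otimes> a' = (|z><b z| +
    |b\<dagger> z><z|) \<otimes> 1\<close>, with the first leg in the conjugate space.\<close>
  define X where "X = ((?L z)\<dagger> ** a' ** ?L z) - ((?L z)\<dagger> ** ?L (b z)) - ((?L ((b\<dagger>) z))\<dagger> ** ?L z)"
  have X: "X \<in> bops" using a by (auto simp: X_def simp del: adj_adj)
  have cX: "cinner \<xi> (X \<eta>) = cinner ((?L z) \<xi>) (a' (?L z \<eta>)) - cinner ((?L z) \<xi>) (?L (b z) \<eta>)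
      - cinner ((?L ((b\<dagger>) z)) \<xi>) (?L z \<eta>)" for \<xi> \<eta>
    by (simp add: X_def blinfun.diff_left cinner_diff_right cinner_adj_right[OF adj_bops[OF lins_bops]] del: adj_adj)
  let ?E = "{Wt (to_conj x \<otimes>\<^sub>h v) | x v. x \<in> Domain P \<and> v \<in> ?V}"
  have E: "ctotal ?E"
    unfolding ctotal_def
  proof (intro allI impI)
    fix y assume y: "\<forall>x\<in>?E. cinner x y = 0"
    have totc: "ctotal (to_conj ` Domain P)"
      by (intro ctotal_to_conj ctotal_mono[OF ctotal_range_g[OF graphs(1,3)]]) blast
    have "(Wt\<dagger>) y = 0"
    proof (rule ctotalD[OF ctotal_htens[OF totc ctotal_range_g[OF graphs(2,4)]]])
      fix x assume "x \<in> {x \<otimes>\<^sub>h y | x y. x \<in> to_conj ` Domain P \<and> y \<in> ?V}"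
      then have "Wt x \<in> ?E" by blast
      then show "cinner x ((Wt\<dagger>) y) = 0" using y by (simp add: cinner_adj_right)
    qed
    then show "y = 0" using unitaryD(5)[OF Wt, of y] by simp
  qed
  have "X = 0"
  proof (rule bops_eq_on_total[OF E X bops_intros(2)])
    fix \<eta> assume \<eta>: "\<eta> \<in> ?E"
    have "X \<eta> = 0"
    proof (rule ctotalD[OF E])
      fix \<xi> assume "\<xi> \<in> ?E"
      with \<eta> obtain x1 v1 x2 v2 where *: "\<xi> = Wt (to_conj x1 \<otimes>\<^sub>h v1)" "x1 \<in> Domain P" "v1 \<in> ?V"
        "\<eta> = Wt (to_conj x2 \<otimes>\<^sub>h v2)" "x2 \<in> Domain P" "v2 \<in> ?V" by blast
      show "cinner \<xi> (X \<eta>) = 0" using form[OF *(2,5,3,6)] unfolding cX *(1,4) by (simp add: slice_left_def)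
    qed
    then show "X \<eta> = blinfun_apply 0 \<eta>" by simp
  qed
  define n where "n = (complex_of_real (norm z))\<^sup>2"
  have n: "n \<noteq> 0" "cnj n = n" using z(2) by (simp_all add: n_def)
  have "a' = cscale ((cinner z (b z) + cnj (cinner z ((b\<dagger>) z))) / n) \<one>"
  proof (rule cinner_op_ext)
    fix h1 h2
    have "cinner (to_conj z \<otimes>\<^sub>h h1) (X (to_conj z \<otimes>\<^sub>h h2)) = 0" by (simp add: \<open>X = 0\<close>)
    then have "n * (n * cinner h1 (a' h2)) = n * ((cinner z (b z) + cnj (cinner z ((b\<dagger>) z))) * cinner h1 h2)"
      unfolding cX lins_adj_htens cinner_to_conj
      by (simp add: cinner_scaleC_left cinner_scaleC_right bops_scaleC[OF a(2)] cinner_norm n_def[symmetric] n(2) algebra_simps)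
    then have "n * cinner h1 (a' h2) = (cinner z (b z) + cnj (cinner z ((b\<dagger>) z))) * cinner h1 h2"
      using n(1) by (simp only: mult_cancel_left simp_thms)
    then show "cinner h1 (a' h2) = cinner h1 (cscale ((cinner z (b z) + cnj (cinner z ((b\<dagger>) z))) / n) \<one> h2)"
      using n(1) by (simp add: cinner_scaleC_right field_simps)
  qed
  then show ?thesis by blast
next
  case False
  \<comment> \<open>The range of \<open>P\<close> is total, so in this case the whole space is
    zero.\<close>
  have "a' = cscale 0 \<one>"
  proof (rule bops_eq_on_total[OF ctotal_range_g[OF graphs(1,3)] a(2)], safe)
    fix x y z assume "(x, y) \<in> P" then have "y = 0" using False by blast
    then show "a' y = (cscale 0 \<one>) y" by simp
  qed auto
  then show ?thesis by blast
qed

end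

text \<open>The consequence of modularity on which the slicing of \<open>Y\<close> rests. It is
  isolated because it passes to the dual by mere flipping, without producing modularity data for the
  dual unitary.\<close>

definition ergodic :: "('h::complex_hilbert, 'h) hop \<Rightarrow> bool" where
  "ergodic W \<longleftrightarrow> (\<forall>a\<in>bops. W ** a \<otimes> \<one> = \<one> \<otimes> a ** W \<longrightarrow> (\<exists>\<kappa>. a = cscale \<kappa> \<one>))"

lemma ergodic_modular: "modular_multiplicative W \<Longrightarrow> ergodic W"
  unfolding ergodic_def using modular_data.intertwines_scalar modular_dataI by metis

lemma ergodic_dual:
  assumes W: "unitary W" and e: "ergodic W" shows "ergodic (dual W)"
  unfolding ergodic_def
proof (intro ballI impI)
  note WD = unitaryD[OF W]
  fix a :: "'a \<Rightarrow>\<^sub>L 'a" assume a: "a \<in> bops" and eq: "dual W ** a \<otimes> \<one> = \<one> \<otimes> a ** dual W"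
  have f: "flip ** a \<otimes> \<one> = \<one> \<otimes> a ** flip" "flip ** \<one> \<otimes> a = a \<otimes> \<one> ** flip"
    using a by (simp_all add: flip_op_tensor)
  have "flip ** (W\<dagger> ** \<one> \<otimes> a) ** flip = flip ** (a \<otimes> \<one> ** W\<dagger>) ** flip"
    using eq by (simp add: dual_def compose_assoc f(1) compose_square[OF f(1)])
  then have "flip ** (flip ** (W\<dagger> ** \<one> \<otimes> a) ** flip) ** flip = flip ** (flip ** (a \<otimes> \<one> ** W\<dagger>) ** flip) ** flip" by (rule arg_cong)
  then have "W\<dagger> ** \<one> \<otimes> a = a \<otimes> \<one> ** W\<dagger>" by (simp add: compose_assoc)
  then have "W ** (W\<dagger> ** \<one> \<otimes> a) ** W = W ** (a \<otimes> \<one> ** W\<dagger>) ** W" by simp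
  then have "W ** a \<otimes> \<one> = \<one> \<otimes> a ** W" by (simp add: compose_assoc WD compose_absorb[OF WD(3)])
  then show "\<exists>\<kappa>. a = cscale \<kappa> \<one>" using e a unfolding ergodic_def by blast
qed

lemma slice_leg23_rins:
  assumes m: "m \<in> bops" shows "(rins p)\<dagger> ** (leg23 m ** rins q) = \<one> \<otimes> ((rins p)\<dagger> ** (m ** rins q))"
proof (rule htens_op_eqI)
  fix x y
  have e: "(leg23 m) ((x \<otimes>\<^sub>h y) \<otimes>\<^sub>h q) = (lins x \<otimes> \<one>) (m (y \<otimes>\<^sub>h q))"
    using arg_cong[OF leg23_lins[OF m, of x], of "\<lambda>T. T (y \<otimes>\<^sub>h q)"] by simp
  have "(rins p)\<dagger> ** (lins x \<otimes> \<one>) = lins x ** (rins p)\<dagger>" by (rule rins_adj_op_tensor) simp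
  from arg_cong[OF this, of "\<lambda>T. T (m (y \<otimes>\<^sub>h q))"]
  show "((rins p)\<dagger> ** (leg23 m ** rins q)) (x \<otimes>\<^sub>h y) =
      (\<one> \<otimes> ((rins p)\<dagger> ** (m ** rins q))) (x \<otimes>\<^sub>h y)"
    using m by (simp add: e)
qed (use m in auto)

text \<open>Every slice of \<open>Y\<close> in the second leg satisfies the relation in
  \<open>ergodic\<close> and is a scalar \<open>\<kappa> p q\<close>. These scalars are the matrix
  coefficients of \<open>Z\<close>, which is recovered by compressing the first leg with a unit
  vector.\<close>

theorem ergodic_invariant:
  fixes W :: "('h::complex_hilbert, 'h) hop" and Y :: "('h, 'd::complex_hilbert) hop"
  assumes W: "W \<in> bops" "ergodic W" and Y: "Y \<in> bops" and eq: "leg12 W ** leg13 Y = leg23 Y ** leg12 W"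
  shows "\<exists>Z\<in>bops. Y = \<one> \<otimes> Z"
proof -
  have "\<exists>\<kappa>. (rins p)\<dagger> ** (Y ** rins q) = cscale \<kappa> \<one>" for p q
  proof -
    let ?a = "(rins p)\<dagger> ** (Y ** rins q)"
    have c: "(rins p)\<dagger> ** leg12 W = W ** (rins p)\<dagger>" unfolding leg12_def by (rule rins_adj_op_tensor) (rule W)
    have "(rins p)\<dagger> ** (leg12 W ** leg13 Y) ** rins q = W ** ((rins p)\<dagger> ** (leg13 Y ** rins q))"
      by (simp only: compose_square[OF c] compose_assoc)
    moreover have "(rins p)\<dagger> ** (leg23 Y ** leg12 W) ** rins q = ((rins p)\<dagger> ** (leg23 Y ** rins q)) ** W"
      by (simp only: leg12_rins[OF W(1)] compose_assoc)
    ultimately have "W ** ?a \<otimes> \<one> = \<one> \<otimes> ?a ** W"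
      unfolding eq slice_leg13[OF Y] slice_leg23_rins[OF Y] by simp
    then show ?thesis using W(2) Y unfolding ergodic_def by simp
  qed
  then obtain \<kappa> where \<kappa>: "\<And>p q. (rins p)\<dagger> ** (Y ** rins q) = cscale (\<kappa> p q) \<one>" by metis
  have c: "cinner (x \<otimes>\<^sub>h p) (Y (y \<otimes>\<^sub>h q)) = \<kappa> p q * cinner x y" for x y p q
    using arg_cong[OF \<kappa>[of p q], of "\<lambda>T. cinner x (T y)"]
    by (simp add: cinner_adj_right[OF rins_bops] cinner_scaleC_right)
  show ?thesis
  proof (cases "\<exists>x :: 'h. x \<noteq> 0")
    case True
    then obtain x :: 'h where "x \<noteq> 0" by blast
    define e where "e = complex_of_real (inverse (norm x)) *\<^sub>C x"
    have "norm e = 1" using \<open>x \<noteq> 0\<close> by (simp add: e_def norm_scaleC norm_inverse)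
    then have ee: "cinner e e = 1" by (simp add: cinner_norm)
    define Z where "Z = (lins e)\<dagger> ** (Y ** lins e)"
    have Z: "Z \<in> bops" using Y by (simp add: Z_def)
    have cZ: "cinner p (Z q) = \<kappa> p q" for p q by (simp add: Z_def cinner_adj_right[OF lins_bops] c ee)
    have "Y = \<one> \<otimes> Z"
    proof (rule htens_op_eqI[OF Y])
      fix y q
      show "Y (y \<otimes>\<^sub>h q) = (\<one> \<otimes> Z) (y \<otimes>\<^sub>h q)"
        by (rule htens_cinner_ext) (use Z in \<open>simp add: c cZ cinner_htens\<close>)
    qed (use Z in auto)
    then show ?thesis using Z by blast
  next
    case False
    have "Y = \<one> \<otimes> 0"
    proof (rule htens_op_eqI[OF Y])
      fix y :: 'h and q :: 'd
      have "y = 0 *\<^sub>C y" using False by auto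
      then have "y \<otimes>\<^sub>h q = 0" using htens_scaleC_left[of 0 y q] by simp
      then show "Y (y \<otimes>\<^sub>h q) = (\<one> \<otimes> 0) (y \<otimes>\<^sub>h q)" by simp
    qed auto
    then show ?thesis using bops_intros(2) by blast
  qed
qed

subsection \<open>The C*-algebra of a modular multiplicative unitary\<close>

definition slices :: "('a::complex_hilbert, 'b::complex_hilbert) hop \<Rightarrow> ('b \<Rightarrow>\<^sub>L 'b) set" where
  "slices W = closure (span {slice_left W x z | x z. True})"

lemma slices_gen: "slice_left W x z \<in> slices W"
  unfolding slices_def by (rule closure_span_mem) blast

lemma closed_slices: "closed (slices W)" and subspace_slices: "subspace (slices W)"
  by (auto simp: slices_def subspace_closure_span)

lemma lins_add: "lins (x + x') = lins x + lins x'" and lins_scaleR: "lins (r *\<^sub>R x) = r *\<^sub>R lins x"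
  and lins_scaleC: "lins (c *\<^sub>C x) = cscale c (lins x)"
  by (rule blinfun_eqI; simp add: htens_add_left htens_scaleR_left htens_scaleC_left blinfun.bilinear_simps)+

lemma bounded_linear_slice_left_right: "bounded_linear (slice_left W x)" if "W \<in> bops"
proof (rule bounded_linear_intro)
  fix z z' r
  show "slice_left W x (z + z') = slice_left W x z + slice_left W x z'" "slice_left W x (r *\<^sub>R z) = r *\<^sub>R slice_left W x z"
    by (simp_all add: slice_left_def lins_add lins_scaleR blinfun_compose_add blinfun_compose_scaleR)
  show "norm (slice_left W x z) \<le> norm z * norm ((lins x)\<dagger> ** W)"
    unfolding slice_left_def by (rule order_trans[OF norm_blinfun_compose]) (metis mult.commute mult_left_mono norm_ge_zero norm_lins_le)
qed

lemma slice_left_adj: "W \<in> bops \<Longrightarrow> (slice_left W x z)\<dagger> = slice_left (W\<dagger>) z x"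
  by (simp add: slice_left_def adj_compose compose_assoc)

lemma bounded_linear_slice_left_left: "bounded_linear (\<lambda>x. slice_left W x z)" if W: "W \<in> bops"
  for W :: "('a::complex_hilbert, 'b::complex_hilbert) hop"
proof (rule bounded_linear_intro)
  fix x x' :: 'a and r
  show "slice_left W (x + x') z = slice_left W x z + slice_left W x' z" "slice_left W (r *\<^sub>R x) z = r *\<^sub>R slice_left W x z"
    by (simp_all add: slice_left_def lins_add lins_scaleR adj_add adj_scaleR blinfun_compose_add blinfun_compose_scaleR)
  have "norm (slice_left W x z) \<le> norm ((lins x :: 'b \<Rightarrow>\<^sub>L ('a, 'b) htensor)\<dagger>) * norm (W ** lins z)"
    unfolding slice_left_def compose_assoc by (rule norm_blinfun_compose)
  also have "\<dots> \<le> norm x * norm (W ** lins z)" by (intro mult_right_mono) (simp_all add: norm_adj norm_lins_le)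
  finally show "norm (slice_left W x z) \<le> norm x * norm (W ** lins z)" .
qed

lemma norm_slice_left:
  fixes W :: "('a::complex_hilbert, 'b::complex_hilbert) hop"
  shows "W \<in> bops \<Longrightarrow> norm (slice_left W x z) \<le> norm W * (norm x * norm z)"
proof -
  assume "W \<in> bops"
  have "norm (slice_left W x z) \<le> norm ((lins x :: 'b \<Rightarrow>\<^sub>L ('a, 'b) htensor)\<dagger>) * norm W * norm (lins z :: 'b \<Rightarrow>\<^sub>L ('a, 'b) htensor)"
    unfolding slice_left_def by (meson norm_blinfun_compose mult_right_mono norm_ge_zero order_trans)
  also have "\<dots> \<le> norm x * norm W * norm z" by (intro mult_mono) (simp_all add: norm_adj norm_lins_le)
  finally show ?thesis by (simp add: mult_ac)
qed

lemma slice_left_in: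
  assumes W: "W \<in> bops" and A: "subspace A" "closed A" and S: "closure (span S) = UNIV" "closure (span S') = UNIV"
    and "\<And>x z. x \<in> S \<Longrightarrow> z \<in> S' \<Longrightarrow> slice_left W x z \<in> A"
  shows "slice_left W x z \<in> A"
proof -
  have 1: "slice_left W x z \<in> A" if x: "x \<in> S" for x
  proof (rule closure_span_image_subset[OF bounded_linear_slice_left_right[OF W] A])
    show "z \<in> closure (span S')" unfolding S(2) by simp
  qed (rule assms(6)[OF x])
  show ?thesis
  proof (rule closure_span_image_subset[OF bounded_linear_slice_left_left[OF W] A])
    show "x \<in> closure (span S)" unfolding S(1) by simp
  qed (rule 1)
qed

lemma subspace_image_subset_slices:
  assumes "bounded_linear f" "subspace A" "closed A" "\<And>x z. f (slice_left W x z) \<in> A" "t \<in> slices W" shows "f t \<in> A"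
  by (rule closure_span_image_subset[OF assms(1-3) _ assms(5)[unfolded slices_def]]) (use assms(4) in blast)

lemma slices_bops: "W \<in> bops \<Longrightarrow> t \<in> slices W \<Longrightarrow> t \<in> bops"
  by (rule subspace_image_subset_slices[where f = "\<lambda>t. t"]) (simp_all add: subspace_bops closed_bops)

lemma matrix_op_eq: "W \<in> bops \<Longrightarrow> matrix_op W u v = (rins u)\<dagger> ** W ** rins v"
  unfolding matrix_op_def
proof (rule the_equality)
  assume W: "W \<in> bops"
  show "(rins u)\<dagger> ** W ** rins v \<in> bops \<and> (\<forall>x y. cinner x (((rins u)\<dagger> ** W ** rins v) y) = cinner (x \<otimes>\<^sub>h u) (W (y \<otimes>\<^sub>h v)))"
    using W by (simp add: cinner_adj_right[OF rins_bops])
  fix S assume "S \<in> bops \<and> (\<forall>x y. cinner x (S y) = cinner (x \<otimes>\<^sub>h u) (W (y \<otimes>\<^sub>h v)))"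
  then show "S = (rins u)\<dagger> ** W ** rins v" by (intro cinner_op_ext) (simp add: cinner_adj_right[OF rins_bops])
qed

lemma slice_eq:
  assumes W: "W \<in> bops" and R: "R \<in> bops" "\<And>u v. cinner u (blinfun_apply R v) = \<omega> (matrix_op W u v)"
  shows "slice \<omega> W = R"
  unfolding slice_def by (rule the_equality) (use R in \<open>auto intro!: cinner_op_ext\<close>)

lemma slice_predual:
  assumes W: "W \<in> bops" and x: "summable (\<lambda>n. (norm (x n))\<^sup>2)" "summable (\<lambda>n. (norm (y n))\<^sup>2)"
  shows "slice (\<lambda>T. \<Sum>n. cinner (x n) (blinfun_apply T (y n))) W = (\<Sum>n. slice_left W (x n) (y n))"
    and "(\<Sum>n. slice_left W (x n) (y n)) \<in> slices W"
proof -
  have sm: "summable (\<lambda>n. norm (x n) * norm (y n))"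
  proof (rule summable_comparison_test[OF _ summable_add[OF x]], intro exI allI impI)
    fix n
    show "norm (norm (x n) * norm (y n)) \<le> (norm (x n))\<^sup>2 + (norm (y n))\<^sup>2"
      using sum_squares_bound[of "norm (x n)" "norm (y n)"] mult_nonneg_nonneg[OF norm_ge_zero[of "x n"] norm_ge_zero[of "y n"]]
      by (simp del: mult_nonneg_nonneg)
  qed
  then have s: "summable (\<lambda>n. slice_left W (x n) (y n))"
    by (intro summable_comparison_test[OF _ summable_mult[OF sm, of "norm W"]]) (auto intro!: norm_slice_left W)
  have lim: "(\<lambda>N. \<Sum>n<N. slice_left W (x n) (y n)) \<longlonglongrightarrow> (\<Sum>n. slice_left W (x n) (y n))" using s by (rule summable_LIMSEQ)
  show m: "(\<Sum>n. slice_left W (x n) (y n)) \<in> slices W"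
    by (rule closed_sequentially[OF closed_slices _ lim]) (auto intro!: subspace_sum[OF subspace_slices] slices_gen)
  show "slice (\<lambda>T. \<Sum>n. cinner (x n) (blinfun_apply T (y n))) W = (\<Sum>n. slice_left W (x n) (y n))"
  proof (rule slice_eq[OF W slices_bops[OF W m]])
    fix u v
    have "cinner u (blinfun_apply (\<Sum>n. slice_left W (x n) (y n)) v) = (\<Sum>n. cinner u (blinfun_apply (slice_left W (x n) (y n)) v))"
      by (rule bounded_linear.suminf[OF bounded_linear_cinner_apply s])
    then show "cinner u (blinfun_apply (\<Sum>n. slice_left W (x n) (y n)) v) = (\<Sum>n. cinner (x n) (blinfun_apply (matrix_op W u v) (y n)))"
      by (simp add: cinner_slice_left matrix_op_eq[OF W] cinner_adj_right[OF rins_bops])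
  qed
qed

text \<open>\<open>qg\<close> is the closure of the slices by normal functionals, with no span. A
  finite combination of vector functionals is again normal, given by sequences padded with zeros;
  conversely a normal functional slices \<open>W\<close> to a norm-convergent series of vector
  slices.\<close>

lemma qg_eq_slices: assumes W: "W \<in> bops" shows "qg W = slices W"
proof
  show "qg W \<subseteq> slices W" unfolding qg_def
    by (rule closure_minimal[OF _ closed_slices]) (use slice_predual[OF W] in \<open>auto simp: predual_def\<close>)
  let ?D = "range (\<lambda>l. \<Sum>p\<leftarrow>l. slice_left W (fst p) (snd p))"
  have "?D \<subseteq> {slice \<omega> W | \<omega>. \<omega> \<in> predual}"
  proof safe
    fix l :: "('a \<times> 'a) list"
    define x y where "x n = (if n < length l then fst (l ! n) else 0)" and "y n = (if n < length l then snd (l ! n) else 0)" for n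
    have fin: "finite {n. n < length l}" by simp
    have s: "summable (\<lambda>n. (norm (x n))\<^sup>2)" "summable (\<lambda>n. (norm (y n))\<^sup>2)"
      by (rule summable_finite[OF fin]; simp add: x_def y_def)+
    have z: "slice_left W 0 0 = 0" by (rule linear_0[OF bounded_linear.linear[OF bounded_linear_slice_left_right[OF W]]])
    have "(\<Sum>n. slice_left W (x n) (y n)) = (\<Sum>n\<in>{n. n < length l}. slice_left W (x n) (y n))"
      by (rule suminf_finite[OF fin]) (simp add: x_def y_def z)
    also have "\<dots> = (\<Sum>n<length l. slice_left W (fst (l ! n)) (snd (l ! n)))" by (rule sum.cong) (auto simp: x_def y_def)
    also have "\<dots> = (\<Sum>p\<leftarrow>l. slice_left W (fst p) (snd p))" by (simp add: sum_list_sum_nth atLeast0LessThan)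
    finally show "\<exists>\<omega>. (\<Sum>p\<leftarrow>l. slice_left W (fst p) (snd p)) = slice \<omega> W \<and> \<omega> \<in> predual"
      using slice_predual(1)[OF W s] s by (intro exI[of _ "\<lambda>T. \<Sum>n. cinner (x n) (blinfun_apply T (y n))"]) (auto simp: predual_def)
  qed
  moreover have "span {slice_left W x z | x z. True} \<subseteq> ?D"
  proof (rule span_minimal)
    show "{slice_left W x z | x z. True} \<subseteq> ?D"
    proof safe
      fix x z show "slice_left W x z \<in> ?D" by (rule range_eqI[of _ _ "[(x, z)]"]) simp
    qed
    show "subspace ?D"
    proof (rule subspaceI)
      show "0 \<in> ?D" by (rule range_eqI[of _ _ "[]"]) simp
      fix r s assume "s \<in> ?D"
      then obtain l where l: "s = (\<Sum>p\<leftarrow>l. slice_left W (fst p) (snd p))" by blast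
      show "r *\<^sub>R s \<in> ?D"
        by (rule range_eqI[of _ _ "map (\<lambda>p. (fst p, r *\<^sub>R snd p)) l"])
          (unfold l, induction l, simp_all add: linear_scale[OF bounded_linear.linear[OF bounded_linear_slice_left_right[OF W]]] scaleR_add_right)
      fix s' assume "s' \<in> ?D"
      then obtain l' where l': "s' = (\<Sum>p\<leftarrow>l'. slice_left W (fst p) (snd p))" by blast
      show "s + s' \<in> ?D" by (rule range_eqI[of _ _ "l @ l'"]) (simp add: l l')
    qed
  qed
  ultimately show "slices W \<subseteq> qg W" unfolding slices_def qg_def by (intro closure_mono) blast
qed

lemma leg12_leg13_coefficients:
  assumes A: "A \<in> bops" and B: "B \<in> bops"
  shows "cinner ((x \<otimes>\<^sub>h p) \<otimes>\<^sub>h q) ((leg12 A ** leg13 B) ((z \<otimes>\<^sub>h u) \<otimes>\<^sub>h v)) =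
      cinner ((A\<dagger>) (x \<otimes>\<^sub>h p)) ((rins u) (((rins q)\<dagger>) (B (z \<otimes>\<^sub>h v))))"
proof -
  have 1: "(leg13 B) ((z \<otimes>\<^sub>h u) \<otimes>\<^sub>h v) = (rins u \<otimes> \<one>) (B (z \<otimes>\<^sub>h v))"
    using arg_cong[OF leg13_rins[OF B, of u], of "\<lambda>T. T (z \<otimes>\<^sub>h v)"] by simp
  have "cinner ((x \<otimes>\<^sub>h p) \<otimes>\<^sub>h q) ((leg12 A ** leg13 B) ((z \<otimes>\<^sub>h u) \<otimes>\<^sub>h v)) =
      cinner (((leg12 A)\<dagger>) ((x \<otimes>\<^sub>h p) \<otimes>\<^sub>h q)) ((rins u \<otimes> \<one>) (B (z \<otimes>\<^sub>h v)))"
    using A by (simp add: 1 cinner_adj_left)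
  also have "((leg12 A)\<dagger>) ((x \<otimes>\<^sub>h p) \<otimes>\<^sub>h q) = (rins q) ((A\<dagger>) (x \<otimes>\<^sub>h p))"
    using A by (simp add: leg12_adj) (simp add: leg12_def)
  also have "cinner \<dots> ((rins u \<otimes> \<one>) (B (z \<otimes>\<^sub>h v))) =
      cinner ((A\<dagger>) (x \<otimes>\<^sub>h p)) (((rins q)\<dagger> ** (rins u \<otimes> \<one>)) (B (z \<otimes>\<^sub>h v)))"
    by (simp only: cinner_adj_right[OF rins_bops] blinfun_apply_blinfun_compose)
  finally show ?thesis by (simp add: rins_adj_op_tensor)
qed

lemma leg13_leg12_coefficients:
  assumes A: "A \<in> bops" and B: "B \<in> bops"
  shows "cinner ((x \<otimes>\<^sub>h p) \<otimes>\<^sub>h q) ((leg13 B ** leg12 A) ((z \<otimes>\<^sub>h u) \<otimes>\<^sub>h v)) =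
      cinner (((rins v)\<dagger>) ((B\<dagger>) (x \<otimes>\<^sub>h q))) (((rins p)\<dagger>) (A (z \<otimes>\<^sub>h u)))" (is "_ = ?r")
proof -
  have "cinner (((leg13 B ** leg12 A)\<dagger>) ((x \<otimes>\<^sub>h p) \<otimes>\<^sub>h q)) ((z \<otimes>\<^sub>h u) \<otimes>\<^sub>h v) = ?r"
    by (rule cinner_swap_eq)
      (unfold adj_compose[OF leg_bops(3)[OF B] leg_bops(1)[OF A]] leg12_adj[OF A] leg13_adj[OF B]
        leg12_leg13_coefficients[OF adj_bops[OF A] adj_bops[OF B]] adj_adj[OF A] cinner_adj_left[OF rins_bops], rule refl)
  then show ?thesis using A B by (simp add: cinner_adj_left)
qed

lemma lins_htens: "lins (x \<otimes>\<^sub>h y) = (lins x \<otimes> \<one>) ** lins y" and lins_htens': "lins (x \<otimes>\<^sub>h y) = (rins y \<otimes> \<one>) ** lins x"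
  by (rule blinfun_eqI; simp)+

text \<open>The coefficients depend on the first leg only through \<open>slice_left V x z\<close>,
  so \<open>slices_eq\<close> allows \<open>Wt\<close> to be exchanged for \<open>W\<close> in the
  role of \<open>V\<close>.\<close>

lemma leg12_conjugate_coefficients:
  fixes W :: "('b::complex_hilbert, 'c::complex_hilbert) hop"
    and V :: "('a::complex_hilbert, 'b) hop"
  assumes W: "W \<in> bops" and V: "V \<in> bops"
  shows "cinner ((x \<otimes>\<^sub>h p) \<otimes>\<^sub>h q) ((leg23 W ** leg12 V ** (leg23 W)\<dagger>) ((z \<otimes>\<^sub>h u) \<otimes>\<^sub>h v)) =
    cinner (p \<otimes>\<^sub>h q) (W ((slice_left V x z \<otimes> \<one>) ((W\<dagger>) (u \<otimes>\<^sub>h v))))"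
proof -
  let ?J = "\<lambda>x. (lins x \<otimes> \<one>) :: ('b, 'c) htensor \<Rightarrow>\<^sub>L (('a, 'b) htensor, 'c) htensor"
  have e: "((leg23 W)\<dagger>) ((x \<otimes>\<^sub>h y) \<otimes>\<^sub>h z) = (?J x) ((W\<dagger>) (y \<otimes>\<^sub>h z))" for x y z
    using arg_cong[OF leg23_lins[OF adj_bops[OF W], of x], of "\<lambda>T. T (y \<otimes>\<^sub>h z)"] by (simp add: leg23_adj W)
  have s: "(?J x)\<dagger> ** leg12 V ** ?J z = slice_left V x z \<otimes> \<one>"
    using V by (simp add: leg12_def op_tensor_adj op_tensor_compose slice_left_def)
  have "cinner ((x \<otimes>\<^sub>h p) \<otimes>\<^sub>h q) ((leg23 W ** leg12 V ** (leg23 W)\<dagger>) ((z \<otimes>\<^sub>h u) \<otimes>\<^sub>h v)) =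
     cinner (((leg23 W)\<dagger>) ((x \<otimes>\<^sub>h p) \<otimes>\<^sub>h q)) ((leg12 V) (((leg23 W)\<dagger>) ((z \<otimes>\<^sub>h u) \<otimes>\<^sub>h v)))"
    using W by (simp add: cinner_adj_left)
  also have "\<dots> = cinner ((W\<dagger>) (p \<otimes>\<^sub>h q)) (((?J x)\<dagger> ** leg12 V ** ?J z) ((W\<dagger>) (u \<otimes>\<^sub>h v)))"
    unfolding e by (simp add: cinner_adj_right)
  finally show ?thesis unfolding s using W by (simp add: cinner_adj_left)
qed

lemma slice_left_conjugate:
  assumes "U \<in> bops" "X \<in> bops"
  shows "slice_left (leg12 U ** X ** (leg12 U)\<dagger>) \<xi> \<eta> = slice_left X ((U\<dagger>) \<xi>) ((U\<dagger>) \<eta>)"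
proof -
  have e: "(leg12 U)\<dagger> ** lins \<eta> = lins ((U\<dagger>) \<eta>)" for \<eta>
    using assms by (simp add: leg12_def op_tensor_adj op_tensor_lins)
  have f: "(lins \<eta>)\<dagger> ** leg12 U = (lins ((U\<dagger>) \<eta>))\<dagger>" for \<eta>
    using arg_cong[OF e[of \<eta>], of adj] assms by (simp add: adj_compose)
  show ?thesis unfolding slice_left_def by (simp only: compose_assoc e compose_left[OF f])
qed

lemma lins_id_inner:
  "(lins x \<otimes> \<one>)\<dagger> ** (lins x' \<otimes> \<one>) = cscale (cinner x x') \<one>"
  by (simp add: op_tensor_adj op_tensor_compose lins_adj_lins op_tensor_cscale_left)

lemma slice_left_leg23:
  fixes W :: "('b::complex_hilbert, 'c::complex_hilbert) hop" and x x' :: "'a::complex_hilbert"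
  assumes W: "W \<in> bops" shows "slice_left (leg23 W) (x \<otimes>\<^sub>h y) (x' \<otimes>\<^sub>h y') = cscale (cinner x x') (slice_left W y y')"
proof -
  have "(lins (x \<otimes>\<^sub>h y) :: 'c \<Rightarrow>\<^sub>L (('a, 'b) htensor, 'c) htensor)\<dagger> = (lins y)\<dagger> ** (lins x \<otimes> \<one>)\<dagger>"
    unfolding lins_htens by (rule adj_compose) simp_all
  moreover have "leg23 W ** lins (x' \<otimes>\<^sub>h y') = (lins x' \<otimes> \<one>) ** (W ** lins y')"
    unfolding lins_htens by (simp only: compose_square[OF leg23_lins[OF W]])
  ultimately have "slice_left (leg23 W) (x \<otimes>\<^sub>h y) (x' \<otimes>\<^sub>h y') = (lins y)\<dagger> ** (((lins x \<otimes> \<one>)\<dagger> ** (lins x' \<otimes> \<one>)) ** (W ** lins y'))"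
    by (simp only: slice_left_def compose_assoc)
  then show ?thesis by (simp add: lins_id_inner slice_left_def blinfun_compose_cscale compose_assoc)
qed

lemma slice_left_leg13_leg23:
  assumes V: "V \<in> bops" and W: "W \<in> bops"
  shows "slice_left (leg13 V ** leg23 W) (x \<otimes>\<^sub>h y) (x' \<otimes>\<^sub>h y') = slice_left V x x' ** slice_left W y y'"
proof -
  have 1: "(lins (x \<otimes>\<^sub>h y))\<dagger> ** leg13 V = (lins x)\<dagger> ** (V ** (rins y \<otimes> \<one>)\<dagger>)"
  proof -
    have "leg13 (V\<dagger>) ** lins (x \<otimes>\<^sub>h y) = (rins y \<otimes> \<one>) ** (V\<dagger> ** lins x)"
      unfolding lins_htens' by (simp only: compose_square[OF leg13_rins[OF adj_bops[OF V]]])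
    from arg_cong[OF this, of adj] show ?thesis using V by (simp add: adj_compose leg13_adj compose_assoc)
  qed
  have 2: "leg23 W ** lins (x' \<otimes>\<^sub>h y') = (lins x' \<otimes> \<one>) ** (W ** lins y')"
    unfolding lins_htens by (simp only: compose_square[OF leg23_lins[OF W]])
  have 3: "(rins y \<otimes> \<one>)\<dagger> ** (lins x' \<otimes> \<one>) = lins x' ** (lins y)\<dagger>"
    by (rule htens_op_eqI)
      (simp_all add: op_tensor_adj rins_adj_htens lins_adj_htens htens_scaleC_left htens_scaleC_right)
  show ?thesis
    unfolding slice_left_def compose_assoc 2 compose_left[OF 1] by (simp only: compose_square[OF 3] compose_assoc)
qed

text \<open>The part of modularity that the dual inherits and that makes \<open>qg W\<close> a C*-algebra: since
  \<open>W\<^sub>2\<^sub>3 Wt\<^sub>1\<^sub>2 W\<^sub>2\<^sub>3\<^sup>* = Wt\<^sub>1\<^sub>3 Wt\<^sub>1\<^sub>2\<close>, the closed span of the slices of \<open>W\<close> is also that of the products \<open>S\<^sup>* T\<close> of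
  slices \<open>S\<close> of \<open>Wt\<close> and \<open>T\<close> of \<open>W\<close>.\<close>

locale semi_modular =
  fixes W :: "('h::complex_hilbert, 'h) hop" and P :: "('h \<times> 'h) set"
    and Wt :: "('h conj_space, 'h) htensor \<Rightarrow>\<^sub>L ('h conj_space, 'h) htensor"
  assumes mult: "multiplicative W" and P: "pos_self_adjoint P" "trivial_kernel P" and Wt: "unitary Wt"
    and slices_eq: "\<And>z z' x x'. (z, z') \<in> P \<Longrightarrow> (x, x') \<in> P \<Longrightarrow>
      slice_left Wt (to_conj z') (to_conj x) = slice_left W x' z"
begin

lemma unitary_W: "unitary W" and pentagon: "leg23 W ** leg12 W = leg12 W ** leg13 W ** leg23 W"
  using mult by (auto simp: multiplicative_def)

lemmas W_bops [simp] = unitaryD(1)[OF unitary_W]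
lemmas Wt_bops [simp] = unitaryD(1)[OF Wt]

lemma P_graph: "sa_graph P" "injective_graph P"
  using P by (auto intro: sa_graph_pos_self_adjoint injective_graph_pos_self_adjoint)

lemma P_memI: "(\<And>x y. (x, y) \<in> P \<Longrightarrow> cinner u y = cinner v x) \<Longrightarrow> (u, v) \<in> P"
  using P(1) by (auto simp: pos_self_adjoint_def adj_graph_def)

abbreviation "cj x \<equiv> to_conj (x :: 'h)"

text \<open>With conjugate vectors read back in \<open>H\<close>, \<open>slices_eq\<close> and
  self-adjointness give \<open>(\<beta>, a)\<close> and \<open>(b, \<alpha>)\<close> in
  \<open>P\<close>. The identity is the symmetry of \<open>P\<close> applied to these two
  pairs.\<close>

lemma matrix_coefficients:
  assumes z: "(z, z') \<in> P" and x: "(x, x') \<in> P"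
  shows "cinner ((W\<dagger>) (x' \<otimes>\<^sub>h p)) ((rins u) (((rins q)\<dagger>) (W (z \<otimes>\<^sub>h v)))) =
    cinner (((rins v)\<dagger>) ((Wt\<dagger>) (cj z' \<otimes>\<^sub>h q))) (((rins p)\<dagger>) (Wt (cj x \<otimes>\<^sub>h u)))"
proof -
  define a b where "a = ((rins u)\<dagger>) ((W\<dagger>) (x' \<otimes>\<^sub>h p))" and "b = ((rins q)\<dagger>) (W (z \<otimes>\<^sub>h v))"
  define \<alpha> \<beta> where "\<alpha> = of_conj (((rins v)\<dagger>) ((Wt\<dagger>) (cj z' \<otimes>\<^sub>h q)))"
    and "\<beta> = of_conj (((rins p)\<dagger>) (Wt (cj x \<otimes>\<^sub>h u)))"
  have "(\<beta>, a) \<in> P"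
  proof (rule P_memI)
    fix e e' assume e: "(e, e') \<in> P"
    have "cinner \<beta> e' = cinner (cj e') (cj \<beta>)" by (simp add: cinner_to_conj)
    also have "\<dots> = cinner p (slice_left Wt (cj e') (cj x) u)"
      by (simp add: \<beta>_def of_conj_inverse cinner_adj_right[OF rins_bops] cinner_slice_left)
    also have "\<dots> = cinner p (slice_left W x' e u)" by (simp only: slices_eq[OF e x])
    also have "\<dots> = cinner a e" by (simp add: a_def cinner_adj_left[OF rins_bops] cinner_adj_left[OF W_bops] cinner_slice_left)
    finally show "cinner \<beta> e' = cinner a e" .
  qed
  moreover have "(b, \<alpha>) \<in> P"
  proof (rule P_memI)
    fix e e' assume e: "(e, e') \<in> P"
    have "cinner e' b = cinner q (slice_left W e' z v)" by (simp add: b_def cinner_adj_right[OF rins_bops] cinner_slice_left)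
    also have "\<dots> = cinner q (slice_left Wt (cj z') (cj e) v)" by (simp only: slices_eq[OF z e])
    also have "\<dots> = cinner (cj \<alpha>) (cj e)"
      by (simp add: \<alpha>_def of_conj_inverse cinner_adj_left[OF rins_bops] cinner_adj_left[OF Wt_bops] cinner_slice_left)
    also have "\<dots> = cinner e \<alpha>" by (simp add: cinner_to_conj)
    finally show "cinner b e' = cinner \<alpha> e" by (rule cinner_swap_eq)
  qed
  ultimately have "cinner \<beta> \<alpha> = cinner a b" using sa_graphD(2)[OF P_graph(1)] by blast
  moreover have "cinner \<beta> \<alpha> = cinner (cj \<alpha>) (cj \<beta>)" by (simp add: cinner_to_conj)
  ultimately show ?thesis by (simp add: a_def b_def \<alpha>_def \<beta>_def of_conj_inverse cinner_adj_left[OF rins_bops])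
qed

lemma P_total: "ctotal (Domain P)" "ctotal (Range P)"
  by (rule ctotal_mono[OF ctotal_range_g[OF P_graph]], blast)+

lemma P_dense: "closure (span (Domain P)) = UNIV" "closure (span (Range P)) = UNIV"
  "closure (span (cj ` Domain P)) = UNIV" "closure (span (cj ` Range P)) = UNIV"
proof -
  have sc: "d *\<^sub>C x \<in> Domain P" "d *\<^sub>C y \<in> Range P" if "(x, y) \<in> P" for d x y using sa_graphD(4)[OF P_graph(1) that] by blast+
  have cc: "d *\<^sub>C cj x = cj (cnj d *\<^sub>C x)" for d x by (simp add: to_conj_scaleC)
  show "closure (span (Domain P)) = UNIV" by (subst closure_span_eq_UNIV_iff) (use sc P_total in auto)
  show "closure (span (Range P)) = UNIV" by (subst closure_span_eq_UNIV_iff) (use sc P_total in auto)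
  show "closure (span (cj ` Domain P)) = UNIV" by (subst closure_span_eq_UNIV_iff) (use sc in \<open>auto simp: cc intro!: ctotal_to_conj P_total\<close>)
  show "closure (span (cj ` Range P)) = UNIV" by (subst closure_span_eq_UNIV_iff) (use sc in \<open>auto simp: cc intro!: ctotal_to_conj P_total\<close>)
qed

text \<open>For first-leg vectors from the range and the domain of \<open>P\<close>,
  \<open>slices_eq\<close> turns \<open>Wt\<close> on the left into \<open>W\<close>. The pentagon
  equation splits the result into a product, and \<open>matrix_coefficients\<close> turns this
  product back into one for \<open>Wt\<close>, in the opposite order because the first leg is
  conjugate.\<close>

lemma Wt_relation: "leg23 W ** leg12 Wt ** (leg23 W)\<dagger> = leg13 Wt ** leg12 Wt"
proof -
  let ?L = "{((cj z' \<otimes>\<^sub>h (p :: 'h)) \<otimes>\<^sub>h (q :: 'h)) | z' p q. z' \<in> Range P}" and ?R = "{((cj x \<otimes>\<^sub>h (u :: 'h)) \<otimes>\<^sub>h (v :: 'h)) | x u v. x \<in> Domain P}"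
  have tot: "ctotal {((cj x \<otimes>\<^sub>h (p :: 'h)) \<otimes>\<^sub>h (q :: 'h)) | x p q. x \<in> D}" if "ctotal D" for D
    by (rule ctotal_mono[OF ctotal_htens[OF ctotal_htens[OF ctotal_to_conj[OF that] ctotal_UNIV] ctotal_UNIV]]) blast
  have W12: "leg23 W ** leg12 W ** (leg23 W)\<dagger> = leg12 W ** leg13 W"
    unfolding pentagon by (simp add: compose_assoc unitaryD[OF unitary_leg(2)[OF unitary_W]])
  have eq: "cinner \<xi> ((leg23 W ** leg12 Wt ** (leg23 W)\<dagger>) \<eta>) = cinner \<xi> ((leg13 Wt ** leg12 Wt) \<eta>)"
    if \<xi>: "\<xi> \<in> ?L" and \<eta>: "\<eta> \<in> ?R" for \<xi> \<eta>
  proof -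
    from \<xi> \<eta> obtain z z' p q x x' u v where *: "\<xi> = (cj z' \<otimes>\<^sub>h p) \<otimes>\<^sub>h q" "(z, z') \<in> P" "\<eta> = (cj x \<otimes>\<^sub>h u) \<otimes>\<^sub>h v" "(x, x') \<in> P" by blast
    have "cinner \<xi> ((leg23 W ** leg12 Wt ** (leg23 W)\<dagger>) \<eta>) =
        cinner ((x' \<otimes>\<^sub>h p) \<otimes>\<^sub>h q) ((leg23 W ** leg12 W ** (leg23 W)\<dagger>) ((z \<otimes>\<^sub>h u) \<otimes>\<^sub>h v))"
      unfolding *(1,3) leg12_conjugate_coefficients[OF W_bops Wt_bops] leg12_conjugate_coefficients[OF W_bops W_bops] slices_eq[OF *(2,4)] by (rule refl)
    also have "\<dots> = cinner \<xi> ((leg13 Wt ** leg12 Wt) \<eta>)"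
      unfolding *(1,3) W12 leg12_leg13_coefficients[OF W_bops W_bops] leg13_leg12_coefficients[OF Wt_bops Wt_bops]
      by (rule matrix_coefficients[OF *(2,4)])
    finally show ?thesis .
  qed
  show ?thesis
  proof (rule bops_eq_on_total[OF tot[OF P_total(1)]])
    fix \<eta> assume \<eta>: "\<eta> \<in> ?R"
    have "(leg23 W ** leg12 Wt ** (leg23 W)\<dagger>) \<eta> - (leg13 Wt ** leg12 Wt) \<eta> = 0"
      by (rule ctotalD[OF tot[OF P_total(2)]]) (simp only: cinner_diff_right eq[OF _ \<eta>] diff_self)
    then show "(leg23 W ** leg12 Wt ** (leg23 W)\<dagger>) \<eta> = (leg13 Wt ** leg12 Wt) \<eta>" by simp
  qed auto
qed

lemma Wt_conjugate: "leg12 Wt ** leg23 W ** (leg12 Wt)\<dagger> = leg13 (Wt\<dagger>) ** leg23 W"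
proof -
  note u = unitaryD[OF unitary_leg(2)[OF unitary_W]] unitaryD[OF unitary_leg(1)[OF Wt]] unitaryD[OF unitary_leg(3)[OF Wt]]
  have "leg23 W ** leg12 Wt = leg13 Wt ** leg12 Wt ** leg23 W"
    using arg_cong[OF Wt_relation, of "\<lambda>X. X ** leg23 W"] by (simp add: compose_assoc u)
  then have "(leg13 Wt)\<dagger> ** (leg23 W ** leg12 Wt) ** (leg12 Wt)\<dagger> = (leg13 Wt)\<dagger> ** (leg13 Wt ** leg12 Wt ** leg23 W) ** (leg12 Wt)\<dagger>" by simp
  then show ?thesis by (simp add: compose_assoc u compose_absorb[OF u(12)] leg13_adj[symmetric])
qed

lemma slices_Wt: "slices Wt = slices W"
proof
  have "slice_left Wt \<xi> \<eta> \<in> slices W" for \<xi> \<eta>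
  proof (rule slice_left_in[OF Wt_bops subspace_slices closed_slices P_dense(4,3)], safe)
    fix z z' x x' assume "(z, z') \<in> P" "(x, x') \<in> P"
    then show "slice_left Wt (cj z') (cj x) \<in> slices W" using slices_gen by (simp only: slices_eq)
  qed
  then show "slices Wt \<subseteq> slices W" unfolding slices_def[of Wt]
    by (intro closure_minimal span_minimal closed_slices subspace_slices) blast
  have "slice_left W x z \<in> slices Wt" for x z
  proof (rule slice_left_in[OF W_bops subspace_slices closed_slices P_dense(2,1)], safe)
    fix z z' x x' assume "(z, z') \<in> P" "(x, x') \<in> P"
    then show "slice_left W x' z \<in> slices Wt" using slices_gen by (simp only: slices_eq[symmetric])
  qed
  then show "slices W \<subseteq> slices Wt" unfolding slices_def[of W]
    by (intro closure_minimal span_minimal closed_slices subspace_slices) blast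
qed

text \<open>Slices of \<open>leg23 W\<close> over the first two legs are multiples of slices of
  \<open>W\<close>, or limits of their combinations. Conjugation by the unitary \<open>Wt\<close> on
  these legs only changes the slicing vectors, and by \<open>Wt_conjugate\<close> it produces
  \<open>leg13 (Wt\<dagger>) ** leg23 W\<close>, whose slices are the products.\<close>

lemma slices_products: "slices W = closure (span {(slice_left Wt \<xi> \<eta>)\<dagger> ** slice_left W x z | \<xi> \<eta> x z. True})" (is "_ = ?B")
proof
  let ?X = "leg13 (Wt\<dagger>) ** leg23 W"
  have X: "?X \<in> bops" by simp
  have Xs: "slice_left ?X \<xi> \<eta> = slice_left (leg23 W) (blinfun_apply (Wt\<dagger>) \<xi>) (blinfun_apply (Wt\<dagger>) \<eta>)" for \<xi> \<eta>
    unfolding Wt_conjugate[symmetric] by (rule slice_left_conjugate) simp_all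
  have gen: "slice_left ?X (\<xi> \<otimes>\<^sub>h y) (\<eta> \<otimes>\<^sub>h y') = (slice_left Wt \<eta> \<xi>)\<dagger> ** slice_left W y y'" for \<xi> \<eta> y y'
    by (simp add: slice_left_leg13_leg23 slice_left_adj)
  have cs: "cscale c (slice_left W x z) \<in> slices W" for c x z
    using slices_gen[of W x "c *\<^sub>C z"] by (simp add: slice_left_def lins_scaleC blinfun_compose_cscale)
  have "slice_left (leg23 W) \<xi> \<eta> \<in> slices W" for \<xi> \<eta> :: "('h conj_space, 'h) htensor"
    by (rule slice_left_in[OF leg_bops(2)[OF W_bops] subspace_slices closed_slices htens_total htens_total]) (auto simp: slice_left_leg23 cs)
  then have "(slice_left Wt \<xi> \<eta>)\<dagger> ** slice_left W x z \<in> slices W" for \<xi> \<eta> x z unfolding gen[symmetric] Xs by blast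
  then show "?B \<subseteq> slices W" by (intro closure_minimal span_minimal closed_slices subspace_slices) blast
  have BX: "slice_left ?X \<xi> \<eta> \<in> ?B" for \<xi> \<eta>
    by (rule slice_left_in[OF X subspace_closure_span closed_closure htens_total htens_total])
      (clarify, subst gen, rule closure_span_mem, blast)
  have "slice_left W y y' \<in> ?B" for y y'
  proof (cases "\<exists>x :: 'h conj_space. x \<noteq> 0")
    case True
    then obtain x :: "'h conj_space" where x: "x \<noteq> 0" by blast
    let ?x = "(inverse (cinner x x)) *\<^sub>C x"
    have "slice_left W y y' = slice_left (leg23 W) (x \<otimes>\<^sub>h y) (?x \<otimes>\<^sub>h y')"
      using x by (simp add: slice_left_leg23 cinner_scaleC_right cinner_eq_zero_iff)
    also have "\<dots> = slice_left ?X (blinfun_apply Wt (x \<otimes>\<^sub>h y)) (blinfun_apply Wt (?x \<otimes>\<^sub>h y'))" by (simp add: Xs unitaryD[OF Wt])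
    finally show ?thesis using BX by simp
  next
    case False
    then have "cj y = 0" by blast
    then have "norm y = 0" by (metis norm_to_conj norm_zero)
    then have "slice_left W y y' = 0" using linear_0[OF bounded_linear.linear[OF bounded_linear_slice_left_left[OF W_bops]]] by simp
    then show ?thesis using subspace_0[OF subspace_closure_span] by simp
  qed
  then show "slices W \<subseteq> ?B" unfolding slices_def by (intro closure_minimal span_minimal closed_closure subspace_closure_span) blast
qed

text \<open>Write \<open>A\<close> for the closed span of slices. By \<open>slices_products\<close>
  and \<open>slices_Wt\<close>, \<open>A\<close> is the closed span of products
  \<open>S\<dagger> T\<close> of elements of \<open>A\<close>, a self-adjoint set. So
  \<open>A\<close> is closed under adjoints and then under products.\<close>

theorem cstar_algebra_slices: "cstar_algebra (slices W)"
proof -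
  have sb: "slices W \<subseteq> bops" using slices_bops[OF W_bops] by auto
  have prod: "a\<dagger> ** b \<in> slices W" if a: "a \<in> slices W" and b: "b \<in> slices W" for a b
  proof -
    have 1: "t\<dagger> ** b \<in> slices W" if t: "t = slice_left Wt \<xi> \<eta>" for t \<xi> \<eta>
      by (rule subspace_image_subset_slices[OF bounded_linear_compose_left subspace_slices closed_slices _ b])
        (subst slices_products, unfold t, rule closure_span_mem, blast)
    let ?S = "{t. t ** b \<in> slices W}"
    have S: "subspace ?S" "closed ?S"
      by (rule subspace_preimage closed_preimage; rule bounded_linear_compose_right subspace_slices closed_slices)+
    have "slices Wt \<subseteq> {T \<in> bops. T\<dagger> \<in> ?S}" unfolding slices_def[of Wt]
      by (rule closure_minimal[OF span_minimal]) (use 1 subspace_closed_adj_preimage[OF S] in auto)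
    then show ?thesis using a unfolding slices_Wt by blast
  qed
  have adj: "a\<dagger> \<in> slices W" if a: "a \<in> slices W" for a
  proof -
    have "(slice_left Wt \<xi> \<eta>)\<dagger> ** slice_left W x z \<in> {T \<in> bops. T\<dagger> \<in> slices W}" for \<xi> \<eta> x z
      using prod[OF slices_gen, of "slice_left Wt \<xi> \<eta>" x z] slices_gen[of Wt \<xi> \<eta>] by (simp add: adj_compose slices_Wt)
    then have "closure (span {(slice_left Wt \<xi> \<eta>)\<dagger> ** slice_left W x z | \<xi> \<eta> x z. True}) \<subseteq> {T \<in> bops. T\<dagger> \<in> slices W}"
      by (intro closure_minimal span_minimal subspace_closed_adj_preimage[OF subspace_slices closed_slices]) blast
    then have "slices W \<subseteq> {T \<in> bops. T\<dagger> \<in> slices W}" unfolding slices_products[symmetric] .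
    then show ?thesis using a by blast
  qed
  have comp: "a ** b \<in> slices W" if "a \<in> slices W" "b \<in> slices W" for a b
    using prod[OF adj[OF that(1)] that(2)] that(1) sb by auto
  have cs: "cscale c a \<in> slices W" if "a \<in> slices W" for c a
  proof (rule subspace_image_subset_slices[OF bounded_linear_cscale subspace_slices closed_slices _ that])
    fix x z show "cscale c (slice_left W x z) \<in> slices W"
      using slices_gen[of W x "c *\<^sub>C z"] by (simp add: slice_left_def lins_scaleC blinfun_compose_cscale)
  qed
  have "star_subalgebra (slices W)"
    unfolding star_subalgebra_def
    by (intro conjI ballI allI; (rule sb closed_slices subspace_0[OF subspace_slices] subspace_add[OF subspace_slices] comp adj cs; assumption?))
  moreover have "ctotal {blinfun_apply T x | T x. T \<in> slices W}"
    unfolding ctotal_def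
  proof (intro allI impI)
    fix v assume v: "\<forall>x\<in>{blinfun_apply T x | T x. T \<in> slices W}. cinner x v = 0"
    have "(W\<dagger>) (v \<otimes>\<^sub>h v) = 0"
    proof (rule htens_cinner_ext)
      fix z u
      have "cinner ((slice_left W v z) u) v = 0" using v slices_gen by blast
      then have "cinner (v \<otimes>\<^sub>h v) (W (z \<otimes>\<^sub>h u)) = 0" by (simp only: cinner_slice_left[symmetric] cinner_flip_zero)
      then show "cinner (z \<otimes>\<^sub>h u) ((W\<dagger>) (v \<otimes>\<^sub>h v)) = cinner (z \<otimes>\<^sub>h u) 0" by (simp add: cinner_adj_right cinner_flip_zero)
    qed
    then have "v \<otimes>\<^sub>h v = 0" using unitaryD(5)[OF unitary_W, of "v \<otimes>\<^sub>h v"] by simp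
    then show "v = 0" using norm_htens[of v v] by simp
  qed
  ultimately show ?thesis unfolding cstar_algebra_iff by blast
qed

end

section \<open>The dual unitary\<close>

lemma dual_flipped: "dual W = flipped (W\<dagger>)"
  by (simp add: dual_def flipped_def)

lemma dual_dual [simp]: "W \<in> bops \<Longrightarrow> dual (dual W) = W"
  by (simp add: dual_flipped flipped_adj)

text \<open>The reversal \<open>x \<otimes> y \<otimes> z \<mapsto> z \<otimes> y \<otimes> x\<close> turns the adjoint of the pentagon equation for \<open>W\<close> into the
  pentagon equation for its dual.\<close>

lemma multiplicative_dual:
  assumes W: "multiplicative W" shows "multiplicative (dual W)"
proof -
  have u: "unitary W" and p: "leg23 W ** leg12 W = leg12 W ** leg13 W ** leg23 W" using W by (auto simp: multiplicative_def)
  let ?T = "W\<dagger>"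
  have T: "?T \<in> bops" and Wb: "W \<in> bops" using unitaryD(1)[OF u] by auto
  define F :: "(('a, 'a) htensor, 'a) htensor \<Rightarrow>\<^sub>L _" where "F = flip \<otimes> \<one> ** rot"
  have ff: "flip \<otimes> \<one> ** flip \<otimes> \<one> = \<one>"
    by (simp add: op_tensor_compose)
  have uF: "unitary F" unfolding F_def by (intro unitary_compose unitary_op_tensor unitary_flip unitary_id unitary_rot)
  have 13: "flip \<otimes> \<one> ** leg13 S = leg23 S ** flip \<otimes> \<one>"
    and 23: "flip \<otimes> \<one> ** leg23 S = leg13 S ** flip \<otimes> \<one>"
    for S :: "('a, 'a) hop"
    by (simp_all add: leg13_def compose_assoc ff compose_absorb[OF ff])
  have 12: "flip \<otimes> \<one> ** leg12 S = leg12 (flipped S) ** flip \<otimes> \<one>" if "S \<in> bops" for S :: "('a, 'a) hop"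
    using that by (simp add: leg12_def op_tensor_compose flip_flipped)
  have F12: "F ** leg12 ?T = leg23 (flipped ?T) ** F" and F13: "F ** leg13 ?T = leg13 (flipped ?T) ** F" and F23: "F ** leg23 ?T = leg12 (flipped ?T) ** F"
    unfolding F_def compose_assoc rot_leg12[OF T] rot_leg13[OF T] rot_leg23[OF T]
    by (simp_all only: compose_assoc[symmetric] 13 23 12[OF T])
  have "leg12 ?T ** leg23 ?T = leg23 ?T ** (leg13 ?T ** leg12 ?T)"
    using arg_cong[OF p, of adj] Wb by (simp add: adj_compose leg12_adj leg13_adj leg23_adj)
  from arg_cong[OF this, of "\<lambda>X. F ** X"]
  have "(leg23 (flipped ?T) ** leg12 (flipped ?T)) ** F = (leg12 (flipped ?T) ** leg13 (flipped ?T) ** leg23 (flipped ?T)) ** F"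
    by (simp add: compose_assoc compose_square[OF F12] compose_square[OF F13] compose_square[OF F23] F12 F13 F23)
  from unitary_cancel_right[OF uF this] show ?thesis
    unfolding multiplicative_def dual_flipped using u by (simp add: unitary_flipped unitary_adj)
qed

lemma semi_modular_modular: "modular_data W P Q Wt \<Longrightarrow> semi_modular W P Wt"
proof -
  assume "modular_data W P Q Wt"
  then interpret modular_data W P Q Wt .
  show ?thesis by (intro semi_modular.intro mult P Wt slices_eq)
qed

definition conj_op :: "('a::complex_hilbert \<Rightarrow>\<^sub>L 'b::complex_hilbert) \<Rightarrow> ('a conj_space \<Rightarrow>\<^sub>L 'b conj_space)" where
  "conj_op T = Blinfun (\<lambda>x. to_conj (T (of_conj x)))"

lemma of_conj_add: "of_conj (x + y) = of_conj x + of_conj y" and of_conj_scaleR: "of_conj (r *\<^sub>R x) = r *\<^sub>R of_conj x"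
  and of_conj_scaleC: "of_conj (c *\<^sub>C x) = cnj c *\<^sub>C of_conj x" and norm_of_conj: "norm (of_conj x) = norm x"
  and to_conj_scaleR: "to_conj (r *\<^sub>R z) = r *\<^sub>R to_conj z" and cinner_of_conj: "cinner (of_conj x) (of_conj y) = cinner y x"
  by (transfer, simp)+

lemma conj_op_apply [simp]: "(conj_op T) x = to_conj (T (of_conj x))"
proof -
  have "bounded_linear (\<lambda>x. to_conj (T (of_conj x)))"
    by (rule bounded_linear_intro[where K = "norm T"])
      (simp_all add: of_conj_add of_conj_scaleR to_conj_add to_conj_scaleR blinfun.add_right blinfun.scaleR_right norm_to_conj,
        metis norm_blinfun norm_of_conj mult.commute)
  then show ?thesis by (simp add: conj_op_def bounded_linear_Blinfun_apply)
qed

lemma conj_op_bops [simp, intro]: "T \<in> bops \<Longrightarrow> conj_op T \<in> bops"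
  by (rule bopsI) (simp add: of_conj_scaleC bops_scaleC to_conj_scaleC)

lemma unitary_conj_op: assumes U: "unitary U" shows "unitary (conj_op U)"
proof -
  note UD = unitaryD[OF U]
  have "(conj_op U)\<dagger> = conj_op (U\<dagger>)"
    by (rule adj_eqI[OF conj_op_bops[OF UD(1)]]) (simp add: cinner_to_conj cinner_of_conj[symmetric] to_conj_inverse cinner_adj_right[OF UD(1)])
  then show ?thesis unfolding unitary_def using UD by (auto intro!: blinfun_eqI simp: to_conj_inverse of_conj_inverse)
qed

text \<open>The roles of the two positive operators are exchanged for the dual; the unitary \<open>Wt\<close> is conjugated by
  the antiunitary \<open>cnj x \<otimes> u \<mapsto> cnj u \<otimes> x\<close>, written here as a unitary \<open>K\<close> onto a conjugate space.\<close>

lemma semi_modular_dual: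
  fixes W :: "('h::complex_hilbert, 'h) hop"
  assumes M: "modular_data W P Q Wt" shows "\<exists>Wt'. semi_modular (dual W) Q Wt'"
proof -
  interpret modular_data W P Q Wt by fact
  let ?v = "\<lambda>p :: 'h \<times> 'h. to_conj (fst p) \<otimes>\<^sub>h snd p" and ?w = "\<lambda>p :: 'h \<times> 'h. to_conj (to_conj (snd p) \<otimes>\<^sub>h fst p)"
  have sj: "\<exists>x. y = to_conj x" for y :: "'z::complex_hilbert conj_space" by (metis of_conj_inverse)
  have v: "ctotal (range ?v)"
  proof (rule ctotal_mono[OF ctotal_range_htens], safe)
    fix a :: "'h conj_space" and b :: 'h
    obtain x where "a = to_conj x" using sj by blast
    then show "fst (a, b) \<otimes>\<^sub>h snd (a, b) \<in> range ?v" by (intro range_eqI[of _ _ "(x, b)"]) simp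
  qed
  have w: "ctotal (range ?w)" unfolding ctotal_def
  proof (intro allI impI)
    fix y assume y: "\<forall>x\<in>range ?w. cinner x y = 0"
    obtain z where z: "y = to_conj z" using sj by blast
    have "z = 0"
    proof (rule ctotalD[OF v])
      fix x assume "x \<in> range ?v"
      then obtain a b where "x = to_conj a \<otimes>\<^sub>h b" by auto
      moreover have "cinner (?w (b, a)) y = 0" using y by blast
      ultimately show "cinner x z = 0" by (simp add: z cinner_to_conj cinner_flip_zero[of z])
    qed
    then show "y = 0" by (simp add: z zero_conj_space_def)
  qed
  obtain K where K: "unitary K" "\<And>p. K (?v p) = ?w p"
    using unitary_extension[OF v w] by (auto simp: cinner_to_conj cinner_htens mult.commute)
  define Wt' where "Wt' = K\<dagger> ** conj_op Wt ** K"
  have "semi_modular (dual W) Q Wt'"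
  proof (intro semi_modular.intro multiplicative_dual mult Q)
    show "unitary Wt'" unfolding Wt'_def by (intro unitary_compose unitary_adj unitary_conj_op K Wt)
    fix z z' x x' assume z: "(z, z') \<in> Q" and x: "(x, x') \<in> Q"
    show "slice_left Wt' (to_conj z') (to_conj x) = slice_left (dual W) x' z"
    proof (rule cinner_op_ext)
      fix y u
      have "cinner y ((slice_left Wt' (to_conj z') (to_conj x)) u) =
          cinner (K (to_conj z' \<otimes>\<^sub>h y)) ((conj_op Wt) (K (to_conj x \<otimes>\<^sub>h u)))"
        by (simp add: cinner_slice_left Wt'_def cinner_adj_right[OF unitaryD(1)[OF K(1)]])
      also have "\<dots> = cinner (Wt (to_conj u \<otimes>\<^sub>h x)) (to_conj y \<otimes>\<^sub>h z')"
        using K(2)[of "(z', y)"] K(2)[of "(x, u)"] by (simp add: cinner_to_conj to_conj_inverse)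
      also have "\<dots> = cinner (W (y \<otimes>\<^sub>h x')) (u \<otimes>\<^sub>h z)" by (rule cinner_swap_eq[OF coeff[OF z x, symmetric]])
      also have "\<dots> = cinner (y \<otimes>\<^sub>h x') ((W\<dagger>) (u \<otimes>\<^sub>h z))" by (simp add: cinner_adj_right)
      also have "\<dots> = cinner ((flip\<dagger>) (x' \<otimes>\<^sub>h y)) ((W\<dagger>) (u \<otimes>\<^sub>h z))" by simp
      also have "\<dots> = cinner y ((slice_left (dual W) x' z) u)"
        unfolding cinner_slice_left dual_def cinner_adj_left[OF flip_bops] by simp
      finally show "cinner y ((slice_left Wt' (to_conj z') (to_conj x)) u) = cinner y ((slice_left (dual W) x' z) u)" .
    qed
  qed
  then show ?thesis by blast
qed

theorem cstar_algebra_qg: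
  assumes "modular_multiplicative W" shows "cstar_algebra (qg W)" "cstar_algebra (qg (dual W))"
proof -
  obtain P Q Wt where M: "modular_data W P Q Wt" using modular_dataI[OF assms] by blast
  show "cstar_algebra (qg W)"
    using semi_modular.cstar_algebra_slices[OF semi_modular_modular[OF M]] qg_eq_slices[OF modular_data.W_bops[OF M]] by simp
  obtain Wt' where D: "semi_modular (dual W) Q Wt'" using semi_modular_dual[OF M] by blast
  show "cstar_algebra (qg (dual W))"
    using semi_modular.cstar_algebra_slices[OF D] qg_eq_slices[OF semi_modular.W_bops[OF D]] by simp
qed

subsection \<open>Hilbert space dimension\<close>

lemma some_onb_inner: "x \<in> some_onb \<Longrightarrow> y \<in> some_onb \<Longrightarrow> cinner x y = (if x = y then 1 else 0)"
  and some_onb_total: "ctotal some_onb"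
  using orthonormal_basis_some_onb unfolding orthonormal_basis_def ctotal_def by blast+

lemma infinite_some_onb:
  assumes "infinite_dimensional TYPE('k::complex_hilbert)" shows "infinite (some_onb :: 'k set)"
proof
  assume fin: "finite (some_onb :: 'k set)"
  \<comment> \<open>\<open>span\<close> is the real span, so the multiples by \<open>\<i>\<close>
    have to be adjoined.\<close>
  let ?B = "some_onb \<union> (\<lambda>b. \<i> *\<^sub>C b) ` (some_onb :: 'k set)"
  have "x \<in> span ?B" for x
  proof -
    have "x - (\<Sum>b\<in>some_onb. cinner b x *\<^sub>C b) = 0"
    proof (rule ctotalD[OF some_onb_total])
      fix c :: 'k assume c: "c \<in> some_onb"
      have "cinner c (\<Sum>b\<in>some_onb. cinner b x *\<^sub>C b) = (\<Sum>b\<in>some_onb. if c = b then cinner b x else 0)"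
        unfolding cinner_sum_right by (rule sum.cong) (use c in \<open>auto simp: cinner_scaleC_right some_onb_inner\<close>)
      then show "cinner c (x - (\<Sum>b\<in>some_onb. cinner b x *\<^sub>C b)) = 0" using c fin by (simp add: cinner_diff_right)
    qed
    then have x: "x = (\<Sum>b\<in>some_onb. cinner b x *\<^sub>C b)" by simp
    have "c *\<^sub>C b \<in> span ?B" if "b \<in> some_onb" for c b
    proof -
      have "c = complex_of_real (Re c) + complex_of_real (Im c) * \<i>" by (simp add: complex_eq_iff)
      from arg_cong[OF this, of "\<lambda>c. c *\<^sub>C b"] have e: "c *\<^sub>C b = Re c *\<^sub>R b + Im c *\<^sub>R (\<i> *\<^sub>C b)"
        unfolding scaleC_add_left scaleC_scaleC[symmetric] scaleR_scaleC[symmetric] .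
      show ?thesis unfolding e using that by (intro span_add span_scale span_base) auto
    qed
    then have "(\<Sum>b\<in>some_onb. cinner b x *\<^sub>C b) \<in> span ?B" by (rule span_sum)
    then show ?thesis unfolding x[symmetric] .
  qed
  then have "span ?B = UNIV" by auto
  moreover have "finite ?B" using fin by simp
  ultimately show False using assms unfolding infinite_dimensional_def by metis
qed

text \<open>Every vector of \<open>E\<close> has a nonzero coefficient against some basis vector,
  and by Bessel's inequality a basis vector sees only countably many elements of \<open>E\<close>.
  So \<open>E\<close> injects into the product of the basis with \<open>nat\<close>, which is no
  larger than the infinite basis.\<close>

lemma orthonormal_lepoll:
  fixes E :: "'k::complex_hilbert set"
  assumes E: "\<And>x y. x \<in> E \<Longrightarrow> y \<in> E \<Longrightarrow> cinner x y = (if x = y then 1 else 0)" and inf: "infinite (some_onb :: 'k set)"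
  shows "E \<lesssim> (some_onb :: 'k set)"
proof -
  let ?N = "\<lambda>b. {e \<in> E. (cmod (cinner e b))\<^sup>2 \<noteq> 0}"
  have count: "countable (?N b)" for b
  proof (rule summable_countable_real, rule nonneg_bdd_above_summable_on)
    have "(\<Sum>e\<in>F. (cmod (cinner e b))\<^sup>2) \<le> (norm b)\<^sup>2" if "F \<subseteq> E" "finite F" for F
      using bessel_finite(1)[of E F b] E that zero_le_power2[of "norm (b - (\<Sum>e\<in>F. cinner e b *\<^sub>C e))"] by auto
    then show "bdd_above (sum (\<lambda>e. (cmod (cinner e b))\<^sup>2) ` {F. F \<subseteq> E \<and> finite F})" by (auto intro!: bdd_aboveI2)
  qed simp
  have "\<exists>b\<in>some_onb. e \<in> ?N b" if e: "e \<in> E" for e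
  proof (rule ccontr)
    assume "\<not> ?thesis"
    then have "\<forall>b\<in>some_onb. cinner b e = 0" using e by (simp add: cinner_flip_zero[of _ e])
    then have "e = 0" using ctotalD[OF some_onb_total] by blast
    then show False using E[OF e e] by simp
  qed
  then have "\<forall>e\<in>E. \<exists>b. b \<in> some_onb \<and> e \<in> ?N b" by blast
  from bchoice[OF this] obtain f where f: "\<And>e. e \<in> E \<Longrightarrow> f e \<in> some_onb" "\<And>e. e \<in> E \<Longrightarrow> e \<in> ?N (f e)" by blast
  have "inj_on (\<lambda>e. (f e, to_nat_on (?N (f e)) e)) E"
  proof (rule inj_onI)
    fix e e' assume e: "e \<in> E" "e' \<in> E" "(f e, to_nat_on (?N (f e)) e) = (f e', to_nat_on (?N (f e')) e')"
    have fe: "f e' = f e" using arg_cong[OF e(3), of fst] by simp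
    have tn: "to_nat_on (?N (f e)) e = to_nat_on (?N (f e)) e'" using arg_cong[OF e(3), of snd] by (simp only: snd_conv fe)
    have m: "e \<in> ?N (f e)" "e' \<in> ?N (f e)" using f(2)[OF e(1)] f(2)[OF e(2)] unfolding fe .
    show "e = e'" by (rule inj_onD[OF inj_on_to_nat_on[OF count] tn m])
  qed
  then have "E \<lesssim> (some_onb :: 'k set) \<times> (UNIV :: nat set)" using f(1) by (force simp: lepoll_def)
  also have "\<dots> \<lesssim> (some_onb :: 'k set) \<times> (some_onb :: 'k set)" by (rule times_lepoll_mono) (use inf in \<open>simp_all add: infinite_le_lepoll\<close>)
  also have "\<dots> \<approx> (some_onb :: 'k set)" unfolding eqpoll_iff_card_of_ordIso by (rule card_of_Times_same_infinite[OF inf])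
  finally show ?thesis .
qed

lemma isometry_adj_compose:
  fixes J :: "'a::complex_hilbert \<Rightarrow>\<^sub>L 'b::complex_hilbert"
  assumes J: "J \<in> bops" "\<And>x. norm (J x) = norm x"
  shows "J\<dagger> ** J = \<one>"
proof -
  have re: "Re (cinner (J x) (J y)) = Re (cinner x y)" for x y
    using norm_add_sq[of "J x" "J y"] norm_add_sq[of x y] J(2)[of "x + y"] J(2)[of x] J(2)[of y] by (simp add: blinfun.add_right)
  have "cinner (J x) (J y) = cinner x y" for x y
    using re[of x y] re[of "\<i> *\<^sub>C x" y] by (simp add: complex_eq_iff cinner_scaleC_left bops_scaleC[OF J(1)])
  then show ?thesis by (intro cinner_op_ext) (simp add: cinner_adj_right[OF J(1)])
qed

text \<open>The spaces \<open>'x \<otimes> 'k\<close> and \<open>'k\<close> have bases of equal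
  cardinality: the basis of \<open>'x\<close> is no larger than the infinite basis of
  \<open>'k\<close>, and it is nonempty because \<open>'x\<close> is nonzero.\<close>

lemma unitary_htensor_absorb:
  assumes k: "infinite_dimensional TYPE('k::complex_hilbert)" and e: "embeds TYPE('x::complex_hilbert) TYPE('k)" and nz: "(x0 :: 'x) \<noteq> 0"
  shows "\<exists>U :: ('x, 'k) htensor \<Rightarrow>\<^sub>L 'k. unitary U"
proof -
  let ?X = "some_onb :: 'x set" and ?K = "some_onb :: 'k set"
  have inf: "infinite ?K" by (rule infinite_some_onb[OF k])
  obtain J :: "'x \<Rightarrow>\<^sub>L 'k" where J: "J \<in> bops" "\<And>x. norm (J x) = norm x" using e by (auto simp: embeds_def)
  note JJ = isometry_adj_compose[OF J]
  have cJ: "cinner (J x) (J y) = cinner x y" for x y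
    using arg_cong[OF JJ, of "\<lambda>T. cinner x (T y)"] by (simp add: cinner_adj_right[OF J(1)])
  have "inj_on (J) ?X" by (rule inj_onI) (metis cJ cinner_eq_zero_iff blinfun.diff_right eq_iff_diff_eq_0)
  then have "?X \<lesssim> J ` ?X" unfolding lepoll_def by blast
  also have "\<dots> \<lesssim> ?K"
  proof (rule orthonormal_lepoll[OF _ inf], safe)
    fix x y :: 'x assume "x \<in> ?X" "y \<in> ?X"
    moreover have "J x = J y \<longleftrightarrow> x = y" by (metis cJ cinner_eq_zero_iff blinfun.diff_right eq_iff_diff_eq_0)
    ultimately show "cinner (J x) (J y) = (if J x = J y then 1 else 0)" by (simp add: cJ some_onb_inner)
  qed
  finally have "?X \<times> ?K \<lesssim> ?K \<times> ?K" by (rule times_lepoll_mono) simp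
  also have "\<dots> \<approx> ?K" unfolding eqpoll_iff_card_of_ordIso by (rule card_of_Times_same_infinite[OF inf])
  finally have 1: "?X \<times> ?K \<lesssim> ?K" .
  obtain x where x: "x \<in> ?X" using ctotalD[OF some_onb_total, of x0] nz by blast
  have "?K \<lesssim> ?X \<times> ?K" unfolding lepoll_def using x by (intro exI[of _ "\<lambda>y. (x, y)"]) (auto intro: inj_onI)
  with 1 have "?X \<times> ?K \<approx> ?K" by (rule lepoll_antisym)
  then obtain f where f: "bij_betw f (?X \<times> ?K) ?K" unfolding eqpoll_def by blast
  \<comment> \<open>Indices outside the bases are sent to 0 on both sides, which keeps the Gram
    matrices equal.\<close>
  define v :: "'x \<times> 'k \<Rightarrow> ('x, 'k) htensor" where "v p = (if p \<in> ?X \<times> ?K then fst p \<otimes>\<^sub>h snd p else 0)" for p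
  define w :: "'x \<times> 'k \<Rightarrow> 'k" where "w p = (if p \<in> ?X \<times> ?K then f p else 0)" for p
  have "ctotal (range v)"
  proof (rule ctotal_mono[OF ctotal_htens[OF some_onb_total some_onb_total]], safe)
    fix x :: 'x and y :: 'k assume "x \<in> some_onb" "y \<in> some_onb"
    then show "x \<otimes>\<^sub>h y \<in> range v" by (intro range_eqI[of _ _ "(x, y)"]) (simp add: v_def)
  qed
  moreover have "ctotal (range w)"
  proof (rule ctotal_mono[OF some_onb_total], safe)
    fix y :: 'k assume "y \<in> some_onb"
    then obtain p where "p \<in> ?X \<times> ?K" "f p = y" using f unfolding bij_betw_def by (metis imageE)
    then show "y \<in> range w" by (intro range_eqI[of _ _ p]) (simp add: w_def)
  qed
  moreover have "cinner (w p) (w q) = cinner (v p) (v q)" for p q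
  proof (cases "p \<in> ?X \<times> ?K \<and> q \<in> ?X \<times> ?K")
    case True
    then have "f p \<in> ?K" "f q \<in> ?K" "f p = f q \<longleftrightarrow> p = q" using f unfolding bij_betw_def by (auto dest: inj_onD)
    moreover have "fst p \<in> ?X" "fst q \<in> ?X" "snd p \<in> ?K" "snd q \<in> ?K" using True by auto
    ultimately show ?thesis using True by (auto simp: v_def w_def cinner_htens some_onb_inner prod_eq_iff)
  qed (auto simp: v_def w_def)
  ultimately show ?thesis using unitary_extension by blast
qed

lemma embeds_htensor:
  assumes k: "infinite_dimensional TYPE('k::complex_hilbert)" and a: "embeds TYPE('a::complex_hilbert) TYPE('k)" and b: "embeds TYPE('b::complex_hilbert) TYPE('k)"
  shows "embeds TYPE(('a, 'b) htensor) TYPE('k)"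
proof -
  have iso: "norm (J x) = norm x" if "J \<in> bops" "J\<dagger> ** J = \<one>"
    for J :: "'p::complex_hilbert \<Rightarrow>\<^sub>L 'q::complex_hilbert" and x
    using norm_sq_adj[OF that(1), of x] unfolding that(2) by (simp add: cinner_norm flip: of_real_power)
  obtain J :: "'a \<Rightarrow>\<^sub>L 'k" where J: "J \<in> bops" "\<And>x. norm (J x) = norm x" using a by (auto simp: embeds_def)
  obtain L :: "'b \<Rightarrow>\<^sub>L 'k" where L: "L \<in> bops" "\<And>x. norm (L x) = norm x" using b by (auto simp: embeds_def)
  have "embeds TYPE('k) TYPE('k)" unfolding embeds_def by (intro exI[of _ \<one>]) simp
  moreover obtain x0 :: 'k where "x0 \<noteq> 0"
    using infinite_some_onb[OF k] some_onb_inner by (metis cinner_zero_left finite.emptyI subsetI subset_empty zero_neq_one)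
  ultimately obtain U :: "('k, 'k) htensor \<Rightarrow>\<^sub>L 'k" where U: "unitary U" using unitary_htensor_absorb[OF k] by blast
  let ?J = "U ** J \<otimes> L"
  have "?J\<dagger> ** ?J = (J \<otimes> L)\<dagger> ** J \<otimes> L"
    using J L unitaryD(1)[OF U] by (simp add: adj_compose compose_assoc compose_absorb[OF unitaryD(2)[OF U]])
  also have "\<dots> = \<one>" using J L by (simp add: op_tensor_adj op_tensor_compose isometry_adj_compose)
  finally have "norm (?J x) = norm x" for x by (intro iso) (use J L unitaryD(1)[OF U] in auto)
  then show ?thesis unfolding embeds_def using J L unitaryD(1)[OF U] by (intro exI[of _ ?J]) auto
qed

subsection \<open>Corepresentations\<close>

lemma flipped_leg12: "T \<in> bops \<Longrightarrow> flipped (leg12 T) = \<one> \<otimes> T"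
  by (simp add: leg12_def flipped_op_tensor)

lemma flipped_leg23: "T \<in> bops \<Longrightarrow> flipped (leg23 T) = pl2 (flipped T)"
  using cyc_id_tensor[of T] compose_square[OF cyc_id_tensor[of T], of "assoc ** flip"]
  by (simp add: flipped_def leg23_def reassoc_def cyc_def compose_assoc)

lemma flipped_leg13:
  assumes T: "T \<in> bops" shows "flipped (leg13 T) = pl1 (flipped T)"
proof -
  have "flipped (leg13 T) = \<one> \<otimes> flip ** pl2 (flipped T) ** \<one> \<otimes> flip"
  proof -
    have 1: "flip ** flip \<otimes> \<one> = \<one> \<otimes> flip ** flip"
      and 2: "flip \<otimes> \<one> ** flip = flip ** \<one> \<otimes> flip" by (simp_all add: flip_op_tensor)
    have "flipped (leg13 T) = \<one> \<otimes> flip ** (flip ** leg23 T ** flip) ** \<one> \<otimes> flip"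
      by (simp only: flipped_def leg13_def compose_assoc 2 compose_square[OF 1])
    then show ?thesis by (simp only: flipped_def[of "leg23 T", symmetric] flipped_leg23[OF T])
  qed
  then show ?thesis
    by (simp add: pl2_def compose_assoc id_flip_flip compose_absorb[OF id_flip_flip])
qed

lemma flipped_inject: "flipped S = flipped T \<longleftrightarrow> S = T"
  by (metis flipped_flipped)

text \<open>The pentagon equation with \<open>V\<close> in the factors that involve the third leg.
  Stated with \<open>W\<close> alone, it avoids the comultiplication of the dual;
  \<open>corep_dual\<close> is the translation.\<close>

definition corep where
  "corep W V \<longleftrightarrow> leg12 W ** leg13 V ** leg23 V = leg23 V ** leg12 W"

lemma corep_flipped:
  assumes "W \<in> bops" "V \<in> bops"
  shows "corep W V \<longleftrightarrow> (\<one> \<otimes> W) ** pl1 (flipped V) ** pl2 (flipped V) = pl2 (flipped V) ** \<one> \<otimes> W"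
  unfolding corep_def flipped_inject[symmetric, of _ "leg23 V ** leg12 W"]
  using assms by (simp add: flipped_compose flipped_leg12 flipped_leg13 flipped_leg23)

text \<open>Flipping brings the algebra leg to the front, where the amplification acts. The relation
  is then a word in \<open>pl1\<close>, \<open>pl2\<close> and \<open>\<one> \<otimes> W\<close>,
  all of which are respected by \<open>amp\<close>.\<close>

lemma corep_amp:
  assumes X: "star_rep X \<pi>" and V: "V \<in> bops" "flipped V \<in> hmul X" and W: "W \<in> bops" and c: "corep W V"
  shows "corep W (flipped (amp X \<pi> (flipped V)))"
proof -
  interpret star_rep X \<pi> by fact
  note h = hmul_pl1[OF subalg V(2)] hmul_pl2[OF subalg V(2)] hmul_id_tensor[OF subalg W]
  have "amp X \<pi> (\<one> \<otimes> W ** pl1 (flipped V) ** pl2 (flipped V)) = amp X \<pi> (pl2 (flipped V) ** \<one> \<otimes> W)"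
    using c unfolding corep_flipped[OF W V(1)] by simp
  then show ?thesis
    unfolding corep_flipped[OF W flipped_bops[OF amp_bops[OF V(2)]]] flipped_flipped
    by (simp only: amp_compose h hmul_compose[OF subalg] amp_pl1[OF V(2)] amp_pl2[OF V(2)] amp_id_tensor[OF W])
qed

lemma star_rep_pairI: "star_rep A \<phi> \<Longrightarrow> star_rep B \<psi> \<Longrightarrow> star_rep_pair A \<phi> B \<psi>"
  by (rule star_rep_pair.intro)

lemma flipped_multipliers_hmul:
  assumes A: "cstar_algebra A" and B: "cstar_algebra B" and V: "V \<in> multipliers (A \<otimes>\<^sub>A B)"
  shows "V \<in> hmul A" "flipped V \<in> hmul B"
proof -
  note A' = cstar_algebraD(1)[OF A] and B' = cstar_algebraD(1)[OF B]
  show "V \<in> hmul A" by (rule multipliers_hmul[OF A' B V])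
  have "flipped V \<in> multipliers (B \<otimes>\<^sub>A A)" using flipped_multipliers[OF V] star_subalgebraD(1)[OF A'] star_subalgebraD(1)[OF B'] by blast
  then show "flipped V \<in> hmul B" by (rule multipliers_hmul[OF B' A])
qed

lemma tensor_ext_left:
  assumes A: "cstar_algebra A" "star_rep A \<phi>" and B: "cstar_algebra B" and V: "V \<in> multipliers (A \<otimes>\<^sub>A B)"
  shows "tensor_ext A \<phi> B (id_morphism B) V = amp A \<phi> V"
proof -
  note h = flipped_multipliers_hmul(2)[OF A(1) B V]
  show ?thesis
    using star_rep_pair.tensor_ext_amp[OF star_rep_pairI[OF A(2) star_rep_id[OF B]] V h] by (simp add: amp_id_morphism[OF B h])
qed

lemma tensor_ext_right:
  assumes A: "cstar_algebra A" and B: "cstar_algebra B" "star_rep B \<psi>" and V: "V \<in> multipliers (A \<otimes>\<^sub>A B)"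
  shows "tensor_ext A (id_morphism A) B \<psi> V = flipped (amp B \<psi> (flipped V))"
proof -
  note h = flipped_multipliers_hmul(2)[OF A B(1) V] and p = star_rep_pairI[OF star_rep_id[OF A] B(2)]
  show ?thesis
    using star_rep_pair.tensor_ext_amp[OF p V h] by (simp add: amp_id_morphism[OF A star_rep_pair.amp_right_multiplier(2)[OF p V h]])
qed

text \<open>Exchanging the first two legs by \<open>flip \<otimes> \<one>\<close> turns the dual
  unitary into \<open>W\<dagger>\<close> and swaps \<open>leg13\<close> with \<open>leg23\<close>.
  What remains is the corepresentation equation up to multiplication by
  \<open>leg12 W\<close>.\<close>

lemma corep_dual:
  assumes W: "unitary W" and V: "unitary V"
  shows "leg12 (dual W) ** leg13 V ** (leg12 (dual W))\<dagger> = leg23 V ** leg13 V \<longleftrightarrow> corep W V"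
proof -
  note WD = unitaryD[OF W] and VD = unitaryD[OF V]
  let ?F = "flip \<otimes> \<one>"
  have ff: "?F ** ?F = \<one>" by (simp add: op_tensor_compose)
  have uF: "unitary ?F" by (intro unitary_op_tensor unitary_flip unitary_id)
  have W12: "leg12 (dual W) = ?F ** leg12 (W\<dagger>) ** ?F"
    using WD by (simp add: dual_def leg12_def op_tensor_compose)
  have V23: "leg23 V = ?F ** leg13 V ** ?F" by (simp add: leg13_def compose_assoc ff compose_absorb[OF ff])
  have u12: "unitary (leg12 W)" by (rule unitary_leg[OF W])
  note u = unitaryD[OF u12]
  have ud: "unitary (leg12 (dual W))" unfolding dual_flipped by (intro unitary_leg unitary_flipped unitary_adj W)
  have "leg12 (dual W) ** leg13 V ** (leg12 (dual W))\<dagger> = leg23 V ** leg13 V \<longleftrightarrow>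
      leg12 (dual W) ** leg13 V = leg23 V ** leg13 V ** leg12 (dual W)" (is "?A \<longleftrightarrow> ?B")
  proof
    assume ?A
    from arg_cong[OF this, of "\<lambda>X. X ** leg12 (dual W)"] show ?B by (simp add: compose_assoc unitaryD[OF ud])
  next
    assume ?B
    from arg_cong[OF this, of "\<lambda>X. X ** (leg12 (dual W))\<dagger>"] show ?A by (simp add: compose_assoc unitaryD[OF ud])
  qed
  also have "\<dots> \<longleftrightarrow> ?F ** (leg12 (dual W) ** leg13 V) ** ?F = ?F ** (leg23 V ** leg13 V ** leg12 (dual W)) ** ?F"
    by (rule iffI, simp only:, rule unitary_cancel_left[OF uF], rule unitary_cancel_right[OF uF])
  also have "?F ** (leg12 (dual W) ** leg13 V) ** ?F = (leg12 W)\<dagger> ** leg23 V"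
    unfolding W12 V23 by (simp add: compose_assoc ff compose_absorb[OF ff] leg12_adj WD)
  also have "?F ** (leg23 V ** leg13 V ** leg12 (dual W)) ** ?F = leg13 V ** leg23 V ** (leg12 W)\<dagger>"
    unfolding W12 V23 by (simp add: compose_assoc ff compose_absorb[OF ff] leg12_adj WD)
  also have "(leg12 W)\<dagger> ** leg23 V = leg13 V ** leg23 V ** (leg12 W)\<dagger> \<longleftrightarrow> corep W V" (is "?A \<longleftrightarrow> _")
  proof
    assume ?A
    from arg_cong[OF this, of "\<lambda>X. leg12 W ** X ** leg12 W"] show "corep W V"
      unfolding corep_def by (simp add: compose_assoc u compose_absorb[OF u(3)])
  next
    assume "corep W V"
    from arg_cong[OF this[unfolded corep_def], of "\<lambda>X. (leg12 W)\<dagger> ** X ** (leg12 W)\<dagger>"] show ?A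
      by (simp add: compose_assoc u compose_absorb[OF u(2)])
  qed
  finally show ?thesis .
qed

lemma left_corep_iff:
  assumes C: "cstar_algebra (qg (dual W))" and W: "unitary W" and D: "cstar_algebra D"
  shows "left_corep (qg (dual W)) (comult (dual W)) D V \<longleftrightarrow>
    V \<in> unitary_multipliers (qg (dual W) \<otimes>\<^sub>A D) \<and> corep W V"
proof -
  have ud: "unitary (dual W)" unfolding dual_flipped by (intro unitary_flipped unitary_adj W)
  show ?thesis
    unfolding left_corep_def unitary_multipliers_def
    by (auto simp: tensor_ext_left[OF C star_rep_comult[OF C ud] D] amp_comult[OF C ud] flipped_multipliers_hmul(1)[OF C D] corep_dual[OF W])
qed

text \<open>\<open>\<phi> s ** rank1 z q\<close> is the rank-one operator with range vector
  \<open>\<phi> s z\<close>, and these vectors are total by nondegeneracy. The compact operators on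
  \<open>'k\<close> can therefore serve as test algebra in the universal property.\<close>

lemma bops_morphism_compacts:
  fixes A :: "('a::complex_hilbert \<Rightarrow>\<^sub>L 'a) set" and \<phi> :: "('a \<Rightarrow>\<^sub>L 'a) \<Rightarrow> ('b::complex_hilbert \<Rightarrow>\<^sub>L 'b)"
  assumes "star_rep A \<phi>" shows "morphism A compacts \<phi>"
proof -
  interpret star_rep A \<phi> by fact
  have m: "T \<in> multipliers compacts" if "T \<in> bops" for T :: "'b \<Rightarrow>\<^sub>L 'b"
    using that by (simp add: multipliers_def bops_compose_compacts compacts_compose_bops)
  let ?S = "closure (span {\<phi> S ** T | S T. S \<in> A \<and> T \<in> compacts})"
  have "?S \<subseteq> compacts"
    by (rule closure_minimal[OF span_minimal[OF _ subspace_compacts] closed_compacts]) (auto intro: bops_compose_compacts)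
  moreover have "rank1 p q \<in> ?S" for p q
  proof -
    have bl: "bounded_linear (\<lambda>p :: 'b. rank1 p q)"
    proof (rule bounded_linear_intro)
      fix x y :: 'b and r
      show "rank1 (x + y) q = rank1 x q + rank1 y q" "rank1 (r *\<^sub>R x) q = r *\<^sub>R rank1 x q"
        by (rule blinfun_eqI; simp add: blinfun.bilinear_simps scaleC_add_right scaleC_scaleR)+
      show "norm (rank1 x q) \<le> norm x * norm q"
        by (rule norm_blinfun_bound)
          (simp_all add: norm_scaleC, metis cmod_cinner_le mult.assoc mult.commute mult_left_mono norm_ge_zero)
    qed
    have tot: "closure (span {(\<phi> s) z | s z. s \<in> A}) = UNIV"
    proof (subst closure_span_eq_UNIV_iff)
      fix c x assume "x \<in> {(\<phi> s) z | s z. s \<in> A}"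
      then obtain s z where "x = (\<phi> s) z" "s \<in> A" by blast
      then have "c *\<^sub>C x = (\<phi> s) (c *\<^sub>C z)" by (simp add: bops_scaleC)
      then show "c *\<^sub>C x \<in> {(\<phi> s) z | s z. s \<in> A}" using \<open>s \<in> A\<close> by blast
    qed (rule nondeg)
    show ?thesis
    proof (rule closure_span_image_subset[OF bl subspace_closure_span closed_closure])
      show "p \<in> closure (span {(\<phi> s) z | s z. s \<in> A})" unfolding tot by simp
      fix x assume "x \<in> {(\<phi> s) z | s z. s \<in> A}"
      then obtain s z where x: "x = (\<phi> s) z" "s \<in> A" by blast
      have "rank1 x q = \<phi> s ** rank1 z q" by (simp add: x compose_rank1)
      then show "rank1 x q \<in> ?S" using x(2) rank1_compacts by (intro closure_span_mem) blast
    qed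
  qed
  then have "compacts \<subseteq> ?S" unfolding compacts_def[where 'a = 'b]
    by (intro closure_minimal span_minimal closed_closure subspace_closure_span) blast
  ultimately have "?S = compacts" by blast
  moreover have "\<phi> \<in> A \<rightarrow>\<^sub>E multipliers compacts" using hom m unfolding star_hom_def by blast
  ultimately show ?thesis using hom unfolding morphism_def by blast
qed

lemma universal_corepD:
  assumes u: "universal_corep TYPE('k::complex_hilbert) W Cu V" and W: "unitary W" and C: "cstar_algebra (qg (dual W))"
  shows "cstar_algebra Cu" "V \<in> multipliers (qg (dual W) \<otimes>\<^sub>A Cu)" "unitary V" "V \<in> bops" "corep W V"
    "flipped V \<in> hmul Cu" "V \<in> hmul (qg (dual W))"
proof -
  show Cu: "cstar_algebra Cu" using u by (simp add: universal_corep_def)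
  have l: "left_corep (qg (dual W)) (comult (dual W)) Cu V" using u by (simp add: universal_corep_def)
  show V: "V \<in> multipliers (qg (dual W) \<otimes>\<^sub>A Cu)" and "unitary V" "corep W V"
    using l unfolding left_corep_iff[OF C W Cu] unitary_multipliers_def by auto
  then show "V \<in> bops" by (simp add: unitary_def)
  show "flipped V \<in> hmul Cu" "V \<in> hmul (qg (dual W))" using flipped_multipliers_hmul[OF C Cu V] by auto
qed

text \<open>Two representations of \<open>Cu\<close> on a space \<open>'x\<close> which agree on the universal corepresentation induce, after
  tensoring with \<open>'k\<close> and identifying \<open>'x \<otimes> 'k\<close> with \<open>'k\<close>, the same corepresentation on the compact operators of \<open>'k\<close>.\<close>

theorem universal_corep_separates:
  fixes \<pi>1 \<pi>2 :: "('u::complex_hilbert \<Rightarrow>\<^sub>L 'u) \<Rightarrow> ('x::complex_hilbert \<Rightarrow>\<^sub>L 'x)"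
  assumes u: "universal_corep TYPE('k::complex_hilbert) W Cu V" and W: "unitary W" and C: "cstar_algebra (qg (dual W))"
    and k: "infinite_dimensional TYPE('k)" and e: "embeds TYPE('x) TYPE('k)"
    and \<pi>: "star_rep Cu \<pi>1" "star_rep Cu \<pi>2" and eq: "amp Cu \<pi>1 (flipped V) = amp Cu \<pi>2 (flipped V)"
  shows "\<pi>1 = \<pi>2"
proof (cases "\<exists>x :: 'x. x \<noteq> 0")
  case True
  then obtain U :: "('x, 'k) htensor \<Rightarrow>\<^sub>L 'k" where U: "unitary U" using unitary_htensor_absorb[OF k e] by blast
  note UD = unitaryD[OF U] and uD = universal_corepD[OF u W C]
  define \<rho> where "\<rho> \<pi> = restrict (\<lambda>s. U ** (\<pi> s \<otimes> \<one>) ** U\<dagger>) Cu" for \<pi>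
  have \<rho>: "star_rep Cu (\<rho> \<pi>1)" "star_rep Cu (\<rho> \<pi>2)" unfolding \<rho>_def by (intro star_rep_conj \<pi> U)+
  let ?U = "\<lambda>\<pi>. flipped (amp Cu (\<rho> \<pi>) (flipped V))"
  have same: "?U \<pi>1 = ?U \<pi>2" unfolding \<rho>_def by (simp add: amp_conj[OF \<pi>(1) U uD(6)] amp_conj[OF \<pi>(2) U uD(6)] eq)
  have ext: "tensor_ext (qg (dual W)) (id_morphism (qg (dual W))) Cu (\<rho> \<pi>) V = ?U \<pi>" if "star_rep Cu (\<rho> \<pi>)" for \<pi>
    by (rule tensor_ext_right[OF C uD(1) that uD(2)])
  have "left_corep (qg (dual W)) (comult (dual W)) compacts (?U \<pi>1)"
    unfolding left_corep_iff[OF C W cstar_algebra_compacts] unitary_multipliers_def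
  proof (intro conjI CollectI)
    show "?U \<pi>1 \<in> multipliers (qg (dual W) \<otimes>\<^sub>A compacts)"
      by (rule hmul_multipliers_compacts[OF cstar_algebraD(1)[OF C]],
          rule star_rep_pair.amp_right_multiplier(2)[OF star_rep_pairI[OF star_rep_id[OF C] \<rho>(1)] uD(2,6)])
    show "unitary (?U \<pi>1)" by (intro unitary_flipped star_rep.amp_unitary[OF \<rho>(1) uD(6)] uD(3))
    show "corep W (?U \<pi>1)" by (rule corep_amp[OF \<rho>(1) uD(4,6) unitaryD(1)[OF W] uD(5)])
  qed
  then have "\<exists>!\<phi>. morphism Cu compacts \<phi> \<and> ?U \<pi>1 = tensor_ext (qg (dual W)) (id_morphism (qg (dual W))) Cu \<phi> V"
    using u cstar_algebra_compacts unfolding universal_corep_def by blast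
  moreover have "morphism Cu compacts (\<rho> \<pi>1) \<and> ?U \<pi>1 = tensor_ext (qg (dual W)) (id_morphism (qg (dual W))) Cu (\<rho> \<pi>1) V"
    by (intro conjI bops_morphism_compacts \<rho> ext[symmetric])
  moreover have "morphism Cu compacts (\<rho> \<pi>2) \<and> ?U \<pi>1 = tensor_ext (qg (dual W)) (id_morphism (qg (dual W))) Cu (\<rho> \<pi>2) V"
    unfolding same by (intro conjI bops_morphism_compacts \<rho> ext[symmetric])
  ultimately have \<rho>eq: "\<rho> \<pi>1 = \<rho> \<pi>2" by blast
  \<comment> \<open>Tensoring with a nonzero space is injective on operators, so
    \<open>\<pi>1\<close> and \<open>\<pi>2\<close> are recovered from the transported
    representations.\<close>
  obtain x0 :: 'k where x0: "x0 \<noteq> 0"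
    using infinite_some_onb[OF k] some_onb_inner by (metis cinner_zero_left finite.emptyI subsetI subset_empty zero_neq_one)
  show ?thesis
  proof
    fix T
    show "\<pi>1 T = \<pi>2 T"
    proof (cases "T \<in> Cu")
      case True
      have b: "\<pi>1 T \<in> bops" "\<pi>2 T \<in> bops" using star_rep.hom_bops[OF \<pi>(1) True] star_rep.hom_bops[OF \<pi>(2) True] by auto
      have "U ** (\<pi>1 T \<otimes> \<one>) ** U\<dagger> = U ** (\<pi>2 T \<otimes> \<one>) ** U\<dagger>"
        using fun_cong[OF \<rho>eq, of T] True by (simp add: \<rho>_def)
      then have eqT: "\<pi>1 T \<otimes> (\<one> :: 'k \<Rightarrow>\<^sub>L 'k) = \<pi>2 T \<otimes> \<one>"
        using unitary_cancel_left[OF U] unitary_cancel_right[OF unitary_adj[OF U]] by metis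
      show ?thesis
      proof (rule blinfun_eqI)
        fix x
        have "((\<pi>1 T) x - (\<pi>2 T) x) \<otimes>\<^sub>h x0 = 0"
          using arg_cong[OF eqT, of "\<lambda>R. R (x \<otimes>\<^sub>h x0)"] b htens_add_left[of "(\<pi>1 T) x - (\<pi>2 T) x" "(\<pi>2 T) x" x0]
          by simp
        then have "norm ((\<pi>1 T) x - (\<pi>2 T) x) * norm x0 = 0" by (metis norm_htens norm_zero)
        then show "(\<pi>1 T) x = (\<pi>2 T) x" using x0 by simp
      qed
    next
      case False
      then show ?thesis using star_homD(7)[OF star_rep.hom[OF \<pi>(1)]] star_homD(7)[OF star_rep.hom[OF \<pi>(2)]] by simp
    qed
  qed
next
  case False
  then have "S = T" for S T :: "'x \<Rightarrow>\<^sub>L 'x" by (intro blinfun_eqI) metis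
  then show ?thesis by blast
qed

subsection \<open>Bicharacters\<close>

lemma reassoc_flipped:
  assumes "R \<in> bops" "V \<in> bops"
  shows "reassoc (flipped R) = leg12 V ** leg13 V \<longleftrightarrow> R = leg13 (flipped V) ** leg23 (flipped V)"
proof -
  note r = unitaryD[OF unitary_rot]
  have e: "reassoc (flipped R) = rot\<dagger> ** R ** rot"
    by (simp add: reassoc_def flipped_def rot_def adj_compose compose_assoc)
  have f: "rot ** (leg12 V ** leg13 V) = (leg13 (flipped V) ** leg23 (flipped V)) ** rot"
    using assms by (simp add: compose_assoc compose_square[OF rot_leg12] rot_leg13)
  show ?thesis
  proof
    assume "reassoc (flipped R) = leg12 V ** leg13 V"
    then have "rot ** (rot\<dagger> ** R ** rot) = (leg13 (flipped V) ** leg23 (flipped V)) ** rot" unfolding e f[symmetric] by simp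
    then have "R ** rot = (leg13 (flipped V) ** leg23 (flipped V)) ** rot" by (simp only: compose_assoc compose_absorb[OF r(3)])
    then show "R = leg13 (flipped V) ** leg23 (flipped V)" by (rule unitary_cancel_right[OF unitary_rot])
  next
    assume "R = leg13 (flipped V) ** leg23 (flipped V)"
    then have "rot\<dagger> ** (R ** rot) = rot\<dagger> ** (rot ** (leg12 V ** leg13 V))" unfolding f by simp
    then show "reassoc (flipped R) = leg12 V ** leg13 V" unfolding e by (simp only: compose_assoc compose_absorb[OF r(2)])
  qed
qed

definition left_character where
  "left_character X \<Delta> V \<longleftrightarrow> amp X \<Delta> V = leg23 V ** leg13 V"

text \<open>The condition \<open>(id \<otimes> \<Delta>)(V) = V12 V13\<close>, flipped so that
  \<open>Y\<close> comes first and \<open>amp\<close> applies. The permutation of the legs turns the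
  factors into \<open>leg13\<close> and \<open>leg23\<close> of \<open>flipped V\<close>.\<close>

definition right_character where
  "right_character Y \<Delta> V \<longleftrightarrow> amp Y \<Delta> (flipped V) = leg13 (flipped V) ** leg23 (flipped V)"

lemma reassoc_tensor_ext_right:
  assumes X: "cstar_algebra X" and Y: "cstar_algebra Y" "star_rep Y \<Delta>" and V: "V \<in> multipliers (X \<otimes>\<^sub>A Y)"
  shows "reassoc (tensor_ext X (id_morphism X) Y \<Delta> V) = leg12 V ** leg13 V \<longleftrightarrow> right_character Y \<Delta> V"
  unfolding tensor_ext_right[OF assms] right_character_def
  by (rule reassoc_flipped[OF star_rep.amp_bops[OF Y(2) flipped_multipliers_hmul(2)[OF X Y(1) V]] multipliersD(1)[OF V]])

lemma bicharacter_iff: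
  assumes X: "cstar_algebra X" "star_rep X \<Delta>X" and Y: "cstar_algebra Y" "star_rep Y \<Delta>Y"
  shows "bicharacter X \<Delta>X Y \<Delta>Y V \<longleftrightarrow> V \<in> multipliers (X \<otimes>\<^sub>A Y) \<and> unitary V \<and> left_character X \<Delta>X V \<and> right_character Y \<Delta>Y V"
  unfolding bicharacter_def unitary_multipliers_def left_character_def
  by (auto simp: tensor_ext_left[OF X Y(1)] reassoc_tensor_ext_right[OF X(1) Y])

text \<open>Exchanging the legs of \<open>V\<dagger>\<close> exchanges the two character properties.\<close>

lemma left_character_swap:
  assumes X: "star_rep X \<Delta>" and V: "V \<in> hmul X"
  shows "right_character X \<Delta> ((flipped V)\<dagger>) \<longleftrightarrow> left_character X \<Delta> V"
proof -
  interpret star_rep X \<Delta> by fact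
  note Vb = hmulD(1)[OF subalg V]
  have e: "flipped ((flipped V)\<dagger>) = V\<dagger>" using Vb by (simp add: flipped_adj)
  have "amp X \<Delta> (V\<dagger>) = leg13 (V\<dagger>) ** leg23 (V\<dagger>) \<longleftrightarrow> (amp X \<Delta> V)\<dagger> = (leg23 V ** leg13 V)\<dagger>"
    using Vb by (simp add: amp_adj[OF V] adj_compose leg23_adj leg13_adj)
  also have "\<dots> \<longleftrightarrow> amp X \<Delta> V = leg23 V ** leg13 V"
  proof
    assume "(amp X \<Delta> V)\<dagger> = (leg23 V ** leg13 V)\<dagger>"
    from arg_cong[OF this, of adj] show "amp X \<Delta> V = leg23 V ** leg13 V" using Vb amp_bops[OF V] by simp
  qed simp
  finally show ?thesis unfolding left_character_def right_character_def e .
qed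

lemma bicharacter_swap:
  assumes X: "cstar_algebra X" "star_rep X \<Delta>X" and Y: "cstar_algebra Y" "star_rep Y \<Delta>Y" and b: "bicharacter X \<Delta>X Y \<Delta>Y V"
  shows "bicharacter Y \<Delta>Y X \<Delta>X ((flipped V)\<dagger>)"
proof -
  have V: "V \<in> multipliers (X \<otimes>\<^sub>A Y)" "unitary V" "left_character X \<Delta>X V" "right_character Y \<Delta>Y V"
    using b unfolding bicharacter_iff[OF X Y] by auto
  note Xs = cstar_algebraD(1)[OF X(1)] and Ys = cstar_algebraD(1)[OF Y(1)] and Vb = multipliersD(1)[OF V(1)]
  note h = flipped_multipliers_hmul[OF X(1) Y(1) V(1)]
  have "flipped V \<in> multipliers (Y \<otimes>\<^sub>A X)" using flipped_multipliers[OF V(1)] star_subalgebraD(1)[OF Xs] star_subalgebraD(1)[OF Ys] by blast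
  then have 1: "(flipped V)\<dagger> \<in> multipliers (Y \<otimes>\<^sub>A X)" by (rule multipliers_adj) (rule star_subalgebra_cstar_tensor[OF Ys Xs])
  have 2: "flipped ((flipped ((flipped V)\<dagger>))\<dagger>) = flipped V" using Vb by (simp add: flipped_adj)
  have "left_character Y \<Delta>Y ((flipped V)\<dagger>) \<longleftrightarrow> right_character Y \<Delta>Y ((flipped ((flipped V)\<dagger>))\<dagger>)"
    by (rule left_character_swap[OF Y(2) hmulD(3)[OF Ys h(2)], symmetric])
  also have "\<dots> \<longleftrightarrow> right_character Y \<Delta>Y V" unfolding right_character_def 2 by (rule refl)
  finally show ?thesis
    unfolding bicharacter_iff[OF Y X] using 1 V left_character_swap[OF X(2) h(1)] by (simp add: unitary_flipped unitary_adj)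
qed

lemma right_character_comult:
  assumes A: "cstar_algebra (qg W)" and W: "unitary W" and V: "flipped V \<in> hmul (qg W)"
  shows "right_character (qg W) (comult W) V \<longleftrightarrow> leg12 W ** leg13 (flipped V) = leg13 (flipped V) ** leg23 (flipped V) ** leg12 W"
proof -
  note u = unitaryD[OF unitary_leg(1)[OF W]]
  show ?thesis unfolding right_character_def amp_comult[OF A W V]
  proof
    assume "leg12 W ** leg13 (flipped V) ** (leg12 W)\<dagger> = leg13 (flipped V) ** leg23 (flipped V)"
    from arg_cong[OF this, of "\<lambda>X. X ** leg12 W"]
    show "leg12 W ** leg13 (flipped V) = leg13 (flipped V) ** leg23 (flipped V) ** leg12 W" by (simp add: compose_assoc u)
  next
    assume "leg12 W ** leg13 (flipped V) = leg13 (flipped V) ** leg23 (flipped V) ** leg12 W"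
    from arg_cong[OF this, of "\<lambda>X. X ** (leg12 W)\<dagger>"]
    show "leg12 W ** leg13 (flipped V) ** (leg12 W)\<dagger> = leg13 (flipped V) ** leg23 (flipped V)" by (simp add: compose_assoc u)
  qed
qed

subsection \<open>Composition of representations\<close>

text \<open>The representation is \<open>(\<psi> \<otimes> id)\<close> after \<open>\<phi>\<close>.
  If \<open>v\<close> is orthogonal to its range, then also to the ranges of the amplifications of
  \<open>\<phi>(X) (Z \<otimes> B)\<close>. The closed span of that set is
  \<open>Z \<otimes> B\<close>, whose elementary tensors act nondegenerately.\<close>

lemma star_rep_compose:
  fixes Z :: "('z::complex_hilbert \<Rightarrow>\<^sub>L 'z) set" and B :: "('b::complex_hilbert \<Rightarrow>\<^sub>L 'b) set"
  assumes \<phi>: "cstar_algebra X" "morphism X (Z \<otimes>\<^sub>A B) \<phi>" and ZB: "cstar_algebra Z" "cstar_algebra B" and \<psi>: "star_rep Z \<psi>"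
  shows "star_rep X (restrict (\<lambda>T. amp Z \<psi> (\<phi> T)) X)" and "T \<in> X \<Longrightarrow> \<phi> T \<in> hmul Z"
proof -
  interpret Z: star_rep Z \<psi> by fact
  interpret X: star_rep X \<phi> by (rule star_rep_morphism[OF \<phi>(1) cstar_algebra_cstar_tensor[OF ZB] \<phi>(2)])
  have mult: "\<phi> T \<in> multipliers (Z \<otimes>\<^sub>A B)" if "T \<in> X" for T using \<phi>(2) that by (auto simp: morphism_def PiE_def)
  show h: "\<phi> T \<in> hmul Z" if "T \<in> X" for T by (rule multipliers_hmul[OF Z.subalg ZB(2) mult[OF that]])
  note H = star_homD[OF X.hom] and Xs = star_subalgebraD[OF X.subalg]
  have hom: "star_hom X (restrict (\<lambda>T. amp Z \<psi> (\<phi> T)) X)"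
    unfolding star_hom_def
  proof (intro conjI ballI allI)
    show "restrict (\<lambda>T. amp Z \<psi> (\<phi> T)) X \<in> X \<rightarrow>\<^sub>E bops" by (auto intro: Z.amp_bops h)
  qed (simp_all add: Xs H h Z.amp_add Z.amp_compose Z.amp_adj Z.amp_cscale)
  have "ctotal {(amp Z \<psi> (\<phi> s)) z | s z. s \<in> X}"
    unfolding ctotal_def
  proof (intro allI impI)
    fix v assume v: "\<forall>x\<in>{blinfun_apply (amp Z \<psi> (\<phi> s)) z | s z. s \<in> X}. cinner x v = 0"
    let ?C = "{R. \<forall>z. cinner v (blinfun_apply R z) = 0}"
    have C: "subspace ?C" "closed ?C"
    proof -
      show "subspace ?C" by (auto simp: subspace_def blinfun.bilinear_simps cinner_add_right scaleR_scaleC cinner_scaleC_right)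
      have "?C = (\<Inter>z. {R. cinner v (blinfun_apply R z) \<in> {0}})" by auto
      also have "closed \<dots>" by (intro closed_INT ballI closed_preimage[OF bounded_linear_cinner_apply]) simp
      finally show "closed ?C" .
    qed
    let ?D = "{t \<in> hmul Z :: ('z, 'b) hop set. amp Z \<psi> t \<in> ?C}"
    have hs: "star_subalgebra (hmul Z :: ('z, 'b) hop set)" by (rule star_subalgebra_hmul[OF Z.subalg])
    have D: "subspace ?D" "closed ?D"
    proof -
      have r: "r *\<^sub>R t \<in> hmul Z \<and> amp Z \<psi> (r *\<^sub>R t) = r *\<^sub>R amp Z \<psi> t" if "t \<in> hmul Z" for r and t :: "('z, 'b) hop"
        using Z.amp_cscale[OF that, of "complex_of_real r"] star_subalgebraD(8)[OF hs that] by (simp add: cscale_of_real)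
      have "0 \<in> ?D" using star_subalgebraD(3)[OF hs] Z.amp_cscale[OF star_subalgebraD(3)[OF hs], of 0] by simp
      then show "subspace ?D" unfolding subspace_def
        using C(1) r by (auto simp: subspace_def Z.amp_add star_subalgebraD(4)[OF hs] blinfun.bilinear_simps scaleR_scaleC cinner_add_right cinner_scaleC_right)
      show "closed ?D" unfolding closed_sequential_limits
      proof (intro allI impI, elim conjE)
        fix f l assume f: "\<forall>n. f n \<in> ?D" and l: "f \<longlonglongrightarrow> l"
        have t: "l \<in> hmul Z" "(\<lambda>n. restrict (amp Z \<psi>) (hmul Z) (f n)) \<longlonglongrightarrow> restrict (amp Z \<psi>) (hmul Z) l"
          by (rule star_hom_tendsto[OF hs Z.star_hom_amp l]; use f in simp)+
        moreover have "restrict (amp Z \<psi>) (hmul Z) (f n) \<in> ?C" for n using f by auto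
        ultimately have "restrict (amp Z \<psi>) (hmul Z) l \<in> ?C" by (intro closed_sequentially[OF C(2) _ t(2)]) auto
        then show "l \<in> ?D" using t(1) by simp
      qed
    qed
    have "Z \<otimes>\<^sub>A B = closure (span {\<phi> S ** T | S T. S \<in> X \<and> T \<in> Z \<otimes>\<^sub>A B})" using \<phi>(2) by (simp add: morphism_def)
    also have "\<dots> \<subseteq> ?D"
    proof (rule closure_minimal[OF span_minimal[OF _ D(1)] D(2)], safe)
      fix S T assume S: "S \<in> X" and T: "T \<in> Z \<otimes>\<^sub>A B"
      have hT: "T \<in> hmul Z" by (rule cstar_tensor_hmul[OF Z.subalg _ T]) (use star_subalgebraD(1)[OF cstar_algebraD(1)[OF ZB(2)]] in blast)
      show "\<phi> S ** T \<in> hmul Z" by (rule hmul_compose[OF Z.subalg h[OF S] hT])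
      fix z
      have "cinner ((amp Z \<psi> (\<phi> S)) ((amp Z \<psi> T) z)) v = 0" using v S by blast
      then show "cinner v ((amp Z \<psi> (\<phi> S ** T)) z) = 0"
        by (simp add: Z.amp_compose[OF h[OF S] hT] cinner_flip_zero)
    qed
    finally have ZBD: "Z \<otimes>\<^sub>A B \<subseteq> ?D" .
    show "v = 0"
    proof (rule ctotalD[OF ctotal_htens[OF Z.nondeg cstar_algebraD(2)[OF ZB(2)]]], safe)
      fix s T z y assume s: "s \<in> Z" and T: "T \<in> B"
      have "s \<otimes> T \<in> ?D" using ZBD op_tensor_in_cstar_tensor[OF s T] by blast
      then have "\<forall>w. cinner v ((\<psi> s \<otimes> T) w) = 0"
        using s T star_subalgebraD(1)[OF cstar_algebraD(1)[OF ZB(2)]] by (auto simp: Z.amp_op_tensor)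
      from this[rule_format, of "z \<otimes>\<^sub>h y"] show "cinner ((\<psi> s) z \<otimes>\<^sub>h T y) v = 0"
        using s T star_subalgebraD(1)[OF cstar_algebraD(1)[OF ZB(2)]] by (simp add: cinner_flip_zero)
    qed
  qed
  then show "star_rep X (restrict (\<lambda>T. amp Z \<psi> (\<phi> T)) X)"
    unfolding star_rep_def using X.subalg hom by (auto simp: ctotal_def)
qed

lemma slice_reassoc:
  fixes T :: "('z::complex_hilbert, ('d::complex_hilbert, 'e::complex_hilbert) htensor) htensor \<Rightarrow>\<^sub>L ('z, ('d, 'e) htensor) htensor"
  shows "(rins p)\<dagger> ** (reassoc T ** rins q) = (\<one> \<otimes> rins p)\<dagger> ** (T ** (\<one> \<otimes> rins q))"
proof -
  have 1: "(rins p)\<dagger> ** assoc\<dagger> = (\<one> \<otimes> rins p :: ('z, 'd) htensor \<Rightarrow>\<^sub>L ('z, ('d, 'e) htensor) htensor)\<dagger>"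
    unfolding assoc_rins[symmetric] by (rule adj_compose[symmetric]) simp_all
  show ?thesis unfolding reassoc_def compose_assoc assoc_rins compose_left[OF 1] by (rule refl)
qed

text \<open>Slicing legs that \<open>\<psi>\<close> does not touch commutes with
  \<open>amp Z \<psi>\<close> (\<open>amp_compress\<close>), so the slices of the composed
  amplification can be computed from \<open>R\<close>.\<close>

lemma amp_composed:
  assumes X: "star_rep X \<phi>" and Z: "star_rep Z \<psi>" and h: "\<And>T. T \<in> X \<Longrightarrow> \<phi> T \<in> hmul Z"
    and \<pi>: "star_rep X (restrict (\<lambda>T. amp Z \<psi> (\<phi> T)) X)" and m: "m \<in> hmul X"
    and R: "R \<in> hmul Z" "amp X \<phi> m = reassoc R"
  shows "amp X (restrict (\<lambda>T. amp Z \<psi> (\<phi> T)) X) m = reassoc (amp Z \<psi> R)"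
proof (rule star_rep.amp_eqI[OF \<pi> m])
  interpret X: star_rep X \<phi> by fact
  interpret Z: star_rep Z \<psi> by fact
  show "reassoc (amp Z \<psi> R) \<in> bops" by (rule reassoc_bops[OF Z.amp_bops[OF R(1)]])
  fix p q s assume s: "s \<in> X"
  note sl = slice_reassoc
  have sX: "(rins p)\<dagger> ** m ** rins q ** s \<in> X" by (rule hmul_slice_in[OF X.subalg m s])
  have c: "(\<one> \<otimes> rins p)\<dagger> ** R ** (\<one> \<otimes> rins q) \<in> hmul Z"
    by (rule hmul_slice_id_tensor[OF Z.subalg R(1)]) simp_all
  have "(rins p)\<dagger> ** reassoc (amp Z \<psi> R) ** rins q ** amp Z \<psi> (\<phi> s) =
      amp Z \<psi> ((\<one> \<otimes> rins p)\<dagger> ** R ** (\<one> \<otimes> rins q)) ** amp Z \<psi> (\<phi> s)"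
    unfolding Z.amp_compress[OF R(1) rins_bops rins_bops] unfolding compose_assoc compose_left[OF sl, unfolded compose_assoc] by (rule refl)
  also have "\<dots> = amp Z \<psi> (((\<one> \<otimes> rins p)\<dagger> ** R ** (\<one> \<otimes> rins q)) ** \<phi> s)"
    by (rule Z.amp_compose[OF c h[OF s], symmetric])
  also have "((\<one> \<otimes> rins p)\<dagger> ** R ** (\<one> \<otimes> rins q)) ** \<phi> s = (rins p)\<dagger> ** amp X \<phi> m ** rins q ** \<phi> s"
    unfolding R(2) compose_assoc compose_left[OF sl, unfolded compose_assoc] by (rule refl)
  also have "\<dots> = \<phi> ((rins p)\<dagger> ** m ** rins q ** s)" by (rule X.amp_slice[OF m s])
  finally show "(rins p)\<dagger> ** reassoc (amp Z \<psi> R) ** rins q ** restrict (\<lambda>T. amp Z \<psi> (\<phi> T)) X s =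
      restrict (\<lambda>T. amp Z \<psi> (\<phi> T)) X ((rins p)\<dagger> ** m ** rins q ** s)"
    using s sX by simp
qed

subsection \<open>Lifting bicharacters\<close>

text \<open>Cancelling an identity leg needs a nonzero vector in it. This is the origin of the case
  distinctions on trivial spaces in the lifting arguments.\<close>

lemma id_tensor_inject:
  fixes A B :: "'b::complex_hilbert \<Rightarrow>\<^sub>L 'c::complex_hilbert"
  assumes "(a0 :: 'a::complex_hilbert) \<noteq> 0" and b: "A \<in> bops" "B \<in> bops" and eq: "(\<one> :: 'a \<Rightarrow>\<^sub>L 'a) \<otimes> A = \<one> \<otimes> B"
  shows "A = B"
proof (rule blinfun_eqI)
  fix x
  have "a0 \<otimes>\<^sub>h (A x - B x) = 0"
    using arg_cong[OF eq, of "\<lambda>R. R (a0 \<otimes>\<^sub>h x)"] b htens_add_right[of a0 "A x - B x" "B x"]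
    by simp
  then have "norm a0 * norm (A x - B x) = 0" by (metis norm_htens norm_zero)
  then show "A x = B x" using assms(1) by simp
qed

lemma unitary_id_tensorD:
  fixes Z :: "'b::complex_hilbert \<Rightarrow>\<^sub>L 'c::complex_hilbert"
  assumes a: "(a0 :: 'a::complex_hilbert) \<noteq> 0" and Z: "Z \<in> bops" and u: "unitary ((\<one> :: 'a \<Rightarrow>\<^sub>L 'a) \<otimes> Z)"
  shows "unitary Z"
proof -
  note uD = unitaryD(2,3)[OF u]
  have "(\<one> :: 'a \<Rightarrow>\<^sub>L 'a) \<otimes> (Z\<dagger> ** Z) = \<one> \<otimes> \<one>" "(\<one> :: 'a \<Rightarrow>\<^sub>L 'a) \<otimes> (Z ** Z\<dagger>) = \<one> \<otimes> \<one>"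
    using uD Z by (simp_all add: op_tensor_adj op_tensor_compose)
  from id_tensor_inject[OF a _ _ this(1)] id_tensor_inject[OF a _ _ this(2)] show ?thesis unfolding unitary_def using Z by simp
qed

lemma pl2_inject:
  assumes b: "(b0 :: 'b::complex_hilbert) \<noteq> 0" and A: "A \<in> bops" "B \<in> bops"
    and eq: "(pl2 A :: ('a::complex_hilbert, ('b, 'c::complex_hilbert) htensor) htensor \<Rightarrow>\<^sub>L _) = pl2 B"
  shows "A = B"
proof (rule id_tensor_inject[OF b A])
  have "\<one> \<otimes> A ** sw = \<one> \<otimes> B ** (sw :: ('a, ('b, 'c) htensor) htensor \<Rightarrow>\<^sub>L _)"
    unfolding sw_pl2[OF A(1), symmetric] sw_pl2[OF A(2), symmetric] eq by (rule refl)
  then show "(\<one> :: 'b \<Rightarrow>\<^sub>L 'b) \<otimes> A = \<one> \<otimes> B" by (rule unitary_cancel_right[OF unitary_sw])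
qed

lemma reassoc_compose: "reassoc (S ** T) = reassoc S ** reassoc T"
  by (simp add: reassoc_def compose_assoc)

lemma reassoc_id_tensor: "reassoc (\<one> \<otimes> T) = leg23 T"
  by (simp add: leg23_def)

lemma reassoc_inject: "reassoc S = reassoc T \<longleftrightarrow> S = T"
proof
  assume "reassoc S = reassoc T"
  from arg_cong[OF this, of "\<lambda>X. assoc ** X ** assoc\<dagger>"] show "S = T" by (simp add: reassoc_def compose_assoc)
qed simp

lemma leg23_inject:
  fixes A B :: "('b::complex_hilbert, 'c::complex_hilbert) hop"
  assumes "(a0 :: 'a::complex_hilbert) \<noteq> 0" "A \<in> bops" "B \<in> bops" "(leg23 A :: (('a, 'b) htensor, 'c) htensor \<Rightarrow>\<^sub>L _) = leg23 B"
  shows "A = B"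
  using id_tensor_inject[OF assms(1-3)] assms(4) by (simp add: leg23_def reassoc_inject)

lemma reassoc_pl2:
  fixes T :: "('a::complex_hilbert, 'c::complex_hilbert) hop"
  assumes T: "T \<in> bops"
  shows "reassoc (pl2 T :: ('a, ('b::complex_hilbert, 'c) htensor) htensor \<Rightarrow>\<^sub>L ('a, ('b, 'c) htensor) htensor) = leg13 T"
proof -
  have sa: "sw ** assoc = assoc ** flip \<otimes> \<one>" by (simp add: sw_def compose_assoc)
  have as: "assoc\<dagger> ** sw = flip \<otimes> \<one> ** assoc\<dagger>" by (simp add: sw_def compose_assoc)
  have "(pl2 T :: ('a, ('b, 'c) htensor) htensor \<Rightarrow>\<^sub>L ('a, ('b, 'c) htensor) htensor) = sw ** (\<one> \<otimes> T ** sw)"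
    by (simp add: compose_square[OF sw_id_tensor[OF T]] sw_sw)
  then have "reassoc (pl2 T :: ('a, ('b, 'c) htensor) htensor \<Rightarrow>\<^sub>L ('a, ('b, 'c) htensor) htensor) = (assoc\<dagger> ** sw) ** (\<one> \<otimes> T ** (sw ** assoc))"
    by (simp only: reassoc_def compose_assoc)
  then show ?thesis unfolding sa as by (simp only: leg13_def leg23_def reassoc_def compose_assoc)
qed

lemma reassoc_pl1: "reassoc (pl1 T) = leg12 T"
  by (simp add: reassoc_def pl1_def compose_assoc)

text \<open>The indices 1 and 2 stand for the legs 13 and 23. Conjugation by \<open>w\<close> sends
  \<open>v1\<close> to \<open>v1 v2\<close> and \<open>u1\<close> to \<open>u2 y\<close>, where
  \<open>y\<close> is the conjugate of \<open>u2\<dagger>\<close>. As \<open>u2\<close> commutes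
  with \<open>v1\<close>, \<open>y\<close> commutes with \<open>v1 v2\<close> and cancels; then
  \<open>v1\<close> cancels because it commutes with \<open>u2\<close>.\<close>

lemma braided_commutator:
  fixes w v1 v2 u1 u2 :: "'z::complex_hilbert \<Rightarrow>\<^sub>L 'z"
  assumes u: "unitary v1" "unitary v2" "unitary u1" "unitary u2"
    and 1: "w ** v1 = v1 ** v2 ** w" and 2: "w ** u1 ** u2 = u2 ** w" and c: "v1 ** u2 = u2 ** v1"
  shows "w ** (v1\<dagger> ** u1 ** v1 ** u1\<dagger>) = (v2\<dagger> ** u2 ** v2 ** u2\<dagger>) ** w"
proof -
  note U = u[THEN unitaryD(2)] u[THEN unitaryD(3)]
  note A = U[THEN compose_absorb]
  note S = compose_assoc
  have v1: "w ** v1\<dagger> = v2\<dagger> ** (v1\<dagger> ** w)"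
    using arg_cong[OF 1, of "\<lambda>X. v2\<dagger> ** (v1\<dagger> ** (X ** v1\<dagger>))"] by (simp add: S U A)
  have u1: "w ** u1 = u2 ** (w ** u2\<dagger>)"
    using arg_cong[OF 2, of "\<lambda>X. X ** u2\<dagger>"] by (simp add: S U A)
  have u21: "u2\<dagger> ** w = w ** (u2\<dagger> ** u1\<dagger>)"
    using arg_cong[OF 2, of "\<lambda>X. u2\<dagger> ** (X ** (u2\<dagger> ** u1\<dagger>))"] by (simp add: S U A)
  have c': "u2\<dagger> ** v1 = v1 ** u2\<dagger>"
    using arg_cong[OF c, of "\<lambda>X. u2\<dagger> ** (X ** u2\<dagger>)"] by (simp add: S U A)
  have "w ** (v1\<dagger> ** u1 ** v1 ** u1\<dagger>) = v2\<dagger> ** (v1\<dagger> ** ((w ** u1) ** (v1 ** u1\<dagger>)))"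
    by (simp only: S compose_square[OF v1])
  also have "\<dots> = v2\<dagger> ** (v1\<dagger> ** (u2 ** ((w ** v1) ** (u2\<dagger> ** u1\<dagger>))))"
    unfolding u1 by (simp only: S compose_square[OF c'])
  also have "\<dots> = v2\<dagger> ** (v1\<dagger> ** ((u2 ** v1) ** (v2 ** (w ** (u2\<dagger> ** u1\<dagger>)))))"
    unfolding 1 by (simp only: S)
  also have "\<dots> = v2\<dagger> ** (u2 ** (v2 ** (u2\<dagger> ** w)))"
    unfolding c[symmetric] u21 by (simp only: S A)
  finally show ?thesis by (simp only: S)
qed

text \<open>After the leg permutation \<open>s\<close>, \<open>n\<close> acts as
  \<open>1 \<otimes> m\<close>, and on a permuted elementary tensor \<open>m\<close> meets only an
  element \<open>h\<close> of its own algebra \<open>B\<close>. The premise \<open>gen\<close>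
  provides this rearrangement and the way back; it is used with \<open>cyc\<close> for
  \<open>pl1\<close> and with \<open>sw\<close> for \<open>pl2\<close>.\<close>

lemma leg_multiplier:
  assumes s: "unitary s" and n: "n \<in> bops" and m: "m \<in> multipliers B" and B: "B \<subseteq> bops"
    and K: "star_subalgebra K" and sn: "s ** n = \<one> \<otimes> m ** s"
    and gen: "\<And>k x f. k \<in> K \<Longrightarrow> x \<in> X \<Longrightarrow> f \<in> F \<Longrightarrow> \<exists>g\<in>bops. \<exists>h\<in>B. s ** (k \<otimes> (x \<otimes> f)) = g \<otimes> h ** s \<and>
      (\<forall>t\<in>B. s\<dagger> ** g \<otimes> t ** s \<in> K \<otimes>\<^sub>A (X \<otimes>\<^sub>A F))"
    and X: "star_subalgebra X" and F: "star_subalgebra F" and t: "t \<in> K \<otimes>\<^sub>A (X \<otimes>\<^sub>A F)"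
  shows "n ** t \<in> K \<otimes>\<^sub>A (X \<otimes>\<^sub>A F)"
proof (rule cstar_tensor_image_subset[OF bounded_linear_compose_left subspace_cstar_tensor closed_cstar_tensor _ t])
  fix k e assume k: "k \<in> K" and e: "e \<in> X \<otimes>\<^sub>A F"
  let ?C = "{R. n ** R \<in> K \<otimes>\<^sub>A (X \<otimes>\<^sub>A F)}"
  have C: "subspace ?C" "closed ?C"
    by (rule subspace_preimage closed_preimage; rule bounded_linear_compose_left subspace_cstar_tensor closed_cstar_tensor)+
  have "e \<in> {d \<in> bops. k \<otimes> d \<in> ?C}"
  proof (rule cstar_tensor_image_subset[OF bounded_linear_ident _ _ _ e])
    show "subspace {d \<in> bops. k \<otimes> d \<in> ?C}" "closed {d \<in> bops. k \<otimes> d \<in> ?C}"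
      by (rule subspace_closed_tensor_preimage[OF star_subalgebraD(1)[OF K k] C])+
    fix x f assume x: "x \<in> X" and f: "f \<in> F"
    obtain g h where g: "g \<in> bops" and h: "h \<in> B" and eq: "s ** (k \<otimes> (x \<otimes> f)) = g \<otimes> h ** s"
      and C': "\<forall>t\<in>B. s\<dagger> ** g \<otimes> t ** s \<in> K \<otimes>\<^sub>A (X \<otimes>\<^sub>A F)" using gen[OF k x f] by blast
    have "n ** (k \<otimes> (x \<otimes> f)) = s\<dagger> ** ((s ** n) ** (k \<otimes> (x \<otimes> f)))"
      by (simp only: compose_assoc compose_absorb[OF unitaryD(2)[OF s]])
    also have "\<dots> = s\<dagger> ** (g \<otimes> (m ** h)) ** s"
      unfolding sn using g h B multipliersD(1)[OF m] compose_left[OF op_tensor_compose[of \<one> m g h], of s]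
      by (simp add: compose_assoc eq subset_iff)
    finally have "n ** (k \<otimes> (x \<otimes> f)) \<in> K \<otimes>\<^sub>A (X \<otimes>\<^sub>A F)" using C' multipliersD(2)[OF m h] by simp
    then show "x \<otimes> f \<in> {d \<in> bops. k \<otimes> d \<in> ?C}" using star_subalgebraD(1)[OF X x] star_subalgebraD(1)[OF F f] by simp
  qed
  then show "n ** k \<otimes> e \<in> K \<otimes>\<^sub>A (X \<otimes>\<^sub>A F)" by simp
qed

lemma permuted_tensor_in:
  assumes s: "unitary s" and g: "g \<in> bops" and C: "subspace C" "closed C"
    and gen: "\<And>S T. S \<in> D \<Longrightarrow> T \<in> E \<Longrightarrow> S \<in> bops \<and> T \<in> bops \<and> s\<dagger> ** (g \<otimes> (S \<otimes> T)) ** s \<in> C" and t: "t \<in> D \<otimes>\<^sub>A E"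
  shows "s\<dagger> ** g \<otimes> t ** s \<in> C"
proof -
  let ?C = "{R. s\<dagger> ** R ** s \<in> C}"
  have bl: "bounded_linear (\<lambda>R. s\<dagger> ** R ** s)"
    by (rule bounded_linear_compose[OF bounded_linear_compose_right bounded_linear_compose_left])
  have C': "subspace ?C" "closed ?C" by (rule subspace_preimage[OF bl C(1)] closed_preimage[OF bl C(2)])+
  have "t \<in> {d \<in> bops. g \<otimes> d \<in> ?C}"
    by (rule cstar_tensor_image_subset[OF bounded_linear_ident subspace_closed_tensor_preimage[OF g C'] _ t]) (use gen in auto)
  then show ?thesis by simp
qed

lemma pl_multipliers:
  assumes K: "star_subalgebra K" and X: "star_subalgebra X" and F: "star_subalgebra F"
  shows "m \<in> multipliers (K \<otimes>\<^sub>A X) \<Longrightarrow> pl1 m \<in> multipliers (K \<otimes>\<^sub>A (X \<otimes>\<^sub>A F))"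
    and "n \<in> multipliers (K \<otimes>\<^sub>A F) \<Longrightarrow> pl2 n \<in> multipliers (K \<otimes>\<^sub>A (X \<otimes>\<^sub>A F))"
proof -
  note b = star_subalgebraD(1)[OF K] star_subalgebraD(1)[OF X] star_subalgebraD(1)[OF F]
  note KX = star_subalgebra_cstar_tensor[OF K X] and KF = star_subalgebra_cstar_tensor[OF K F]
  note KXF = star_subalgebra_cstar_tensor[OF K star_subalgebra_cstar_tensor[OF X F]]
  have cyc: "cyc ** (k \<otimes> (x \<otimes> f)) = (f \<otimes> (k \<otimes> x)) ** cyc" if "k \<in> K" "x \<in> X" "f \<in> F" for k x f
    by (rule htens_op_eqI_right3) (use b that in auto)
  have sw: "sw ** (k \<otimes> (x \<otimes> f)) = (x \<otimes> (k \<otimes> f)) ** sw" if "k \<in> K" "x \<in> X" "f \<in> F" for k x f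
    by (rule htens_op_eqI_right3) (use b that in auto)
  have 1: "pl1 m ** t \<in> K \<otimes>\<^sub>A (X \<otimes>\<^sub>A F)" if m: "m \<in> multipliers (K \<otimes>\<^sub>A X)" and t: "t \<in> K \<otimes>\<^sub>A (X \<otimes>\<^sub>A F)" for m t
  proof (rule leg_multiplier[OF unitary_cyc _ m _ K cyc_pl1 _ X F t])
    fix k x f assume k: "k \<in> K" "x \<in> X" "f \<in> F"
    have "cyc\<dagger> ** f \<otimes> t ** cyc \<in> K \<otimes>\<^sub>A (X \<otimes>\<^sub>A F)" if "t \<in> K \<otimes>\<^sub>A X" for t
    proof (rule permuted_tensor_in[OF unitary_cyc b(3)[OF k(3)] subspace_cstar_tensor closed_cstar_tensor _ that], intro conjI b)
      fix S T assume "S \<in> K" "T \<in> X"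
      then show "cyc\<dagger> ** (f \<otimes> (S \<otimes> T)) ** cyc \<in> K \<otimes>\<^sub>A (X \<otimes>\<^sub>A F)"
        using k(3) by (simp only: compose_assoc cyc[symmetric] compose_absorb[OF unitaryD(2)[OF unitary_cyc]] op_tensor_in_cstar_tensor)
    qed
    then show "\<exists>g\<in>bops. \<exists>h\<in>K \<otimes>\<^sub>A X. cyc ** (k \<otimes> (x \<otimes> f)) = g \<otimes> h ** cyc \<and> (\<forall>t\<in>K \<otimes>\<^sub>A X. cyc\<dagger> ** g \<otimes> t ** cyc \<in> K \<otimes>\<^sub>A (X \<otimes>\<^sub>A F))"
      using cyc[OF k] b(3)[OF k(3)] op_tensor_in_cstar_tensor[OF k(1,2)] by blast
  qed (use star_subalgebraD(1)[OF KX] multipliersD(1)[OF m] in auto)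
  have 2: "pl2 n ** t \<in> K \<otimes>\<^sub>A (X \<otimes>\<^sub>A F)" if n: "n \<in> multipliers (K \<otimes>\<^sub>A F)" and t: "t \<in> K \<otimes>\<^sub>A (X \<otimes>\<^sub>A F)" for n t
  proof (rule leg_multiplier[OF unitary_sw _ n _ K sw_pl2 _ X F t])
    fix k x f assume k: "k \<in> K" "x \<in> X" "f \<in> F"
    have "sw\<dagger> ** x \<otimes> t ** sw \<in> K \<otimes>\<^sub>A (X \<otimes>\<^sub>A F)" if "t \<in> K \<otimes>\<^sub>A F" for t
    proof (rule permuted_tensor_in[OF unitary_sw b(2)[OF k(2)] subspace_cstar_tensor closed_cstar_tensor _ that], intro conjI b)
      fix S T assume "S \<in> K" "T \<in> F"
      then show "sw\<dagger> ** (x \<otimes> (S \<otimes> T)) ** sw \<in> K \<otimes>\<^sub>A (X \<otimes>\<^sub>A F)"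
        using k(2) by (simp only: compose_assoc sw[symmetric] compose_absorb[OF unitaryD(2)[OF unitary_sw]] op_tensor_in_cstar_tensor)
    qed
    then show "\<exists>g\<in>bops. \<exists>h\<in>K \<otimes>\<^sub>A F. sw ** (k \<otimes> (x \<otimes> f)) = g \<otimes> h ** sw \<and> (\<forall>t\<in>K \<otimes>\<^sub>A F. sw\<dagger> ** g \<otimes> t ** sw \<in> K \<otimes>\<^sub>A (X \<otimes>\<^sub>A F))"
      using sw[OF k] b(2)[OF k(2)] op_tensor_in_cstar_tensor[OF k(1,3)] by blast
  qed (use star_subalgebraD(1)[OF KF] multipliersD(1)[OF n] in auto)
  show "pl1 m \<in> multipliers (K \<otimes>\<^sub>A (X \<otimes>\<^sub>A F))" if m: "m \<in> multipliers (K \<otimes>\<^sub>A X)" for m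
    by (rule multipliersI[OF _ 1[OF m] _ KXF])
      (use 1[OF multipliers_adj[OF m KX]] multipliersD(1)[OF m] in \<open>simp_all add: pl1_adj\<close>)
  show "pl2 n \<in> multipliers (K \<otimes>\<^sub>A (X \<otimes>\<^sub>A F))" if n: "n \<in> multipliers (K \<otimes>\<^sub>A F)" for n
    by (rule multipliersI[OF _ 2[OF n] _ KXF])
      (use 2[OF multipliers_adj[OF n KF]] multipliersD(1)[OF n] in \<open>simp_all add: pl2_adj\<close>)
qed

text \<open>Compression by \<open>lins p\<close> for a unit vector \<open>p\<close> maps
  \<open>compacts \<otimes>\<^sub>A D\<close> into \<open>D\<close> and recovers \<open>T\<close>
  from \<open>rank1 p p \<otimes> T\<close>.\<close>

lemma id_tensor_multiplierD:
  fixes D :: "('d::complex_hilbert \<Rightarrow>\<^sub>L 'd) set"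
  assumes a: "(a0 :: 'a::complex_hilbert) \<noteq> 0" and D: "star_subalgebra D" and Z: "Z \<in> bops"
    and m: "(\<one> :: 'a \<Rightarrow>\<^sub>L 'a) \<otimes> Z \<in> multipliers (compacts \<otimes>\<^sub>A D)"
  shows "Z \<in> multipliers D"
proof -
  define p where "p = complex_of_real (inverse (norm a0)) *\<^sub>C a0"
  have pp: "cinner p p = 1" using a by (simp add: p_def cinner_norm norm_scaleC norm_inverse)
  let ?k = "rank1 p p"
  have sl: "(lins p)\<dagger> ** R ** lins p \<in> D" if R: "R \<in> compacts \<otimes>\<^sub>A D" for R
  proof (rule cstar_tensor_image_subset[OF _ star_subalgebra_subspace[OF D] star_subalgebraD(2)[OF D] _ R])
    show "bounded_linear (\<lambda>R. (lins p)\<dagger> ** R ** lins p)"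
      by (rule bounded_linear_compose[OF bounded_linear_compose_right bounded_linear_compose_left])
    fix S T assume S: "S \<in> (compacts :: ('a \<Rightarrow>\<^sub>L 'a) set)" and T: "T \<in> D"
    have "(lins p)\<dagger> ** S \<otimes> T ** lins p = cscale (cinner p (S p)) T"
      using compacts_bops[OF S] star_subalgebraD(1)[OF D T]
      by (simp add: compose_assoc op_tensor_lins compose_left[OF lins_adj_lins] blinfun_compose_cscale)
    then show "(lins p)\<dagger> ** S \<otimes> T ** lins p \<in> D" using star_subalgebraD(7)[OF D T] by simp
  qed
  have eq: "(lins p)\<dagger> ** ?k \<otimes> R ** lins p = R" if "R \<in> bops" for R :: "'d \<Rightarrow>\<^sub>L 'd"
    using that pp by (simp add: compose_assoc op_tensor_lins compose_left[OF lins_adj_lins] blinfun_compose_cscale cinner_scaleC_right)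
  show ?thesis unfolding multipliers_def
  proof (intro CollectI conjI ballI Z)
    fix T assume T: "T \<in> D"
    have kT: "?k \<otimes> T \<in> compacts \<otimes>\<^sub>A D" by (rule op_tensor_in_cstar_tensor[OF rank1_compacts T])
    have Tb: "T \<in> bops" by (rule star_subalgebraD(1)[OF D T])
    have "?k \<otimes> (Z ** T) \<in> compacts \<otimes>\<^sub>A D" "?k \<otimes> (T ** Z) \<in> compacts \<otimes>\<^sub>A D"
      using multipliersD(2)[OF m kT] multipliersD(3)[OF m kT] Z Tb by (simp_all add: op_tensor_compose)
    from this[THEN sl] show "Z ** T \<in> D" "T ** Z \<in> D" using Z Tb by (simp_all add: eq)
  qed
qed

section \<open>Existence and uniqueness of lifts in the second leg\<close>

lemma htensor_trivial:
  fixes z :: "('a::complex_hilbert, 'b::complex_hilbert) htensor"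
  shows "(\<And>x :: 'a. x = 0) \<Longrightarrow> z = 0" and "(\<And>y :: 'b. y = 0) \<Longrightarrow> z = 0"
proof -
  have *: "x \<otimes>\<^sub>h y = 0" if "x = 0 \<or> y = 0" for x :: 'a and y :: 'b
    using that norm_htens[of x y] by (metis mult_zero_left mult_zero_right norm_eq_zero)
  show "z = 0" if "\<And>x :: 'a. x = 0" by (rule htens_cinner_ext) (simp add: * that)
  show "z = 0" if "\<And>y :: 'b. y = 0" by (rule htens_cinner_ext) (simp add: * that)
qed

lemma blinfun_trivial:
  fixes R R' :: "'a::real_normed_vector \<Rightarrow>\<^sub>L 'b::real_normed_vector"
  assumes "\<And>x :: 'a. x = 0" shows "R = R'"
proof (rule blinfun_eqI)
  fix x show "R x = R' x" unfolding assms[of x] by simp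
qed

text \<open>Ergodicity of \<open>W\<close> and the C*-property of both algebras stand in for
  modularity, so that the locale can be interpreted for \<open>WA\<close> as well as for
  \<open>dual WC\<close>.\<close>

locale universal_quantum_group =
  fixes k :: "'k::complex_hilbert itself"
    and W :: "('a::complex_hilbert, 'a) hop"
    and Au :: "('f::complex_hilbert \<Rightarrow>\<^sub>L 'f) set" and VA :: "('a, 'f) hop"
    and \<Delta>u :: "('f \<Rightarrow>\<^sub>L 'f) \<Rightarrow> ('f, 'f) hop" and \<Lambda> :: "('f \<Rightarrow>\<^sub>L 'f) \<Rightarrow> ('a \<Rightarrow>\<^sub>L 'a)"
  assumes W: "unitary W" "ergodic W" and A: "cstar_algebra (qg W)" and Ah: "cstar_algebra (qg (dual W))"
    and k: "infinite_dimensional TYPE('k)" "embeds TYPE('a) TYPE('k)" "embeds TYPE('f) TYPE('k)"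
    and univ: "universal_corep TYPE('k) W Au VA" and comult: "universal_comult W Au VA \<Delta>u" and red: "reducing_morphism W Au VA \<Lambda>"
begin

lemmas W_bops [simp] = unitaryD(1)[OF W(1)]
lemmas VA = universal_corepD[OF univ W(1) Ah]
lemmas Au_sub = cstar_algebraD(1)[OF VA(1)]

lemma \<Delta>u: "star_rep Au \<Delta>u" "morphism Au (Au \<otimes>\<^sub>A Au) \<Delta>u"
  using comult star_rep_morphism[OF VA(1) cstar_algebra_cstar_tensor[OF VA(1) VA(1)]] by (auto simp: universal_comult_def)

lemma \<Lambda>: "star_rep Au \<Lambda>" "morphism Au (qg W) \<Lambda>"
  using red star_rep_morphism[OF VA(1) A] by (auto simp: reducing_morphism_def)

sublocale D: star_rep Au \<Delta>u by (rule \<Delta>u)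
sublocale L: star_rep Au \<Lambda> by (rule \<Lambda>)

lemma right_character_VA: "right_character Au \<Delta>u VA"
  using comult reassoc_tensor_ext_right[OF Ah VA(1) \<Delta>u(1) VA(2)] by (simp add: universal_comult_def)

lemma amp_\<Lambda>_VA: "amp Au \<Lambda> (flipped VA) = flipped W"
  using red tensor_ext_right[OF Ah VA(1) \<Lambda>(1) VA(2)] by (auto simp: reducing_morphism_def)

definition comult_left where "comult_left = restrict (\<lambda>T. amp Au \<Lambda> (\<Delta>u T)) Au"
definition conj_left where "conj_left = restrict (\<lambda>T. VA ** (\<Lambda> T \<otimes> \<one>) ** VA\<dagger>) Au"

lemma star_rep_comult_left: "star_rep Au comult_left" and \<Delta>u_hmul: "T \<in> Au \<Longrightarrow> \<Delta>u T \<in> hmul Au"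
  unfolding comult_left_def using star_rep_compose[OF VA(1) \<Delta>u(2) VA(1) VA(1) \<Lambda>(1)] by auto

text \<open>\<open>\<Lambda>\<close> acts on the first of the two copies of \<open>Au\<close>. The
  factor \<open>leg13 m\<close> contains this copy and is reduced; \<open>leg23 m\<close> does not
  and stays.\<close>

lemma amp_comult_left:
  assumes m: "m \<in> hmul Au" and r: "amp Au \<Delta>u m = leg13 m ** leg23 m"
  shows "amp Au comult_left m = leg13 (amp Au \<Lambda> m) ** leg23 m"
proof -
  have mb: "m \<in> bops" by (rule hmulD(1)[OF Au_sub m])
  have R: "pl2 m ** \<one> \<otimes> m \<in> hmul Au"
    by (intro hmul_compose[OF Au_sub] hmul_pl2[OF Au_sub m] hmul_id_tensor[OF Au_sub mb])
  have "amp Au \<Delta>u m = reassoc (pl2 m ** \<one> \<otimes> m)"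
    by (simp add: r reassoc_compose reassoc_pl2 reassoc_id_tensor mb)
  from amp_composed[OF \<Delta>u(1) \<Lambda>(1) \<Delta>u_hmul star_rep_comult_left[unfolded comult_left_def] m R this]
  show ?thesis
    unfolding comult_left_def[symmetric]
    by (simp add: L.amp_compose[OF hmul_pl2[OF Au_sub m] hmul_id_tensor[OF Au_sub mb]] L.amp_pl2[OF m] L.amp_id_tensor[OF mb]
        reassoc_compose reassoc_id_tensor reassoc_pl2[OF L.amp_bops[OF m]])
qed

lemma amp_conj_left: "m \<in> hmul Au \<Longrightarrow> amp Au conj_left m = leg12 VA ** leg13 (amp Au \<Lambda> m) ** (leg12 VA)\<dagger>"
  unfolding conj_left_def leg12_def by (rule amp_conj[OF \<Lambda>(1) VA(3)])

lemma comult_left_eq_conj_left: "comult_left = conj_left"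
proof (rule universal_corep_separates[OF univ W(1) Ah k(1) embeds_htensor[OF k]])
  show "star_rep Au comult_left" by (rule star_rep_comult_left)
  show "star_rep Au conj_left" unfolding conj_left_def by (rule star_rep_conj[OF \<Lambda>(1) VA(3)])
  note r = unitary_cancel_right[OF unitary_rot]
  \<comment> \<open>This is the corepresentation equation of \<open>VA\<close> with the legs
    permuted cyclically by \<open>rot\<close>.\<close>
  have "leg13 (flipped W) ** leg23 (flipped VA) ** leg12 VA = leg12 VA ** leg13 (flipped W)"
  proof (rule r)
    have "rot ** (leg12 W ** leg13 VA ** leg23 VA) = rot ** (leg23 VA ** leg12 W)" using VA(5) by (simp add: corep_def)
    then show "(leg13 (flipped W) ** leg23 (flipped VA) ** leg12 VA) ** rot = (leg12 VA ** leg13 (flipped W)) ** rot"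
      using VA(4) by (simp add: compose_assoc compose_square[OF rot_leg12] compose_square[OF rot_leg13] compose_square[OF rot_leg23] rot_leg23 rot_leg12)
  qed
  then have "leg13 (flipped W) ** leg23 (flipped VA) ** leg12 VA ** (leg12 VA)\<dagger> = leg12 VA ** leg13 (flipped W) ** (leg12 VA)\<dagger>" by simp
  then show "amp Au comult_left (flipped VA) = amp Au conj_left (flipped VA)"
    unfolding amp_conj_left[OF VA(6)] amp_comult_left[OF VA(6) right_character_VA[unfolded right_character_def]] amp_\<Lambda>_VA
    by (simp add: compose_assoc unitaryD[OF unitary_leg(1)[OF VA(3)]])
qed

text \<open>If the space of \<open>W\<close> is zero, the universal corepresentation acts on a zero
  space and cannot tell representations apart, so universality forces them to coincide.\<close>

lemma degenerate_representations:
  assumes "\<And>x :: 'a. x = 0" and "star_rep Au \<pi>1" "star_rep Au \<pi>2"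
  shows "\<pi>1 = (\<pi>2 :: ('f \<Rightarrow>\<^sub>L 'f) \<Rightarrow> ('f, 'f) hop)"
proof (rule universal_corep_separates[OF univ W(1) Ah k(1) embeds_htensor[OF k(1,3,3)] assms(2,3)])
  show "amp Au \<pi>1 (flipped VA) = amp Au \<pi>2 (flipped VA)"
    by (rule blinfun_trivial[OF htensor_trivial(2)[OF assms(1)]])
qed

text \<open>Evaluating \<open>comult_left = conj_left\<close> on a lift expresses
  \<open>leg13 r ** leg23 v\<close>, for the flipped lift \<open>v\<close> and its reduction
  \<open>r\<close>, in terms of \<open>r\<close> and \<open>VA\<close> only. Since
  \<open>leg13 r\<close> is unitary, \<open>v\<close> is determined by \<open>r\<close>.\<close>

theorem lift_unique:
  fixes V1 V2 :: "('x::complex_hilbert, 'f) hop"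
  assumes V1: "unitary V1" "flipped V1 \<in> hmul Au" "right_character Au \<Delta>u V1"
    and V2: "unitary V2" "flipped V2 \<in> hmul Au" "right_character Au \<Delta>u V2"
    and eq: "amp Au \<Lambda> (flipped V1) = amp Au \<Lambda> (flipped V2)"
  shows "V1 = V2"
proof (cases "\<exists>x :: 'a. x \<noteq> 0")
  case True
  then obtain a0 :: 'a where a0: "a0 \<noteq> 0" by blast
  let ?V = "amp Au \<Lambda> (flipped V1)"
  have uV: "unitary ?V" by (rule L.amp_unitary[OF V1(2) unitary_flipped[OF V1(1)]])
  have "leg13 (amp Au \<Lambda> (flipped V)) ** leg23 (flipped V) = leg12 VA ** leg13 (amp Au \<Lambda> (flipped V)) ** (leg12 VA)\<dagger>"
    if "flipped V \<in> hmul Au" "right_character Au \<Delta>u V" for V :: "('x, 'f) hop"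
    using amp_comult_left[OF that(1) that(2)[unfolded right_character_def]] amp_conj_left[OF that(1)] by (simp add: comult_left_eq_conj_left)
  from this[OF V1(2,3)] this[OF V2(2,3)]
  have "leg13 ?V ** leg23 (flipped V1) = leg13 ?V ** leg23 (flipped V2)" by (simp add: eq)
  then have l: "leg23 (flipped V1) = (leg23 (flipped V2) :: (('a, 'f) htensor, 'x) htensor \<Rightarrow>\<^sub>L _)" by (rule unitary_cancel_left[OF unitary_leg(3)[OF uV]])
  have "flipped V1 = flipped V2"
    by (rule leg23_inject[OF a0 _ _ l]) (use unitaryD(1)[OF V1(1)] unitaryD(1)[OF V2(1)] in auto)
  then show ?thesis by (simp add: flipped_inject)
next
  case False
  show ?thesis
  proof (cases "\<exists>x :: 'f. x \<noteq> 0")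
    case True
    then obtain f0 :: 'f where f0: "f0 \<noteq> 0" by blast
    \<comment> \<open>With a zero space for \<open>W\<close>, \<open>\<Delta>u\<close> coincides
      with \<open>s \<mapsto> s \<otimes> \<one>\<close>. The character equation for
      \<open>v = flipped V\<close> then reads \<open>leg13 v = leg13 v ** leg23 v\<close>, which
      leaves only \<open>v = \<one>\<close>.\<close>
    define \<pi> where "\<pi> = restrict (\<lambda>s. \<one> ** (id_morphism Au s \<otimes> (\<one> :: 'f \<Rightarrow>\<^sub>L 'f)) ** \<one>\<dagger>) Au"
    have \<pi>: "star_rep Au \<pi>" unfolding \<pi>_def by (rule star_rep_conj[OF star_rep_id[OF VA(1)] unitary_id])
    have "\<Delta>u = \<pi>" by (rule degenerate_representations[OF _ \<Delta>u(1) \<pi>]) (use False in blast)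
    have "flipped V = \<one>" if V: "unitary V" "flipped V \<in> hmul Au" "right_character Au \<Delta>u V" for V :: "('x, 'f) hop"
    proof -
      have "amp Au \<pi> (flipped V) = leg13 (flipped V)"
        unfolding \<pi>_def amp_conj[OF star_rep_id[OF VA(1)] unitary_id V(2)] by (simp add: amp_id_morphism[OF VA(1) V(2)])
      then have "leg13 (flipped V) ** \<one> = leg13 (flipped V) ** leg23 (flipped V)"
        using V(3) by (simp add: right_character_def \<open>\<Delta>u = \<pi>\<close>)
      then have "leg23 \<one> = (leg23 (flipped V) :: (('f, 'f) htensor, 'x) htensor \<Rightarrow>\<^sub>L _)"
        unfolding leg23_id by (rule unitary_cancel_left[OF unitary_leg(3)[OF unitary_flipped[OF V(1)]]])
      then show ?thesis using leg23_inject[OF f0, of id_blinfun "flipped V"] unitaryD(1)[OF V(1)] by auto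
    qed
    from this[OF V1] this[OF V2] show ?thesis by (simp add: flipped_inject[of V1 V2, symmetric])
  next
    case False
    have 0: "x = 0" for x :: 'f using False by blast
    show ?thesis by (rule blinfun_trivial[OF htensor_trivial(2)[OF 0]])
  qed
qed

text \<open>The legs are, in order, the space of \<open>W\<close>, the first leg of \<open>V\<close>
  and the space of \<open>Au\<close>. \<open>pl1\<close> and \<open>pl2\<close> carry the two
  character equations there, and \<open>leg13_pl1_leg23_pl2_commute\<close> supplies the commutation
  that \<open>braided_commutator\<close> asks for.\<close>

lemma lift_candidate:
  fixes V :: "('x::complex_hilbert, 'a) hop"
  assumes V: "unitary V" "flipped V \<in> hmul (qg W)" and r: "right_character (qg W) (comult W) V"
  shows "\<exists>V'\<in>bops. \<one> \<otimes> V' = pl1 (flipped (V\<dagger>)) ** pl2 VA ** pl1 (flipped V) ** pl2 (VA\<dagger>)"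
proof -
  let ?v = "pl1 (flipped V) :: ('a, ('x, 'f) htensor) htensor \<Rightarrow>\<^sub>L _" and ?u = "pl2 VA :: ('a, ('x, 'f) htensor) htensor \<Rightarrow>\<^sub>L _"
  note Vb = unitaryD(1)[OF V(1)]
  have uv: "unitary ?v" "unitary ?u" by (intro unitary_pl unitary_flipped V VA)+
  let ?Y = "?v\<dagger> ** ?u ** ?v ** ?u\<dagger>"
  note b = unitaryD(1)[OF uv(1)] unitaryD(1)[OF uv(2)]
  note fv = flipped_bops[OF Vb]
  have 1: "leg12 W ** leg13 ?v = leg13 ?v ** leg23 ?v ** leg12 W"
    using arg_cong[OF r[unfolded right_character_comult[OF A W(1) V(2)]], of pl1] fv
    by (simp add: pl1_compose leg_pl1 pl1_leg12)
  have 2: "leg12 W ** leg13 ?u ** leg23 ?u = leg23 ?u ** leg12 W"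
    using arg_cong[OF VA(5)[unfolded corep_def], of pl2] VA(4) by (simp add: pl2_compose leg_pl2 pl2_leg12)
  have "leg12 W ** ((leg13 ?v)\<dagger> ** leg13 ?u ** leg13 ?v ** (leg13 ?u)\<dagger>) =
      ((leg23 ?v)\<dagger> ** leg23 ?u ** leg23 ?v ** (leg23 ?u)\<dagger>) ** leg12 W"
    by (rule braided_commutator[OF unitary_leg(3)[OF uv(1)] unitary_leg(2)[OF uv(1)] unitary_leg(3)[OF uv(2)] unitary_leg(2)[OF uv(2)] 1 2
          leg13_pl1_leg23_pl2_commute[OF fv VA(4)]])
  then have "leg12 W ** leg13 ?Y = leg23 ?Y ** leg12 W"
    using b by (simp add: leg13_compose leg23_compose leg13_adj leg23_adj)
  moreover have "?Y \<in> bops" using b by auto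
  ultimately obtain Z where "Z \<in> bops" "?Y = \<one> \<otimes> Z" using ergodic_invariant[OF W_bops W(2)] by blast
  moreover have "?Y = pl1 (flipped (V\<dagger>)) ** pl2 VA ** pl1 (flipped V) ** pl2 (VA\<dagger>)"
    using Vb VA(4) by (simp add: pl1_adj pl2_adj flipped_adj)
  ultimately show ?thesis by metis
qed

context
  fixes X :: "('x::complex_hilbert \<Rightarrow>\<^sub>L 'x) set" and \<Delta>X and V :: "('x, 'a) hop" and V' :: "('x, 'f) hop"
    and a0 :: 'a
  assumes X: "cstar_algebra X" "star_rep X \<Delta>X" and V: "unitary V" "V \<in> hmul X" "flipped V \<in> hmul (qg W)"
    and lr: "left_character X \<Delta>X V" "right_character (qg W) (comult W) V" and a0: "a0 \<noteq> 0"
    and V': "V' \<in> bops" "\<one> \<otimes> V' = pl1 (flipped (V\<dagger>)) ** pl2 VA ** pl1 (flipped V) ** pl2 (VA\<dagger>)"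
begin

lemma V_bops [simp]: "V \<in> bops" by (rule unitaryD(1)[OF V(1)])

lemma lift_unitary: "unitary V'"
  by (rule unitary_id_tensorD[OF a0 V'(1)], unfold V'(2)) (intro unitary_compose unitary_pl unitary_flipped unitary_adj V VA)

text \<open>Only \<open>\<one> \<otimes> V'\<close> is given explicitly. With compact operators on
  the first leg, its factors are multipliers because \<open>V\<close> is adjointable over
  \<open>X\<close> and \<open>flipped VA\<close> over \<open>Au\<close>; the first leg is then
  sliced off.\<close>

lemma lift_multiplier: "V' \<in> multipliers (X \<otimes>\<^sub>A Au)"
proof -
  note Xs = cstar_algebraD(1)[OF X(1)]
  have K: "star_subalgebra (compacts :: ('a \<Rightarrow>\<^sub>L 'a) set)" by (rule cstar_algebraD(1)[OF cstar_algebra_compacts])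
  note sub = star_subalgebraD(1)[OF K] star_subalgebraD(1)[OF Xs] star_subalgebraD(1)[OF Au_sub]
  have fV: "flipped T \<in> multipliers (compacts \<otimes>\<^sub>A X)" if "T \<in> hmul X" for T :: "('x, 'a) hop"
    using flipped_multipliers[OF hmul_multipliers_compacts[OF Xs that]] sub by blast
  have "flipped (flipped VA) \<in> multipliers (compacts \<otimes>\<^sub>A Au)"
    using flipped_multipliers[OF hmul_multipliers_compacts[OF Au_sub VA(6)]] sub by blast
  then have mVA: "VA \<in> multipliers (compacts \<otimes>\<^sub>A Au)" by simp
  show ?thesis
    by (rule id_tensor_multiplierD[OF a0 star_subalgebra_cstar_tensor[OF Xs Au_sub] V'(1)], unfold V'(2))
      (intro multipliers_compose pl_multipliers[OF K Xs Au_sub] fV V(2) hmulD(3)[OF Xs V(2)] mVA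
        multipliers_adj[OF mVA star_subalgebra_cstar_tensor[OF K Au_sub]])
qed

text \<open>The commutator formula with the leg of \<open>X\<close> in front, where
  \<open>amp X \<Delta>X\<close> acts; \<open>lift_cyc\<close> does the same for the leg of
  \<open>Au\<close>.\<close>

lemma lift_sw: "pl2 V' = pl1 (V\<dagger>) ** \<one> \<otimes> VA ** pl1 V ** \<one> \<otimes> VA\<dagger>"
proof (rule unitary_cancel_right[OF unitary_sw])
  have "pl2 V' ** sw = sw ** \<one> \<otimes> V'" by (rule sw_id_tensor[OF V'(1), symmetric])
  also have "\<dots> = (pl1 (V\<dagger>) ** \<one> \<otimes> VA ** pl1 V ** \<one> \<otimes> VA\<dagger>) ** sw"
    unfolding V'(2) compose_assoc
    by (simp add: compose_square[OF sw_pl1] compose_square[OF sw_pl2] sw_pl2 VA(4))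
  finally show "pl2 V' ** sw = (pl1 (V\<dagger>) ** \<one> \<otimes> VA ** pl1 V ** \<one> \<otimes> VA\<dagger>) ** sw" .
qed

lemma lift_cyc: "pl2 (flipped V') = (\<one> \<otimes> flipped (V\<dagger>)) ** pl1 (flipped VA) ** (\<one> \<otimes> flipped V) ** pl1 (flipped (VA\<dagger>))"
proof (rule unitary_cancel_right[OF unitary_cyc])
  have "pl2 (flipped V') ** cyc = cyc ** \<one> \<otimes> V'" by (rule cyc_id_tensor[OF V'(1), symmetric])
  also have "\<dots> = ((\<one> \<otimes> flipped (V\<dagger>)) ** pl1 (flipped VA) ** (\<one> \<otimes> flipped V) ** pl1 (flipped (VA\<dagger>))) ** cyc"
    unfolding V'(2) compose_assoc
    by (simp add: compose_square[OF cyc_pl1] compose_square[OF cyc_pl2] cyc_pl2 VA(4))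
  finally show "pl2 (flipped V') ** cyc = ((\<one> \<otimes> flipped (V\<dagger>)) ** pl1 (flipped VA) ** (\<one> \<otimes> flipped V) ** pl1 (flipped (VA\<dagger>))) ** cyc" .
qed

text \<open>Amplifying \<open>lift_sw\<close> by \<open>\<Delta>X\<close> doubles \<open>V\<close>
  into a \<open>leg23\<close> and a \<open>leg13\<close> factor. Inserting
  \<open>VA\<dagger> VA\<close> completes the commutator for \<open>leg23\<close>; the adjoint
  \<open>leg13\<close> factor on its left commutes past it and completes the commutator for
  \<open>leg13\<close>.\<close>

lemma lift_left_character: "left_character X \<Delta>X V'"
proof -
  interpret X: star_rep X \<Delta>X by (rule X(2))
  note Xs = X.subalg
  note hV' = flipped_multipliers_hmul(1)[OF X(1) VA(1) lift_multiplier]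
  let ?U = "\<one> \<otimes> VA"
  let ?p1 = "leg13 (pl1 V)" and ?p2 = "leg23 (pl1 V)"
  note h = hmul_pl1[OF Xs V(2)] hmul_pl1[OF Xs hmulD(3)[OF Xs V(2)]] hmul_id_tensor[OF Xs VA(4)] hmul_id_tensor[OF Xs adj_bops[OF VA(4)]]
  have aV: "pl1 (amp X \<Delta>X V) = ?p2 ** ?p1" "pl1 (amp X \<Delta>X (V\<dagger>)) = ?p1\<dagger> ** ?p2\<dagger>"
    using lr(1) by (simp_all add: left_character_def X.amp_adj[OF V(2)] pl1_compose adj_compose leg_pl1 pl1_adj leg13_adj leg23_adj)
  have l2: "leg23 (pl2 V') = ?p2\<dagger> ** ?U ** ?p2 ** \<one> \<otimes> VA\<dagger>"
    unfolding lift_sw using VA(4) by (simp add: leg23_compose leg23_id_tensor leg23_adj pl1_adj)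
  have l1: "leg13 (pl2 V') = ?p1\<dagger> ** ?U ** ?p1 ** \<one> \<otimes> VA\<dagger>"
    unfolding lift_sw using VA(4) by (simp add: leg13_compose leg13_id_tensor leg13_adj pl1_adj)
  have UU: "\<one> \<otimes> VA\<dagger> ** (?U ** Z) = Z" for Z :: "'z::complex_hilbert \<Rightarrow>\<^sub>L ('y::complex_hilbert, ('a, 'f) htensor) htensor"
    using VA(4) compose_left[OF op_tensor_compose[of id_blinfun "VA\<dagger>" \<one> VA], of Z] by (simp add: unitaryD[OF VA(3)])
  have c: "?p1\<dagger> ** leg23 (pl2 V') = leg23 (pl2 V') ** ?p1\<dagger>"
    using leg13_pl1_leg23_pl2_commute[of "V\<dagger>" V'] V'(1) by (simp add: leg13_adj pl1_adj)
  have "pl2 (amp X \<Delta>X V') = amp X \<Delta>X (pl2 V')" by (rule X.amp_pl2[OF hV', symmetric])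
  also have "\<dots> = (?p1\<dagger> ** ?p2\<dagger>) ** ?U ** (?p2 ** ?p1) ** \<one> \<otimes> VA\<dagger>"
    unfolding lift_sw
    by (simp only: X.amp_compose h hmul_compose[OF Xs] X.amp_id_tensor VA(4) adj_bops X.amp_pl1[OF V(2)] X.amp_pl1[OF hmulD(3)[OF Xs V(2)]] aV)
  also have "\<dots> = (?p1\<dagger> ** leg23 (pl2 V')) ** (?U ** (?p1 ** \<one> \<otimes> VA\<dagger>))"
    unfolding l2 by (simp only: compose_assoc UU)
  also have "\<dots> = leg23 (pl2 V') ** leg13 (pl2 V')" unfolding c l1 by (simp only: compose_assoc)
  also have "\<dots> = pl2 (leg23 V' ** leg13 V')" using V'(1) by (simp add: pl2_compose leg_pl2)
  finally show ?thesis unfolding left_character_def by (rule pl2_inject[OF a0 X.amp_bops[OF hV'], rotated]) (use V'(1) in auto)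
qed

lemma hmul_flipped_lift: "flipped V' \<in> hmul Au"
  by (rule flipped_multipliers_hmul(2)[OF X(1) VA(1) lift_multiplier])

text \<open>Now \<open>VA\<close> is doubled by \<open>\<Delta>u\<close> while \<open>V\<close>
  stays fixed, and \<open>V V\<dagger>\<close> is inserted between the two copies. The adjoint
  \<open>leg13\<close> factor stands on the right this time, which yields the opposite order of the
  legs.\<close>

lemma lift_right_character: "right_character Au \<Delta>u V'"
proof -
  note h' = hmul_flipped_lift
  let ?s = "\<one> \<otimes> flipped V" and ?t = "\<one> \<otimes> flipped (V\<dagger>)"
  let ?q1 = "leg13 (pl1 (flipped VA))" and ?q2 = "leg23 (pl1 (flipped VA))"
  have fVA: "flipped (VA\<dagger>) = (flipped VA)\<dagger>" using VA(4) by (simp add: flipped_adj)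
  have hd: "flipped (VA\<dagger>) \<in> hmul Au" unfolding fVA by (rule hmulD(3)[OF Au_sub VA(6)])
  note h = hmul_pl1[OF Au_sub VA(6)] hmul_pl1[OF Au_sub hd] hmul_id_tensor[OF Au_sub flipped_bops[OF V_bops]] hmul_id_tensor[OF Au_sub flipped_bops[OF adj_bops[OF V_bops]]]
  have aV: "pl1 (amp Au \<Delta>u (flipped VA)) = ?q1 ** ?q2" "pl1 (amp Au \<Delta>u (flipped (VA\<dagger>))) = ?q2\<dagger> ** ?q1\<dagger>"
    using right_character_VA VA(4) unfolding fVA
    by (simp_all add: right_character_def D.amp_adj[OF VA(6)] pl1_compose adj_compose leg_pl1 pl1_adj leg13_adj leg23_adj)
  have l2: "leg23 (pl2 (flipped V')) = ?t ** ?q2 ** ?s ** ?q2\<dagger>"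
    unfolding lift_cyc fVA using VA(4) by (simp add: leg23_compose leg23_id_tensor leg23_adj pl1_adj)
  have l1: "leg13 (pl2 (flipped V')) = ?t ** ?q1 ** ?s ** ?q1\<dagger>"
    unfolding lift_cyc fVA using VA(4) by (simp add: leg13_compose leg13_id_tensor leg13_adj pl1_adj)
  have st: "flipped V ** flipped (V\<dagger>) = \<one>" by (simp add: flipped_compose[symmetric] unitaryD[OF V(1)])
  have SS: "?s ** (?t ** Z) = Z" for Z :: "'z::complex_hilbert \<Rightarrow>\<^sub>L ('y::complex_hilbert, ('a, 'x) htensor) htensor"
    using compose_left[OF op_tensor_compose[of id_blinfun "flipped V" \<one> "flipped (V\<dagger>)"], of Z] by (simp add: st)
  have c: "leg23 (pl2 (flipped V')) ** ?q1\<dagger> = ?q1\<dagger> ** leg23 (pl2 (flipped V'))"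
    using leg13_pl1_leg23_pl2_commute[of "(flipped VA)\<dagger>" "flipped V'"] V'(1) VA(4) by (simp add: leg13_adj pl1_adj)
  have "pl2 (amp Au \<Delta>u (flipped V')) = amp Au \<Delta>u (pl2 (flipped V'))" by (rule D.amp_pl2[OF h', symmetric])
  also have "\<dots> = ?t ** (?q1 ** ?q2) ** ?s ** (?q2\<dagger> ** ?q1\<dagger>)"
    unfolding lift_cyc
    by (simp only: D.amp_compose h hmul_compose[OF Au_sub] D.amp_id_tensor flipped_bops V_bops adj_bops D.amp_pl1[OF VA(6)] D.amp_pl1[OF hd] aV)
  also have "\<dots> = (?t ** (?q1 ** ?s)) ** (leg23 (pl2 (flipped V')) ** ?q1\<dagger>)"
    unfolding l2 by (simp only: compose_assoc SS)
  also have "\<dots> = leg13 (pl2 (flipped V')) ** leg23 (pl2 (flipped V'))" unfolding c l1 by (simp only: compose_assoc)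
  also have "\<dots> = pl2 (leg13 (flipped V') ** leg23 (flipped V'))" using V'(1) by (simp add: pl2_compose leg_pl2)
  finally show ?thesis unfolding right_character_def by (rule pl2_inject[OF a0 D.amp_bops[OF h'], rotated]) (use V'(1) in auto)
qed

text \<open>\<open>\<Lambda>\<close> replaces \<open>VA\<close> by \<open>W\<close>, and for
  \<open>W\<close> the commutator equals \<open>V\<close> by the character property of
  \<open>V\<close> over \<open>qg W\<close>.\<close>

lemma lift_reduces: "amp Au \<Lambda> (flipped V') = flipped V"
proof -
  note h' = hmul_flipped_lift
  let ?s = "\<one> \<otimes> flipped V" and ?t = "\<one> \<otimes> flipped (V\<dagger>)"
  have fVA: "flipped (VA\<dagger>) = (flipped VA)\<dagger>" using VA(4) by (simp add: flipped_adj)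
  have hd: "flipped (VA\<dagger>) \<in> hmul Au" unfolding fVA by (rule hmulD(3)[OF Au_sub VA(6)])
  note h = hmul_pl1[OF Au_sub VA(6)] hmul_pl1[OF Au_sub hd] hmul_id_tensor[OF Au_sub flipped_bops[OF V_bops]] hmul_id_tensor[OF Au_sub flipped_bops[OF adj_bops[OF V_bops]]]
  have aW: "amp Au \<Lambda> (flipped (VA\<dagger>)) = (flipped W)\<dagger>" unfolding fVA L.amp_adj[OF VA(6)] amp_\<Lambda>_VA by (rule refl)
  have "pl2 (amp Au \<Lambda> (flipped V')) = amp Au \<Lambda> (pl2 (flipped V'))" by (rule L.amp_pl2[OF h', symmetric])
  also have "\<dots> = ?t ** pl1 (flipped W) ** ?s ** pl1 ((flipped W)\<dagger>)"
    unfolding lift_cyc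
    by (simp only: L.amp_compose h hmul_compose[OF Au_sub] L.amp_id_tensor flipped_bops V_bops adj_bops L.amp_pl1[OF VA(6)] L.amp_pl1[OF hd] amp_\<Lambda>_VA aW)
  also have "\<dots> = pl2 (flipped V)"
  proof -
    have "reassoc (pl1 W ** pl2 (flipped V)) = reassoc (pl2 (flipped V) ** ?s ** pl1 W)"
      using lr(2)[unfolded right_character_comult[OF A W(1) V(3)]]
      by (simp add: reassoc_compose reassoc_pl1 reassoc_pl2 reassoc_id_tensor)
    then have "sw ** (pl1 W ** pl2 (flipped V)) = sw ** (pl2 (flipped V) ** ?s ** pl1 W)" unfolding reassoc_inject by simp
    then have "(pl1 (flipped W) ** ?s) ** sw = (?s ** pl2 (flipped V) ** pl1 (flipped W)) ** sw"
      by (simp add: compose_assoc compose_square[OF sw_pl1] compose_square[OF sw_pl2] compose_square[OF sw_id_tensor] sw_pl1 sw_pl2)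
    then have "pl1 (flipped W) ** ?s = ?s ** pl2 (flipped V) ** pl1 (flipped W)" by (rule unitary_cancel_right[OF unitary_sw])
    then have e: "?t ** (pl1 (flipped W) ** ?s) ** pl1 ((flipped W)\<dagger>) = ?t ** (?s ** pl2 (flipped V) ** pl1 (flipped W)) ** pl1 ((flipped W)\<dagger>)" by simp
    have "flipped (V\<dagger>) ** flipped V = \<one>" by (simp add: flipped_compose[symmetric] unitaryD[OF V(1)])
    then have ts: "?t ** ?s = \<one>" by (simp add: op_tensor_compose)
    have WW: "pl1 (flipped W) ** pl1 ((flipped W)\<dagger>) = \<one>"
      by (simp add: pl1_compose[symmetric] unitaryD[OF unitary_flipped[OF W(1)]])
    show ?thesis using e by (simp add: compose_assoc compose_absorb[OF ts] WW)
  qed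
  finally show ?thesis by (rule pl2_inject[OF a0 L.amp_bops[OF h'], rotated]) simp
qed

end

theorem lift_exists:
  fixes V :: "('x::complex_hilbert, 'a) hop"
  assumes X: "cstar_algebra X" "star_rep X \<Delta>X" and V: "bicharacter X \<Delta>X (qg W) (comult W) V"
  shows "\<exists>V'. bicharacter X \<Delta>X Au \<Delta>u V' \<and> amp Au \<Lambda> (flipped V') = flipped V"
proof -
  have V: "V \<in> multipliers (X \<otimes>\<^sub>A qg W)" "unitary V" "left_character X \<Delta>X V" "right_character (qg W) (comult W) V"
    using V unfolding bicharacter_iff[OF X A star_rep_comult[OF A W(1)]] by auto
  note h = flipped_multipliers_hmul[OF X(1) A V(1)]
  show ?thesis unfolding bicharacter_iff[OF X VA(1) \<Delta>u(1)]
  proof (cases "\<exists>a0 :: 'a. a0 \<noteq> 0")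
    case True
    then obtain a0 :: 'a where a0: "a0 \<noteq> 0" by blast
    obtain V' where V': "V' \<in> bops" "\<one> \<otimes> V' = pl1 (flipped (V\<dagger>)) ** pl2 VA ** pl1 (flipped V) ** pl2 (VA\<dagger>)"
      using lift_candidate[OF V(2) h(2) V(4)] by blast
    note c = X V(2) h V(3,4) a0 V'
    show "\<exists>V'. (V' \<in> multipliers (X \<otimes>\<^sub>A Au) \<and> unitary V' \<and> left_character X \<Delta>X V' \<and> right_character Au \<Delta>u V') \<and> amp Au \<Lambda> (flipped V') = flipped V"
      by (intro exI[of _ V'] conjI lift_multiplier[OF c] lift_unitary[OF c] lift_left_character[OF c] lift_right_character[OF c] lift_reduces[OF c])
  next
    case False
    then have 0: "y = 0" for y :: 'a by blast
    \<comment> \<open>If the space of \<open>W\<close> is zero, every operator reduces to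
      \<open>V\<close>, so the identity can be taken as the lift.\<close>
    show "\<exists>V'. (V' \<in> multipliers (X \<otimes>\<^sub>A Au) \<and> unitary V' \<and> left_character X \<Delta>X V' \<and> right_character Au \<Delta>u V') \<and> amp Au \<Lambda> (flipped V') = flipped V"
    proof (intro exI[of _ \<one>] conjI)
      show "\<one> \<in> multipliers (X \<otimes>\<^sub>A Au)" by (simp add: multipliers_def)
      show "left_character X \<Delta>X \<one>" using star_rep.amp_id[OF X(2)] by (simp add: left_character_def)
      show "right_character Au \<Delta>u \<one>" using D.amp_id by (simp add: right_character_def)
      show "amp Au \<Lambda> (flipped \<one>) = flipped V" by (rule blinfun_trivial[OF htensor_trivial(1)[OF 0]])
    qed simp
  qed
qed

end

context universal_quantum_group
begin

lemma bicharacter_liftD: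
  assumes X: "cstar_algebra X" "star_rep X \<Delta>X" and V: "bicharacter X \<Delta>X Au \<Delta>u V"
  shows "V \<in> multipliers (X \<otimes>\<^sub>A Au)" "unitary V" "left_character X \<Delta>X V" "right_character Au \<Delta>u V"
    "V \<in> hmul X" "flipped V \<in> hmul Au" "tensor_ext X (id_morphism X) Au \<Lambda> V = flipped (amp Au \<Lambda> (flipped V))"
proof -
  show m: "V \<in> multipliers (X \<otimes>\<^sub>A Au)" and "unitary V" "left_character X \<Delta>X V" "right_character Au \<Delta>u V"
    using V unfolding bicharacter_iff[OF X VA(1) \<Delta>u(1)] by auto
  show "V \<in> hmul X" "flipped V \<in> hmul Au" by (rule flipped_multipliers_hmul[OF X(1) VA(1) m])+
  show "tensor_ext X (id_morphism X) Au \<Lambda> V = flipped (amp Au \<Lambda> (flipped V))"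
    by (rule tensor_ext_right[OF X(1) VA(1) \<Lambda>(1) m])
qed

theorem lift_ex1:
  assumes X: "cstar_algebra X" "star_rep X \<Delta>X" and V: "bicharacter X \<Delta>X (qg W) (comult W) V"
  shows "\<exists>!V'. bicharacter X \<Delta>X Au \<Delta>u V' \<and> tensor_ext X (id_morphism X) Au \<Lambda> V' = V"
proof (rule ex_ex1I)
  obtain V' where V': "bicharacter X \<Delta>X Au \<Delta>u V'" "amp Au \<Lambda> (flipped V') = flipped V" using lift_exists[OF X V] by blast
  then show "\<exists>V'. bicharacter X \<Delta>X Au \<Delta>u V' \<and> tensor_ext X (id_morphism X) Au \<Lambda> V' = V"
    using bicharacter_liftD(7)[OF X V'(1)] by auto
  fix V1 V2
  assume 1: "bicharacter X \<Delta>X Au \<Delta>u V1 \<and> tensor_ext X (id_morphism X) Au \<Lambda> V1 = V"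
    and 2: "bicharacter X \<Delta>X Au \<Delta>u V2 \<and> tensor_ext X (id_morphism X) Au \<Lambda> V2 = V"
  note D1 = bicharacter_liftD[OF X 1[THEN conjunct1]] and D2 = bicharacter_liftD[OF X 2[THEN conjunct1]]
  have "amp Au \<Lambda> (flipped V1) = amp Au \<Lambda> (flipped V2)" using 1 2 unfolding D1(7) D2(7) by (metis flipped_inject)
  then show "V1 = V2" by (rule lift_unique[OF D1(2,6,4) D2(2,6,4)])
qed

section \<open>Lifts in the first leg\<close>

lemma lift_swapped_unique:
  fixes V1 V2 :: "('f, 'x::complex_hilbert) hop"
  assumes V1: "unitary V1" "V1 \<in> hmul Au" "left_character Au \<Delta>u V1"
    and V2: "unitary V2" "V2 \<in> hmul Au" "left_character Au \<Delta>u V2" and eq: "amp Au \<Lambda> V1 = amp Au \<Lambda> V2"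
  shows "V1 = V2"
proof -
  have f: "flipped ((flipped V)\<dagger>) = V\<dagger>" if "unitary V" for V :: "('f, 'x) hop"
    using unitaryD(1)[OF that] by (simp add: flipped_adj)
  have "(flipped V1)\<dagger> = (flipped V2)\<dagger>"
  proof (rule lift_unique)
    show "unitary ((flipped V1)\<dagger>)" "unitary ((flipped V2)\<dagger>)" by (intro unitary_adj unitary_flipped V1 V2)+
    show "flipped ((flipped V1)\<dagger>) \<in> hmul Au" "flipped ((flipped V2)\<dagger>) \<in> hmul Au"
      unfolding f[OF V1(1)] f[OF V2(1)] by (intro hmulD(3)[OF Au_sub] V1 V2)+
    show "right_character Au \<Delta>u ((flipped V1)\<dagger>)" "right_character Au \<Delta>u ((flipped V2)\<dagger>)"
      using left_character_swap[OF \<Delta>u(1) V1(2)] left_character_swap[OF \<Delta>u(1) V2(2)] V1(3) V2(3) by auto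
    show "amp Au \<Lambda> (flipped ((flipped V1)\<dagger>)) = amp Au \<Lambda> (flipped ((flipped V2)\<dagger>))"
      unfolding f[OF V1(1)] f[OF V2(1)] L.amp_adj[OF V1(2)] L.amp_adj[OF V2(2)] eq by (rule refl)
  qed
  from arg_cong[OF this, of flipped] show ?thesis
    unfolding f[OF V1(1)] f[OF V2(1)] using unitaryD(1)[OF V1(1)] unitaryD(1)[OF V2(1)] by (metis adj_adj)
qed

theorem lift_swapped_ex1:
  assumes Y: "cstar_algebra Y" "star_rep Y \<Delta>Y" and V: "bicharacter (qg W) (comult W) Y \<Delta>Y V"
  shows "\<exists>!V'. bicharacter Au \<Delta>u Y \<Delta>Y V' \<and> tensor_ext Au \<Lambda> Y (id_morphism Y) V' = V"
proof (rule ex_ex1I)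
  note WA = A star_rep_comult[OF A W(1)]
  have D: "V' \<in> multipliers (Au \<otimes>\<^sub>A Y)" "unitary V'" "left_character Au \<Delta>u V'" "V' \<in> hmul Au" "tensor_ext Au \<Lambda> Y (id_morphism Y) V' = amp Au \<Lambda> V'"
    if "bicharacter Au \<Delta>u Y \<Delta>Y V'" for V'
  proof -
    show m: "V' \<in> multipliers (Au \<otimes>\<^sub>A Y)" and "unitary V'" "left_character Au \<Delta>u V'"
      using that unfolding bicharacter_iff[OF VA(1) \<Delta>u(1) Y] by auto
    show "V' \<in> hmul Au" by (rule flipped_multipliers_hmul(1)[OF VA(1) Y(1) m])
    show "tensor_ext Au \<Lambda> Y (id_morphism Y) V' = amp Au \<Lambda> V'" by (rule tensor_ext_left[OF VA(1) \<Lambda>(1) Y(1) m])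
  qed
  have Vb: "V \<in> bops" using V unfolding bicharacter_iff[OF WA Y] unitary_def by auto
  obtain U where U: "bicharacter Y \<Delta>Y Au \<Delta>u U" "amp Au \<Lambda> (flipped U) = flipped ((flipped V)\<dagger>)"
    using lift_exists[OF Y bicharacter_swap[OF WA Y V]] by blast
  have "flipped U \<in> hmul Au" by (rule bicharacter_liftD(6)[OF Y U(1)])
  then have "amp Au \<Lambda> ((flipped U)\<dagger>) = V" using U(2) Vb by (simp add: L.amp_adj flipped_adj)
  then show "\<exists>V'. bicharacter Au \<Delta>u Y \<Delta>Y V' \<and> tensor_ext Au \<Lambda> Y (id_morphism Y) V' = V"
    using bicharacter_swap[OF Y VA(1) \<Delta>u(1) U(1)] D(5) by (intro exI[of _ "(flipped U)\<dagger>"]) auto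
  fix V1 V2
  assume 1: "bicharacter Au \<Delta>u Y \<Delta>Y V1 \<and> tensor_ext Au \<Lambda> Y (id_morphism Y) V1 = V"
    and 2: "bicharacter Au \<Delta>u Y \<Delta>Y V2 \<and> tensor_ext Au \<Lambda> Y (id_morphism Y) V2 = V"
  note D1 = D[OF 1[THEN conjunct1]] and D2 = D[OF 2[THEN conjunct1]]
  have "amp Au \<Lambda> V1 = amp Au \<Lambda> V2" using 1 2 unfolding D1(5) D2(5) by simp
  then show "V1 = V2" by (rule lift_swapped_unique[OF D1(2,4,3) D2(2,4,3)])
qed

text \<open>\<open>\<Delta>X\<close> on the first leg and \<open>\<Lambda>\<close> on the second
  commute by \<open>amp_commute\<close>, and the amplification of \<open>\<Lambda>\<close> respects
  the product of the two placed copies of \<open>V\<close>.\<close>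

lemma left_character_reduce:
  assumes X: "star_rep X \<Delta>X" and V: "V \<in> multipliers (X \<otimes>\<^sub>A Au)" "V \<in> hmul X" "flipped V \<in> hmul Au" and l: "left_character X \<Delta>X V"
  shows "left_character X \<Delta>X (flipped (amp Au \<Lambda> (flipped V)))"
proof -
  let ?V = "flipped (amp Au \<Lambda> (flipped V))"
  have b: "V \<in> bops" "?V \<in> bops" using multipliersD(1)[OF V(1)] L.amp_bops[OF V(3)] by auto
  have "amp X \<Delta>X ?V = flipped (amp Au \<Lambda> (flipped (leg23 V ** leg13 V)))"
    using star_rep_pair.amp_commute[OF star_rep_pairI[OF X \<Lambda>(1)] V(1,3,2)] l by (simp add: left_character_def)
  also have "\<dots> = flipped (pl2 (flipped ?V) ** pl1 (flipped ?V))"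
    by (simp add: flipped_compose[of "leg23 V"] flipped_leg23 flipped_leg13 b(1) L.amp_compose[OF hmul_pl2[OF Au_sub V(3)] hmul_pl1[OF Au_sub V(3)]]
        L.amp_pl1[OF V(3)] L.amp_pl2[OF V(3)])
  also have "\<dots> = leg23 ?V ** leg13 ?V"
    unfolding flipped_leg23[OF b(2), symmetric] flipped_leg13[OF b(2), symmetric] flipped_compose[symmetric] by (rule flipped_flipped)
  finally show ?thesis unfolding left_character_def .
qed

end

text \<open>\<open>Vuu\<close> is obtained in two stages: \<open>V\<close> is lifted to
  \<open>V''\<close> in the first leg, and \<open>V''\<close> to \<open>Vuu\<close> in the second.
  Its uniqueness is reduced to the uniqueness of these one-leg lifts.\<close>

theorem proposition4p14:
  fixes WC :: "('c::complex_hilbert, 'c) htensor \<Rightarrow>\<^sub>L ('c, 'c) htensor"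
    and WA :: "('a::complex_hilbert, 'a) htensor \<Rightarrow>\<^sub>L ('a, 'a) htensor"
    and Chu :: "('e::complex_hilbert \<Rightarrow>\<^sub>L 'e) set"
    and VCh :: "('c, 'e) htensor \<Rightarrow>\<^sub>L ('c, 'e) htensor"
    and \<Delta>Chu :: "('e \<Rightarrow>\<^sub>L 'e) \<Rightarrow> (('e, 'e) htensor \<Rightarrow>\<^sub>L ('e, 'e) htensor)"
    and \<Lambda>Ch :: "('e \<Rightarrow>\<^sub>L 'e) \<Rightarrow> ('c \<Rightarrow>\<^sub>L 'c)"
    and Au :: "('f::complex_hilbert \<Rightarrow>\<^sub>L 'f) set"
    and VA :: "('a, 'f) htensor \<Rightarrow>\<^sub>L ('a, 'f) htensor"
    and \<Delta>Au :: "('f \<Rightarrow>\<^sub>L 'f) \<Rightarrow> (('f, 'f) htensor \<Rightarrow>\<^sub>L ('f, 'f) htensor)"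
    and \<Lambda>A :: "('f \<Rightarrow>\<^sub>L 'f) \<Rightarrow> ('a \<Rightarrow>\<^sub>L 'a)"
  assumes "modular_multiplicative WC"
    and "modular_multiplicative WA"
    and "infinite_dimensional TYPE('k::complex_hilbert)"
    and "embeds TYPE('c) TYPE('k)" and "embeds TYPE('a) TYPE('k)"
    and "embeds TYPE('e) TYPE('k)" and "embeds TYPE('f) TYPE('k)"
    and "universal_corep TYPE('k) (dual WC) Chu VCh"
    and "universal_comult (dual WC) Chu VCh \<Delta>Chu"
    and "reducing_morphism (dual WC) Chu VCh \<Lambda>Ch"
    and "universal_corep TYPE('k) WA Au VA"
    and "universal_comult WA Au VA \<Delta>Au"
    and "reducing_morphism WA Au VA \<Lambda>A"
  shows "\<forall>V. bicharacter (qg (dual WC)) (comult (dual WC)) (qg WA) (comult WA) V \<longrightarrow>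
    (\<exists>!Vuu. bicharacter Chu \<Delta>Chu Au \<Delta>Au Vuu \<and>
       tensor_ext Chu \<Lambda>Ch Au \<Lambda>A Vuu = V) \<and>
    (\<exists>!V'. bicharacter (qg (dual WC)) (comult (dual WC)) Au \<Delta>Au V' \<and>
       tensor_ext (qg (dual WC)) (id_morphism (qg (dual WC))) Au \<Lambda>A V' = V) \<and>
    (\<exists>!V''. bicharacter Chu \<Delta>Chu (qg WA) (comult WA) V'' \<and>
       tensor_ext Chu \<Lambda>Ch (qg WA) (id_morphism (qg WA)) V'' = V)"
proof (intro allI impI conjI)
  have uC: "unitary WC" and uA: "unitary WA" using assms(1,2) by (auto simp: modular_multiplicative_def multiplicative_def)
  note cC = cstar_algebra_qg[OF assms(1)] and cA = cstar_algebra_qg[OF assms(2)]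
  have udC: "unitary (dual WC)" unfolding dual_flipped by (intro unitary_flipped unitary_adj uC)
  have cC': "cstar_algebra (qg (dual (dual WC)))" using cC(1) unitaryD(1)[OF uC] by simp
  interpret A: universal_quantum_group "TYPE('k)" WA Au VA \<Delta>Au \<Lambda>A
    by (intro universal_quantum_group.intro uA ergodic_modular assms cA)
  \<comment> \<open>The base unitary for \<open>Chu\<close> is \<open>dual WC\<close>. The dual of
    the latter is \<open>WC\<close> again, so the universal corepresentation \<open>VCh\<close> has
    its first leg in \<open>qg WC\<close>.\<close>
  interpret C: universal_quantum_group "TYPE('k)" "dual WC" Chu VCh \<Delta>Chu \<Lambda>Ch
    by (intro universal_quantum_group.intro udC ergodic_dual[OF uC] ergodic_modular assms cC(2) cC')
  note rC = star_rep_comult[OF cC(2) udC] and rA = star_rep_comult[OF cA(1) uA]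
  fix V assume V: "bicharacter (qg (dual WC)) (comult (dual WC)) (qg WA) (comult WA) V"
  show "\<exists>!V'. bicharacter (qg (dual WC)) (comult (dual WC)) Au \<Delta>Au V' \<and>
       tensor_ext (qg (dual WC)) (id_morphism (qg (dual WC))) Au \<Lambda>A V' = V"
    by (rule A.lift_ex1[OF cC(2) rC V])
  show ex1: "\<exists>!V''. bicharacter Chu \<Delta>Chu (qg WA) (comult WA) V'' \<and>
       tensor_ext Chu \<Lambda>Ch (qg WA) (id_morphism (qg WA)) V'' = V"
    by (rule C.lift_swapped_ex1[OF cA(1) rA V])
  then obtain V'' where b: "bicharacter Chu \<Delta>Chu (qg WA) (comult WA) V''"
    and t: "tensor_ext Chu \<Lambda>Ch (qg WA) (id_morphism (qg WA)) V'' = V" by blast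
  have V'': "V'' \<in> multipliers (Chu \<otimes>\<^sub>A qg WA)" "unitary V''" "left_character Chu \<Delta>Chu V''"
    using b unfolding bicharacter_iff[OF C.VA(1) C.\<Delta>u(1) cA(1) rA] by auto
  have hV'': "V'' \<in> hmul Chu" by (rule flipped_multipliers_hmul(1)[OF C.VA(1) cA(1) V''(1)])
  have aV'': "amp Chu \<Lambda>Ch V'' = V" using t tensor_ext_left[OF C.VA(1) C.\<Lambda>(1) cA(1) V''(1)] by simp
  note pair = star_rep_pairI[OF C.\<Lambda>(1) A.\<Lambda>(1)]
  note lD = A.bicharacter_liftD[OF C.VA(1) C.\<Delta>u(1)]
  \<comment> \<open>Reducing \<open>U\<close> in the second leg gives an operator that is a left
    character and whose reduction in the first leg is that of \<open>U\<close> in both legs. If the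
    latter is \<open>V\<close>, uniqueness of lifts in the first leg identifies this operator with
    \<open>V''\<close>.\<close>
  have key: "tensor_ext Chu \<Lambda>Ch Au \<Lambda>A U = V \<longleftrightarrow> tensor_ext Chu (id_morphism Chu) Au \<Lambda>A U = V''"
    if U: "bicharacter Chu \<Delta>Chu Au \<Delta>Au U" for U
  proof -
    let ?U = "flipped (amp Au \<Lambda>A (flipped U))"
    note D = lD[OF U]
    have h: "?U \<in> hmul Chu" by (rule star_rep_pair.amp_right_multiplier(2)[OF pair D(1,6)])
    have u: "unitary ?U" by (intro unitary_flipped A.L.amp_unitary D)
    have "tensor_ext Chu \<Lambda>Ch Au \<Lambda>A U = amp Chu \<Lambda>Ch ?U" by (rule star_rep_pair.tensor_ext_amp[OF pair D(1,6)])
    moreover have "amp Chu \<Lambda>Ch ?U = V \<longleftrightarrow> ?U = V''"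
      using C.lift_swapped_unique[OF u h A.left_character_reduce[OF C.\<Delta>u(1) D(1,5,6,3)] V''(2) hV'' V''(3)] aV'' by auto
    ultimately show ?thesis using D(7) by simp
  qed
  show "\<exists>!Vuu. bicharacter Chu \<Delta>Chu Au \<Delta>Au Vuu \<and> tensor_ext Chu \<Lambda>Ch Au \<Lambda>A Vuu = V"
    using A.lift_ex1[OF C.VA(1) C.\<Delta>u(1) b] key by (auto simp: Ex1_def)
qed

end
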